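(* Let $d\ge1$, $q\ge2$ an integer, and for each $n$ consider the $q$-state Potts model at inverse-temperature $\beta$ on a box $\Lambda\subset\mathbb{Z}^d$ of side-length $n$ with an arbitrary boundary condition. (1) If $\beta\ge0$ satisfies $$\beta<\tfrac12\log\Big(\max\Big\{1+\tfrac{1}{2d-1},\ \big(1+\tfrac{q}{2d}\big)^{1/2d}\Big\}\Big),$$ then the (heat-bath) Glauber dynamics exhibits cutoff with a window of $O(\log\log n)$. (2) The same conclusion holds for the (heat-bath) Glauber dynamics for the anti-ferromagnetic Potts model as long as $0\ge\beta\ge-\tfrac12\log\big(1+\tfrac{1}{2dq-1}\big)$.
   Context: The $q$-state Potts model on $\Lambda$ with inverse-temperature $\beta\in\mathbb{R}$ is the probability measure on $\{1,\dots,q\}^\Lambda$ with $\mu(\sigma)\propto\exp\big(\sum_{uv}2\beta\,\mathbf{1}\{\sigma(u)=\sigma(v)\}\big)$, the sum running over nearest-neighbour pairs within $\Lambda$ together with pairs joining $\Lambda$ to outer boundary sites whose colors are fixed by the boundary condition (a boundary condition assigns a color to each neighbouring site outside $\Lambda$, or leaves it free). Note the factor $2$ in front of $\beta$. It is ferromagnetic for $\beta\ge0$ and anti-ferromagnetic for $\beta<0$. Heat-bath Glauber dynamics is the continuous-time chain where each site has an independent rate-one Poisson clock and when the clock at $x$ rings the spin at $x$ is resampled from its conditional distribution under $\mu$ given all other spins. $t_{\mathrm{mix}}(\epsilon)=\inf\{t:\max_{\sigma_0}\|\mathbb{P}_{\sigma_0}(X_t\in\cdot)-\mu\|_{\mathrm{TV}}\le\epsilon\}$.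 Cutoff: $t_{\mathrm{mix}}(\epsilon)/t_{\mathrm{mix}}(1-\epsilon)\to1$ as $n\to\infty$ for every $0<\epsilon<1$. Window $O(\log\log n)$: $\log\log n=o(t_{\mathrm{mix}}(1/e))$ and $t_{\mathrm{mix}}(\epsilon)=t_{\mathrm{mix}}(1-\epsilon)+O(\log\log n)$ for every $0<\epsilon<1$, with implicit constant that may depend on $\epsilon$. *)

theory Defs
  imports "HOL-Probability.Probability"
begin

section \<open>The Potts model with boundary condition\<close>

definition adjacent :: "int ^ 'd \<Rightarrow> int ^ 'd \<Rightarrow> bool" where
  "adjacent u v \<longleftrightarrow> (\<Sum>i\<in>UNIV. \<bar>u $ i - v $ i\<bar>) = 1"

definition lattice_box :: "int ^ 'd \<Rightarrow> nat \<Rightarrow> (int ^ 'd) set" where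
  "lattice_box a n = {x. \<forall>i. a $ i \<le> x $ i \<and> x $ i < a $ i + int n}"

definition outer_boundary :: "(int ^ 'd) set \<Rightarrow> (int ^ 'd) set" where
  "outer_boundary \<Lambda> = {v. v \<notin> \<Lambda> \<and> (\<exists>u\<in>\<Lambda>. adjacent u v)}"

text \<open>Outer boundary sites are either free (\<^const>\<open>None\<close>) or carry a fixed color, site by
  site; values elsewhere are never used.\<close>

definition boundary_condition ::
  "nat \<Rightarrow> (int ^ 'd) set \<Rightarrow> (int ^ 'd \<Rightarrow> nat option) \<Rightarrow> bool" where
  "boundary_condition q \<Lambda> \<tau> \<longleftrightarrow>
     (\<forall>v\<in>outer_boundary \<Lambda>. \<forall>c. \<tau> v = Some c \<longrightarrow> c \<in> {1..q})"

definition configs :: "nat \<Rightarrow> (int ^ 'd) set \<Rightarrow> (int ^ 'd \<Rightarrow> nat) set" where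
  "configs q \<Lambda> = PiE \<Lambda> (\<lambda>_. {1..q})"

definition with_boundary ::
  "(int ^ 'd) set \<Rightarrow> (int ^ 'd \<Rightarrow> nat option) \<Rightarrow> (int ^ 'd \<Rightarrow> nat) \<Rightarrow> int ^ 'd \<Rightarrow> nat option" where
  "with_boundary \<Lambda> \<tau> \<sigma> x = (if x \<in> \<Lambda> then Some (\<sigma> x) else \<tau> x)"

text \<open>Unordered pairs: within the domain, or joining it to a boundary site of fixed color.\<close>

definition bonds :: "(int ^ 'd) set \<Rightarrow> (int ^ 'd \<Rightarrow> nat option) \<Rightarrow> (int ^ 'd) set set" where
  "bonds \<Lambda> \<tau> = {{u, v} | u v. u \<in> \<Lambda> \<and> adjacent u v \<and> (v \<in> \<Lambda> \<or> \<tau> v \<noteq> None)}"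

definition potts_weight ::
  "real \<Rightarrow> (int ^ 'd) set \<Rightarrow> (int ^ 'd \<Rightarrow> nat option) \<Rightarrow> (int ^ 'd \<Rightarrow> nat) \<Rightarrow> real" where
  "potts_weight \<beta> \<Lambda> \<tau> \<sigma> =
     exp (\<Sum>e\<in>bonds \<Lambda> \<tau>. 2 * \<beta> * of_bool (\<exists>c. \<forall>w\<in>e. with_boundary \<Lambda> \<tau> \<sigma> w = Some c))"

definition potts ::
  "nat \<Rightarrow> real \<Rightarrow> (int ^ 'd) set \<Rightarrow> (int ^ 'd \<Rightarrow> nat option) \<Rightarrow> (int ^ 'd \<Rightarrow> nat) pmf" where
  "potts q \<beta> \<Lambda> \<tau> = embed_pmf (\<lambda>\<sigma>. if \<sigma> \<in> configs q \<Lambda>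
     then potts_weight \<beta> \<Lambda> \<tau> \<sigma> / (\<Sum>\<eta>\<in>configs q \<Lambda>. potts_weight \<beta> \<Lambda> \<tau> \<eta>) else 0)"

lemma finite_configs: "finite \<Lambda> \<Longrightarrow> finite (configs q \<Lambda>)"
  unfolding configs_def by (intro finite_PiE) auto

lemma configs_nonempty: "q \<ge> 1 \<Longrightarrow> configs q \<Lambda> \<noteq> {}"
  unfolding configs_def by (auto simp: PiE_eq_empty_iff)

lemma finite_lattice_box: "finite (lattice_box a n)"
proof -
  have "lattice_box a n \<subseteq> vec_lambda ` PiE UNIV (\<lambda>i. {a $ i ..< a $ i + int n})"
  proof
    fix x assume "x \<in> lattice_box a n"
    then have "vec_nth x \<in> PiE UNIV (\<lambda>i. {a $ i ..< a $ i + int n})"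
      by (auto simp: lattice_box_def)
    then show "x \<in> vec_lambda ` PiE UNIV (\<lambda>i. {a $ i ..< a $ i + int n})"
      by (metis image_eqI vec_nth_inverse)
  qed
  then show ?thesis
    by (rule finite_subset) (intro finite_imageI finite_PiE, auto)
qed

lemma pmf_potts:
  assumes "finite \<Lambda>" and "q \<ge> 1"
  shows "pmf (potts q \<beta> \<Lambda> \<tau>) \<sigma> = (if \<sigma> \<in> configs q \<Lambda>
    then potts_weight \<beta> \<Lambda> \<tau> \<sigma> / (\<Sum>\<eta>\<in>configs q \<Lambda>. potts_weight \<beta> \<Lambda> \<tau> \<eta>) else 0)"
proof -
  let ?w = "potts_weight \<beta> \<Lambda> \<tau>" and ?C = "configs q \<Lambda>"
  let ?f = "\<lambda>\<sigma>. if \<sigma> \<in> ?C then ?w \<sigma> / (\<Sum>\<eta>\<in>?C. ?w \<eta>) else 0"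
  have Z: "(\<Sum>\<eta>\<in>?C. ?w \<eta>) > 0"
    using assms by (intro sum_pos finite_configs configs_nonempty) (auto simp: potts_weight_def)
  have nn: "0 \<le> ?f \<sigma>" for \<sigma>
    using Z by (auto simp: potts_weight_def)
  have "(\<integral>\<^sup>+ \<sigma>. ennreal (?f \<sigma>) \<partial>count_space UNIV) = (\<Sum>\<sigma>\<in>?C. ennreal (?f \<sigma>))"
    using finite_configs[OF assms(1)]
    by (subst nn_integral_count_space'[of ?C]) auto
  also have "\<dots> = ennreal (\<Sum>\<sigma>\<in>?C. ?f \<sigma>)"
    using nn by (intro sum_ennreal)
  also have "(\<Sum>\<sigma>\<in>?C. ?f \<sigma>) = 1"
    using Z by (simp flip: sum_divide_distrib)
  finally show ?thesis
    unfolding potts_def using nn by (subst pmf_embed_pmf) auto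
qed

section \<open>Heat-bath Glauber dynamics\<close>

definition heat_bath ::
  "(int ^ 'd \<Rightarrow> nat) pmf \<Rightarrow> int ^ 'd \<Rightarrow> (int ^ 'd \<Rightarrow> nat) \<Rightarrow> (int ^ 'd \<Rightarrow> nat) pmf" where
  "heat_bath \<mu> x \<sigma> = cond_pmf \<mu> {\<eta>. \<forall>y. y \<noteq> x \<longrightarrow> \<eta> y = \<sigma> y}"

text \<open>Independent rate-one Poisson clocks at the sites of the domain, given by their
  independent exponential inter-ring times: \<open>\<omega> (x, j)\<close> is the gap before ring \<open>j\<close> at \<open>x\<close>,
  with rings numbered from \<open>0\<close>.\<close>

definition clocks :: "(int ^ 'd) set \<Rightarrow> ((int ^ 'd) \<times> nat \<Rightarrow> real) measure" where
  "clocks \<Lambda> = PiM (\<Lambda> \<times> UNIV) (\<lambda>_. density lborel (exponential_density 1))"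

definition ring_time :: "((int ^ 'd) \<times> nat \<Rightarrow> real) \<Rightarrow> int ^ 'd \<Rightarrow> nat \<Rightarrow> real" where
  "ring_time \<omega> x k = (\<Sum>j\<le>k. \<omega> (x, j))"

text \<open>The sites whose clocks ring up to time \<open>t\<close>, in chronological order.  This is meaningful
  when there are finitely many rings up to \<open>t\<close> and no two clocks ring at once, which is almost
  surely the case.\<close>

definition ring_sites ::
  "(int ^ 'd) set \<Rightarrow> ((int ^ 'd) \<times> nat \<Rightarrow> real) \<Rightarrow> real \<Rightarrow> (int ^ 'd) list" where
  "ring_sites \<Lambda> \<omega> t =
     map (\<lambda>s. THE x. x \<in> \<Lambda> \<and> (\<exists>k. ring_time \<omega> x k = s))
       (sorted_list_of_set {s. s \<le> t \<and> (\<exists>x\<in>\<Lambda>. \<exists>k. ring_time \<omega> x k = s)})"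

definition run_updates ::
  "(int ^ 'd \<Rightarrow> nat) pmf \<Rightarrow> (int ^ 'd) list \<Rightarrow> (int ^ 'd \<Rightarrow> nat) \<Rightarrow> (int ^ 'd \<Rightarrow> nat) pmf" where
  "run_updates \<mu> xs \<sigma> = fold (\<lambda>x p. bind_pmf p (heat_bath \<mu> x)) xs (return_pmf \<sigma>)"

text \<open>The probability that the dynamics started from \<open>\<sigma>\<close> lies in \<open>A\<close> at time \<open>t\<close>: the clocks
  determine which sites are resampled and in which order.\<close>

definition glauber_prob ::
  "(int ^ 'd) set \<Rightarrow> (int ^ 'd \<Rightarrow> nat) pmf \<Rightarrow> (int ^ 'd \<Rightarrow> nat) \<Rightarrow> real \<Rightarrow> (int ^ 'd \<Rightarrow> nat) set \<Rightarrow> real"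
where
  "glauber_prob \<Lambda> \<mu> \<sigma> t A =
     (\<integral>\<omega>. measure_pmf.prob (run_updates \<mu> (ring_sites \<Lambda> \<omega> t) \<sigma>) A \<partial>clocks \<Lambda>)"

section \<open>Mixing time and cutoff\<close>

definition tv_to_equilibrium ::
  "(int ^ 'd) set \<Rightarrow> (int ^ 'd \<Rightarrow> nat) pmf \<Rightarrow> (int ^ 'd \<Rightarrow> nat) \<Rightarrow> real \<Rightarrow> real" where
  "tv_to_equilibrium \<Lambda> \<mu> \<sigma> t =
     (SUP A. \<bar>glauber_prob \<Lambda> \<mu> \<sigma> t A - measure_pmf.prob \<mu> A\<bar>)"

definition t_mix ::
  "nat \<Rightarrow> real \<Rightarrow> (int ^ 'd) set \<Rightarrow> (int ^ 'd \<Rightarrow> nat option) \<Rightarrow> real \<Rightarrow> real" where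
  "t_mix q \<beta> \<Lambda> \<tau> \<epsilon> = Inf {t. 0 \<le> t \<and>
     (MAX \<sigma>\<in>configs q \<Lambda>. tv_to_equilibrium \<Lambda> (potts q \<beta> \<Lambda> \<tau>) \<sigma> t) \<le> \<epsilon>}"

text \<open>Below, \<open>T n \<epsilon>\<close> is the \<open>\<epsilon>\<close>-mixing time of the \<open>n\<close>-th chain of a sequence.\<close>

definition cutoff :: "(nat \<Rightarrow> real \<Rightarrow> real) \<Rightarrow> bool" where
  "cutoff T \<longleftrightarrow> (\<forall>\<epsilon>. 0 < \<epsilon> \<and> \<epsilon> < 1 \<longrightarrow> (\<lambda>n. T n \<epsilon> / T n (1 - \<epsilon>)) \<longlonglongrightarrow> 1)"

definition has_window :: "(nat \<Rightarrow> real \<Rightarrow> real) \<Rightarrow> (nat \<Rightarrow> real) \<Rightarrow> bool" where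
  "has_window T w \<longleftrightarrow> w \<in> o(\<lambda>n. T n (1 / exp 1)) \<and>
     (\<forall>\<epsilon>. 0 < \<epsilon> \<and> \<epsilon> < 1 \<longrightarrow> (\<lambda>n. T n \<epsilon> - T n (1 - \<epsilon>)) \<in> O(w))"

definition cutoff_with_window :: "(nat \<Rightarrow> real \<Rightarrow> real) \<Rightarrow> (nat \<Rightarrow> real) \<Rightarrow> bool" where
  "cutoff_with_window T w \<longleftrightarrow> cutoff T \<and> has_window T w"

end

theory Submission
  imports Defs "HOL-Real_Asymp.Real_Asymp"
begin

text \<open>Under either hypothesis a change of color at one site moves the heat-bath law at each of its at
  most \<open>2 * d\<close> neighbours by so little that Dobrushin's uniqueness condition holds with a constant
  \<open>\<alpha> < 1\<close> that does not depend on the box or its boundary condition. Marton's argument then bounds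
  the entropy of a density by the sum of its local entropies, so that the entropy of the chain
  relative to equilibrium decays at a rate of order one per unit time.

  Cutoff comes from the varentropy, the variance of the log-density along the chain. An update is
  felt only in a ball of logarithmic radius, and local fluctuations of the log-density cost local
  entropy, so the varentropy at each step is at most a power of \<open>ln n\<close> times the entropy dissipated
  there. If the entropy were still above a suitable power of \<open>ln n\<close>, then by Chebyshev's inequality
  the chain would sit on a set of negligible Gibbs measure. Hence soon after the distance to
  equilibrium first drops below \<open>1 - \<epsilon>\<close> the entropy is at most a power of \<open>ln n\<close>, and
  \<open>O (ln (ln n))\<close> further units of time make it small.

  The entropy argument is run for the discrete chain that updates a uniformly chosen site, of which
  the continuous-time dynamics is the Poissonization. That the mixing time is of order at least
  \<open>ln n\<close> follows from a second-moment estimate for the sum of the correlations of the spins with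
  their initial values.\<close>

section \<open>Finite averages\<close>

text \<open>Write N for the number of sites. The varentropy at a step is bounded only by the entropy
  lost at that very step, so Chebyshev's inequality may fail at an individual step and cannot be
  used at one chosen time. It is used at all steps together: while the entropy stays above D, the
  failure probabilities add up to order N / D times a power of ln n. To turn this sum into a small
  average, the continuous-time chain is continued by a number of discrete steps that runs over a
  block of length N, that is, one unit of time; each step index is then met with weight at most 1 /
  N.

  The powers of ln n have two sources: in the decomposition of the variance over the updates a site
  is counted as often as it is updated, which is of order ln n in the relevant range of times, and a
  ball of radius of order ln n has volume polynomial in ln n. The exceptional contributions only
  have to beat a power of N, since log-densities are bounded by N * ln (N / p). Both temperature
  ranges enter through a single inequality: the influence of one neighbour times 2 * d is less than
  1.\<close>

definition mean_on :: "'a set \<Rightarrow> (('a \<Rightarrow> real) \<Rightarrow> real) \<Rightarrow> bool" where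
  "mean_on S L \<longleftrightarrow> finite S \<and>
     (\<exists>k. (\<forall>x\<in>S. 0 \<le> k x) \<and> (\<Sum>x\<in>S. k x) = 1 \<and> (\<forall>f. L f = (\<Sum>x\<in>S. k x * f x)))"

lemma mean_onE:
  assumes "mean_on S L"
  obtains k where "finite S" "\<forall>x\<in>S. 0 \<le> k x" "(\<Sum>x\<in>S. k x) = 1"
    "\<forall>f. L f = (\<Sum>x\<in>S. k x * f x)"
  using assms unfolding mean_on_def by (elim conjE exE) (rule that)

lemma mean_on_mono_set:
  assumes "mean_on S L" "S \<subseteq> S'" "finite S'"
  shows "mean_on S' L"
proof -
  obtain k where k': "finite S" "\<forall>x\<in>S. 0 \<le> k x" "(\<Sum>x\<in>S. k x) = 1"
    "\<forall>f. L f = (\<Sum>x\<in>S. k x * f x)" by (rule mean_onE[OF assms(1)]) (rule that)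
  note k = k'(1) k'(2)[rule_format] k'(3) k'(4)[rule_format]
  let ?k = "\<lambda>x. if x \<in> S then k x else 0"
  have e: "(\<Sum>x\<in>S'. ?k x * f x) = (\<Sum>x\<in>S. k x * f x)" for f
    using assms by (intro sum.mono_neutral_cong_right) auto
  show ?thesis unfolding mean_on_def
  proof (intro conjI exI[of _ ?k] allI)
    show "(\<Sum>x\<in>S'. ?k x) = 1" using e[of "\<lambda>_. 1"] k(3) by simp
    show "L f = (\<Sum>x\<in>S'. ?k x * f x)" for f by (simp only: e k(4))
  qed (use assms k(2) in auto)
qed

section \<open>Calculus of positive normalised linear functionals\<close>

context
  fixes S :: "'a set" and L :: "('a \<Rightarrow> real) \<Rightarrow> real"
  assumes L: "mean_on S L"
begin

lemma mean_cong: "(\<And>x. x \<in> S \<Longrightarrow> f x = g x) \<Longrightarrow> L f = L g"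
  using L by (elim mean_onE) simp

lemma mean_mono: "(\<And>x. x \<in> S \<Longrightarrow> f x \<le> g x) \<Longrightarrow> L f \<le> L g"
  using L by (elim mean_onE) (auto intro!: sum_mono mult_left_mono)

lemma mean_add: "L (\<lambda>x. f x + g x) = L f + L g"
  using L by (elim mean_onE) (simp add: sum.distrib algebra_simps)

lemma mean_diff: "L (\<lambda>x. f x - g x) = L f - L g"
  using L by (elim mean_onE) (simp add: sum_subtractf algebra_simps)

lemma mean_cmult: "L (\<lambda>x. c * f x) = c * L f"
  using L by (elim mean_onE) (simp add: sum_distrib_left algebra_simps)

lemma mean_mult_const: "L (\<lambda>x. f x * c) = L f * c"
  using mean_cmult[of c f] by (simp add: mult.commute)

lemma mean_divide: "L (\<lambda>x. f x / c) = L f / c"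
  using mean_cmult[of "1/c" f] by simp

lemma mean_const: "L (\<lambda>x. c) = c"
  using L by (elim mean_onE) (simp flip: sum_distrib_right)

lemma mean_sum: "L (\<lambda>x. \<Sum>i\<in>I. f i x) = (\<Sum>i\<in>I. L (f i))"
  using L by (elim mean_onE) (simp add: sum_distrib_left, subst sum.swap, simp)

lemma mean_nonneg: "(\<And>x. x \<in> S \<Longrightarrow> 0 \<le> f x) \<Longrightarrow> 0 \<le> L f"
  using mean_mono[of "\<lambda>_. 0" f] mean_const[of 0] by simp

lemma mean_le: "(\<And>x. x \<in> S \<Longrightarrow> f x \<le> c) \<Longrightarrow> L f \<le> c"
  using mean_mono[of f "\<lambda>_. c"] mean_const[of c] by simp

lemma mean_ge: "(\<And>x. x \<in> S \<Longrightarrow> c \<le> f x) \<Longrightarrow> c \<le> L f"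
  using mean_mono[of "\<lambda>_. c" f] mean_const[of c] by simp

lemma mean_abs_le: "\<bar>L f\<bar> \<le> L (\<lambda>x. \<bar>f x\<bar>)"
proof -
  have "L f \<le> L (\<lambda>x. \<bar>f x\<bar>)" "L (\<lambda>x. - 1 * f x) \<le> L (\<lambda>x. \<bar>f x\<bar>)"
    by (rule mean_mono; simp)+
  then show ?thesis using mean_cmult[of "-1" f] by linarith
qed

lemma mean_pos: "(\<And>x. x \<in> S \<Longrightarrow> 0 < f x) \<Longrightarrow> 0 < L f"
proof -
  assume f: "\<And>x. x \<in> S \<Longrightarrow> 0 < f x"
  obtain k where k': "finite S" "\<forall>x\<in>S. 0 \<le> k x" "(\<Sum>x\<in>S. k x) = 1"
    "\<forall>f. L f = (\<Sum>x\<in>S. k x * f x)" by (rule mean_onE[OF L]) (rule that)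
  note k = k'(1) k'(2)[rule_format] k'(3) k'(4)[rule_format]
  have "S \<noteq> {}" using k(3) by auto
  then have "0 < Min (f ` S)" using f k(1) by auto
  also have "\<dots> \<le> L f" by (rule mean_ge) (use k(1) in auto)
  finally show ?thesis .
qed

lemma mean_Cauchy_Schwarz: "(L (\<lambda>x. f x * g x))\<^sup>2 \<le> L (\<lambda>x. (f x)\<^sup>2) * L (\<lambda>x. (g x)\<^sup>2)"
proof -
  obtain k where k': "finite S" "\<forall>x\<in>S. 0 \<le> k x" "(\<Sum>x\<in>S. k x) = 1"
    "\<forall>f. L f = (\<Sum>x\<in>S. k x * f x)" by (rule mean_onE[OF L]) (rule that)
  note k = k'(1) k'(2)[rule_format] k'(3) k'(4)[rule_format]
  have "(\<Sum>x\<in>S. k x * (f x * g x)) = (\<Sum>x\<in>S. (sqrt (k x) * f x) * (sqrt (k x) * g x))"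
    by (rule sum.cong[OF refl]) (use k(2) in simp)
  also have "\<dots>\<^sup>2 \<le> (\<Sum>x\<in>S. (sqrt (k x) * f x)\<^sup>2) * (\<Sum>x\<in>S. (sqrt (k x) * g x)\<^sup>2)"
    by (rule Cauchy_Schwarz_ineq_sum)
  finally show ?thesis using k by (simp add: power_mult_distrib)
qed

lemma mean_power2_le: "(L f)\<^sup>2 \<le> L (\<lambda>x. (f x)\<^sup>2)"
  using mean_Cauchy_Schwarz[of f "\<lambda>_. 1"] by (simp add: mean_const)

lemma mean_variance_le: "L (\<lambda>x. (f x)\<^sup>2) - (L f)\<^sup>2 \<le> L (\<lambda>x. (f x - c)\<^sup>2)"
proof -
  have "L (\<lambda>x. (f x - c)\<^sup>2) = L (\<lambda>x. (f x)\<^sup>2 - 2 * c * f x + c\<^sup>2)"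
    by (rule mean_cong) (simp add: power2_eq_square algebra_simps)
  also have "\<dots> = L (\<lambda>x. (f x)\<^sup>2) - 2 * c * L f + c\<^sup>2"
    by (simp add: mean_add mean_diff mean_cmult mean_const)
  finally have "L (\<lambda>x. (f x - c)\<^sup>2) - (L (\<lambda>x. (f x)\<^sup>2) - (L f)\<^sup>2) = (L f - c)\<^sup>2"
    by (simp add: power2_eq_square algebra_simps)
  then show ?thesis using zero_le_power2[of "L f - c"] by linarith
qed

text \<open>Jensen's inequality for x ln x, read off from the tangent line at the mean. A zero mean
  is treated apart because the tangent there is vertical; then \<open>f\<close> vanishes wherever
  the weight is positive and both sides are 0.\<close>

lemma mean_xlnx:
  assumes f: "\<And>x. x \<in> S \<Longrightarrow> 0 \<le> f x"
  shows "L f * ln (L f) \<le> L (\<lambda>x. f x * ln (f x))"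
proof (cases "L f = 0")
  case True
  obtain k where k': "finite S" "\<forall>x\<in>S. 0 \<le> k x" "(\<Sum>x\<in>S. k x) = 1"
    "\<forall>f. L f = (\<Sum>x\<in>S. k x * f x)" by (rule mean_onE[OF L]) (rule that)
  note k = k'(1) k'(2)[rule_format] k'(3) k'(4)[rule_format]
  have "\<forall>x\<in>S. k x * f x = 0"
    using True k f by (subst (asm) k(4), subst (asm) sum_nonneg_eq_0_iff) auto
  then have "L (\<lambda>x. f x * ln (f x)) = 0"
    unfolding k(4) by (intro sum.neutral) auto
  then show ?thesis using True by simp
next
  case False
  define m where "m = L f"
  have m: "m > 0" using False mean_nonneg[of f] f m_def by simp
  have tangent: "m * ln m + (1 + ln m) * (y - m) \<le> y * ln y" if "0 \<le> y" for y
  proof (cases "y = 0")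
    case False
    then have y: "y > 0" using that by simp
    have "ln (m / y) \<le> m / y - 1" using y m by (intro ln_le_minus_one) simp
    then have "y * ln (m / y) \<le> m - y"
      using y by (simp add: field_simps)
    then show ?thesis using y m by (simp add: ln_div algebra_simps)
  qed (use m in \<open>simp add: algebra_simps\<close>)
  have "m * ln m = m * ln m + (1 + ln m) * (L f - m)" by (simp add: m_def)
  also have "\<dots> = L (\<lambda>x. m * ln m + (1 + ln m) * (f x - m))"
    by (simp only: mean_add mean_cmult mean_diff mean_const)
  also have "\<dots> \<le> L (\<lambda>x. f x * ln (f x))"
    by (rule mean_mono) (use tangent f in auto)
  finally show ?thesis by (simp add: m_def)
qed

text \<open>Through the Hellinger bound $(\sqrt r - 1)^2 \le r \ln r - r + 1$.\<close>

lemma mean_Pinsker: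
  assumes f: "\<And>x. x \<in> S \<Longrightarrow> 0 < f x"
  shows "(L (\<lambda>x. \<bar>f x - L f\<bar>))\<^sup>2 \<le> 4 * L f * (L (\<lambda>x. f x * ln (f x)) - L f * ln (L f))"
proof -
  define m where "m = L f"
  have m: "m > 0" using mean_pos[OF f] m_def by simp
  have key: "(sqrt y - sqrt m)\<^sup>2 \<le> y * ln y - y * ln m - y + m" if y: "y > 0" for y
  proof -
    \<comment> \<open>The bound ln u \<le> u - 1 is taken at u = \<open>sqrt m / sqrt y\<close>; at
      u = m / y it would give only nonnegativity of the right-hand side.\<close>
    have "ln (sqrt m / sqrt y) \<le> sqrt m / sqrt y - 1" using y m by (intro ln_le_minus_one) simp
    then have "2 * y * ln (sqrt m / sqrt y) \<le> 2 * y * (sqrt m / sqrt y - 1)"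
      using y by (intro mult_left_mono) auto
    also have "\<dots> = 2 * sqrt m * (y / sqrt y) - 2 * y"
      by (simp add: algebra_simps)
    also have "\<dots> = 2 * sqrt m * sqrt y - 2 * y"
      using y by (simp add: real_div_sqrt)
    also have "2 * y * ln (sqrt m / sqrt y) = y * ln m - y * ln y"
      using y m by (simp add: ln_div ln_sqrt algebra_simps)
    finally show ?thesis using y m by (simp add: power2_eq_square algebra_simps)
  qed
  have "L (\<lambda>x. \<bar>f x - m\<bar>) = L (\<lambda>x. \<bar>sqrt (f x) - sqrt m\<bar> * (sqrt (f x) + sqrt m))"
  proof (rule mean_cong)
    fix x assume "x \<in> S"
    then have "f x > 0" using f by simp
    then have "f x - m = (sqrt (f x) - sqrt m) * (sqrt (f x) + sqrt m)"
      using m by (simp add: algebra_simps)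
    moreover have "sqrt (f x) + sqrt m \<ge> 0" using \<open>f x > 0\<close> m by simp
    ultimately show "\<bar>f x - m\<bar> = \<bar>sqrt (f x) - sqrt m\<bar> * (sqrt (f x) + sqrt m)"
      by (simp add: abs_mult)
  qed
  moreover have "(L (\<lambda>x. \<bar>sqrt (f x) - sqrt m\<bar> * (sqrt (f x) + sqrt m)))\<^sup>2
      \<le> L (\<lambda>x. \<bar>sqrt (f x) - sqrt m\<bar>\<^sup>2) * L (\<lambda>x. (sqrt (f x) + sqrt m)\<^sup>2)"
    using mean_Cauchy_Schwarz[of "\<lambda>x. \<bar>sqrt (f x) - sqrt m\<bar>" "\<lambda>x. sqrt (f x) + sqrt m"] by simp
  ultimately have "(L (\<lambda>x. \<bar>f x - m\<bar>))\<^sup>2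
      \<le> L (\<lambda>x. \<bar>sqrt (f x) - sqrt m\<bar>\<^sup>2) * L (\<lambda>x. (sqrt (f x) + sqrt m)\<^sup>2)"
    by presburger
  also have "\<dots> \<le> L (\<lambda>x. f x * ln (f x) - f x * ln m - f x + m) * L (\<lambda>x. 2 * (f x + m))"
  proof (rule mult_mono)
    show "L (\<lambda>x. \<bar>sqrt (f x) - sqrt m\<bar>\<^sup>2) \<le> L (\<lambda>x. f x * ln (f x) - f x * ln m - f x + m)"
      by (rule mean_mono) (use key f in auto)
    show "L (\<lambda>x. (sqrt (f x) + sqrt m)\<^sup>2) \<le> L (\<lambda>x. 2 * (f x + m))"
    proof (rule mean_mono)
      fix x assume "x \<in> S"
      then have "(sqrt (f x) + sqrt m)\<^sup>2 + (sqrt (f x) - sqrt m)\<^sup>2 = 2 * (f x + m)"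
        using f[of x] m by (simp add: power2_eq_square algebra_simps)
      then show "(sqrt (f x) + sqrt m)\<^sup>2 \<le> 2 * (f x + m)"
        using zero_le_power2[of "sqrt (f x) - sqrt m"] by linarith
    qed
    have "L (\<lambda>x. \<bar>sqrt (f x) - sqrt m\<bar>\<^sup>2) \<ge> 0" by (rule mean_nonneg) simp
    also have "L (\<lambda>x. \<bar>sqrt (f x) - sqrt m\<bar>\<^sup>2) \<le> L (\<lambda>x. f x * ln (f x) - f x * ln m - f x + m)"
      by (rule mean_mono) (use key f in auto)
    finally show "0 \<le> L (\<lambda>x. f x * ln (f x) - f x * ln m - f x + m)" .
    show "0 \<le> L (\<lambda>x. (sqrt (f x) + sqrt m)\<^sup>2)" by (rule mean_nonneg) simp
  qed
  also have "L (\<lambda>x. f x * ln (f x) - f x * ln m - f x + m) = L (\<lambda>x. f x * ln (f x)) - m * ln m"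
    by (simp add: mean_add mean_diff mean_mult_const mean_const m_def)
  also have "L (\<lambda>x. 2 * (f x + m)) = 4 * m"
    by (simp add: mean_add mean_cmult mean_const m_def)
  finally show ?thesis by (simp add: m_def mult.commute)
qed

end

lemma mean_on_uniform:
  assumes "finite I" "I \<noteq> {}"
  shows "mean_on I (\<lambda>f. (\<Sum>i\<in>I. f i) / real (card I))"
  unfolding mean_on_def
  by (intro conjI exI[of _ "\<lambda>_. 1 / real (card I)"]) (use assms in \<open>auto simp: sum_divide_distrib\<close>)

text \<open>Averaging a kernel: this makes averages over a random site and powers of the transition
  operator again functionals with nonnegative weights of total mass 1.\<close>

lemma mean_on_compose:
  assumes L: "mean_on S L" and M: "\<And>x. x \<in> S \<Longrightarrow> mean_on S' (\<lambda>f. M f x)"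
  shows "mean_on S' (\<lambda>f. L (M f))"
proof -
  obtain k where k': "finite S" "\<forall>x\<in>S. 0 \<le> k x" "(\<Sum>x\<in>S. k x) = 1"
    "\<forall>f. L f = (\<Sum>x\<in>S. k x * f x)" by (rule mean_onE[OF L]) (rule that)
  note k = k'(1) k'(2)[rule_format] k'(3) k'(4)[rule_format]
  have "\<forall>x\<in>S. \<exists>j. (\<forall>y\<in>S'. 0 \<le> j y) \<and> (\<Sum>y\<in>S'. j y) = 1 \<and> (\<forall>f. M f x = (\<Sum>y\<in>S'. j y * f y))"
    using M unfolding mean_on_def by blast
  from bchoice[OF this] obtain j where j': "\<forall>x\<in>S. (\<forall>y\<in>S'. 0 \<le> j x y) \<and>
      (\<Sum>y\<in>S'. j x y) = 1 \<and> (\<forall>f. M f x = (\<Sum>y\<in>S'. j x y * f y))" ..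
  have j: "x \<in> S \<Longrightarrow> y \<in> S' \<Longrightarrow> 0 \<le> j x y" "x \<in> S \<Longrightarrow> (\<Sum>y\<in>S'. j x y) = 1"
    "x \<in> S \<Longrightarrow> M f x = (\<Sum>y\<in>S'. j x y * f y)" for x y f
    using j' by simp_all
  have S': "finite S'"
  proof -
    have "S \<noteq> {}" using k(3) by auto
    then show ?thesis using M unfolding mean_on_def by blast
  qed
  let ?k = "\<lambda>y. \<Sum>x\<in>S. k x * j x y"
  have "L (M f) = (\<Sum>y\<in>S'. ?k y * f y)" for f
  proof -
    have "L (M f) = (\<Sum>x\<in>S. \<Sum>y\<in>S'. k x * j x y * f y)"
      unfolding k(4) by (intro sum.cong refl) (simp add: j sum_distrib_left mult.assoc)
    also have "\<dots> = (\<Sum>y\<in>S'. ?k y * f y)"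
      by (subst sum.swap) (simp add: sum_distrib_right)
    finally show ?thesis .
  qed
  moreover have "(\<Sum>y\<in>S'. ?k y) = 1"
    by (subst sum.swap) (simp add: j k flip: sum_distrib_left)
  moreover have "\<forall>y\<in>S'. 0 \<le> ?k y" by (auto intro!: sum_nonneg simp: j k)
  ultimately show ?thesis unfolding mean_on_def using S' by (intro conjI exI[of _ ?k]) auto
qed

section \<open>Conditional expectations of a Gibbs measure\<close>

text \<open>Only positivity of the weights on a finite product space is assumed, so that the entropy
  and chain arguments make no reference to the interaction; the Potts weights are substituted at the
  end.\<close>

locale gibbs =
  fixes \<Lambda> :: "'s set" and Q :: "'c set" and w :: "('s \<Rightarrow> 'c) \<Rightarrow> real"
  assumes finite_sites: "finite \<Lambda>" and finite_spins: "finite Q"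
    and sites_nonempty: "\<Lambda> \<noteq> {}" and spins_nonempty: "Q \<noteq> {}"
    and weight_pos: "\<And>\<sigma>. \<sigma> \<in> PiE \<Lambda> (\<lambda>_. Q) \<Longrightarrow> 0 < w \<sigma>"
begin

definition \<Omega> :: "('s \<Rightarrow> 'c) set" where "\<Omega> = PiE \<Lambda> (\<lambda>_. Q)"

definition fiber :: "'s set \<Rightarrow> ('s \<Rightarrow> 'c) \<Rightarrow> ('s \<Rightarrow> 'c) set" where
  "fiber B \<sigma> = {\<eta>\<in>\<Omega>. \<forall>y. y \<notin> B \<longrightarrow> \<eta> y = \<sigma> y}"

text \<open>The conditional expectation given the configuration off \<open>B\<close>.\<close>

definition avg :: "'s set \<Rightarrow> (('s \<Rightarrow> 'c) \<Rightarrow> real) \<Rightarrow> ('s \<Rightarrow> 'c) \<Rightarrow> real" where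
  "avg B f \<sigma> = (\<Sum>\<eta>\<in>fiber B \<sigma>. w \<eta> * f \<eta>) / (\<Sum>\<eta>\<in>fiber B \<sigma>. w \<eta>)"

text \<open>The entropy under the conditional measure on \<open>B\<close>, as a function of the
  configuration off \<open>B\<close>; \<open>f\<close> need not have mean 1, hence the subtracted
  term.\<close>

definition Ent :: "'s set \<Rightarrow> (('s \<Rightarrow> 'c) \<Rightarrow> real) \<Rightarrow> ('s \<Rightarrow> 'c) \<Rightarrow> real" where
  "Ent B f \<sigma> = avg B (\<lambda>\<eta>. f \<eta> * ln (f \<eta>)) \<sigma> - avg B f \<sigma> * ln (avg B f \<sigma>)"

lemma finite_\<Omega>: "finite \<Omega>"
  unfolding \<Omega>_def using finite_sites finite_spins by (intro finite_PiE) auto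

lemma \<Omega>_nonempty: "\<Omega> \<noteq> {}"
  unfolding \<Omega>_def using spins_nonempty by (simp add: PiE_eq_empty_iff)

lemma \<Omega>_upd: "\<sigma> \<in> \<Omega> \<Longrightarrow> x \<in> \<Lambda> \<Longrightarrow> c \<in> Q \<Longrightarrow> \<sigma>(x := c) \<in> \<Omega>"
  unfolding \<Omega>_def by (auto simp: PiE_iff extensional_def)

lemma \<Omega>_spin: "\<sigma> \<in> \<Omega> \<Longrightarrow> x \<in> \<Lambda> \<Longrightarrow> \<sigma> x \<in> Q"
  unfolding \<Omega>_def by auto

lemma w_pos: "\<sigma> \<in> \<Omega> \<Longrightarrow> 0 < w \<sigma>"
  using weight_pos by (simp add: \<Omega>_def)

lemma fiber_subset: "fiber B \<sigma> \<subseteq> \<Omega>"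
  by (auto simp: fiber_def)

lemma fiber_\<Omega>: "\<eta> \<in> fiber B \<sigma> \<Longrightarrow> \<eta> \<in> \<Omega>"
  by (auto simp: fiber_def)

lemma finite_fiber: "finite (fiber B \<sigma>)"
  using finite_subset[OF fiber_subset finite_\<Omega>] .

lemma fiber_self: "\<sigma> \<in> \<Omega> \<Longrightarrow> \<sigma> \<in> fiber B \<sigma>"
  by (simp add: fiber_def)

lemma fiber_eq: "\<eta> \<in> fiber B \<sigma> \<Longrightarrow> fiber B \<eta> = fiber B \<sigma>"
  by (auto simp: fiber_def)

lemma fiber_cong: "(\<And>y. y \<notin> B \<Longrightarrow> \<eta> y = \<sigma> y) \<Longrightarrow> fiber B \<eta> = fiber B \<sigma>"
  by (auto simp: fiber_def)

lemma fiber_mono: "C \<subseteq> B \<Longrightarrow> fiber C \<sigma> \<subseteq> fiber B \<sigma>"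
  by (auto simp: fiber_def)

lemma fiber_sym: "\<eta> \<in> fiber B \<sigma> \<Longrightarrow> \<sigma> \<in> \<Omega> \<Longrightarrow> \<sigma> \<in> fiber B \<eta>"
  by (auto simp: fiber_def)

lemma fiber_all: "\<sigma> \<in> \<Omega> \<Longrightarrow> fiber \<Lambda> \<sigma> = \<Omega>"
  by (auto simp: fiber_def \<Omega>_def PiE_iff extensional_def)

lemma fiber_single:
  assumes "\<sigma> \<in> \<Omega>" "x \<in> \<Lambda>"
  shows "fiber {x} \<sigma> = (\<lambda>c. \<sigma>(x := c)) ` Q"
proof
  show "fiber {x} \<sigma> \<subseteq> (\<lambda>c. \<sigma>(x := c)) ` Q"
  proof
    fix \<eta> assume \<eta>: "\<eta> \<in> fiber {x} \<sigma>"
    then have "\<eta> = \<sigma>(x := \<eta> x)" by (auto simp: fiber_def)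
    moreover have "\<eta> x \<in> Q" using \<eta> assms by (auto simp: fiber_def \<Omega>_spin)
    ultimately show "\<eta> \<in> (\<lambda>c. \<sigma>(x := c)) ` Q" by blast
  qed
qed (use assms in \<open>auto simp: fiber_def \<Omega>_upd\<close>)

lemma weight_fiber_pos: "\<sigma> \<in> \<Omega> \<Longrightarrow> 0 < (\<Sum>\<eta>\<in>fiber B \<sigma>. w \<eta>)"
  using fiber_self by (intro sum_pos finite_fiber) (auto intro!: w_pos fiber_\<Omega>)

lemma mean_avg: "\<sigma> \<in> \<Omega> \<Longrightarrow> mean_on (fiber B \<sigma>) (\<lambda>f. avg B f \<sigma>)"
  unfolding mean_on_def avg_def
  by (intro conjI exI[of _ "\<lambda>\<eta>. w \<eta> / (\<Sum>\<eta>\<in>fiber B \<sigma>. w \<eta>)"])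
    (use finite_fiber weight_fiber_pos[of \<sigma> B] in
      \<open>auto simp: sum_divide_distrib[symmetric] intro!: divide_nonneg_pos less_imp_le[OF w_pos] fiber_\<Omega>\<close>)

lemma mean_avg_\<Omega>: "\<sigma> \<in> \<Omega> \<Longrightarrow> mean_on \<Omega> (\<lambda>f. avg B f \<sigma>)"
  using mean_on_mono_set[OF mean_avg fiber_subset finite_\<Omega>] .

lemma avg_fiber: "\<eta> \<in> fiber B \<sigma> \<Longrightarrow> avg B f \<eta> = avg B f \<sigma>"
  using fiber_eq[of \<eta> B \<sigma>] by (simp add: avg_def)

lemma avg_fiber_cong: "(\<And>y. y \<notin> B \<Longrightarrow> \<eta> y = \<sigma> y) \<Longrightarrow> avg B f \<eta> = avg B f \<sigma>"
  using fiber_cong[of B \<eta> \<sigma>] by (simp add: avg_def)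

lemma avg_pull:
  assumes "\<sigma> \<in> \<Omega>" "\<And>\<eta>. \<eta> \<in> fiber B \<sigma> \<Longrightarrow> g \<eta> = g \<sigma>"
  shows "avg B (\<lambda>\<eta>. g \<eta> * f \<eta>) \<sigma> = g \<sigma> * avg B f \<sigma>"
proof -
  have "avg B (\<lambda>\<eta>. g \<eta> * f \<eta>) \<sigma> = avg B (\<lambda>\<eta>. g \<sigma> * f \<eta>) \<sigma>"
    by (rule mean_cong[OF mean_avg]) (use assms in auto)
  then show ?thesis by (simp add: mean_cmult[OF mean_avg] assms)
qed

text \<open>Membership in a \<open>C\<close>-fiber is symmetric and the normalising weight is
  constant along a fiber, so after exchanging the two sums the sum over \<open>\<eta>\<close>
  cancels the normalisation.\<close>

lemma avg_tower:
  assumes "C \<subseteq> B" "\<sigma> \<in> \<Omega>"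
  shows "avg B (avg C f) \<sigma> = avg B f \<sigma>"
proof -
  let ?W = "\<lambda>\<eta>. \<Sum>\<zeta>\<in>fiber C \<eta>. w \<zeta>"
  let ?F = "fiber B \<sigma>"
  have "(\<Sum>\<eta>\<in>?F. w \<eta> * avg C f \<eta>) = (\<Sum>\<eta>\<in>?F. \<Sum>\<zeta>\<in>fiber C \<eta>. w \<eta> * w \<zeta> * f \<zeta> / ?W \<eta>)"
    by (simp add: avg_def sum_distrib_left sum_divide_distrib mult.assoc)
  also have "\<dots> = (\<Sum>\<eta>\<in>?F. \<Sum>\<zeta>\<in>?F. if \<zeta> \<in> fiber C \<eta> then w \<eta> * w \<zeta> * f \<zeta> / ?W \<eta> else 0)"
  proof (rule sum.cong[OF refl])
    fix \<eta> assume \<eta>: "\<eta> \<in> ?F"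
    have "fiber C \<eta> \<subseteq> ?F" using fiber_mono[OF assms(1), of \<eta>] fiber_eq[OF \<eta>] by simp
    then show "(\<Sum>\<zeta>\<in>fiber C \<eta>. w \<eta> * w \<zeta> * f \<zeta> / ?W \<eta>)
      = (\<Sum>\<zeta>\<in>?F. if \<zeta> \<in> fiber C \<eta> then w \<eta> * w \<zeta> * f \<zeta> / ?W \<eta> else 0)"
      by (simp add: sum.If_cases finite_fiber Int_absorb1)
  qed
  also have "\<dots> = (\<Sum>\<zeta>\<in>?F. \<Sum>\<eta>\<in>?F. if \<zeta> \<in> fiber C \<eta> then w \<eta> * w \<zeta> * f \<zeta> / ?W \<eta> else 0)"
    by (rule sum.swap)
  also have "\<dots> = (\<Sum>\<zeta>\<in>?F. w \<zeta> * f \<zeta>)"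
  proof (rule sum.cong[OF refl])
    fix \<zeta> assume \<zeta>: "\<zeta> \<in> ?F"
    have sub: "fiber C \<zeta> \<subseteq> ?F" using fiber_mono[OF assms(1), of \<zeta>] fiber_eq[OF \<zeta>] by simp
    have "(\<Sum>\<eta>\<in>?F. if \<zeta> \<in> fiber C \<eta> then w \<eta> * w \<zeta> * f \<zeta> / ?W \<eta> else 0)
      = (\<Sum>\<eta>\<in>?F. if \<eta> \<in> fiber C \<zeta> then w \<eta> * (w \<zeta> * f \<zeta> / ?W \<zeta>) else 0)"
    proof (rule sum.cong[OF refl])
      fix \<eta> assume \<eta>: "\<eta> \<in> ?F"
      have iff: "\<zeta> \<in> fiber C \<eta> \<longleftrightarrow> \<eta> \<in> fiber C \<zeta>"
        using fiber_sym fiber_\<Omega>[OF \<eta>] fiber_\<Omega>[OF \<zeta>] by blast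
      show "(if \<zeta> \<in> fiber C \<eta> then w \<eta> * w \<zeta> * f \<zeta> / ?W \<eta> else 0)
        = (if \<eta> \<in> fiber C \<zeta> then w \<eta> * (w \<zeta> * f \<zeta> / ?W \<zeta>) else 0)"
        using iff fiber_eq[of \<eta> C \<zeta>] by simp
    qed
    also have "\<dots> = (\<Sum>\<eta>\<in>fiber C \<zeta>. w \<eta> * (w \<zeta> * f \<zeta> / ?W \<zeta>))"
      using sub by (simp add: sum.If_cases finite_fiber Int_absorb1)
    also have "\<dots> = w \<zeta> * f \<zeta>"
      using weight_fiber_pos[OF fiber_\<Omega>[OF \<zeta>], of C]
      by (subst sum_distrib_right[symmetric]) simp
    finally show "(\<Sum>\<eta>\<in>?F. if \<zeta> \<in> fiber C \<eta> then w \<eta> * w \<zeta> * f \<zeta> / ?W \<eta> else 0) = w \<zeta> * f \<zeta>" .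
  qed
  finally show ?thesis by (simp add: avg_def[of B])
qed

definition EE :: "(('s \<Rightarrow> 'c) \<Rightarrow> real) \<Rightarrow> real" where
  "EE f = (\<Sum>\<eta>\<in>\<Omega>. w \<eta> * f \<eta>) / (\<Sum>\<eta>\<in>\<Omega>. w \<eta>)"

lemma EE_eq: "\<sigma> \<in> \<Omega> \<Longrightarrow> avg \<Lambda> f \<sigma> = EE f"
  by (simp add: EE_def avg_def fiber_all)

lemma mean_EE: "mean_on \<Omega> EE"
proof -
  obtain \<sigma> where \<sigma>: "\<sigma> \<in> \<Omega>" using \<Omega>_nonempty by blast
  have "EE = (\<lambda>f. avg \<Lambda> f \<sigma>)" using EE_eq[OF \<sigma>] by auto
  then show ?thesis using mean_avg[OF \<sigma>, of \<Lambda>] fiber_all[OF \<sigma>] by simp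
qed

lemma EE_avg: "B \<subseteq> \<Lambda> \<Longrightarrow> EE (avg B f) = EE f"
  using avg_tower[of B \<Lambda>] EE_eq \<Omega>_nonempty by (metis ex_in_conv)

lemma avg_mult_avg:
  assumes "\<sigma> \<in> \<Omega>"
  shows "avg B (\<lambda>\<eta>. avg B g \<eta> * f \<eta>) \<sigma> = avg B g \<sigma> * avg B f \<sigma>"
  using assms by (intro avg_pull) (auto intro: avg_fiber)

text \<open>Each conditional expectation is an orthogonal projection for the Gibbs measure; averaged
  over the sites, this is the source of the reversibility of the chain.\<close>

lemma EE_self_adjoint:
  assumes "B \<subseteq> \<Lambda>"
  shows "EE (\<lambda>\<eta>. g \<eta> * avg B f \<eta>) = EE (\<lambda>\<eta>. avg B g \<eta> * f \<eta>)"
proof -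
  have "EE (\<lambda>\<eta>. g \<eta> * avg B f \<eta>) = EE (avg B (\<lambda>\<eta>. avg B f \<eta> * g \<eta>))"
    by (simp add: EE_avg[OF assms] mult.commute)
  also have "\<dots> = EE (avg B (\<lambda>\<eta>. avg B g \<eta> * f \<eta>))"
    by (rule mean_cong[OF mean_EE]) (simp only: avg_mult_avg, rule mult.commute)
  finally show ?thesis by (simp add: EE_avg[OF assms])
qed

section \<open>Heat-bath probabilities and oscillation bounds\<close>

definition pr :: "'s \<Rightarrow> ('s \<Rightarrow> 'c) \<Rightarrow> 'c \<Rightarrow> real" where
  "pr x \<sigma> c = w (\<sigma>(x := c)) / (\<Sum>c'\<in>Q. w (\<sigma>(x := c')))"

lemma weight_spin_pos:
  assumes "\<sigma> \<in> \<Omega>" "x \<in> \<Lambda>"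
  shows "0 < (\<Sum>c\<in>Q. w (\<sigma>(x := c)))"
  using assms spins_nonempty by (intro sum_pos finite_spins w_pos \<Omega>_upd) auto

lemma pr_nonneg: "\<sigma> \<in> \<Omega> \<Longrightarrow> x \<in> \<Lambda> \<Longrightarrow> c \<in> Q \<Longrightarrow> 0 \<le> pr x \<sigma> c"
  unfolding pr_def using w_pos[OF \<Omega>_upd] weight_spin_pos by (simp add: less_imp_le)

lemma sum_pr: "\<sigma> \<in> \<Omega> \<Longrightarrow> x \<in> \<Lambda> \<Longrightarrow> (\<Sum>c\<in>Q. pr x \<sigma> c) = 1"
  unfolding pr_def using weight_spin_pos[of \<sigma> x] by (simp flip: sum_divide_distrib)

lemma avg_single:
  assumes "\<sigma> \<in> \<Omega>" "x \<in> \<Lambda>"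
  shows "avg {x} f \<sigma> = (\<Sum>c\<in>Q. pr x \<sigma> c * f (\<sigma>(x := c)))"
proof -
  have inj: "inj_on (\<lambda>c. \<sigma>(x := c)) Q" by (auto simp: inj_on_def fun_upd_eqD)
  show ?thesis unfolding avg_def fiber_single[OF assms] pr_def
    by (simp add: sum.reindex[OF inj] sum_divide_distrib)
qed

text \<open>An oscillation vector in the sense of Dobrushin: \<open>D y\<close> is any upper bound
  for the effect of the spin at \<open>y\<close>, not the optimal one, so that bounds can be
  propagated without computing suprema.\<close>

definition lip :: "(('s \<Rightarrow> 'c) \<Rightarrow> real) \<Rightarrow> ('s \<Rightarrow> real) \<Rightarrow> bool" where
  "lip h D \<longleftrightarrow> (\<forall>y\<in>\<Lambda>. \<forall>\<sigma>\<in>\<Omega>. \<forall>c\<in>Q. \<bar>h (\<sigma>(y := c)) - h \<sigma>\<bar> \<le> D y)"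

lemma lipD: "lip h D \<Longrightarrow> y \<in> \<Lambda> \<Longrightarrow> \<sigma> \<in> \<Omega> \<Longrightarrow> c \<in> Q \<Longrightarrow> \<bar>h (\<sigma>(y := c)) - h \<sigma>\<bar> \<le> D y"
  by (simp add: lip_def)

lemma lip_mono: "lip h D \<Longrightarrow> (\<And>y. y \<in> \<Lambda> \<Longrightarrow> D y \<le> D' y) \<Longrightarrow> lip h D'"
  unfolding lip_def by (meson order_trans)

lemma lip_nonneg: "lip h D \<Longrightarrow> y \<in> \<Lambda> \<Longrightarrow> 0 \<le> D y"
  using \<Omega>_nonempty spins_nonempty lipD abs_ge_zero order_trans by (metis ex_in_conv)

lemma lip_single:
  assumes "lip h D" "x \<in> \<Lambda>" "\<sigma> \<in> \<Omega>" "\<eta> \<in> fiber {x} \<sigma>"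
  shows "\<bar>h \<eta> - h \<sigma>\<bar> \<le> D x"
  using assms fiber_single[OF assms(3,2)] by (auto simp: lip_def)

text \<open>The spins in \<open>B\<close> are reset one after another; the intermediate
  configurations stay in \<open>\<Omega>\<close> because the state space is a full product.\<close>

lemma lip_fiber:
  assumes h: "lip h D" and "B \<subseteq> \<Lambda>" and "\<sigma> \<in> \<Omega>" "\<eta> \<in> fiber B \<sigma>"
  shows "\<bar>h \<eta> - h \<sigma>\<bar> \<le> (\<Sum>y\<in>B. D y)"
proof -
  have "finite B" using finite_subset[OF assms(2) finite_sites] .
  then show ?thesis using assms(2-)
  proof (induction B arbitrary: \<eta> rule: finite_induct)
    case empty
    then have "\<eta> = \<sigma>" by (auto simp: fiber_def)
    then show ?case by simp
  next
    case (insert x B)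
    let ?\<eta> = "\<eta>(x := \<sigma> x)"
    have \<eta>: "\<eta> \<in> \<Omega>" using insert fiber_\<Omega> by blast
    have x: "x \<in> \<Lambda>" using insert by simp
    have "?\<eta> \<in> fiber B \<sigma>"
      using insert \<eta> x by (auto simp: fiber_def \<Omega>_upd \<Omega>_spin)
    then have "\<bar>h ?\<eta> - h \<sigma>\<bar> \<le> (\<Sum>y\<in>B. D y)" using insert by simp
    moreover have "\<bar>h ?\<eta> - h \<eta>\<bar> \<le> D x"
      using lipD[OF h x \<eta> \<Omega>_spin[OF insert(5) x]] .
    ultimately show ?case using insert by simp
  qed
qed

end

section \<open>Entropy tensorization under Dobrushin's condition\<close>

text \<open>Since both vectors have the same total, \<open>u\<close> may be shifted by its minimum;
  the negative parts of \<open>a c - b c\<close> are then dropped, so the oscillation is paid once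
  and no factor 2 appears.\<close>

lemma sum_diff_mult_le:
  fixes u :: "'c \<Rightarrow> real" and Q :: "'c set"
  assumes "(\<Sum>c\<in>Q. max 0 (a c - b c)) \<le> r" "(\<Sum>c\<in>Q. a c) = (\<Sum>c\<in>Q. b c)"
    "\<And>c c'. c \<in> Q \<Longrightarrow> c' \<in> Q \<Longrightarrow> \<bar>u c - u c'\<bar> \<le> d" "0 \<le> d" "finite Q" "Q \<noteq> {}"
  shows "(\<Sum>c\<in>Q. (a c - b c) * u c) \<le> r * d"
proof -
  obtain c0 where c0: "c0 \<in> Q" "\<And>c. c \<in> Q \<Longrightarrow> u c0 \<le> u c"
    using arg_min_if_finite(1)[of Q u] arg_min_least[of Q _ u] assms(5,6) by blast
  have "(\<Sum>c\<in>Q. (a c - b c) * u c) = (\<Sum>c\<in>Q. (a c - b c) * (u c - u c0)) + (\<Sum>c\<in>Q. (a c - b c) * u c0)"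
    by (simp add: sum.distrib[symmetric] algebra_simps)
  also have "(\<Sum>c\<in>Q. (a c - b c) * u c0) = 0"
    using assms(2) by (simp add: sum_distrib_right[symmetric] sum_subtractf)
  also have "(\<Sum>c\<in>Q. (a c - b c) * (u c - u c0)) \<le> (\<Sum>c\<in>Q. max 0 (a c - b c) * d)"
  proof (rule sum_mono)
    fix c assume c: "c \<in> Q"
    have "(a c - b c) * (u c - u c0) \<le> max 0 (a c - b c) * (u c - u c0)"
      using c0(2)[OF c] by (intro mult_right_mono) auto
    also have "\<dots> \<le> max 0 (a c - b c) * d"
      using assms(3)[OF c c0(1)] by (intro mult_left_mono) auto
    finally show "(a c - b c) * (u c - u c0) \<le> max 0 (a c - b c) * d" .
  qed
  also have "\<dots> \<le> r * d"
    unfolding sum_distrib_right[symmetric] using assms by (intro mult_right_mono)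
  finally show ?thesis by simp
qed

text \<open>The sum of positive parts in \<open>influence\<close> is the total variation distance of
  two heat-bath laws, that is, an entry of Dobrushin's matrix. The majorant with entries \<rho> and
  0 is symmetric, so \<alpha> bounds its row and column sums alike: both together give the
  square-summed estimates behind the entropy bound, and the columns give the decay of oscillations
  along the chain.\<close>

locale dobrushin = gibbs +
  fixes nb :: "'a \<Rightarrow> 'a set" and \<rho> \<alpha> p :: real
  assumes nb_subset: "x \<in> \<Lambda> \<Longrightarrow> nb x \<subseteq> \<Lambda>"
    and nb_irrefl: "x \<notin> nb x"
    and nb_sym: "x \<in> \<Lambda> \<Longrightarrow> y \<in> \<Lambda> \<Longrightarrow> y \<in> nb x \<longleftrightarrow> x \<in> nb y"
    and nb_card: "x \<in> \<Lambda> \<Longrightarrow> real (card (nb x)) * \<rho> \<le> \<alpha>"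
    and \<rho>_nonneg: "0 \<le> \<rho>" and \<alpha>_pos: "0 < \<alpha>" and \<alpha>_less: "\<alpha> < 1"
    and p_pos: "0 < p"
    and pr_ge: "x \<in> \<Lambda> \<Longrightarrow> \<sigma> \<in> \<Omega> \<Longrightarrow> c \<in> Q \<Longrightarrow> p \<le> pr x \<sigma> c"
    and influence: "x \<in> \<Lambda> \<Longrightarrow> y \<in> \<Lambda> \<Longrightarrow> x \<noteq> y \<Longrightarrow> \<sigma> \<in> \<Omega> \<Longrightarrow> c' \<in> Q \<Longrightarrow>
      (\<Sum>c\<in>Q. max 0 (pr x \<sigma> c - pr x (\<sigma>(y := c')) c)) \<le> (if y \<in> nb x then \<rho> else 0)"
begin

definition infl :: "'a \<Rightarrow> 'a \<Rightarrow> real" where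
  "infl x y = (if y \<in> nb x then \<rho> else 0)"

lemma infl_nonneg: "0 \<le> infl x y"
  by (simp add: infl_def \<rho>_nonneg)

lemma infl_self: "infl x x = 0"
  by (simp add: infl_def nb_irrefl)

lemma infl_sym: "x \<in> \<Lambda> \<Longrightarrow> y \<in> \<Lambda> \<Longrightarrow> infl x y = infl y x"
  by (simp add: infl_def nb_sym)

lemma p_le_1: "p \<le> 1"
proof -
  obtain x \<sigma> c where x: "x \<in> \<Lambda>" "\<sigma> \<in> \<Omega>" "c \<in> Q"
    using sites_nonempty \<Omega>_nonempty spins_nonempty by blast
  have "pr x \<sigma> c \<le> (\<Sum>c\<in>Q. pr x \<sigma> c)"
    by (rule member_le_sum) (use x finite_spins pr_nonneg in auto)
  then show ?thesis using pr_ge[OF x] sum_pr[OF x(2,1)] by simp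
qed

lemma infl_row:
  assumes "x \<in> \<Lambda>" "B \<subseteq> \<Lambda>"
  shows "(\<Sum>y\<in>B. infl x y) \<le> \<alpha>"
proof -
  have "(\<Sum>y\<in>B. infl x y) \<le> (\<Sum>y\<in>\<Lambda>. infl x y)"
    by (rule sum_mono2) (use assms finite_sites infl_nonneg in auto)
  also have "\<dots> = (\<Sum>y\<in>nb x. \<rho>)"
    unfolding infl_def using nb_subset[OF assms(1)] finite_sites
    by (simp add: sum.If_cases Int_absorb1)
  also have "\<dots> \<le> \<alpha>" using nb_card[OF assms(1)] by simp
  finally show ?thesis .
qed

text \<open>Averaging at \<open>x\<close> erases the dependence on the spin at \<open>x\<close> and
  hands it on to the neighbours. For a change at another site \<open>y\<close> the difference splits
  into the old kernel applied to a difference of values, at most \<open>D y\<close>, and a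
  difference of kernels applied to one function, at most \<open>infl x y * D x\<close>.\<close>

lemma lip_avg:
  assumes h: "lip h D" and x: "x \<in> \<Lambda>"
  shows "lip (avg {x} h) (\<lambda>y. if y = x then 0 else D y + infl x y * D x)"
  unfolding lip_def
proof (intro ballI)
  fix y \<sigma> c' assume y: "y \<in> \<Lambda>" and \<sigma>: "\<sigma> \<in> \<Omega>" and c': "c' \<in> Q"
  let ?\<sigma> = "\<sigma>(y := c')"
  have \<sigma>': "?\<sigma> \<in> \<Omega>" using \<Omega>_upd[OF \<sigma> y c'] .
  show "\<bar>avg {x} h ?\<sigma> - avg {x} h \<sigma>\<bar> \<le> (if y = x then 0 else D y + infl x y * D x)"
  proof (cases "y = x")
    case True
    have "avg {x} h ?\<sigma> = avg {x} h \<sigma>" by (rule avg_fiber_cong) (use True in auto)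
    then show ?thesis using True by simp
  next
    case False
    let ?u = "\<lambda>c. h (?\<sigma>(x := c))"
    have tw: "?\<sigma>(x := c) = (\<sigma>(x := c))(y := c')" for c using False by (simp add: fun_upd_twist)
    have "avg {x} h ?\<sigma> - avg {x} h \<sigma> = (\<Sum>c\<in>Q. pr x \<sigma> c * (?u c - h (\<sigma>(x := c))))
        + (\<Sum>c\<in>Q. (pr x ?\<sigma> c - pr x \<sigma> c) * ?u c)"
      by (simp add: avg_single[OF \<sigma> x] avg_single[OF \<sigma>' x] sum.distrib[symmetric]
          sum_subtractf[symmetric] algebra_simps)
    moreover have "\<bar>\<Sum>c\<in>Q. pr x \<sigma> c * (?u c - h (\<sigma>(x := c)))\<bar> \<le> D y"
    proof -
      have "\<bar>\<Sum>c\<in>Q. pr x \<sigma> c * (?u c - h (\<sigma>(x := c)))\<bar> \<le> (\<Sum>c\<in>Q. pr x \<sigma> c * D y)"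
      proof (rule order_trans[OF sum_abs], rule sum_mono)
        fix c assume c: "c \<in> Q"
        have "\<bar>?u c - h (\<sigma>(x := c))\<bar> \<le> D y"
          unfolding tw by (rule lipD[OF h y \<Omega>_upd[OF \<sigma> x c] c'])
        then show "\<bar>pr x \<sigma> c * (?u c - h (\<sigma>(x := c)))\<bar> \<le> pr x \<sigma> c * D y"
          using pr_nonneg[OF \<sigma> x c] by (simp add: abs_mult mult_left_mono)
      qed
      then show ?thesis by (simp add: sum_pr[OF \<sigma> x] sum_distrib_right[symmetric])
    qed
    moreover have "\<bar>\<Sum>c\<in>Q. (pr x ?\<sigma> c - pr x \<sigma> c) * ?u c\<bar> \<le> infl x y * D x"
    proof -
      have osc: "\<bar>?u c - ?u c''\<bar> \<le> D x" if "c \<in> Q" "c'' \<in> Q" for c c''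
        using lipD[OF h x \<Omega>_upd[OF \<sigma>' x that(2)] that(1)] by simp
      have i1: "(\<Sum>c\<in>Q. max 0 (pr x \<sigma> c - pr x ?\<sigma> c)) \<le> infl x y"
        unfolding infl_def using influence[OF x y _ \<sigma> c'] False by blast
      have i2: "(\<Sum>c\<in>Q. max 0 (pr x ?\<sigma> c - pr x \<sigma> c)) \<le> infl x y"
        unfolding infl_def using influence[OF x y _ \<sigma>' \<Omega>_spin[OF \<sigma> y]] False by simp
      have s: "(\<Sum>c\<in>Q. pr x ?\<sigma> c) = (\<Sum>c\<in>Q. pr x \<sigma> c)"
        by (simp add: sum_pr \<sigma> \<sigma>' x)
      have "(\<Sum>c\<in>Q. (pr x ?\<sigma> c - pr x \<sigma> c) * ?u c) \<le> infl x y * D x"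
        by (rule sum_diff_mult_le[OF i2 s osc lip_nonneg[OF h x] finite_spins spins_nonempty])
      moreover have "(\<Sum>c\<in>Q. (pr x \<sigma> c - pr x ?\<sigma> c) * ?u c) \<le> infl x y * D x"
        by (rule sum_diff_mult_le[OF i1 s[symmetric] osc lip_nonneg[OF h x] finite_spins spins_nonempty])
      moreover have "(\<Sum>c\<in>Q. (pr x \<sigma> c - pr x ?\<sigma> c) * ?u c) = - (\<Sum>c\<in>Q. (pr x ?\<sigma> c - pr x \<sigma> c) * ?u c)"
        by (simp add: sum_negf[symmetric] algebra_simps)
      ultimately show ?thesis by linarith
    qed
    ultimately show ?thesis using False by simp
  qed
qed

lemma avg_spin_ge:
  assumes "x \<in> B" "B \<subseteq> \<Lambda>" "\<sigma> \<in> \<Omega>" "c \<in> Q"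
  shows "p \<le> avg B (\<lambda>\<eta>. of_bool (\<eta> x = c)) \<sigma>"
proof -
  have x: "x \<in> \<Lambda>" using assms by blast
  have "p \<le> avg B (avg {x} (\<lambda>\<eta>. of_bool (\<eta> x = c))) \<sigma>"
  proof (rule mean_ge[OF mean_avg_\<Omega>[OF assms(3)]])
    fix \<eta> assume \<eta>: "\<eta> \<in> \<Omega>"
    have "avg {x} (\<lambda>\<eta>. of_bool (\<eta> x = c)) \<eta> = (\<Sum>c'\<in>Q. if c' = c then pr x \<eta> c else 0)"
      unfolding avg_single[OF \<eta> x] by (rule sum.cong) auto
    also have "\<dots> = pr x \<eta> c" using assms(4) finite_spins by simp
    finally show "p \<le> avg {x} (\<lambda>\<eta>. of_bool (\<eta> x = c)) \<eta>" using pr_ge[OF x \<eta> assms(4)] by simp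
  qed
  then show ?thesis using avg_tower[of "{x}" B \<sigma>] assms by simp
qed

end

text \<open>Dobrushin's comparison of a density \<open>f\<close> relative to the Gibbs measure in \<open>B\<close> with boundary
  values \<open>\<sigma>\<close>.\<close>

locale dobrushin_density = dobrushin \<Lambda> Q w nb \<rho> \<alpha> p
  for \<Lambda> :: "'a set" and Q :: "'b set" and w nb \<rho> \<alpha> p +
  fixes B and f :: "('a \<Rightarrow> 'b) \<Rightarrow> real" and \<sigma>
  assumes B: "B \<subseteq> \<Lambda>" and f_pos: "\<And>\<eta>. \<eta> \<in> \<Omega> \<Longrightarrow> 0 < f \<eta>" and \<sigma>: "\<sigma> \<in> \<Omega>"
begin

definition "m = avg B f \<sigma>"

definition \<nu> :: "(('a \<Rightarrow> 'b) \<Rightarrow> real) \<Rightarrow> real" where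
  "\<nu> h = avg B (\<lambda>\<eta>. f \<eta> * h \<eta>) \<sigma> / m"

text \<open>For \<open>x\<close> in \<open>B\<close>, this is the L1 distance between the
  conditional laws of the spin at \<open>x\<close> under \<open>\<nu>\<close> and under the Gibbs
  measure, averaged over \<open>\<nu>\<close>.\<close>

definition dev :: "'a \<Rightarrow> real" where
  "dev x = avg B (\<lambda>\<eta>. \<bar>f \<eta> - avg {x} f \<eta>\<bar>) \<sigma> / m"

text \<open>Dobrushin's notion of an estimate for two measures, here \<open>\<nu>\<close> and the
  conditional Gibbs measure: \<open>a y\<close> is the discrepancy attributed to the site
  \<open>y\<close>.\<close>

definition bounds :: "('a \<Rightarrow> real) \<Rightarrow> bool" where
  "bounds a \<longleftrightarrow> (\<forall>h D. lip h D \<longrightarrow> \<bar>\<nu> h - avg B h \<sigma>\<bar> \<le> (\<Sum>y\<in>B. a y * D y))"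

text \<open>The affine map whose fixed point is the estimate aimed at; iterating it sums the Neumann
  series of the influence matrix applied to \<open>dev\<close>.\<close>

definition step :: "('a \<Rightarrow> real) \<Rightarrow> 'a \<Rightarrow> real" where
  "step a x = dev x + (\<Sum>y\<in>B. infl x y * a y)"

lemma finite_B: "finite B"
  using finite_subset[OF B finite_sites] .

lemma m_pos: "0 < m"
  unfolding m_def by (rule mean_pos[OF mean_avg_\<Omega>[OF \<sigma>]]) (rule f_pos)

lemma dev_nonneg: "0 \<le> dev x"
  unfolding dev_def using m_pos by (intro divide_nonneg_pos mean_nonneg[OF mean_avg_\<Omega>[OF \<sigma>]]) auto

lemma mean_\<nu>: "mean_on (fiber B \<sigma>) \<nu>"
proof -
  have M: "mean_on (fiber B \<sigma>) (\<lambda>f. avg B f \<sigma>)" using mean_avg[OF \<sigma>] .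
  obtain k where k: "\<forall>x\<in>fiber B \<sigma>. 0 \<le> k x"
    "\<forall>f. avg B f \<sigma> = (\<Sum>x\<in>fiber B \<sigma>. k x * f x)" by (rule mean_onE[OF M]) (rule that)
  show ?thesis unfolding mean_on_def
  proof (intro conjI exI[of _ "\<lambda>x. k x * f x / m"] ballI allI)
    show "0 \<le> k x * f x / m" if "x \<in> fiber B \<sigma>" for x
      using that k(1) f_pos[OF fiber_\<Omega>[OF that]] m_pos by simp
    have "(\<Sum>x\<in>fiber B \<sigma>. k x * f x / m) = m / m"
      unfolding sum_divide_distrib[symmetric] m_def by (simp only: k(2)[rule_format])
    then show "(\<Sum>x\<in>fiber B \<sigma>. k x * f x / m) = 1" using m_pos by simp
    show "\<nu> h = (\<Sum>x\<in>fiber B \<sigma>. k x * f x / m * h x)" for h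
      unfolding \<nu>_def k(2)[rule_format] by (simp add: sum_divide_distrib mult.assoc)
  qed (rule finite_fiber)
qed

text \<open>The starting point of the iteration: two configurations in one fiber differ by at most
  the full oscillation, so this estimate holds for any density.\<close>

lemma bounds_one: "bounds (\<lambda>_. 1)"
  unfolding bounds_def
proof (intro allI impI)
  fix h D assume h: "lip h D"
  let ?S = "\<Sum>y\<in>B. 1 * D y"
  have "\<bar>h \<eta> - avg B h \<sigma>\<bar> \<le> ?S" if \<eta>: "\<eta> \<in> fiber B \<sigma>" for \<eta>
  proof -
    have *: "\<bar>h \<zeta> - h \<eta>\<bar> \<le> ?S" if "\<zeta> \<in> fiber B \<sigma>" for \<zeta>
      using lip_fiber[OF h B fiber_\<Omega>[OF \<eta>], of \<zeta>] that fiber_eq[OF \<eta>] by simp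
    have "avg B h \<sigma> \<le> h \<eta> + ?S"
      by (rule mean_le[OF mean_avg[OF \<sigma>]]) (use * in \<open>force simp: abs_le_iff\<close>)
    moreover have "h \<eta> - ?S \<le> avg B h \<sigma>"
      by (rule mean_ge[OF mean_avg[OF \<sigma>]]) (use * in \<open>force simp: abs_le_iff\<close>)
    ultimately show ?thesis by linarith
  qed
  then have "\<nu> (\<lambda>\<eta>. \<bar>h \<eta> - avg B h \<sigma>\<bar>) \<le> ?S" by (intro mean_le[OF mean_\<nu>])
  moreover have "\<bar>\<nu> (\<lambda>\<eta>. h \<eta> - avg B h \<sigma>)\<bar> \<le> \<nu> (\<lambda>\<eta>. \<bar>h \<eta> - avg B h \<sigma>\<bar>)"
    by (rule mean_abs_le[OF mean_\<nu>])
  ultimately show "\<bar>\<nu> h - avg B h \<sigma>\<bar> \<le> ?S"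
    by (simp add: mean_diff[OF mean_\<nu>] mean_const[OF mean_\<nu>])
qed

text \<open>The increment \<open>h - avg {x} h\<close> has mean zero given the spins off
  \<open>x\<close>, so the density \<open>f\<close> may be replaced by \<open>f - avg {x} f\<close>;
  this is where \<open>dev x\<close> comes from.\<close>

lemma \<nu>_update_diff:
  assumes h: "lip h D" and x: "x \<in> B"
  shows "\<bar>\<nu> (\<lambda>\<eta>. h \<eta> - avg {x} h \<eta>)\<bar> \<le> dev x * D x"
proof -
  have xL: "x \<in> \<Lambda>" using x B by blast
  have xs: "{x} \<subseteq> B" using x by simp
  let ?g = "\<lambda>\<eta>. h \<eta> - avg {x} h \<eta>" and ?f = "\<lambda>\<eta>. f \<eta> - avg {x} f \<eta>"
  have "avg B (\<lambda>\<eta>. avg {x} f \<eta> * ?g \<eta>) \<sigma> = avg B (avg {x} (\<lambda>\<eta>. avg {x} f \<eta> * ?g \<eta>)) \<sigma>"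
    by (simp add: avg_tower[OF xs \<sigma>])
  also have "\<dots> = avg B (\<lambda>_. 0) \<sigma>"
  proof (rule mean_cong[OF mean_avg_\<Omega>[OF \<sigma>]])
    fix \<eta> assume \<eta>: "\<eta> \<in> \<Omega>"
    have "avg {x} ?g \<eta> = 0"
      by (simp add: mean_diff[OF mean_avg[OF \<eta>]] avg_tower[OF subset_refl \<eta>])
    then show "avg {x} (\<lambda>\<eta>. avg {x} f \<eta> * ?g \<eta>) \<eta> = 0" by (simp add: avg_mult_avg[OF \<eta>])
  qed
  also have "\<dots> = 0" by (rule mean_const[OF mean_avg[OF \<sigma>]])
  finally have "avg B (\<lambda>\<eta>. f \<eta> * ?g \<eta>) \<sigma> = avg B (\<lambda>\<eta>. ?f \<eta> * ?g \<eta>) \<sigma>"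
    using mean_diff[OF mean_avg[OF \<sigma>], of B "\<lambda>\<eta>. f \<eta> * ?g \<eta>" "\<lambda>\<eta>. avg {x} f \<eta> * ?g \<eta>"]
    by (simp add: left_diff_distrib)
  moreover have "\<bar>avg B (\<lambda>\<eta>. ?f \<eta> * ?g \<eta>) \<sigma>\<bar> \<le> avg B (\<lambda>\<eta>. \<bar>?f \<eta>\<bar> * D x) \<sigma>"
  proof (rule order_trans[OF mean_abs_le[OF mean_avg_\<Omega>[OF \<sigma>]]], rule mean_mono[OF mean_avg_\<Omega>[OF \<sigma>]])
    fix \<eta> assume \<eta>: "\<eta> \<in> \<Omega>"
    have b: "\<bar>h \<zeta> - h \<eta>\<bar> \<le> D x" if "\<zeta> \<in> fiber {x} \<eta>" for \<zeta> using lip_single[OF h xL \<eta> that] .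
    have "avg {x} h \<eta> \<le> h \<eta> + D x" "h \<eta> - D x \<le> avg {x} h \<eta>"
      by (rule mean_le[OF mean_avg[OF \<eta>]] mean_ge[OF mean_avg[OF \<eta>]]; use b in \<open>force simp: abs_le_iff\<close>)+
    then have "\<bar>?g \<eta>\<bar> \<le> D x" by linarith
    then show "\<bar>?f \<eta> * ?g \<eta>\<bar> \<le> \<bar>?f \<eta>\<bar> * D x" by (simp add: abs_mult mult_left_mono)
  qed
  ultimately have "\<bar>avg B (\<lambda>\<eta>. f \<eta> * ?g \<eta>) \<sigma>\<bar> \<le> avg B (\<lambda>\<eta>. \<bar>?f \<eta>\<bar>) \<sigma> * D x"
    by (simp add: mean_mult_const[OF mean_avg[OF \<sigma>]])
  then show ?thesis using m_pos by (simp add: \<nu>_def dev_def divide_right_mono)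
qed

text \<open>Replace \<open>h\<close> by \<open>avg {x} h\<close>. The cost is
  \<open>dev x * D x\<close>, and the oscillation at \<open>x\<close> moves to the neighbours, where
  the old estimate applies; collecting the terms with \<open>D x\<close> gives
  \<open>step a x\<close> as an admissible entry at \<open>x\<close>.\<close>

lemma bounds_update:
  assumes a: "bounds a" "\<And>y. 0 \<le> a y" and x: "x \<in> B" and v: "step a x \<le> v"
  shows "bounds (a(x := v))"
  unfolding bounds_def
proof (intro allI impI)
  fix h D assume h: "lip h D"
  have xL: "x \<in> \<Lambda>" using x B by blast
  let ?D = "\<lambda>y. if y = x then 0 else D y + infl x y * D x"
  have Dx: "0 \<le> D x" using lip_nonneg[OF h xL] .
  let ?S = "\<Sum>y\<in>B. infl x y * a y" and ?T = "\<Sum>y\<in>B-{x}. a y * D y"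
  have split: "\<nu> h - avg B h \<sigma> = \<nu> (\<lambda>\<eta>. h \<eta> - avg {x} h \<eta>) + (\<nu> (avg {x} h) - avg B (avg {x} h) \<sigma>)"
    using mean_diff[OF mean_\<nu>, of h "avg {x} h"] avg_tower[OF _ \<sigma>, of "{x}" B h] x by simp
  have d: "\<bar>\<nu> (\<lambda>\<eta>. h \<eta> - avg {x} h \<eta>)\<bar> \<le> dev x * D x"
    by (rule \<nu>_update_diff[OF h x])
  have "\<bar>\<nu> (avg {x} h) - avg B (avg {x} h) \<sigma>\<bar> \<le> (\<Sum>y\<in>B. a y * ?D y)"
    using a(1) lip_avg[OF h xL] unfolding bounds_def by blast
  moreover have "(\<Sum>y\<in>B. a y * ?D y) = ?T + ?S * D x"
  proof -
    have "(\<Sum>y\<in>B. a y * ?D y) = (\<Sum>y\<in>B-{x}. a y * ?D y)"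
      by (simp add: sum.remove[OF finite_B x])
    also have "\<dots> = (\<Sum>y\<in>B-{x}. a y * D y + infl x y * a y * D x)"
      by (rule sum.cong) (auto simp: algebra_simps)
    also have "\<dots> = ?T + (\<Sum>y\<in>B-{x}. infl x y * a y) * D x"
      by (simp add: sum.distrib sum_distrib_right)
    also have "(\<Sum>y\<in>B-{x}. infl x y * a y) = ?S"
      by (simp add: sum.remove[OF finite_B x] infl_self)
    finally show ?thesis .
  qed
  ultimately have "\<bar>\<nu> h - avg B h \<sigma>\<bar> \<le> step a x * D x + ?T"
    using d by (simp add: split step_def distrib_right abs_if split: if_splits)
  also have "\<dots> \<le> v * D x + ?T"
    using v Dx by (simp add: mult_right_mono)
  also have "\<dots> = (\<Sum>y\<in>B. (a(x := v)) y * D y)"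
  proof -
    have "?T = (\<Sum>y\<in>B-{x}. (a(x := v)) y * D y)"
      by (rule sum.cong) auto
    then show ?thesis by (simp add: sum.remove[OF finite_B x])
  qed
  finally show "\<bar>\<nu> h - avg B h \<sigma>\<bar> \<le> (\<Sum>y\<in>B. (a(x := v)) y * D y)" .
qed

lemma step_mono: "(\<And>y. y \<in> B \<Longrightarrow> a y \<le> b y) \<Longrightarrow> step a x \<le> step b x"
  unfolding step_def by (intro add_left_mono sum_mono mult_left_mono infl_nonneg)

lemma step_nonneg: "(\<And>y. 0 \<le> a y) \<Longrightarrow> 0 \<le> step a x"
  unfolding step_def by (intro add_nonneg_nonneg sum_nonneg mult_nonneg_nonneg dev_nonneg infl_nonneg)

text \<open>The entries are updated one site at a time. Because \<open>a\<close> dominates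
  \<open>step a\<close>, the entries already changed have only decreased, and by monotonicity the
  value \<open>step a x\<close> computed from the original \<open>a\<close> remains
  admissible.\<close>

lemma bounds_step:
  assumes a: "bounds a" "\<And>y. 0 \<le> a y" and super: "\<And>x. x \<in> B \<Longrightarrow> step a x \<le> a x"
  shows "bounds (step a)"
proof -
  have "bounds (\<lambda>x. if x \<in> S then step a x else a x)" if "S \<subseteq> B" for S
    using finite_subset[OF that finite_B] that
  proof (induction S rule: finite_induct)
    case empty
    then show ?case using a by simp
  next
    case (insert x S)
    let ?a = "\<lambda>x. if x \<in> S then step a x else a x"
    have "bounds (?a(x := step a x))"
    proof (rule bounds_update)
      show "bounds ?a" using insert by simp
      show "0 \<le> ?a y" for y using a(2) step_nonneg[OF a(2)] by simp
      show "x \<in> B" using insert by simp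
      show "step ?a x \<le> step a x" by (rule step_mono) (use super in auto)
    qed
    moreover have "?a(x := step a x) = (\<lambda>y. if y \<in> insert x S then step a y else a y)" by auto
    ultimately show ?case by simp
  qed
  from this[of B] have b: "bounds (\<lambda>x. if x \<in> B then step a x else a x)" by simp
  show ?thesis unfolding bounds_def
  proof (intro allI impI)
    fix h D assume "lip h D"
    then have "\<bar>\<nu> h - avg B h \<sigma>\<bar> \<le> (\<Sum>y\<in>B. (if y \<in> B then step a y else a y) * D y)"
      using b unfolding bounds_def by blast
    also have "\<dots> = (\<Sum>y\<in>B. step a y * D y)" by (rule sum.cong) auto
    finally show "\<bar>\<nu> h - avg B h \<sigma>\<bar> \<le> (\<Sum>y\<in>B. step a y * D y)" .
  qed
qed

text \<open>Schur's test in the square norm: row sums enter through Cauchy-Schwarz, column sums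
  after exchanging the sums. Young's inequality is weighted with \<open>1 - \<alpha>\<close> and
  \<alpha> so that the quadratic part contracts by exactly \<alpha>.\<close>

lemma step_norm:
  assumes a: "\<And>y. 0 \<le> a y"
  shows "(\<Sum>x\<in>B. (step a x)\<^sup>2) \<le> (\<Sum>x\<in>B. (dev x)\<^sup>2) / (1 - \<alpha>) + \<alpha> * (\<Sum>x\<in>B. (a x)\<^sup>2)"
proof -
  have young: "(u + v)\<^sup>2 \<le> u\<^sup>2 / (1 - \<alpha>) + v\<^sup>2 / \<alpha>" for u v :: real
  proof -
    have "u\<^sup>2 / (1 - \<alpha>) + v\<^sup>2 / \<alpha> - (u + v)\<^sup>2 = (\<alpha> * u - (1 - \<alpha>) * v)\<^sup>2 / (\<alpha> * (1 - \<alpha>))"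
      using \<alpha>_pos \<alpha>_less by (simp add: field_simps power2_eq_square)
    also have "\<dots> \<ge> 0" using \<alpha>_pos \<alpha>_less by simp
    finally show ?thesis by simp
  qed
  have cs: "(\<Sum>y\<in>B. infl x y * a y)\<^sup>2 \<le> \<alpha> * (\<Sum>y\<in>B. infl x y * (a y)\<^sup>2)" if x: "x \<in> B" for x
  proof -
    have "(\<Sum>y\<in>B. infl x y * a y)\<^sup>2 = (\<Sum>y\<in>B. sqrt (infl x y) * (sqrt (infl x y) * a y))\<^sup>2"
      by (simp add: infl_nonneg mult.assoc[symmetric])
    also have "\<dots> \<le> (\<Sum>y\<in>B. (sqrt (infl x y))\<^sup>2) * (\<Sum>y\<in>B. (sqrt (infl x y) * a y)\<^sup>2)"
      by (rule Cauchy_Schwarz_ineq_sum)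
    also have "\<dots> = (\<Sum>y\<in>B. infl x y) * (\<Sum>y\<in>B. infl x y * (a y)\<^sup>2)"
      by (simp add: infl_nonneg power_mult_distrib)
    also have "\<dots> \<le> \<alpha> * (\<Sum>y\<in>B. infl x y * (a y)\<^sup>2)"
      using infl_row[of x B] x B by (intro mult_right_mono sum_nonneg mult_nonneg_nonneg infl_nonneg) auto
    finally show ?thesis .
  qed
  have "(\<Sum>x\<in>B. (step a x)\<^sup>2) \<le> (\<Sum>x\<in>B. (dev x)\<^sup>2 / (1 - \<alpha>) + (\<Sum>y\<in>B. infl x y * (a y)\<^sup>2))"
  proof (rule sum_mono)
    fix x assume x: "x \<in> B"
    have "(step a x)\<^sup>2 \<le> (dev x)\<^sup>2 / (1 - \<alpha>) + (\<Sum>y\<in>B. infl x y * a y)\<^sup>2 / \<alpha>"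
      unfolding step_def by (rule young)
    also have "(\<Sum>y\<in>B. infl x y * a y)\<^sup>2 / \<alpha> \<le> (\<Sum>y\<in>B. infl x y * (a y)\<^sup>2)"
      using cs[OF x] \<alpha>_pos by (simp add: field_simps)
    finally show "(step a x)\<^sup>2 \<le> (dev x)\<^sup>2 / (1 - \<alpha>) + (\<Sum>y\<in>B. infl x y * (a y)\<^sup>2)" by simp
  qed
  also have "\<dots> = (\<Sum>x\<in>B. (dev x)\<^sup>2) / (1 - \<alpha>) + (\<Sum>y\<in>B. (\<Sum>x\<in>B. infl x y) * (a y)\<^sup>2)"
    by (simp add: sum.distrib sum_divide_distrib sum_distrib_right) (rule sum.swap)
  also have "(\<Sum>y\<in>B. (\<Sum>x\<in>B. infl x y) * (a y)\<^sup>2) \<le> (\<Sum>y\<in>B. \<alpha> * (a y)\<^sup>2)"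
  proof (rule sum_mono)
    fix y assume y: "y \<in> B"
    have "(\<Sum>x\<in>B. infl x y) = (\<Sum>x\<in>B. infl y x)"
      by (rule sum.cong) (use y B infl_sym in auto)
    also have "\<dots> \<le> \<alpha>" using infl_row y B by blast
    finally show "(\<Sum>x\<in>B. infl x y) * (a y)\<^sup>2 \<le> \<alpha> * (a y)\<^sup>2" by (intro mult_right_mono) auto
  qed
  finally show ?thesis by (simp add: sum_distrib_left)
qed

lemma bounds_iterate:
  "\<exists>a s. (\<forall>n. bounds (a n) \<and> (\<forall>y. 0 \<le> a n y) \<and>
     (\<Sum>x\<in>B. (a n x)\<^sup>2) \<le> (\<Sum>x\<in>B. (dev x)\<^sup>2) / (1 - \<alpha>)\<^sup>2 + \<alpha> ^ n * s)"
proof -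
  \<comment> \<open>\<open>K\<close> is at least 1, so that the constant vector inherits
    \<open>bounds_one\<close>, and large enough that \<open>step\<close> does not increase it, which
    starts the monotone iteration.\<close>
  define K where "K = 1 + (\<Sum>x\<in>B. dev x) / (1 - \<alpha>)"
  have K: "1 \<le> K" unfolding K_def using \<alpha>_less by (auto intro!: divide_nonneg_pos sum_nonneg dev_nonneg)
  define a where "a n = (step ^^ n) (\<lambda>_. K)" for n
  have a0: "a 0 = (\<lambda>_. K)" and aS: "a (Suc n) = step (a n)" for n by (simp_all add: a_def)
  let ?E = "\<Sum>x\<in>B. (dev x)\<^sup>2" and ?s = "\<Sum>x\<in>B. K\<^sup>2"
  have "bounds (a n) \<and> (\<forall>y. 0 \<le> a n y) \<and> (\<forall>x\<in>B. step (a n) x \<le> a n x) \<and>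
     (\<Sum>x\<in>B. (a n x)\<^sup>2) \<le> ?E / (1 - \<alpha>)\<^sup>2 + \<alpha> ^ n * ?s" for n
  proof (induction n)
    case 0
    have "bounds (\<lambda>_. K)" unfolding bounds_def
    proof (intro allI impI)
      fix h D assume h: "lip h D"
      have "\<bar>\<nu> h - avg B h \<sigma>\<bar> \<le> (\<Sum>y\<in>B. 1 * D y)"
        using bounds_one h unfolding bounds_def by blast
      also have "\<dots> \<le> (\<Sum>y\<in>B. K * D y)"
        using lip_nonneg[OF h] B K by (intro sum_mono mult_right_mono) auto
      finally show "\<bar>\<nu> h - avg B h \<sigma>\<bar> \<le> (\<Sum>y\<in>B. K * D y)" .
    qed
    moreover have "step (\<lambda>_. K) x \<le> K" if x: "x \<in> B" for x
    proof -
      have "step (\<lambda>_. K) x = dev x + (\<Sum>y\<in>B. infl x y) * K"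
        by (simp add: step_def sum_distrib_right)
      also have "\<dots> \<le> (\<Sum>x\<in>B. dev x) + \<alpha> * K"
        using infl_row[of x B] x B K
        by (intro add_mono mult_right_mono member_le_sum finite_B dev_nonneg) auto
      also have "(\<Sum>x\<in>B. dev x) = (1 - \<alpha>) * (K - 1)"
        using \<alpha>_less by (simp add: K_def)
      also have "(1 - \<alpha>) * (K - 1) + \<alpha> * K \<le> K"
        using \<alpha>_less by (simp add: algebra_simps)
      finally show ?thesis .
    qed
    ultimately show ?case using K by (auto simp: a0 sum_nonneg)
  next
    case (Suc n)
    then have IH: "bounds (a n)" "\<And>y. 0 \<le> a n y" "\<And>x. x \<in> B \<Longrightarrow> step (a n) x \<le> a n x"
      "(\<Sum>x\<in>B. (a n x)\<^sup>2) \<le> ?E / (1 - \<alpha>)\<^sup>2 + \<alpha> ^ n * ?s" by blast+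
    have "(\<Sum>x\<in>B. (step (a n) x)\<^sup>2) \<le> ?E / (1 - \<alpha>) + \<alpha> * (\<Sum>x\<in>B. (a n x)\<^sup>2)"
      by (rule step_norm[OF IH(2)])
    also have "\<dots> \<le> ?E / (1 - \<alpha>) + \<alpha> * (?E / (1 - \<alpha>)\<^sup>2 + \<alpha> ^ n * ?s)"
      using IH(4) \<alpha>_pos by simp
    also have "\<dots> \<le> ?E / (1 - \<alpha>)\<^sup>2 + \<alpha> ^ Suc n * ?s"
    proof -
      have "E / u + (1 - u) * (E / u\<^sup>2) = E / u\<^sup>2" if "u \<noteq> 0" for E u :: real
        using that by (simp add: field_simps power2_eq_square)
      from this[of "1 - \<alpha>" ?E] have "?E / (1 - \<alpha>) + \<alpha> * (?E / (1 - \<alpha>)\<^sup>2) = ?E / (1 - \<alpha>)\<^sup>2"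
        using \<alpha>_less by simp
      then show ?thesis by (simp add: algebra_simps)
    qed
    finally have "(\<Sum>x\<in>B. (step (a n) x)\<^sup>2) \<le> ?E / (1 - \<alpha>)\<^sup>2 + \<alpha> ^ Suc n * ?s" .
    moreover have "bounds (step (a n))" by (rule bounds_step[OF IH(1-3)])
    ultimately show ?case
      using step_nonneg[OF IH(2)] step_mono[of "step (a n)" "a n"] IH(3) by (auto simp: aS)
  qed
  then show ?thesis by blast
qed

end

lemma (in gibbs) Ent_nonneg:
  assumes "\<sigma> \<in> \<Omega>" "\<And>\<eta>. \<eta> \<in> \<Omega> \<Longrightarrow> 0 \<le> f \<eta>"
  shows "0 \<le> Ent B f \<sigma>"
  unfolding Ent_def using mean_xlnx[OF mean_avg_\<Omega>[OF assms(1)], of f B] assms(2) by simp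

lemma (in gibbs) Ent_chain:
  assumes "C \<subseteq> B" "\<sigma> \<in> \<Omega>"
  shows "Ent B f \<sigma> = avg B (Ent C f) \<sigma> + Ent B (avg C f) \<sigma>"
proof -
  have "avg B (Ent C f) \<sigma> = avg B (avg C (\<lambda>\<eta>. f \<eta> * ln (f \<eta>))) \<sigma> - avg B (\<lambda>\<eta>. avg C f \<eta> * ln (avg C f \<eta>)) \<sigma>"
    unfolding Ent_def by (rule mean_diff[OF mean_avg[OF assms(2)]])
  then show ?thesis by (simp add: Ent_def avg_tower[OF assms])
qed

section \<open>Marginal entropies from the Dobrushin estimate\<close>

context dobrushin_density
begin

definition spin_dev :: "'a \<Rightarrow> 'b \<Rightarrow> real" where
  "spin_dev x c = \<nu> (\<lambda>\<eta>. of_bool (\<eta> x = c)) - avg B (\<lambda>\<eta>. of_bool (\<eta> x = c)) \<sigma>"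

text \<open>The indicator of a color at \<open>x\<close> oscillates only at \<open>x\<close>, so an
  estimate bounds each marginal error by its entry \<open>a n x\<close>, and the term
  \<open>\<alpha> ^ n * s\<close> of the iteration vanishes in the limit. Squares are summed because
  entropies are quadratic in the deviations.\<close>

lemma sum_spin_dev:
  "(\<Sum>x\<in>B. \<Sum>c\<in>Q. (spin_dev x c)\<^sup>2) \<le> real (card Q) * ((\<Sum>x\<in>B. (dev x)\<^sup>2) / (1 - \<alpha>)\<^sup>2)"
proof -
  obtain a s where a: "\<And>n. bounds (a n)" "\<And>n y. 0 \<le> a n y"
    "\<And>n. (\<Sum>x\<in>B. (a n x)\<^sup>2) \<le> (\<Sum>x\<in>B. (dev x)\<^sup>2) / (1 - \<alpha>)\<^sup>2 + \<alpha> ^ n * s"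
    using bounds_iterate by blast
  have le: "(\<Sum>x\<in>B. \<Sum>c\<in>Q. (spin_dev x c)\<^sup>2)
      \<le> real (card Q) * ((\<Sum>x\<in>B. (dev x)\<^sup>2) / (1 - \<alpha>)\<^sup>2 + \<alpha> ^ n * s)" for n
  proof -
    have "(spin_dev x c)\<^sup>2 \<le> (a n x)\<^sup>2" if x: "x \<in> B" for x c
    proof -
      have "lip (\<lambda>\<eta>. of_bool (\<eta> x = c)) (\<lambda>y. of_bool (y = x))"
        unfolding lip_def by auto
      then have "\<bar>spin_dev x c\<bar> \<le> (\<Sum>y\<in>B. a n y * of_bool (y = x))"
        using a(1)[of n] unfolding spin_dev_def bounds_def by blast
      also have "\<dots> = a n x" using x finite_B by (simp add: of_bool_def if_distrib cong: if_cong)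
      finally show ?thesis using power_mono[of "\<bar>spin_dev x c\<bar>" "a n x" 2] by simp
    qed
    then have "(\<Sum>x\<in>B. \<Sum>c\<in>Q. (spin_dev x c)\<^sup>2) \<le> (\<Sum>x\<in>B. \<Sum>c\<in>Q. (a n x)\<^sup>2)"
      by (intro sum_mono) auto
    also have "\<dots> = real (card Q) * (\<Sum>x\<in>B. (a n x)\<^sup>2)" by (simp add: sum_distrib_left)
    also have "\<dots> \<le> real (card Q) * ((\<Sum>x\<in>B. (dev x)\<^sup>2) / (1 - \<alpha>)\<^sup>2 + \<alpha> ^ n * s)"
      by (intro mult_left_mono a(3)) simp
    finally show ?thesis .
  qed
  have "(\<lambda>n. real (card Q) * ((\<Sum>x\<in>B. (dev x)\<^sup>2) / (1 - \<alpha>)\<^sup>2 + \<alpha> ^ n * s))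
      \<longlonglongrightarrow> real (card Q) * ((\<Sum>x\<in>B. (dev x)\<^sup>2) / (1 - \<alpha>)\<^sup>2 + 0 * s)"
    using \<alpha>_pos \<alpha>_less by (intro tendsto_intros LIMSEQ_realpow_zero) auto
  from LIMSEQ_le_const[OF this] le show ?thesis by auto
qed

text \<open>Pinsker's inequality is applied on every fiber at \<open>x\<close>, with the fiber mean
  as a factor; Cauchy-Schwarz over \<open>B\<close> then separates these means, whose average is
  \<open>m\<close>, from the local entropies.\<close>

lemma dev_Ent:
  assumes x: "x \<in> B"
  shows "(dev x)\<^sup>2 \<le> 4 / m * avg B (Ent {x} f) \<sigma>"
proof -
  have xs: "{x} \<subseteq> B" using x by simp
  note M = mean_avg_\<Omega>[OF \<sigma>]
  let ?u = "\<lambda>\<eta>. \<bar>f \<eta> - avg {x} f \<eta>\<bar>"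
  let ?A = "avg {x} f" and ?E = "Ent {x} f"
  have A: "0 < ?A \<eta>" if "\<eta> \<in> \<Omega>" for \<eta> by (rule mean_pos[OF mean_avg_\<Omega>[OF that]]) (rule f_pos)
  have E: "0 \<le> ?E \<eta>" if "\<eta> \<in> \<Omega>" for \<eta> using Ent_nonneg[OF that] f_pos by (simp add: less_imp_le)
  have "avg B ?u \<sigma> = avg B (avg {x} ?u) \<sigma>" by (simp add: avg_tower[OF xs \<sigma>])
  also have "\<dots> \<le> avg B (\<lambda>\<eta>. 2 * (sqrt (?A \<eta>) * sqrt (?E \<eta>))) \<sigma>"
  proof (rule mean_mono[OF M])
    fix \<eta> assume \<eta>: "\<eta> \<in> \<Omega>"
    have "avg {x} ?u \<eta> = avg {x} (\<lambda>\<zeta>. \<bar>f \<zeta> - ?A \<eta>\<bar>) \<eta>"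
      by (rule mean_cong[OF mean_avg[OF \<eta>]]) (simp add: avg_fiber)
    also have "(\<dots>)\<^sup>2 \<le> 4 * ?A \<eta> * ?E \<eta>"
      unfolding Ent_def by (rule mean_Pinsker[OF mean_avg_\<Omega>[OF \<eta>]]) (rule f_pos)
    also have "\<dots> = (2 * (sqrt (?A \<eta>) * sqrt (?E \<eta>)))\<^sup>2"
      using A[OF \<eta>] E[OF \<eta>] by (simp add: power_mult_distrib)
    finally show "avg {x} ?u \<eta> \<le> 2 * (sqrt (?A \<eta>) * sqrt (?E \<eta>))"
      by (rule power2_le_imp_le) (use A[OF \<eta>] E[OF \<eta>] in auto)
  qed
  also have "\<dots> = 2 * avg B (\<lambda>\<eta>. sqrt (?A \<eta>) * sqrt (?E \<eta>)) \<sigma>" by (rule mean_cmult[OF M])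
  finally have "(avg B ?u \<sigma>)\<^sup>2 \<le> (2 * avg B (\<lambda>\<eta>. sqrt (?A \<eta>) * sqrt (?E \<eta>)) \<sigma>)\<^sup>2"
    by (intro power_mono mean_nonneg[OF M]) auto
  also have "\<dots> \<le> 4 * (avg B (\<lambda>\<eta>. (sqrt (?A \<eta>))\<^sup>2) \<sigma> * avg B (\<lambda>\<eta>. (sqrt (?E \<eta>))\<^sup>2) \<sigma>)"
    using mean_Cauchy_Schwarz[OF M, of B "\<lambda>\<eta>. sqrt (?A \<eta>)" "\<lambda>\<eta>. sqrt (?E \<eta>)"] by (simp add: power_mult_distrib)
  also have "avg B (\<lambda>\<eta>. (sqrt (?A \<eta>))\<^sup>2) \<sigma> = avg B ?A \<sigma>"
    by (rule mean_cong[OF M]) (use A in \<open>simp add: less_imp_le\<close>)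
  also have "avg B ?A \<sigma> = m" by (simp add: avg_tower[OF xs \<sigma>] m_def)
  also have "avg B (\<lambda>\<eta>. (sqrt (?E \<eta>))\<^sup>2) \<sigma> = avg B ?E \<sigma>"
    by (rule mean_cong[OF M]) (use E in simp)
  finally have "(avg B ?u \<sigma>)\<^sup>2 \<le> 4 * (m * avg B ?E \<sigma>)" .
  then have "(avg B ?u \<sigma>)\<^sup>2 / m\<^sup>2 \<le> 4 * (m * avg B ?E \<sigma>) / m\<^sup>2"
    by (intro divide_right_mono) auto
  then show ?thesis using m_pos by (simp add: dev_def power_divide power2_eq_square)
qed

text \<open>On a fiber of \<open>B\<close> the averaged density depends on the spin at
  \<open>x\<close> only. Its entropy is at most its variance over \<open>m\<close>, and since every
  color has probability at least \<open>p\<close>, that variance is controlled by the squared color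
  deviations at the price 1 / \<open>p\<close>.\<close>

lemma Ent_marginal:
  assumes x: "x \<in> B"
  shows "Ent B (avg (B - {x}) f) \<sigma> \<le> m / p * (\<Sum>c\<in>Q. (spin_dev x c)\<^sup>2)"
proof -
  have xL: "x \<in> \<Lambda>" using x B by blast
  have sub: "B - {x} \<subseteq> B" by blast
  note M = mean_avg[OF \<sigma>, of B] and M\<Omega> = mean_avg_\<Omega>[OF \<sigma>, of B]
  let ?g = "avg (B - {x}) f" and ?I = "\<lambda>c \<eta>. of_bool (\<eta> x = c) :: real"
  have g_pos: "0 < ?g \<eta>" if "\<eta> \<in> \<Omega>" for \<eta> by (rule mean_pos[OF mean_avg_\<Omega>[OF that]]) (rule f_pos)
  have gm: "avg B ?g \<sigma> = m" by (simp add: avg_tower[OF sub \<sigma>] m_def)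
  \<comment> \<open>The summand linear in \<open>?g\<close> averages to \<open>m * ln m\<close>, the
    term subtracted in \<open>Ent\<close>, so only the quadratic one survives.\<close>
  have "avg B (\<lambda>\<eta>. ?g \<eta> * ln (?g \<eta>)) \<sigma> \<le> avg B (\<lambda>\<eta>. (?g \<eta> - m)\<^sup>2 / m + (?g \<eta> * (1 + ln m) - m)) \<sigma>"
  proof (rule mean_mono[OF M\<Omega>])
    fix \<eta> assume "\<eta> \<in> \<Omega>"
    then have g: "0 < ?g \<eta>" by (rule g_pos)
    have "ln (?g \<eta> / m) \<le> ?g \<eta> / m - 1" using g m_pos by (intro ln_le_minus_one) simp
    then have "?g \<eta> * ln (?g \<eta> / m) \<le> ?g \<eta> * (?g \<eta> / m - 1)" using g by (intro mult_left_mono) auto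
    then show "?g \<eta> * ln (?g \<eta>) \<le> (?g \<eta> - m)\<^sup>2 / m + (?g \<eta> * (1 + ln m) - m)"
      using g m_pos by (simp add: ln_div field_simps power2_eq_square)
  qed
  also have "\<dots> = avg B (\<lambda>\<eta>. (?g \<eta> - m)\<^sup>2) \<sigma> / m + (m * (1 + ln m) - m)"
    by (simp only: mean_add[OF M] mean_diff[OF M] mean_divide[OF M] mean_mult_const[OF M] mean_const[OF M] gm)
  finally have "Ent B ?g \<sigma> \<le> avg B (\<lambda>\<eta>. (?g \<eta> - m)\<^sup>2) \<sigma> / m"
    by (simp add: Ent_def gm algebra_simps)
  also have "avg B (\<lambda>\<eta>. (?g \<eta> - m)\<^sup>2) \<sigma> = (\<Sum>c\<in>Q. avg B (\<lambda>\<eta>. ?I c \<eta> * (?g \<eta> - m)\<^sup>2) \<sigma>)"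
  proof -
    have "avg B (\<lambda>\<eta>. (?g \<eta> - m)\<^sup>2) \<sigma> = avg B (\<lambda>\<eta>. \<Sum>c\<in>Q. ?I c \<eta> * (?g \<eta> - m)\<^sup>2) \<sigma>"
    proof (rule mean_cong[OF M\<Omega>])
      fix \<eta> assume "\<eta> \<in> \<Omega>"
      then have "\<eta> x \<in> Q" using \<Omega>_spin xL by blast
      then have "(\<Sum>c\<in>Q. ?I c \<eta>) = 1" using finite_spins by (simp add: of_bool_def)
      then show "(?g \<eta> - m)\<^sup>2 = (\<Sum>c\<in>Q. ?I c \<eta> * (?g \<eta> - m)\<^sup>2)" by (simp add: sum_distrib_right[symmetric])
    qed
    then show ?thesis by (simp add: mean_sum[OF M])
  qed
  also have "\<dots> \<le> (\<Sum>c\<in>Q. m\<^sup>2 / p * (spin_dev x c)\<^sup>2)"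
  proof (rule sum_mono)
    fix c assume c: "c \<in> Q"
    let ?P = "avg B (?I c) \<sigma>"
    have P: "p \<le> ?P" by (rule avg_spin_ge[OF x B \<sigma> c])
    then have P0: "0 < ?P" using p_pos by simp
    define G where "G = ?g (\<sigma>(x := c))"
    have G: "?g \<eta> = G" if "\<eta> \<in> fiber B \<sigma>" "\<eta> x = c" for \<eta>
      unfolding G_def by (rule avg_fiber_cong) (use that in \<open>auto simp: fiber_def\<close>)
    have e2: "avg B (\<lambda>\<eta>. ?I c \<eta> * (?g \<eta> - m)\<^sup>2) \<sigma> = ?P * (G - m)\<^sup>2"
    proof -
      have "avg B (\<lambda>\<eta>. ?I c \<eta> * (?g \<eta> - m)\<^sup>2) \<sigma> = avg B (\<lambda>\<eta>. ?I c \<eta> * (G - m)\<^sup>2) \<sigma>"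
        by (rule mean_cong[OF M]) (use G in auto)
      then show ?thesis by (simp only: mean_mult_const[OF M])
    qed
    have "avg B (\<lambda>\<eta>. ?I c \<eta> * f \<eta>) \<sigma> = avg B (avg (B - {x}) (\<lambda>\<eta>. ?I c \<eta> * f \<eta>)) \<sigma>"
      by (simp add: avg_tower[OF sub \<sigma>])
    also have "\<dots> = avg B (\<lambda>\<eta>. ?I c \<eta> * ?g \<eta>) \<sigma>"
      by (intro mean_cong[OF M\<Omega>] avg_pull) (auto simp: fiber_def)
    also have "\<dots> = avg B (\<lambda>\<eta>. ?I c \<eta> * G) \<sigma>"
      by (rule mean_cong[OF M]) (use G in auto)
    also have "\<dots> = ?P * G" by (simp only: mean_mult_const[OF M])
    finally have e1: "m * spin_dev x c = ?P * (G - m)"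
      using m_pos by (simp add: spin_dev_def \<nu>_def algebra_simps)
    have "?P * (G - m)\<^sup>2 = (?P * (G - m))\<^sup>2 / ?P" using P0 by (simp add: power2_eq_square)
    also have "\<dots> \<le> (?P * (G - m))\<^sup>2 / p" using P P0 p_pos by (intro divide_left_mono) auto
    finally show "avg B (\<lambda>\<eta>. ?I c \<eta> * (?g \<eta> - m)\<^sup>2) \<sigma> \<le> m\<^sup>2 / p * (spin_dev x c)\<^sup>2"
      unfolding e2 e1[symmetric] by (simp add: power_mult_distrib)
  qed
  also have "(\<Sum>c\<in>Q. m\<^sup>2 / p * (spin_dev x c)\<^sup>2) = m\<^sup>2 / p * (\<Sum>c\<in>Q. (spin_dev x c)\<^sup>2)"
    by (simp add: sum_distrib_left)
  finally show ?thesis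
    using m_pos by (simp add: power2_eq_square divide_right_mono)
qed

lemma sum_Ent_marginal:
  "(\<Sum>x\<in>B. Ent B (avg (B - {x}) f) \<sigma>)
     \<le> 4 * real (card Q) / (p * (1 - \<alpha>)\<^sup>2) * (\<Sum>x\<in>B. avg B (Ent {x} f) \<sigma>)"
proof -
  have "(\<Sum>x\<in>B. Ent B (avg (B - {x}) f) \<sigma>) \<le> (\<Sum>x\<in>B. m / p * (\<Sum>c\<in>Q. (spin_dev x c)\<^sup>2))"
    by (rule sum_mono) (rule Ent_marginal)
  also have "\<dots> = m / p * (\<Sum>x\<in>B. \<Sum>c\<in>Q. (spin_dev x c)\<^sup>2)" by (simp add: sum_distrib_left)
  also have "\<dots> \<le> m / p * (real (card Q) * ((\<Sum>x\<in>B. (dev x)\<^sup>2) / (1 - \<alpha>)\<^sup>2))"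
    using m_pos p_pos by (intro mult_left_mono sum_spin_dev) auto
  also have "\<dots> \<le> m / p * (real (card Q) * ((\<Sum>x\<in>B. 4 / m * avg B (Ent {x} f) \<sigma>) / (1 - \<alpha>)\<^sup>2))"
    using m_pos p_pos by (intro mult_left_mono divide_right_mono sum_mono dev_Ent) auto
  also have "\<dots> = 4 * real (card Q) / (p * (1 - \<alpha>)\<^sup>2) * (\<Sum>x\<in>B. avg B (Ent {x} f) \<sigma>)"
    using m_pos by (subst sum_distrib_left[symmetric]) simp
  finally show ?thesis .
qed

end

context dobrushin
begin

text \<open>The tensorization constant; it involves the number of colors, \<open>p\<close> and
  \<alpha> only, hence is the same for all boxes.\<close>

definition "C\<^sub>T = 4 * real (card Q) / (p * (1 - \<alpha>)\<^sup>2)"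

lemma C\<^sub>T_pos: "0 < C\<^sub>T"
  unfolding C\<^sub>T_def using p_pos \<alpha>_less finite_spins spins_nonempty
  by (intro divide_pos_pos mult_pos_pos) (auto simp: card_gt_0_iff)

text \<open>Marton's induction: average the chain rule over the site that is revealed first.\<close>

theorem Ent_tensorization:
  assumes "B \<subseteq> \<Lambda>" and f: "\<And>\<eta>. \<eta> \<in> \<Omega> \<Longrightarrow> 0 < f \<eta>" and "\<sigma> \<in> \<Omega>"
  shows "Ent B f \<sigma> \<le> C\<^sub>T * (\<Sum>x\<in>B. avg B (Ent {x} f) \<sigma>)"
  using finite_subset[OF assms(1) finite_sites] assms(1,3)
proof (induction B arbitrary: \<sigma> rule: finite_psubset_induct)
  case (psubset B)
  note \<sigma> = psubset.prems(2) and fB = psubset.hyps(1)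
  note M = mean_avg_\<Omega>[OF \<sigma>, of B]
  show ?case
  proof (cases "B = {}")
    case True
    have "fiber {} \<sigma> = {\<sigma>}" using \<sigma> by (auto simp: fiber_def)
    then show ?thesis using w_pos[OF \<sigma>] True by (simp add: Ent_def avg_def)
  next
    case False
    interpret dobrushin_density \<Lambda> Q w nb \<rho> \<alpha> p B f \<sigma>
      by unfold_locales (use psubset.prems f in auto)
    let ?S = "\<Sum>y\<in>B. avg B (Ent {y} f) \<sigma>"
    have "real (card B) * Ent B f \<sigma> = (\<Sum>x\<in>B. avg B (Ent (B - {x}) f) \<sigma> + Ent B (avg (B - {x}) f) \<sigma>)"
      using Ent_chain[OF Diff_subset \<sigma>, of B] by (simp flip: Ent_chain[OF Diff_subset \<sigma>])
    also have "\<dots> = (\<Sum>x\<in>B. avg B (Ent (B - {x}) f) \<sigma>) + (\<Sum>x\<in>B. Ent B (avg (B - {x}) f) \<sigma>)"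
      by (rule sum.distrib)
    \<comment> \<open>Each induction hypothesis omits one site, so together they account for
      \<open>card B - 1\<close> copies of \<open>?S\<close>; the marginal entropies cost exactly one
      more copy. Hence the constant does not grow with \<open>B\<close>.\<close>
    also have "\<dots> \<le> (\<Sum>x\<in>B. C\<^sub>T * (?S - avg B (Ent {x} f) \<sigma>)) + C\<^sub>T * ?S"
    proof (intro add_mono sum_mono)
      show "(\<Sum>x\<in>B. Ent B (avg (B - {x}) f) \<sigma>) \<le> C\<^sub>T * ?S"
        unfolding C\<^sub>T_def by (rule sum_Ent_marginal)
      fix x assume x: "x \<in> B"
      have "avg B (Ent (B - {x}) f) \<sigma> \<le> avg B (\<lambda>\<eta>. C\<^sub>T * (\<Sum>y\<in>B-{x}. avg (B - {x}) (Ent {y} f) \<eta>)) \<sigma>"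
        by (rule mean_mono[OF M], rule psubset.IH) (use psubset.prems x in auto)
      also have "\<dots> = C\<^sub>T * (\<Sum>y\<in>B-{x}. avg B (avg (B - {x}) (Ent {y} f)) \<sigma>)"
        by (simp add: mean_cmult[OF M] mean_sum[OF M])
      also have "\<dots> = C\<^sub>T * (?S - avg B (Ent {x} f) \<sigma>)"
        using x fB by (simp add: avg_tower[OF Diff_subset \<sigma>] sum.remove[of B x])
      finally show "avg B (Ent (B - {x}) f) \<sigma> \<le> C\<^sub>T * (?S - avg B (Ent {x} f) \<sigma>)" .
    qed
    also have "\<dots> = real (card B) * (C\<^sub>T * ?S)"
      by (simp add: sum_distrib_left[symmetric] sum_subtractf algebra_simps)
    finally show ?thesis using False fB by (simp add: card_gt_0_iff)
  qed
qed

end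

section \<open>The discrete-time chain\<close>

text \<open>Compares the squared logarithm with the integrand of relative entropy. The bound
  \<open>L\<close> matters only for \<open>r\<close> above 1; below 1 the quadratic Taylor bound of
  exp at \<open>- ln r\<close> gives the factor 2.\<close>

lemma ln_square_le:
  fixes r :: real
  assumes r: "0 < r" and L: "ln r \<le> L" "0 \<le> L"
  shows "r * (ln r)\<^sup>2 \<le> (2 + L) * (r * ln r - r + 1)"
proof -
  have psi: "0 \<le> r * ln r - r + 1"
  proof -
    have "ln (1 / r) \<le> 1 / r - 1" using r by (intro ln_le_minus_one) simp
    then have "r * ln (1 / r) \<le> r * (1 / r - 1)" using r by (intro mult_left_mono) auto
    then show ?thesis using r by (simp add: ln_div algebra_simps)
  qed
  show ?thesis
  proof (cases "r \<le> 1")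
    case True
    define y where "y = - ln r"
    have y: "0 \<le> y" "r * exp y = 1" using r True by (simp_all add: y_def exp_minus)
    have "r * (1 + y + y\<^sup>2 / 2) \<le> r * exp y"
      using r y by (intro mult_left_mono exp_lower_Taylor_quadratic) auto
    then have "r * (ln r)\<^sup>2 \<le> 2 * (r * ln r - r + 1)"
      using y(2) by (simp add: y_def algebra_simps)
    also have "\<dots> \<le> (2 + L) * (r * ln r - r + 1)" using L psi by (intro mult_right_mono) auto
    finally show ?thesis .
  next
    case False
    define y where "y = ln r"
    have y: "0 \<le> y" "r = exp y" using r False by (simp_all add: y_def)
    let ?\<phi> = "\<lambda>y::real. y * (exp y + 1) - 2 * (exp y - 1)"
    \<comment> \<open>Equivalent to tanh (y / 2) \<le> y / 2.\<close>
    have "?\<phi> 0 \<le> ?\<phi> y"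
    proof (rule DERIV_nonneg_imp_nondecreasing[OF y(1)])
      fix z :: real
      have "DERIV ?\<phi> z :> 1 + (z - 1) * exp z"
        by (auto intro!: derivative_eq_intros simp: algebra_simps)
      moreover have "0 \<le> 1 + (z - 1) * exp z"
      proof -
        have "1 - z \<le> exp (- z)" using exp_ge_add_one_self[of "-z"] by simp
        then have "(1 - z) * exp z \<le> exp (- z) * exp z" by (intro mult_right_mono) auto
        also have "\<dots> = 1" by (simp flip: exp_add)
        finally show ?thesis by (simp add: algebra_simps)
      qed
      ultimately show "\<exists>d. DERIV ?\<phi> z :> d \<and> 0 \<le> d" by blast
    qed
    then have "2 * (exp y - 1) \<le> y * (exp y + 1)" by simp
    then have "2 * (r - 1) \<le> ln r * (r + 1)" unfolding y_def using r by simp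
    then have "r * (ln r)\<^sup>2 \<le> (2 + ln r) * (r * ln r - r + 1)"
      by (simp add: algebra_simps power2_eq_square)
    also have "\<dots> \<le> (2 + L) * (r * ln r - r + 1)" using L psi by (intro mult_right_mono) auto
    finally show ?thesis .
  qed
qed

lemma sum_point:
  fixes f :: "'a \<Rightarrow> real"
  assumes "finite A" "a \<in> A"
  shows "(\<Sum>x\<in>A. of_bool (x = a) * f x) = f a" "(\<Sum>x\<in>A. f x * of_bool (x = a)) = f a"
proof -
  have "(\<Sum>x\<in>A. of_bool (x = a) * f x) = (\<Sum>x\<in>A. if x = a then f a else 0)"
    by (rule sum.cong) auto
  then show "(\<Sum>x\<in>A. of_bool (x = a) * f x) = f a" using assms by simp
  then show "(\<Sum>x\<in>A. f x * of_bool (x = a)) = f a" by (simp add: mult.commute)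
qed

section \<open>The random-site heat-bath chain: reversibility, densities, entropy\<close>

context gibbs
begin

definition "N = real (card \<Lambda>)"

lemma N_ge_1: "1 \<le> N"
  unfolding N_def using finite_sites sites_nonempty by (simp add: Suc_leI card_gt_0_iff)

definition P :: "(('s \<Rightarrow> 'c) \<Rightarrow> real) \<Rightarrow> ('s \<Rightarrow> 'c) \<Rightarrow> real" where
  "P f \<sigma> = (\<Sum>x\<in>\<Lambda>. avg {x} f \<sigma>) / N"

lemma mean_P: "\<sigma> \<in> \<Omega> \<Longrightarrow> mean_on \<Omega> (\<lambda>f. P f \<sigma>)"
  unfolding P_def N_def
  by (rule mean_on_compose[OF mean_on_uniform[OF finite_sites sites_nonempty],
      of \<Omega> "\<lambda>f x. avg {x} f \<sigma>"]) (rule mean_avg_\<Omega>)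

lemma mean_Pk: "\<sigma> \<in> \<Omega> \<Longrightarrow> mean_on \<Omega> (\<lambda>f. (P ^^ k) f \<sigma>)"
proof (induction k arbitrary: \<sigma>)
  case 0
  then show ?case unfolding mean_on_def
    by (intro conjI exI[of _ "\<lambda>\<eta>. of_bool (\<eta> = \<sigma>)"])
      (use 0 sum_point(1)[OF finite_\<Omega>, of \<sigma> "\<lambda>_. 1"] in \<open>auto simp: finite_\<Omega> sum_point\<close>)
next
  case (Suc k)
  then show ?case using mean_on_compose[OF mean_P, of \<sigma> \<Omega> "P ^^ k"] by simp
qed

lemma Pk_Suc2: "(P ^^ Suc k) f = (P ^^ k) (P f)"
  by (induction k) simp_all

lemma EE_P: "EE (P f) = EE f"
proof -
  have "EE (P f) = (\<Sum>x\<in>\<Lambda>. EE (avg {x} f)) / N"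
    unfolding P_def by (simp only: mean_divide[OF mean_EE] mean_sum[OF mean_EE])
  also have "\<dots> = (\<Sum>x\<in>\<Lambda>. EE f) / N" by (simp add: EE_avg)
  also have "\<dots> = EE f" using N_ge_1 by (simp add: N_def)
  finally show ?thesis .
qed

lemma EE_Pk: "EE ((P ^^ k) f) = EE f"
  by (induction k) (simp, simp add: EE_P)

lemma P_self_adjoint: "EE (\<lambda>\<eta>. g \<eta> * P f \<eta>) = EE (\<lambda>\<eta>. P g \<eta> * f \<eta>)"
proof -
  have "EE (\<lambda>\<eta>. g \<eta> * P f \<eta>) = EE (\<lambda>\<eta>. (\<Sum>x\<in>\<Lambda>. g \<eta> * avg {x} f \<eta>) / N)"
    unfolding P_def by (simp add: sum_distrib_left)
  also have "\<dots> = (\<Sum>x\<in>\<Lambda>. EE (\<lambda>\<eta>. g \<eta> * avg {x} f \<eta>)) / N"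
    by (simp only: mean_divide[OF mean_EE] mean_sum[OF mean_EE])
  also have "\<dots> = (\<Sum>x\<in>\<Lambda>. EE (\<lambda>\<eta>. avg {x} g \<eta> * f \<eta>)) / N"
    by (simp add: EE_self_adjoint)
  also have "\<dots> = EE (\<lambda>\<eta>. (\<Sum>x\<in>\<Lambda>. avg {x} g \<eta> * f \<eta>) / N)"
    by (simp only: mean_divide[OF mean_EE] mean_sum[OF mean_EE])
  also have "\<dots> = EE (\<lambda>\<eta>. P g \<eta> * f \<eta>)"
    unfolding P_def by (simp add: sum_distrib_right)
  finally show ?thesis .
qed

lemma Pk_self_adjoint: "EE (\<lambda>\<eta>. g \<eta> * (P ^^ k) f \<eta>) = EE (\<lambda>\<eta>. (P ^^ k) g \<eta> * f \<eta>)"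
proof (induction k arbitrary: g)
  case (Suc k)
  have "EE (\<lambda>\<eta>. g \<eta> * (P ^^ Suc k) f \<eta>) = EE (\<lambda>\<eta>. P g \<eta> * (P ^^ k) f \<eta>)"
    using P_self_adjoint[of g "(P ^^ k) f"] by simp
  also have "\<dots> = EE (\<lambda>\<eta>. (P ^^ Suc k) g \<eta> * f \<eta>)" unfolding Suc.IH Pk_Suc2 ..
  finally show ?case .
qed simp

definition mass :: "('s \<Rightarrow> 'c) \<Rightarrow> real" where
  "mass \<sigma> = EE (\<lambda>\<eta>. of_bool (\<eta> = \<sigma>))"

text \<open>By reversibility, this is the density, relative to the Gibbs measure, of the chain at step \<open>k\<close>
  started from \<open>\<sigma>\<close>.\<close>

definition dens :: "('s \<Rightarrow> 'c) \<Rightarrow> nat \<Rightarrow> ('s \<Rightarrow> 'c) \<Rightarrow> real" where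
  "dens \<sigma> k = (P ^^ k) (\<lambda>\<eta>. of_bool (\<eta> = \<sigma>) / mass \<sigma>)"

lemma EE_point: "\<sigma> \<in> \<Omega> \<Longrightarrow> EE (\<lambda>\<eta>. of_bool (\<eta> = \<sigma>) * h \<eta>) = h \<sigma> * mass \<sigma>"
  using sum_point(2)[OF finite_\<Omega>, of \<sigma> "\<lambda>\<eta>. w \<eta> * h \<eta>"] sum_point(2)[OF finite_\<Omega>, of \<sigma> w]
  by (simp add: mass_def EE_def ac_simps)

lemma mass_pos: "\<sigma> \<in> \<Omega> \<Longrightarrow> 0 < mass \<sigma>"
proof -
  assume \<sigma>: "\<sigma> \<in> \<Omega>"
  have "mass \<sigma> = w \<sigma> / (\<Sum>\<eta>\<in>\<Omega>. w \<eta>)"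
    using \<sigma> by (simp add: mass_def EE_def sum_point finite_\<Omega>)
  then show ?thesis using w_pos[OF \<sigma>] weight_fiber_pos[OF \<sigma>, of \<Lambda>] fiber_all[OF \<sigma>] by simp
qed

text \<open>Self-adjointness moves the \<open>k\<close> steps from the density to the observable,
  where the normalised point mass evaluates at \<open>\<sigma>\<close>.\<close>

lemma EE_dens:
  assumes "\<sigma> \<in> \<Omega>"
  shows "EE (\<lambda>\<eta>. dens \<sigma> k \<eta> * h \<eta>) = (P ^^ k) h \<sigma>"
proof -
  have "EE (\<lambda>\<eta>. dens \<sigma> k \<eta> * h \<eta>) = EE (\<lambda>\<eta>. of_bool (\<eta> = \<sigma>) / mass \<sigma> * (P ^^ k) h \<eta>)"
    unfolding dens_def by (rule Pk_self_adjoint[symmetric])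
  also have "\<dots> = EE (\<lambda>\<eta>. of_bool (\<eta> = \<sigma>) * ((P ^^ k) h \<eta> / mass \<sigma>))" by simp
  also have "\<dots> = (P ^^ k) h \<sigma>" using mass_pos[OF assms] by (subst EE_point[OF assms]) simp
  finally show ?thesis .
qed

lemma dens_Suc: "dens \<sigma> (Suc k) = P (dens \<sigma> k)"
  by (simp add: dens_def)

lemma dens_nonneg:
  assumes "\<sigma> \<in> \<Omega>" "\<eta> \<in> \<Omega>"
  shows "0 \<le> dens \<sigma> k \<eta>"
  unfolding dens_def using mass_pos[OF assms(1)] by (intro mean_nonneg[OF mean_Pk[OF assms(2)]]) simp

lemma EE_dens_1: "\<sigma> \<in> \<Omega> \<Longrightarrow> EE (dens \<sigma> k) = 1"
  using EE_dens[of \<sigma> k "\<lambda>_. 1"] by (simp add: mean_const[OF mean_Pk])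

definition H :: "(('s \<Rightarrow> 'c) \<Rightarrow> real) \<Rightarrow> real" where
  "H f = EE (\<lambda>\<eta>. f \<eta> * ln (f \<eta>))"

text \<open>An update at \<open>x\<close> replaces \<open>f\<close> by its average and removes
  exactly the local entropy at \<open>x\<close>; convexity of x ln x over the random choice of the
  site does the rest.\<close>

lemma H_P_le:
  assumes f: "\<And>\<eta>. \<eta> \<in> \<Omega> \<Longrightarrow> 0 \<le> f \<eta>"
  shows "H (P f) \<le> H f - (\<Sum>x\<in>\<Lambda>. EE (Ent {x} f)) / N"
proof -
  let ?A = "\<lambda>x \<eta>. avg {x} f \<eta> * ln (avg {x} f \<eta>)"
  have "H (P f) \<le> EE (\<lambda>\<eta>. (\<Sum>x\<in>\<Lambda>. ?A x \<eta>) / N)"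
    unfolding H_def
  proof (rule mean_mono[OF mean_EE])
    fix \<eta> assume \<eta>: "\<eta> \<in> \<Omega>"
    have "0 \<le> avg {x} f \<eta>" for x by (rule mean_nonneg[OF mean_avg_\<Omega>[OF \<eta>]]) (rule f)
    then show "P f \<eta> * ln (P f \<eta>) \<le> (\<Sum>x\<in>\<Lambda>. ?A x \<eta>) / N"
      unfolding P_def N_def
      using mean_xlnx[OF mean_on_uniform[OF finite_sites sites_nonempty], of "\<lambda>x. avg {x} f \<eta>"] by simp
  qed
  also have "\<dots> = (\<Sum>x\<in>\<Lambda>. EE (?A x)) / N"
    by (simp only: mean_divide[OF mean_EE] mean_sum[OF mean_EE])
  also have "\<dots> = (\<Sum>x\<in>\<Lambda>. H f - EE (Ent {x} f)) / N"
  proof -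
    have "EE (?A x) = H f - EE (Ent {x} f)" if "x \<in> \<Lambda>" for x
    proof -
      have "EE (Ent {x} f) = EE (avg {x} (\<lambda>\<eta>. f \<eta> * ln (f \<eta>))) - EE (?A x)"
        unfolding Ent_def by (rule mean_diff[OF mean_EE])
      then show ?thesis using that by (simp add: EE_avg H_def)
    qed
    then show ?thesis by simp
  qed
  also have "\<dots> = H f - (\<Sum>x\<in>\<Lambda>. EE (Ent {x} f)) / N"
    using N_ge_1 by (simp add: sum_subtractf N_def diff_divide_distrib)
  finally show ?thesis .
qed

text \<open>The law of total variance, conditioning on the first step of the chain.\<close>

lemma Pk_variance_Suc:
  "(P ^^ Suc k) (\<lambda>\<eta>. (g \<eta>)\<^sup>2) \<sigma> - ((P ^^ Suc k) g \<sigma>)\<^sup>2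
    = P (\<lambda>\<eta>. (P ^^ k) (\<lambda>\<eta>. (g \<eta>)\<^sup>2) \<eta> - ((P ^^ k) g \<eta>)\<^sup>2) \<sigma>
      + (P (\<lambda>\<eta>. ((P ^^ k) g \<eta>)\<^sup>2) \<sigma> - (P ((P ^^ k) g) \<sigma>)\<^sup>2)" if "\<sigma> \<in> \<Omega>"
  using mean_diff[OF mean_P[OF that], of "(P ^^ k) (\<lambda>\<eta>. (g \<eta>)\<^sup>2)" "\<lambda>\<eta>. ((P ^^ k) g \<eta>)\<^sup>2"] by simp

lemma P_variance_le:
  assumes "\<sigma> \<in> \<Omega>"
  shows "P (\<lambda>\<eta>. (h \<eta>)\<^sup>2) \<sigma> - (P h \<sigma>)\<^sup>2 \<le> (\<Sum>x\<in>\<Lambda>. avg {x} (\<lambda>\<eta>. (h \<eta> - h \<sigma>)\<^sup>2) \<sigma>) / N"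
  using mean_variance_le[OF mean_P[OF assms], of h "h \<sigma>"] by (simp add: P_def)

end

section \<open>Pointwise bounds on densities and decay of oscillations\<close>

context dobrushin
begin

lemma avg_point_ge:
  assumes "B \<subseteq> \<Lambda>" "\<sigma> \<in> \<Omega>"
  shows "p ^ card B \<le> avg B (\<lambda>\<eta>. of_bool (\<eta> = \<sigma>)) \<sigma>"
  using finite_subset[OF assms(1) finite_sites] assms(1)
proof (induction B rule: finite_induct)
  case empty
  have "fiber {} \<sigma> = {\<sigma>}" using assms(2) by (auto simp: fiber_def)
  then show ?case using w_pos[OF assms(2)] by (simp add: avg_def)
next
  case (insert x B)
  have x: "x \<in> \<Lambda>" using insert by simp
  note M = mean_avg[OF assms(2), of "insert x B"]
  have "p ^ card (insert x B) = p ^ card B * p" using insert by simp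
  also have "\<dots> \<le> p ^ card B * avg (insert x B) (\<lambda>\<eta>. of_bool (\<eta> x = \<sigma> x)) \<sigma>"
    using insert p_pos assms(2) x by (intro mult_left_mono avg_spin_ge) (auto intro: \<Omega>_spin)
  also have "\<dots> = avg (insert x B) (\<lambda>\<eta>. p ^ card B * of_bool (\<eta> x = \<sigma> x)) \<sigma>"
    by (rule mean_cmult[OF M, symmetric])
  also have "\<dots> \<le> avg (insert x B) (avg B (\<lambda>\<eta>. of_bool (\<eta> = \<sigma>))) \<sigma>"
  proof (rule mean_mono[OF M])
    fix \<eta> assume \<eta>: "\<eta> \<in> fiber (insert x B) \<sigma>"
    show "p ^ card B * of_bool (\<eta> x = \<sigma> x) \<le> avg B (\<lambda>\<eta>. of_bool (\<eta> = \<sigma>)) \<eta>"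
    proof (cases "\<eta> x = \<sigma> x")
      case True
      then have "\<eta> \<in> fiber B \<sigma>" using \<eta> by (auto simp: fiber_def)
      then show ?thesis using True insert by (simp add: avg_fiber)
    next
      case False
      then show ?thesis using mean_nonneg[OF mean_avg[OF fiber_\<Omega>[OF \<eta>]]] by simp
    qed
  qed
  also have "\<dots> = avg (insert x B) (\<lambda>\<eta>. of_bool (\<eta> = \<sigma>)) \<sigma>"
    by (rule avg_tower) (use assms in auto)
  finally show ?case .
qed

text \<open>Bounds the ratio of \<open>f\<close> to its local average by
  \<open>(1 / p) ^ card B\<close>, so that the logarithm of the ratio is at most linear in the
  volume of \<open>B\<close>.\<close>

lemma avg_ge_point:
  assumes "B \<subseteq> \<Lambda>" "\<sigma> \<in> \<Omega>" "\<And>\<eta>. \<eta> \<in> \<Omega> \<Longrightarrow> 0 \<le> f \<eta>"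
  shows "p ^ card B * f \<sigma> \<le> avg B f \<sigma>"
proof -
  have "p ^ card B * f \<sigma> \<le> avg B (\<lambda>\<eta>. of_bool (\<eta> = \<sigma>)) \<sigma> * f \<sigma>"
    using assms by (intro mult_right_mono avg_point_ge) auto
  also have "\<dots> = avg B (\<lambda>\<eta>. of_bool (\<eta> = \<sigma>) * f \<sigma>) \<sigma>"
    by (rule mean_mult_const[OF mean_avg[OF assms(2)], symmetric])
  also have "\<dots> \<le> avg B f \<sigma>"
    by (rule mean_mono[OF mean_avg_\<Omega>[OF assms(2)]]) (use assms(3) in auto)
  finally show ?thesis .
qed

text \<open>With r the ratio of \<open>f\<close> to \<open>avg B f\<close>, the quantity r ln r - r
  + 1 weighted by \<open>avg B f\<close> averages to the local entropy, as the two linear terms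
  cancel. The factor in front is the bound 2 + ln r from \<open>ln_square_le\<close>, with ln r at
  most \<open>card B * ln (1 / p)\<close>.\<close>

lemma EE_log_ratio_le:
  assumes "B \<subseteq> \<Lambda>" and f: "\<And>\<eta>. \<eta> \<in> \<Omega> \<Longrightarrow> 0 < f \<eta>"
  shows "EE (\<lambda>\<eta>. f \<eta> * (ln (f \<eta>) - ln (avg B f \<eta>))\<^sup>2) \<le> (2 + real (card B) * ln (1 / p)) * EE (Ent B f)"
proof -
  let ?A = "avg B f" and ?L = "real (card B) * ln (1 / p)"
  have L: "0 \<le> ?L" using p_pos p_le_1 by simp
  have A: "0 < ?A \<eta>" if "\<eta> \<in> \<Omega>" for \<eta> by (rule mean_pos[OF mean_avg_\<Omega>[OF that]]) (rule f)
  have "EE (\<lambda>\<eta>. f \<eta> * (ln (f \<eta>) - ln (?A \<eta>))\<^sup>2)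
      \<le> EE (\<lambda>\<eta>. (2 + ?L) * (f \<eta> * ln (f \<eta>) - ln (?A \<eta>) * f \<eta> - f \<eta> + ?A \<eta>))"
  proof (rule mean_mono[OF mean_EE])
    fix \<eta> assume \<eta>: "\<eta> \<in> \<Omega>"
    let ?r = "f \<eta> / ?A \<eta>"
    note p = f[OF \<eta>] A[OF \<eta>]
    have "p ^ card B * f \<eta> \<le> ?A \<eta>" using avg_ge_point[OF assms(1) \<eta>] f by (simp add: less_imp_le)
    then have "?r \<le> (1 / p) ^ card B" using p p_pos by (simp add: field_simps power_one_over)
    then have "ln ?r \<le> ln ((1 / p) ^ card B)" using p p_pos by (subst ln_le_cancel_iff) auto
    also have "\<dots> = ?L" using p_pos by (simp add: ln_realpow)
    finally have "?r * (ln ?r)\<^sup>2 \<le> (2 + ?L) * (?r * ln ?r - ?r + 1)"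
      using p L by (intro ln_square_le) auto
    then have "?A \<eta> * (?r * (ln ?r)\<^sup>2) \<le> ?A \<eta> * ((2 + ?L) * (?r * ln ?r - ?r + 1))"
      using p by (intro mult_left_mono) auto
    also have "\<dots> = (2 + ?L) * (?A \<eta> * (?r * ln ?r - ?r + 1))" by (simp only: ac_simps)
    also have "?A \<eta> * (?r * ln ?r - ?r + 1) = f \<eta> * ln ?r - f \<eta> + ?A \<eta>"
      using p by (simp add: algebra_simps)
    also have "ln ?r = ln (f \<eta>) - ln (?A \<eta>)" using p by (simp add: ln_div)
    finally show "f \<eta> * (ln (f \<eta>) - ln (?A \<eta>))\<^sup>2
      \<le> (2 + ?L) * (f \<eta> * ln (f \<eta>) - ln (?A \<eta>) * f \<eta> - f \<eta> + ?A \<eta>)"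
      using p by (simp add: algebra_simps)
  qed
  also have "\<dots> = (2 + ?L) * (EE (\<lambda>\<eta>. f \<eta> * ln (f \<eta>)) - EE (\<lambda>\<eta>. ln (?A \<eta>) * f \<eta>) - EE f + EE ?A)"
    by (simp only: mean_cmult[OF mean_EE] mean_add[OF mean_EE] mean_diff[OF mean_EE])
  also have "EE (\<lambda>\<eta>. ln (?A \<eta>) * f \<eta>) = EE (\<lambda>\<eta>. ?A \<eta> * ln (?A \<eta>))"
  proof -
    have "EE (\<lambda>\<eta>. ln (?A \<eta>) * f \<eta>) = EE (avg B (\<lambda>\<eta>. ln (?A \<eta>) * f \<eta>))" by (simp add: EE_avg assms)
    \<comment> \<open>The logarithm of \<open>avg B f\<close> is constant on the fibers of
      \<open>B\<close>, so the averaging acts on \<open>f\<close> alone.\<close>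
    also have "\<dots> = EE (\<lambda>\<eta>. ln (?A \<eta>) * ?A \<eta>)"
      by (intro mean_cong[OF mean_EE] avg_pull) (auto simp: avg_fiber)
    finally show ?thesis by (simp add: mult.commute)
  qed
  also have "EE ?A = EE f" by (simp add: EE_avg assms)
  also have "EE (\<lambda>\<eta>. f \<eta> * ln (f \<eta>)) - EE (\<lambda>\<eta>. ?A \<eta> * ln (?A \<eta>)) - EE f + EE f = EE (Ent B f)"
    unfolding Ent_def by (simp add: mean_diff[OF mean_EE] EE_avg assms)
  finally show ?thesis .
qed

text \<open>Only one scenario is counted: the sites of \<open>B\<close> are chosen in a fixed order,
  each with probability 1 / N, and each receives the required color with probability at least
  \<open>p\<close>. With \<open>B\<close> the whole box this makes the density positive from step
  \<open>card \<Lambda>\<close> on, so that its logarithm is meaningful.\<close>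

lemma P_point_ge:
  assumes "B \<subseteq> \<Lambda>" "\<sigma> \<in> \<Omega>" "\<eta> \<in> fiber B \<sigma>"
  shows "(p / N) ^ card B \<le> (P ^^ card B) (\<lambda>\<zeta>. of_bool (\<zeta> = \<sigma>)) \<eta>"
  using finite_subset[OF assms(1) finite_sites] assms(1,3)
proof (induction B arbitrary: \<eta> rule: finite_induct)
  case empty
  have "\<eta> = \<sigma>" using empty by (auto simp: fiber_def)
  then show ?case by simp
next
  case (insert x B)
  have x: "x \<in> \<Lambda>" and \<eta>: "\<eta> \<in> \<Omega>" using insert fiber_\<Omega> by auto
  let ?h = "(P ^^ card B) (\<lambda>\<zeta>. of_bool (\<zeta> = \<sigma>))"
  have h: "0 \<le> ?h \<zeta>" if "\<zeta> \<in> \<Omega>" for \<zeta> by (rule mean_nonneg[OF mean_Pk[OF that]]) simp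
  have "(p / N) ^ card (insert x B) = p * (p / N) ^ card B / N" using insert by simp
  also have "\<dots> \<le> pr x \<eta> (\<sigma> x) * ?h (\<eta>(x := \<sigma> x)) / N"
  proof (intro divide_right_mono mult_mono)
    show "p \<le> pr x \<eta> (\<sigma> x)" using pr_ge[OF x \<eta> \<Omega>_spin[OF assms(2) x]] .
    have "\<eta>(x := \<sigma> x) \<in> fiber B \<sigma>"
      using insert(5) \<Omega>_upd[OF \<eta> x \<Omega>_spin[OF assms(2) x]] by (auto simp: fiber_def)
    then show "(p / N) ^ card B \<le> ?h (\<eta>(x := \<sigma> x))" using insert by simp
    show "0 \<le> pr x \<eta> (\<sigma> x)" using pr_nonneg[OF \<eta> x \<Omega>_spin[OF assms(2) x]] .
  qed (use p_pos N_ge_1 in auto)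
  also have "pr x \<eta> (\<sigma> x) * ?h (\<eta>(x := \<sigma> x)) \<le> avg {x} ?h \<eta>"
    unfolding avg_single[OF \<eta> x]
    by (rule member_le_sum[of "\<sigma> x" Q "\<lambda>c. pr x \<eta> c * ?h (\<eta>(x := c))"])
      (use \<eta> x assms(2) finite_spins in \<open>auto intro!: mult_nonneg_nonneg pr_nonneg h \<Omega>_upd \<Omega>_spin\<close>)
  also have "avg {x} ?h \<eta> \<le> (\<Sum>y\<in>\<Lambda>. avg {y} ?h \<eta>)"
    by (rule member_le_sum) (use x finite_sites in \<open>auto intro!: mean_nonneg[OF mean_avg_\<Omega>[OF \<eta>]] h\<close>)
  also have "(\<Sum>y\<in>\<Lambda>. avg {y} ?h \<eta>) / N = (P ^^ card (insert x B)) (\<lambda>\<zeta>. of_bool (\<zeta> = \<sigma>)) \<eta>"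
    using insert(1,2) by (simp add: P_def[of ?h])
  finally show ?case using N_ge_1 by (simp add: divide_right_mono)
qed

lemma mass_ge: "\<sigma> \<in> \<Omega> \<Longrightarrow> p ^ card \<Lambda> \<le> mass \<sigma>"
  using avg_point_ge[of \<Lambda> \<sigma>] by (simp add: EE_eq mass_def)

lemma dens_le:
  assumes "\<sigma> \<in> \<Omega>" "\<eta> \<in> \<Omega>"
  shows "dens \<sigma> k \<eta> \<le> (1 / p) ^ card \<Lambda>"
  unfolding dens_def
proof (rule mean_le[OF mean_Pk[OF assms(2)]])
  fix \<zeta>
  have "of_bool (\<zeta> = \<sigma>) / mass \<sigma> \<le> 1 / mass \<sigma>" using mass_pos[OF assms(1)] by (simp add: divide_right_mono)
  also have "\<dots> \<le> 1 / p ^ card \<Lambda>"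
    using mass_ge[OF assms(1)] p_pos mass_pos[OF assms(1)] by (intro divide_left_mono) auto
  finally show "of_bool (\<zeta> = \<sigma>) / mass \<sigma> \<le> (1 / p) ^ card \<Lambda>" by (simp add: power_one_over)
qed

lemma dens_ge:
  assumes "\<sigma> \<in> \<Omega>" "\<eta> \<in> \<Omega>" "card \<Lambda> \<le> k"
  shows "(p / N) ^ card \<Lambda> \<le> dens \<sigma> k \<eta>"
proof -
  have mass1: "mass \<sigma> \<le> 1" unfolding mass_def by (rule mean_le[OF mean_EE]) simp
  have base: "(p / N) ^ card \<Lambda> \<le> dens \<sigma> (card \<Lambda>) \<zeta>" if \<zeta>: "\<zeta> \<in> \<Omega>" for \<zeta>
  proof -
    have "(p / N) ^ card \<Lambda> \<le> (P ^^ card \<Lambda>) (\<lambda>\<zeta>. of_bool (\<zeta> = \<sigma>)) \<zeta>"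
      by (rule P_point_ge) (use assms \<zeta> in \<open>auto simp: fiber_all\<close>)
    also have "\<dots> \<le> dens \<sigma> (card \<Lambda>) \<zeta>" unfolding dens_def
      by (rule mean_mono[OF mean_Pk[OF \<zeta>]]) (use mass1 mass_pos[OF assms(1)] in \<open>auto simp: field_simps\<close>)
    finally show ?thesis .
  qed
  have "dens \<sigma> k = (P ^^ (k - card \<Lambda>)) (dens \<sigma> (card \<Lambda>))"
    unfolding dens_def using assms(3) funpow_add[of "k - card \<Lambda>" "card \<Lambda>" P] by simp
  then show ?thesis using mean_ge[OF mean_Pk[OF assms(2)], of "(p / N) ^ card \<Lambda>" "dens \<sigma> (card \<Lambda>)"] base by simp
qed

lemma dens_pos: "\<sigma> \<in> \<Omega> \<Longrightarrow> \<eta> \<in> \<Omega> \<Longrightarrow> card \<Lambda> \<le> k \<Longrightarrow> 0 < dens \<sigma> k \<eta>"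
proof -
  assume a: "\<sigma> \<in> \<Omega>" "\<eta> \<in> \<Omega>" "card \<Lambda> \<le> k"
  have "0 < p / N" using p_pos N_ge_1 by simp
  then have "0 < (p / N) ^ card \<Lambda>" by (rule zero_less_power)
  then show ?thesis using dens_ge[OF a] by linarith
qed

lemma H_contract:
  assumes f: "\<And>\<eta>. \<eta> \<in> \<Omega> \<Longrightarrow> 0 < f \<eta>" and "EE f = 1"
  shows "H (P f) \<le> (1 - 1 / (C\<^sub>T * N)) * H f"
proof -
  obtain \<sigma> where \<sigma>: "\<sigma> \<in> \<Omega>" using \<Omega>_nonempty by blast
  have "H f \<le> C\<^sub>T * (\<Sum>x\<in>\<Lambda>. EE (Ent {x} f))"
    using Ent_tensorization[of \<Lambda> f \<sigma>] f \<sigma> assms(2) by (simp add: Ent_def[of \<Lambda>] EE_eq H_def)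
  then have "H f / (C\<^sub>T * N) \<le> (\<Sum>x\<in>\<Lambda>. EE (Ent {x} f)) / N"
    using C\<^sub>T_pos N_ge_1 by (simp add: field_simps)
  then show ?thesis using H_P_le[of f] f by (simp add: algebra_simps less_imp_le)
qed

text \<open>The average of \<open>lip_avg\<close> over the updated site: with probability 1 / N the
  oscillation at \<open>y\<close> is erased, and in the other cases it stays and gains the influence
  of the updated site \<open>x\<close>.\<close>

lemma lip_P:
  assumes h: "lip h D"
  shows "lip (P h) (\<lambda>y. (1 - 1 / N) * D y + (\<Sum>x\<in>\<Lambda>. infl x y * D x) / N)"
  unfolding lip_def
proof (intro ballI)
  fix y \<sigma> c assume y: "y \<in> \<Lambda>" and \<sigma>: "\<sigma> \<in> \<Omega>" and c: "c \<in> Q"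
  let ?\<sigma> = "\<sigma>(y := c)"
  have "\<bar>P h ?\<sigma> - P h \<sigma>\<bar> = \<bar>\<Sum>x\<in>\<Lambda>. avg {x} h ?\<sigma> - avg {x} h \<sigma>\<bar> / N"
    using N_ge_1 by (simp add: P_def sum_subtractf diff_divide_distrib[symmetric] abs_divide)
  also have "\<dots> \<le> (\<Sum>x\<in>\<Lambda>. if y = x then 0 else D y + infl x y * D x) / N"
  proof (intro divide_right_mono order_trans[OF sum_abs] sum_mono)
    fix x assume x: "x \<in> \<Lambda>"
    show "\<bar>avg {x} h ?\<sigma> - avg {x} h \<sigma>\<bar> \<le> (if y = x then 0 else D y + infl x y * D x)"
      using lipD[OF lip_avg[OF h x] y \<sigma> c] .
  qed (use N_ge_1 in auto)
  also have "(\<Sum>x\<in>\<Lambda>. if y = x then 0 else D y + infl x y * D x) = (\<Sum>x\<in>\<Lambda>-{y}. D y + infl x y * D x)"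
  proof -
    have "(\<Sum>x\<in>\<Lambda>-{y}. if y = x then 0 else D y + infl x y * D x) = (\<Sum>x\<in>\<Lambda>-{y}. D y + infl x y * D x)"
      by (rule sum.cong) auto
    then show ?thesis using y finite_sites by (simp add: sum.remove[of \<Lambda> y])
  qed
  also have "\<dots> = (N - 1) * D y + (\<Sum>x\<in>\<Lambda>-{y}. infl x y * D x)"
    using y finite_sites N_ge_1 by (simp add: sum.distrib N_def card_Diff_singleton of_nat_diff)
  also have "(\<Sum>x\<in>\<Lambda>-{y}. infl x y * D x) = (\<Sum>x\<in>\<Lambda>. infl x y * D x)"
    using y finite_sites by (simp add: sum.remove[of \<Lambda> y] infl_self)
  also have "((N - 1) * D y + (\<Sum>x\<in>\<Lambda>. infl x y * D x)) / N = (1 - 1 / N) * D y + (\<Sum>x\<in>\<Lambda>. infl x y * D x) / N"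
    using N_ge_1 by (simp add: field_simps)
  finally show "\<bar>P h ?\<sigma> - P h \<sigma>\<bar> \<le> (1 - 1 / N) * D y + (\<Sum>x\<in>\<Lambda>. infl x y * D x) / N" .
qed

lemma infl_column: "y \<in> \<Lambda> \<Longrightarrow> (\<Sum>x\<in>\<Lambda>. infl x y) \<le> \<alpha>"
  using infl_row[of y \<Lambda>] sum.cong[OF refl, of \<Lambda> "\<lambda>x. infl x y" "infl y"] infl_sym by fastforce

text \<open>The factor by which a uniform oscillation bound shrinks per step; over \<open>N\<close>
  steps, one unit of time, this amounts to about exp (- (1 - \<alpha>)).\<close>

definition "\<kappa> = 1 - (1 - \<alpha>) / N"

lemma \<kappa>: "0 \<le> \<kappa>" "\<kappa> < 1"
  unfolding \<kappa>_def using N_ge_1 \<alpha>_pos \<alpha>_less by (auto simp: field_simps)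

lemma lip_Pk_uniform:
  assumes h: "lip h (\<lambda>_. D)"
  shows "lip ((P ^^ k) h) (\<lambda>_. \<kappa> ^ k * D)"
proof (induction k)
  case (Suc k)
  let ?D = "\<kappa> ^ k * D"
  obtain x where "x \<in> \<Lambda>" using sites_nonempty by blast
  then have D: "0 \<le> ?D" using lip_nonneg[OF Suc] by blast
  have "lip (P ((P ^^ k) h)) (\<lambda>y. (1 - 1 / N) * ?D + (\<Sum>x\<in>\<Lambda>. infl x y * ?D) / N)"
    by (rule lip_P[OF Suc])
  then have "lip (P ((P ^^ k) h)) (\<lambda>_. \<kappa> ^ Suc k * D)"
  proof (rule lip_mono)
    fix y assume y: "y \<in> \<Lambda>"
    have "(\<Sum>x\<in>\<Lambda>. infl x y * ?D) / N \<le> \<alpha> * ?D / N"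
      unfolding sum_distrib_right[symmetric]
      using N_ge_1 D infl_column[OF y] by (intro divide_right_mono mult_right_mono) auto
    then show "(1 - 1 / N) * ?D + (\<Sum>x\<in>\<Lambda>. infl x y * ?D) / N \<le> \<kappa> ^ Suc k * D"
      by (simp add: \<kappa>_def algebra_simps diff_divide_distrib)
  qed
  then show ?case by simp
qed (use h in simp)

end

section \<open>The local variance inequality\<close>

lemma square_diff_le:
  fixes a b c d :: real
  shows "((a + c) - (b + d))\<^sup>2 \<le> 4 * a\<^sup>2 + 4 * b\<^sup>2 + 2 * (c - d)\<^sup>2"
proof -
  have "4 * a\<^sup>2 + 4 * b\<^sup>2 + 2 * (c - d)\<^sup>2 - ((a + c) - (b + d))\<^sup>2 = 2 * (a + b)\<^sup>2 + ((a - b) - (c - d))\<^sup>2"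
    by (simp add: power2_eq_square algebra_simps)
  then show ?thesis using zero_le_power2[of "a + b"] zero_le_power2[of "(a - b) - (c - d)"] by linarith
qed

context gibbs
begin

text \<open>The sum of \<open>P\<^sup>j (avg {x} / N) P\<^sup>k\<^sup>-\<^sup>1\<^sup>-\<^sup>j\<close> over \<open>j < k\<close>, in which each sequence of
  \<open>k\<close> updates is counted with the number of updates at \<open>x\<close>.\<close>

primrec counted :: "'s \<Rightarrow> nat \<Rightarrow> (('s \<Rightarrow> 'c) \<Rightarrow> real) \<Rightarrow> ('s \<Rightarrow> 'c) \<Rightarrow> real" where
  "counted x 0 f = (\<lambda>\<sigma>. 0)"
| "counted x (Suc k) f = (\<lambda>\<sigma>. P (counted x k f) \<sigma> + avg {x} ((P ^^ k) f) \<sigma> / N)"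

text \<open>An update at \<open>x\<close> has double weight here, so a sequence with c updates at
  \<open>x\<close> carries the weight 2 ^ c: the exponential moment that controls sequences with
  unusually many updates at \<open>x\<close>.\<close>

primrec doubled :: "'s \<Rightarrow> nat \<Rightarrow> (('s \<Rightarrow> 'c) \<Rightarrow> real) \<Rightarrow> ('s \<Rightarrow> 'c) \<Rightarrow> real" where
  "doubled x 0 f = f"
| "doubled x (Suc k) f = (\<lambda>\<sigma>. P (doubled x k f) \<sigma> + avg {x} (doubled x k f) \<sigma> / N)"

lemma doubled_bounds:
  assumes "\<And>\<eta>. \<eta> \<in> \<Omega> \<Longrightarrow> 0 \<le> f \<eta>" "\<And>\<eta>. \<eta> \<in> \<Omega> \<Longrightarrow> f \<eta> \<le> c" "\<sigma> \<in> \<Omega>"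
  shows "0 \<le> doubled x k f \<sigma>" "doubled x k f \<sigma> \<le> (1 + 1 / N) ^ k * c"
proof -
  have "0 \<le> doubled x k f \<sigma> \<and> doubled x k f \<sigma> \<le> (1 + 1 / N) ^ k * c" using assms(3)
  proof (induction k arbitrary: \<sigma>)
    case (Suc k)
    let ?c = "(1 + 1 / N) ^ k * c"
    have "0 \<le> P (doubled x k f) \<sigma>" by (rule mean_nonneg[OF mean_P[OF Suc.prems]]) (use Suc.IH in blast)
    moreover have "0 \<le> avg {x} (doubled x k f) \<sigma>"
      by (rule mean_nonneg[OF mean_avg_\<Omega>[OF Suc.prems]]) (use Suc.IH in blast)
    moreover have "P (doubled x k f) \<sigma> \<le> ?c" by (rule mean_le[OF mean_P[OF Suc.prems]]) (use Suc.IH in blast)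
    moreover have "avg {x} (doubled x k f) \<sigma> \<le> ?c"
      by (rule mean_le[OF mean_avg_\<Omega>[OF Suc.prems]]) (use Suc.IH in blast)
    then have "avg {x} (doubled x k f) \<sigma> / N \<le> ?c / N" using N_ge_1 by (simp add: divide_right_mono)
    ultimately show ?case using N_ge_1 by (simp add: algebra_simps)
  qed (use assms in auto)
  then show "0 \<le> doubled x k f \<sigma>" "doubled x k f \<sigma> \<le> (1 + 1 / N) ^ k * c" by auto
qed

text \<open>This rests on \<open>c \<le> M + 2\<^sup>c\<^sup>-\<^sup>M\<close> for the number \<open>c\<close> of updates at \<open>x\<close>.\<close>

lemma counted_le:
  assumes f: "\<And>\<eta>. \<eta> \<in> \<Omega> \<Longrightarrow> 0 \<le> f \<eta>" and x: "x \<in> \<Lambda>" and "\<sigma> \<in> \<Omega>"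
  shows "counted x k f \<sigma> \<le> real M * (P ^^ k) f \<sigma> + (1 / 2) ^ M * doubled x k f \<sigma>"
  using assms(3)
proof (induction k arbitrary: \<sigma> M)
  case 0
  then show ?case using f by simp
next
  case (Suc k)
  note \<sigma> = Suc.prems
  note M = mean_avg_\<Omega>[OF \<sigma>]
  let ?Pk = "(P ^^ k) f" and ?U = "doubled x k f" and ?T = "counted x k f"
  define R where "R h = (\<Sum>y\<in>\<Lambda>-{x}. avg {y} h \<sigma>) / N" for h
  have P_split: "P h \<sigma> = R h + avg {x} h \<sigma> / N" for h
    unfolding P_def R_def using x finite_sites by (simp add: sum.remove[of \<Lambda> x] add_divide_distrib)
  have R_mono: "R h \<le> R h'" if "\<And>\<eta>. \<eta> \<in> \<Omega> \<Longrightarrow> h \<eta> \<le> h' \<eta>" for h h'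
    unfolding R_def using N_ge_1 by (intro divide_right_mono sum_mono mean_mono[OF M] that) auto
  have R_lin: "R (\<lambda>\<eta>. a * h \<eta> + b * h' \<eta>) = a * R h + b * R h'" for a b h h'
    unfolding R_def
    by (simp add: mean_add[OF M] mean_cmult[OF M] sum.distrib sum_distrib_left add_divide_distrib)
  have Pk_nonneg: "0 \<le> ?Pk \<eta>" if "\<eta> \<in> \<Omega>" for \<eta> by (rule mean_nonneg[OF mean_Pk[OF that]]) (rule f)
  have U_nonneg: "0 \<le> ?U \<eta>" if "\<eta> \<in> \<Omega>" for \<eta>
  proof -
    show ?thesis by (rule doubled_bounds(1)[where c = "Max (f ` \<Omega>)"]) (use f that finite_\<Omega> in auto)
  qed
  have 1: "R ?T \<le> real M * R ?Pk + (1 / 2) ^ M * R ?U"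
    unfolding R_lin[symmetric] by (rule R_mono) (rule Suc.IH)
  \<comment> \<open>An update at \<open>x\<close> raises the count by one and doubles the weight, so
    for \<open>M = Suc M'\<close> the induction hypothesis is used at \<open>M'\<close>. The value 0
    has no predecessor; there the extra copy of \<open>(P ^^ k) f\<close> is absorbed by
    \<open>doubled\<close>, which dominates it.\<close>
  have 2: "avg {x} ?T \<sigma> + avg {x} ?Pk \<sigma> \<le> real M * avg {x} ?Pk \<sigma> + (1 / 2) ^ M * (2 * avg {x} ?U \<sigma>)"
  proof (cases M)
    case 0
    have "?T \<eta> + ?Pk \<eta> \<le> 2 * ?U \<eta>" if "\<eta> \<in> \<Omega>" for \<eta>
    proof -
      have "?Pk \<eta> \<le> ?U \<eta>"
      proof -
        have "\<forall>\<eta>\<in>\<Omega>. (P ^^ j) f \<eta> \<le> doubled x j f \<eta> \<and> 0 \<le> doubled x j f \<eta>" for j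
        proof (induction j)
          case (Suc j)
          show ?case
          proof
            fix \<eta> assume \<eta>: "\<eta> \<in> \<Omega>"
            have "P ((P ^^ j) f) \<eta> \<le> P (doubled x j f) \<eta>" by (rule mean_mono[OF mean_P[OF \<eta>]]) (use Suc in blast)
            moreover have "0 \<le> avg {x} (doubled x j f) \<eta>"
              by (rule mean_nonneg[OF mean_avg_\<Omega>[OF \<eta>]]) (use Suc in blast)
            moreover have "0 \<le> P (doubled x j f) \<eta>"
              by (rule mean_nonneg[OF mean_P[OF \<eta>]]) (use Suc in blast)
            ultimately show "(P ^^ Suc j) f \<eta> \<le> doubled x (Suc j) f \<eta> \<and> 0 \<le> doubled x (Suc j) f \<eta>"
              using N_ge_1 by (simp add: add_increasing2)
          qed
        qed (use f in auto)
        then show ?thesis using that by blast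
      qed
      then show ?thesis using Suc.IH[OF that, of 0] by simp
    qed
    then have "avg {x} (\<lambda>\<eta>. ?T \<eta> + ?Pk \<eta>) \<sigma> \<le> avg {x} (\<lambda>\<eta>. 2 * ?U \<eta>) \<sigma>"
      by (rule mean_mono[OF M])
    then show ?thesis using 0 by (simp add: mean_add[OF M] mean_cmult[OF M])
  next
    case (Suc M')
    have "?T \<eta> + ?Pk \<eta> \<le> real M * ?Pk \<eta> + (1 / 2) ^ M * 2 * ?U \<eta>" if "\<eta> \<in> \<Omega>" for \<eta>
      using Suc.IH[OF that, of M'] Suc by (simp add: algebra_simps)
    then have "avg {x} (\<lambda>\<eta>. ?T \<eta> + ?Pk \<eta>) \<sigma> \<le> avg {x} (\<lambda>\<eta>. real M * ?Pk \<eta> + (1 / 2) ^ M * 2 * ?U \<eta>) \<sigma>"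
      by (rule mean_mono[OF M])
    then show ?thesis by (simp only: mean_add[OF M] mean_cmult[OF M] mult.assoc)
  qed
  have "counted x (Suc k) f \<sigma> = R ?T + (avg {x} ?T \<sigma> + avg {x} ?Pk \<sigma>) / N"
    by (simp add: P_split add_divide_distrib)
  also have "\<dots> \<le> (real M * R ?Pk + (1 / 2) ^ M * R ?U)
      + (real M * avg {x} ?Pk \<sigma> + (1 / 2) ^ M * (2 * avg {x} ?U \<sigma>)) / N"
    using N_ge_1 by (intro add_mono[OF 1] divide_right_mono 2) auto
  also have "\<dots> = real M * (P ^^ Suc k) f \<sigma> + (1 / 2) ^ M * doubled x (Suc k) f \<sigma>"
    by (simp add: P_split algebra_simps add_divide_distrib)
  finally show ?case .
qed

end

text \<open>Geometry enters in two ways: influence travels at most distance 1 per step along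
  \<open>nb\<close>, which gives a factor \<alpha> per unit of distance, and balls have polynomial
  volume, which keeps local costs at powers of the radius.\<close>

locale spatial_dobrushin = dobrushin \<Lambda> Q w nb \<rho> \<alpha> p
  for \<Lambda> :: "'a set" and Q :: "'b set" and w nb \<rho> \<alpha> p +
  fixes dst :: "'a \<Rightarrow> 'a \<Rightarrow> nat" and dim :: nat
  assumes dst_self: "dst x x = 0" and dst_sym: "dst x y = dst y x"
    and dst_nb: "x \<in> \<Lambda> \<Longrightarrow> y \<in> \<Lambda> \<Longrightarrow> z \<in> nb y \<Longrightarrow> dst x z \<le> dst x y + 1"
    and card_ball: "x \<in> \<Lambda> \<Longrightarrow> card {y\<in>\<Lambda>. dst x y \<le> R} \<le> (2 * R + 1) ^ dim"
begin

definition ball_at :: "nat \<Rightarrow> 'a \<Rightarrow> 'a set" where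
  "ball_at R x = {y\<in>\<Lambda>. dst x y \<le> R}"

lemma ball_subset: "ball_at R x \<subseteq> \<Lambda>"
  by (auto simp: ball_at_def)

text \<open>The profile \<open>d * \<alpha> ^ (R + 1 - r)\<close> in the distance r from
  \<open>x\<close> is preserved by one step: the column sum contributes a factor \<alpha> while the
  distance changes by at most 1. Truncated subtraction makes it equal to \<open>d\<close> outside
  the ball, where the dependence starts.\<close>

lemma lip_far:
  assumes x: "x \<in> \<Lambda>" and h: "lip h (\<lambda>y. if y \<in> ball_at R x then 0 else d)" and d: "0 \<le> d"
  shows "lip ((P ^^ k) h) (\<lambda>y. d * \<alpha> ^ (R + 1 - dst x y))"
proof (induction k)
  case 0
  show ?case
    using h d \<alpha>_pos \<alpha>_less
    by (auto elim!: lip_mono simp: ball_at_def)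
next
  case (Suc k)
  let ?D = "\<lambda>y. d * \<alpha> ^ (R + 1 - dst x y)"
  have "lip (P ((P ^^ k) h)) (\<lambda>y. (1 - 1 / N) * ?D y + (\<Sum>z\<in>\<Lambda>. infl z y * ?D z) / N)"
    by (rule lip_P[OF Suc])
  then have "lip (P ((P ^^ k) h)) ?D"
  proof (rule lip_mono)
    fix y assume y: "y \<in> \<Lambda>"
    have "(\<Sum>z\<in>\<Lambda>. infl z y * ?D z) \<le> (\<Sum>z\<in>\<Lambda>. infl z y * (d * \<alpha> ^ (R + 1 - dst x y - 1)))"
    proof (rule sum_mono)
      fix z assume z: "z \<in> \<Lambda>"
      show "infl z y * ?D z \<le> infl z y * (d * \<alpha> ^ (R + 1 - dst x y - 1))"
      proof (cases "y \<in> nb z")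
        case True
        then have "z \<in> nb y" using nb_sym y z by blast
        then have "dst x z \<le> dst x y + 1" using dst_nb x y by blast
        then have "\<alpha> ^ (R + 1 - dst x z) \<le> \<alpha> ^ (R + 1 - dst x y - 1)"
          using \<alpha>_pos \<alpha>_less by (intro power_decreasing) auto
        then show ?thesis using d infl_nonneg by (intro mult_left_mono) auto
      qed (simp add: infl_def)
    qed
    also have "\<dots> = (\<Sum>z\<in>\<Lambda>. infl z y) * (d * \<alpha> ^ (R + 1 - dst x y - 1))"
      by (simp add: sum_distrib_right)
    also have "\<dots> \<le> \<alpha> * (d * \<alpha> ^ (R + 1 - dst x y - 1))"
      using infl_column[OF y] d \<alpha>_pos by (intro mult_right_mono) auto
    \<comment> \<open>If the exponent is already truncated to 0, both powers are 1 and \<alpha> < 1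
      suffices.\<close>
    also have "\<dots> \<le> ?D y"
    proof (cases "R + 1 - dst x y")
      case 0
      then show ?thesis using d \<alpha>_pos \<alpha>_less by (simp add: mult_left_le_one_le)
    next
      case (Suc j)
      then show ?thesis by simp
    qed
    finally have "(\<Sum>z\<in>\<Lambda>. infl z y * ?D z) / N \<le> ?D y / N"
      using N_ge_1 by (simp add: divide_right_mono)
    then show "(1 - 1 / N) * ?D y + (\<Sum>z\<in>\<Lambda>. infl z y * ?D z) / N \<le> ?D y"
      by (simp add: left_diff_distrib)
  qed
  then show ?case by simp
qed

text \<open>\<open>m x\<close> is a substitute for \<open>g\<close> that does not see the spins in
  the ball around \<open>x\<close>. The contribution of an update at \<open>x\<close> to the
  variance is the fluctuation of \<open>(P ^^ k) g\<close> along the fiber at \<open>x\<close>; in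
  the splitting of \<open>g\<close> into \<open>g - m x\<close> and \<open>m x\<close>, the second
  part fluctuates by at most \<open>2 * G * \<alpha> ^ (R + 1)\<close> and the first is bounded by
  its mean square. Over all steps these mean squares are what \<open>counted\<close> adds
  up.\<close>

lemma variance_le_counted:
  assumes g: "\<And>\<eta>. \<eta> \<in> \<Omega> \<Longrightarrow> \<bar>g \<eta>\<bar> \<le> G"
    and mG: "\<And>x \<eta>. x \<in> \<Lambda> \<Longrightarrow> \<eta> \<in> \<Omega> \<Longrightarrow> \<bar>m x \<eta>\<bar> \<le> G"
    and m_local: "\<And>x \<sigma> \<eta>. x \<in> \<Lambda> \<Longrightarrow> \<sigma> \<in> \<Omega> \<Longrightarrow> \<eta> \<in> fiber (ball_at R x) \<sigma> \<Longrightarrow> m x \<eta> = m x \<sigma>"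
    and \<sigma>: "\<sigma> \<in> \<Omega>"
  shows "(P ^^ k) (\<lambda>\<eta>. (g \<eta>)\<^sup>2) \<sigma> - ((P ^^ k) g \<sigma>)\<^sup>2
    \<le> (4 + 4 / p) * (\<Sum>x\<in>\<Lambda>. counted x k (\<lambda>\<eta>. (g \<eta> - m x \<eta>)\<^sup>2) \<sigma>)
      + real k * (8 * G\<^sup>2 * (\<alpha> ^ (R + 1))\<^sup>2)"
  using \<sigma>
proof (induction k arbitrary: \<sigma>)
  case (Suc k)
  note \<sigma> = Suc.prems
  let ?\<psi> = "\<lambda>x \<eta>. (g \<eta> - m x \<eta>)\<^sup>2" and ?e = "8 * G\<^sup>2 * (\<alpha> ^ (R + 1))\<^sup>2"
  let ?V = "\<lambda>\<eta>. (P ^^ k) (\<lambda>\<eta>. (g \<eta>)\<^sup>2) \<eta> - ((P ^^ k) g \<eta>)\<^sup>2"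
  let ?h = "(P ^^ k) g"
  obtain \<eta>0 where \<eta>0: "\<eta>0 \<in> \<Omega>" using \<Omega>_nonempty by blast
  have G: "0 \<le> G" using g[OF \<eta>0] by linarith
  have one: "avg {x} (\<lambda>\<eta>. (?h \<eta> - ?h \<sigma>)\<^sup>2) \<sigma> \<le> (4 + 4 / p) * avg {x} ((P ^^ k) (?\<psi> x)) \<sigma> + ?e"
    if x: "x \<in> \<Lambda>" for x
  proof -
    let ?\<Psi> = "(P ^^ k) (?\<psi> x)" and ?m = "(P ^^ k) (m x)" and ?r = "(P ^^ k) (\<lambda>\<eta>. g \<eta> - m x \<eta>)"
    have h_split: "?h \<eta> = ?r \<eta> + ?m \<eta>" if "\<eta> \<in> \<Omega>" for \<eta>
      by (simp add: mean_diff[OF mean_Pk[OF that]])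
    have r: "(?r \<eta>)\<^sup>2 \<le> ?\<Psi> \<eta>" if "\<eta> \<in> \<Omega>" for \<eta>
      by (rule mean_power2_le[OF mean_Pk[OF that]])
    have \<Psi>: "0 \<le> ?\<Psi> \<eta>" if "\<eta> \<in> \<Omega>" for \<eta> by (rule mean_nonneg[OF mean_Pk[OF that]]) simp
    have "lip (m x) (\<lambda>y. if y \<in> ball_at R x then 0 else 2 * G)"
      unfolding lip_def
    proof (intro ballI)
      fix y \<zeta> c assume *: "y \<in> \<Lambda>" "\<zeta> \<in> \<Omega>" "c \<in> Q"
      note u = \<Omega>_upd[OF *(2,1,3)]
      show "\<bar>m x (\<zeta>(y := c)) - m x \<zeta>\<bar> \<le> (if y \<in> ball_at R x then 0 else 2 * G)"
      proof (cases "y \<in> ball_at R x")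
        case True
        then have "\<zeta>(y := c) \<in> fiber (ball_at R x) \<zeta>" using u by (auto simp: fiber_def)
        then show ?thesis using m_local[OF x *(2)] True by simp
      next
        case False
        then show ?thesis using mG[OF x u] mG[OF x *(2)] by simp
      qed
    qed
    then have "lip ?m (\<lambda>y. 2 * G * \<alpha> ^ (R + 1 - dst x y))" using lip_far[OF x] G by simp
    then have m_diff: "\<bar>?m \<eta> - ?m \<sigma>\<bar> \<le> 2 * G * \<alpha> ^ (R + 1)" if "\<eta> \<in> fiber {x} \<sigma>" for \<eta>
      using lip_single[OF _ x \<sigma> that] by (fastforce simp: dst_self)
    have "avg {x} (\<lambda>\<eta>. (?h \<eta> - ?h \<sigma>)\<^sup>2) \<sigma> \<le> avg {x} (\<lambda>\<eta>. 4 * ?\<Psi> \<eta> + (4 * ?\<Psi> \<sigma> + ?e)) \<sigma>"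
    proof (rule mean_mono[OF mean_avg[OF \<sigma>]])
      fix \<eta> assume \<eta>: "\<eta> \<in> fiber {x} \<sigma>"
      have "(?h \<eta> - ?h \<sigma>)\<^sup>2 \<le> 4 * (?r \<eta>)\<^sup>2 + 4 * (?r \<sigma>)\<^sup>2 + 2 * (?m \<eta> - ?m \<sigma>)\<^sup>2"
        unfolding h_split[OF fiber_\<Omega>[OF \<eta>]] h_split[OF \<sigma>] by (rule square_diff_le)
      also have "(?m \<eta> - ?m \<sigma>)\<^sup>2 \<le> (2 * G * \<alpha> ^ (R + 1))\<^sup>2"
        using m_diff[OF \<eta>] power_mono[OF m_diff[OF \<eta>], of 2] by simp
      also have "(2 * G * \<alpha> ^ (R + 1))\<^sup>2 = 4 * G\<^sup>2 * (\<alpha> ^ (R + 1))\<^sup>2"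
        by (simp add: power_mult_distrib)
      finally show "(?h \<eta> - ?h \<sigma>)\<^sup>2 \<le> 4 * ?\<Psi> \<eta> + (4 * ?\<Psi> \<sigma> + ?e)"
        using r[OF \<sigma>] r[OF fiber_\<Omega>[OF \<eta>]] by linarith
    qed
    also have "\<dots> = 4 * avg {x} ?\<Psi> \<sigma> + (4 * ?\<Psi> \<sigma> + ?e)"
      by (simp only: mean_add[OF mean_avg[OF \<sigma>]] mean_cmult[OF mean_avg[OF \<sigma>]] mean_const[OF mean_avg[OF \<sigma>]])
    \<comment> \<open>The point \<open>\<sigma>\<close> has weight at least \<open>p\<close> in its
      fiber; together with the average itself this yields the factor
      \<open>4 + 4 / p\<close>.\<close>
    also have "?\<Psi> \<sigma> \<le> avg {x} ?\<Psi> \<sigma> / p"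
      using avg_ge_point[of "{x}" \<sigma> ?\<Psi>] x \<sigma> \<Psi> p_pos by (simp add: field_simps)
    finally show ?thesis by (simp add: algebra_simps)
  qed
  have "P (\<lambda>\<eta>. (?h \<eta>)\<^sup>2) \<sigma> - (P ?h \<sigma>)\<^sup>2 \<le> (\<Sum>x\<in>\<Lambda>. avg {x} (\<lambda>\<eta>. (?h \<eta> - ?h \<sigma>)\<^sup>2) \<sigma>) / N"
    by (rule P_variance_le[OF \<sigma>])
  also have "\<dots> \<le> (\<Sum>x\<in>\<Lambda>. (4 + 4 / p) * avg {x} ((P ^^ k) (?\<psi> x)) \<sigma> + ?e) / N"
    using N_ge_1 by (intro divide_right_mono sum_mono one) auto
  also have "\<dots> = (4 + 4 / p) * (\<Sum>x\<in>\<Lambda>. avg {x} ((P ^^ k) (?\<psi> x)) \<sigma> / N) + ?e"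
    using N_ge_1 by (simp add: sum.distrib sum_distrib_left sum_divide_distrib N_def add_divide_distrib)
  finally have step: "P (\<lambda>\<eta>. (?h \<eta>)\<^sup>2) \<sigma> - (P ?h \<sigma>)\<^sup>2
    \<le> (4 + 4 / p) * (\<Sum>x\<in>\<Lambda>. avg {x} ((P ^^ k) (?\<psi> x)) \<sigma> / N) + ?e" .
  have "P ?V \<sigma> \<le> P (\<lambda>\<eta>. (4 + 4 / p) * (\<Sum>x\<in>\<Lambda>. counted x k (?\<psi> x) \<eta>) + real k * ?e) \<sigma>"
    by (rule mean_mono[OF mean_P[OF \<sigma>]]) (rule Suc.IH)
  also have "\<dots> = (4 + 4 / p) * (\<Sum>x\<in>\<Lambda>. P (counted x k (?\<psi> x)) \<sigma>) + real k * ?e"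
    by (simp only: mean_add[OF mean_P[OF \<sigma>]] mean_cmult[OF mean_P[OF \<sigma>]] mean_const[OF mean_P[OF \<sigma>]]
        mean_sum[OF mean_P[OF \<sigma>]])
  finally have prev: "P ?V \<sigma> \<le> (4 + 4 / p) * (\<Sum>x\<in>\<Lambda>. P (counted x k (?\<psi> x)) \<sigma>) + real k * ?e" .
  have "(P ^^ Suc k) (\<lambda>\<eta>. (g \<eta>)\<^sup>2) \<sigma> - ((P ^^ Suc k) g \<sigma>)\<^sup>2
      \<le> ((4 + 4 / p) * (\<Sum>x\<in>\<Lambda>. P (counted x k (?\<psi> x)) \<sigma>) + real k * ?e)
        + ((4 + 4 / p) * (\<Sum>x\<in>\<Lambda>. avg {x} ((P ^^ k) (?\<psi> x)) \<sigma> / N) + ?e)"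
    unfolding Pk_variance_Suc[OF \<sigma>] by (intro add_mono prev step)
  also have "\<dots> = (4 + 4 / p) * (\<Sum>x\<in>\<Lambda>. counted x (Suc k) (?\<psi> x) \<sigma>) + real (Suc k) * ?e"
    by (simp add: sum.distrib algebra_simps)
  finally show ?case .
qed simp

text \<open>The balls enter because an update at \<open>x\<close> is invisible outside \<open>ball_at R x\<close>, up to an exponentially small error, while the
  fluctuations of the log-density inside the ball are bounded by local entropies.\<close>

lemma varentropy_le:
  fixes R M k :: nat
  defines "G \<equiv> N * ln (N / p)" and "b \<equiv> real ((2 * R + 1) ^ dim)"
  assumes \<sigma>: "\<sigma> \<in> \<Omega>" and k: "card \<Lambda> \<le> k"
  shows "(P ^^ k) (\<lambda>\<eta>. (ln (dens \<sigma> k \<eta>))\<^sup>2) \<sigma> - ((P ^^ k) (\<lambda>\<eta>. ln (dens \<sigma> k \<eta>)) \<sigma>)\<^sup>2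
    \<le> (4 + 4 / p) * real M * (2 + b * ln (1 / p)) * C\<^sub>T * b * (N * (H (dens \<sigma> k) - H (dens \<sigma> (Suc k))))
      + ((4 + 4 / p) * N * (1 / 2) ^ M * (1 + 1 / N) ^ k * (4 * G\<^sup>2) + real k * (8 * G\<^sup>2 * (\<alpha> ^ (R + 1))\<^sup>2))"
proof -
  let ?f = "dens \<sigma> k"
  let ?m = "\<lambda>x \<eta>. ln (avg (ball_at R x) ?f \<eta>)"
  let ?\<psi> = "\<lambda>x \<eta>. (ln (?f \<eta>) - ?m x \<eta>)\<^sup>2"
  let ?I = "\<lambda>y. EE (Ent {y} ?f)"
  have f_pos: "0 < ?f \<eta>" if "\<eta> \<in> \<Omega>" for \<eta> using dens_pos[OF \<sigma> that k] .
  have lnp: "0 \<le> ln (1 / p)" using p_pos p_le_1 by simp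
  have b: "1 \<le> b" unfolding b_def by (simp add: Suc_leI)
  have C: "0 \<le> (4 + 4 / p)" using p_pos by simp
  \<comment> \<open>Densities and their local averages lie between these two powers, so all
    logarithms are at most \<open>G\<close>. The bound is crude, but in the result it is multiplied
    by exponentially small factors only.\<close>
  have range: "\<bar>ln u\<bar> \<le> G" if "(p / N) ^ card \<Lambda> \<le> u" "u \<le> (1 / p) ^ card \<Lambda>" for u
  proof -
    have pN: "0 < p / N" using p_pos N_ge_1 by simp
    then have pNn: "0 < (p / N) ^ card \<Lambda>" by (rule zero_less_power)
    have u: "0 < u" by (rule less_le_trans[OF pNn that(1)])
    have "ln u \<le> ln ((1 / p) ^ card \<Lambda>)" using u that p_pos by (subst ln_le_cancel_iff) auto
    also have "\<dots> = N * ln (1 / p)" using p_pos by (simp add: ln_realpow N_def)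
    also have "\<dots> \<le> G" unfolding G_def using N_ge_1 p_pos by (intro mult_left_mono) (auto simp: divide_right_mono)
    finally have "ln u \<le> G" .
    moreover have "ln ((p / N) ^ card \<Lambda>) \<le> ln u"
      by (rule iffD2[OF ln_le_cancel_iff[OF pNn u] that(1)])
    then have "- G \<le> ln u"
      using pN p_pos N_ge_1 by (simp add: ln_realpow N_def[symmetric] G_def ln_div algebra_simps)
    ultimately show ?thesis by linarith
  qed
  have fr: "(p / N) ^ card \<Lambda> \<le> ?f \<eta>" "?f \<eta> \<le> (1 / p) ^ card \<Lambda>" if "\<eta> \<in> \<Omega>" for \<eta>
    using dens_ge[OF \<sigma> that k] dens_le[OF \<sigma> that] by auto
  have lnf: "\<bar>ln (?f \<eta>)\<bar> \<le> G" if "\<eta> \<in> \<Omega>" for \<eta> using range fr[OF that] by blast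
  have lnm: "\<bar>?m x \<eta>\<bar> \<le> G" if "\<eta> \<in> \<Omega>" for x \<eta>
    by (rule range) (use mean_ge[OF mean_avg_\<Omega>[OF that]] mean_le[OF mean_avg_\<Omega>[OF that]] fr in blast)+
  have \<psi>G: "?\<psi> x \<eta> \<le> 4 * G\<^sup>2" if "\<eta> \<in> \<Omega>" for x \<eta>
  proof -
    have "\<bar>ln (?f \<eta>) - ?m x \<eta>\<bar> \<le> 2 * G" using lnf[OF that] lnm[OF that, of x] by linarith
    then have "\<bar>ln (?f \<eta>) - ?m x \<eta>\<bar>\<^sup>2 \<le> (2 * G)\<^sup>2" by (intro power_mono) auto
    then show ?thesis by (simp add: power_mult_distrib)
  qed
  have I: "0 \<le> ?I y" for y
    by (rule mean_nonneg[OF mean_EE]) (use Ent_nonneg f_pos in \<open>simp add: less_imp_le\<close>)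
  obtain \<sigma>0 where \<sigma>0: "\<sigma>0 \<in> \<Omega>" using \<sigma> by blast
  \<comment> \<open>The fluctuation of the log-density in the ball costs the entropy of the ball,
    which tensorization inside the ball splits into single-site entropies.\<close>
  have EB: "(P ^^ k) (?\<psi> x) \<sigma> \<le> (2 + b * ln (1 / p)) * (C\<^sub>T * (\<Sum>y\<in>ball_at R x. ?I y))" if x: "x \<in> \<Lambda>" for x
  proof -
    have c: "real (card (ball_at R x)) \<le> b"
      using card_ball[OF x, of R] unfolding b_def ball_at_def of_nat_le_iff .
    have "(P ^^ k) (?\<psi> x) \<sigma> = EE (\<lambda>\<eta>. ?f \<eta> * ?\<psi> x \<eta>)" by (rule EE_dens[OF \<sigma>, symmetric])
    also have "\<dots> \<le> (2 + real (card (ball_at R x)) * ln (1 / p)) * EE (Ent (ball_at R x) ?f)"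
      by (rule EE_log_ratio_le[OF ball_subset f_pos])
    also have "\<dots> \<le> (2 + b * ln (1 / p)) * EE (\<lambda>\<eta>. C\<^sub>T * (\<Sum>y\<in>ball_at R x. avg (ball_at R x) (Ent {y} ?f) \<eta>))"
    proof (intro mult_mono add_left_mono mult_right_mono c lnp mean_mono[OF mean_EE])
      show "0 \<le> EE (Ent (ball_at R x) ?f)"
        by (rule mean_nonneg[OF mean_EE]) (use Ent_nonneg f_pos in \<open>simp add: less_imp_le\<close>)
      show "0 \<le> 2 + b * ln (1 / p)" using b lnp by simp
    qed (use b in \<open>auto intro: Ent_tensorization[OF ball_subset f_pos]\<close>)
    also have "EE (\<lambda>\<eta>. C\<^sub>T * (\<Sum>y\<in>ball_at R x. avg (ball_at R x) (Ent {y} ?f) \<eta>)) = C\<^sub>T * (\<Sum>y\<in>ball_at R x. ?I y)"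
      by (simp add: mean_cmult[OF mean_EE] mean_sum[OF mean_EE] EE_avg[OF ball_subset])
    finally show ?thesis .
  qed
  have V: "(P ^^ k) (\<lambda>\<eta>. (ln (?f \<eta>))\<^sup>2) \<sigma> - ((P ^^ k) (\<lambda>\<eta>. ln (?f \<eta>)) \<sigma>)\<^sup>2
      \<le> (4 + 4 / p) * (\<Sum>x\<in>\<Lambda>. counted x k (?\<psi> x) \<sigma>) + real k * (8 * G\<^sup>2 * (\<alpha> ^ (R + 1))\<^sup>2)"
    by (rule variance_le_counted[OF lnf lnm _ \<sigma>]) (auto intro: arg_cong[where f = ln] avg_fiber)
  have S: "(\<Sum>x\<in>\<Lambda>. counted x k (?\<psi> x) \<sigma>)
      \<le> real M * ((2 + b * ln (1 / p)) * (C\<^sub>T * (b * (N * (H ?f - H (dens \<sigma> (Suc k)))))))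
        + N * ((1 / 2) ^ M * ((1 + 1 / N) ^ k * (4 * G\<^sup>2)))"
  proof -
    have "(\<Sum>x\<in>\<Lambda>. counted x k (?\<psi> x) \<sigma>)
      \<le> (\<Sum>x\<in>\<Lambda>. real M * (P ^^ k) (?\<psi> x) \<sigma> + (1 / 2) ^ M * doubled x k (?\<psi> x) \<sigma>)"
      by (rule sum_mono) (rule counted_le[OF _ _ \<sigma>], auto)
    also have "\<dots> \<le> (\<Sum>x\<in>\<Lambda>. real M * ((2 + b * ln (1 / p)) * (C\<^sub>T * (\<Sum>y\<in>ball_at R x. ?I y)))
        + (1 / 2) ^ M * ((1 + 1 / N) ^ k * (4 * G\<^sup>2)))"
      by (intro sum_mono add_mono mult_left_mono EB doubled_bounds(2) \<psi>G \<sigma>) auto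
    also have "\<dots> = real M * ((2 + b * ln (1 / p)) * (C\<^sub>T * (\<Sum>x\<in>\<Lambda>. \<Sum>y\<in>ball_at R x. ?I y)))
        + N * ((1 / 2) ^ M * ((1 + 1 / N) ^ k * (4 * G\<^sup>2)))"
      by (simp add: sum.distrib sum_distrib_left N_def)
    \<comment> \<open>By symmetry of \<open>dst\<close> each site lies in at most \<open>b\<close>
      of the balls, and the sum of all local entropies is at most \<open>N\<close> times the entropy
      lost in one step.\<close>
    also have "(\<Sum>x\<in>\<Lambda>. \<Sum>y\<in>ball_at R x. ?I y) \<le> b * (N * (H ?f - H (dens \<sigma> (Suc k))))"
    proof -
      have "(\<Sum>x\<in>\<Lambda>. \<Sum>y\<in>ball_at R x. ?I y) = (\<Sum>y\<in>\<Lambda>. \<Sum>x\<in>ball_at R y. ?I y)"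
        unfolding ball_at_def by (subst sum.swap_restrict[OF finite_sites finite_sites]) (simp add: dst_sym)
      also have "\<dots> \<le> (\<Sum>y\<in>\<Lambda>. b * ?I y)"
      proof (rule sum_mono)
        fix y assume y: "y \<in> \<Lambda>"
        have "real (card (ball_at R y)) \<le> b"
          using card_ball[OF y, of R] unfolding b_def ball_at_def of_nat_le_iff .
        then show "(\<Sum>x\<in>ball_at R y. ?I y) \<le> b * ?I y" using I by (simp add: mult_right_mono)
      qed
      also have "\<dots> = b * (\<Sum>y\<in>\<Lambda>. ?I y)" by (simp add: sum_distrib_left)
      also have "(\<Sum>y\<in>\<Lambda>. ?I y) \<le> N * (H ?f - H (dens \<sigma> (Suc k)))"
        using H_P_le[of ?f] dens_nonneg[OF \<sigma>] N_ge_1 by (simp add: dens_Suc field_simps)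
      finally show ?thesis using b by (simp add: mult_left_mono)
    qed
    finally show ?thesis using b lnp C\<^sub>T_pos by (simp add: mult_left_mono)
  qed
  show ?thesis
    by (rule order_trans[OF V], rule order_trans[OF add_right_mono[OF mult_left_mono[OF S C]]])
      (simp only: mult.assoc, simp only: distrib_left add.assoc order_refl)
qed

end

section \<open>Poissonization\<close>

definition pois :: "real \<Rightarrow> nat \<Rightarrow> real" where
  "pois x k = exp (- x) * x ^ k / fact k"

lemma pois_nonneg: "0 \<le> x \<Longrightarrow> 0 \<le> pois x k"
  by (simp add: pois_def)

lemma pois_sums_power: "(\<lambda>k. pois x k * r ^ k) sums exp (- (1 - r) * x)"
proof -
  have "(\<lambda>k. exp (- x) * ((r * x) ^ k /\<^sub>R fact k)) sums (exp (- x) * exp (r * x))"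
    by (intro sums_mult exp_converges)
  also have "(\<lambda>k. exp (- x) * ((r * x) ^ k /\<^sub>R fact k)) = (\<lambda>k. pois x k * r ^ k)"
    by (simp add: pois_def fun_eq_iff power_mult_distrib divide_inverse mult_ac)
  also have "exp (- x) * exp (r * x) = exp (- (1 - r) * x)"
    by (simp add: algebra_simps flip: exp_add)
  finally show ?thesis .
qed

lemma pois_sums: "pois x sums 1"
  using pois_sums_power[of x 1] by simp

lemma pois_shift: "real (Suc k) * pois x (Suc k) = x * pois x k"
  by (simp add: pois_def field_simps del: of_nat_Suc)

lemma pois_mean: "(\<lambda>k. pois x k * real k) sums x"
proof -
  have "(\<lambda>k. x * pois x k) sums (x * 1)" by (intro sums_mult pois_sums)
  then have "(\<lambda>k. pois x (Suc k) * real (Suc k)) sums x"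
    by (simp only: pois_shift[symmetric] mult.commute mult_1)
  then show ?thesis by (subst (asm) sums_Suc_iff) simp
qed

lemma pois_variance: "(\<lambda>k. pois x k * (real k - x)\<^sup>2) sums x"
proof -
  have "(\<lambda>k. x * (pois x k * real k) + x * pois x k) sums (x * x + x * 1)"
    by (intro sums_add sums_mult pois_mean pois_sums)
  also have "(\<lambda>k. x * (pois x k * real k) + x * pois x k) = (\<lambda>k. pois x (Suc k) * (real (Suc k))\<^sup>2)"
  proof
    fix k
    have "x * (pois x k * real k) + x * pois x k = (x * pois x k) * real (Suc k)"
      by (simp add: algebra_simps)
    also have "\<dots> = pois x (Suc k) * (real (Suc k))\<^sup>2"
      unfolding pois_shift[symmetric] by (simp only: power2_eq_square mult_ac)
    finally show "x * (pois x k * real k) + x * pois x k = pois x (Suc k) * (real (Suc k))\<^sup>2" .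
  qed
  finally have "(\<lambda>k. pois x k * (real k)\<^sup>2) sums (x * x + x)"
    by (subst (asm) sums_Suc_iff) simp
  then have "(\<lambda>k. pois x k * (real k)\<^sup>2 - 2 * x * (pois x k * real k) + x\<^sup>2 * pois x k)
      sums ((x * x + x) - 2 * x * x + x\<^sup>2 * 1)"
    by (intro sums_add sums_diff sums_mult pois_mean pois_sums)
  then show ?thesis by (simp add: power2_eq_square algebra_simps)
qed

lemma pois_summable:
  assumes "0 \<le> x" "\<And>k. \<bar>c k\<bar> \<le> C"
  shows "summable (\<lambda>k. pois x k * c k)"
proof (rule summable_comparison_test')
  show "summable (\<lambda>k. pois x k * C)"
    using sums_summable[OF pois_sums] by (rule summable_mult2)
  show "norm (pois x k * c k) \<le> pois x k * C" for k
    using pois_nonneg[OF assms(1)] assms(2) by (simp add: abs_mult mult_left_mono)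
qed

lemma pois_sum_le_1:
  assumes "0 \<le> x" "finite S"
  shows "(\<Sum>k\<in>S. pois x k) \<le> 1"
  using sum_le_suminf[OF sums_summable[OF pois_sums] assms(2)] pois_nonneg[OF assms(1)]
    sums_unique[OF pois_sums] by simp

text \<open>Later \<open>c\<close> is the indicator that the Poisson number of steps falls on the
  wrong side of a threshold.\<close>

lemma pois_Chebyshev:
  assumes "0 \<le> x" "0 < a" and c: "\<And>k. \<bar>real k - x\<bar> < a \<Longrightarrow> c k \<le> 0" "\<And>k. \<bar>c k\<bar> \<le> 1"
  shows "(\<Sum>k. pois x k * c k) \<le> x / a\<^sup>2"
proof -
  have s: "(\<lambda>k. pois x k * (real k - x)\<^sup>2 / a\<^sup>2) sums (x / a\<^sup>2)"
    by (intro sums_divide pois_variance)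
  have "(\<Sum>k. pois x k * c k) \<le> (\<Sum>k. pois x k * (real k - x)\<^sup>2 / a\<^sup>2)"
  proof (rule suminf_le)
    fix k
    have "c k \<le> (real k - x)\<^sup>2 / a\<^sup>2"
    proof (cases "\<bar>real k - x\<bar> < a")
      case True
      then show ?thesis using c(1)[of k] by (meson divide_nonneg_nonneg order_trans zero_le_power2)
    next
      case False
      then have "a\<^sup>2 \<le> \<bar>real k - x\<bar>\<^sup>2" using assms(2) by (intro power_mono) auto
      then have "1 \<le> (real k - x)\<^sup>2 / a\<^sup>2" using assms(2) by simp
      then show ?thesis using c(2)[of k] by linarith
    qed
    from mult_left_mono[OF this pois_nonneg[OF assms(1)], of k]
    show "pois x k * c k \<le> pois x k * (real k - x)\<^sup>2 / a\<^sup>2" by simp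
  next
    show "summable (\<lambda>k. pois x k * c k)" by (rule pois_summable[OF assms(1) c(2)])
  qed (use s sums_summable in blast)
  also have "\<dots> = x / a\<^sup>2" using sums_unique[OF s] by simp
  finally show ?thesis .
qed

section \<open>The continuous-time semigroup\<close>

context gibbs
begin

definition pt :: "real \<Rightarrow> (('s \<Rightarrow> 'c) \<Rightarrow> real) \<Rightarrow> ('s \<Rightarrow> 'c) \<Rightarrow> real" where
  "pt t f \<sigma> = (\<Sum>k. pois (N * t) k * (P ^^ k) f \<sigma>)"

lemma Pk_bounded: "\<exists>C. \<forall>k. \<bar>(P ^^ k) f \<sigma>\<bar> \<le> C" if "\<sigma> \<in> \<Omega>"
proof (intro exI allI)
  fix k
  have "\<bar>(P ^^ k) f \<sigma>\<bar> \<le> (P ^^ k) (\<lambda>\<eta>. \<bar>f \<eta>\<bar>) \<sigma>" by (rule mean_abs_le[OF mean_Pk[OF that]])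
  also have "\<dots> \<le> Max ((\<lambda>\<eta>. \<bar>f \<eta>\<bar>) ` \<Omega>)"
    by (rule mean_le[OF mean_Pk[OF that]]) (use finite_\<Omega> in auto)
  finally show "\<bar>(P ^^ k) f \<sigma>\<bar> \<le> Max ((\<lambda>\<eta>. \<bar>f \<eta>\<bar>) ` \<Omega>)" .
qed

lemma pt_summable:
  assumes "\<sigma> \<in> \<Omega>" "0 \<le> t"
  shows "summable (\<lambda>k. pois (N * t) k * (P ^^ k) f \<sigma>)"
proof -
  obtain C where "\<And>k. \<bar>(P ^^ k) f \<sigma>\<bar> \<le> C" using Pk_bounded[OF assms(1)] by blast
  then show ?thesis using assms(2) N_ge_1 by (intro pois_summable) auto
qed

text \<open>The weights are the values on point masses; the finite sum over configurations is
  exchanged with the series over the number of steps.\<close>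

lemma mean_pt:
  assumes "\<sigma> \<in> \<Omega>" "0 \<le> t"
  shows "mean_on \<Omega> (\<lambda>f. pt t f \<sigma>)"
proof -
  have Nt: "0 \<le> N * t" using assms(2) N_ge_1 by simp
  let ?k = "\<lambda>\<eta>. pt t (\<lambda>\<zeta>. of_bool (\<zeta> = \<eta>)) \<sigma>"
  have lin: "pt t f \<sigma> = (\<Sum>\<eta>\<in>\<Omega>. ?k \<eta> * f \<eta>)" for f
  proof -
    have "(P ^^ k) f \<sigma> = (\<Sum>\<eta>\<in>\<Omega>. (P ^^ k) (\<lambda>\<zeta>. of_bool (\<zeta> = \<eta>)) \<sigma> * f \<eta>)" for k
    proof -
      have "(P ^^ k) f \<sigma> = (P ^^ k) (\<lambda>\<zeta>. \<Sum>\<eta>\<in>\<Omega>. of_bool (\<zeta> = \<eta>) * f \<eta>) \<sigma>"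
      proof (rule mean_cong[OF mean_Pk[OF assms(1)]])
        fix \<zeta> assume "\<zeta> \<in> \<Omega>"
        then show "f \<zeta> = (\<Sum>\<eta>\<in>\<Omega>. of_bool (\<zeta> = \<eta>) * f \<eta>)"
          using sum_point(1)[OF finite_\<Omega>, of \<zeta> f] by (simp add: eq_commute)
      qed
      then show ?thesis by (simp add: mean_sum[OF mean_Pk[OF assms(1)]] mean_mult_const[OF mean_Pk[OF assms(1)]])
    qed
    then have "pt t f \<sigma> = (\<Sum>k. \<Sum>\<eta>\<in>\<Omega>. pois (N * t) k * (P ^^ k) (\<lambda>\<zeta>. of_bool (\<zeta> = \<eta>)) \<sigma> * f \<eta>)"
      by (simp add: pt_def sum_distrib_left mult.assoc)
    also have "\<dots> = (\<Sum>\<eta>\<in>\<Omega>. \<Sum>k. pois (N * t) k * (P ^^ k) (\<lambda>\<zeta>. of_bool (\<zeta> = \<eta>)) \<sigma> * f \<eta>)"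
      by (intro suminf_sum summable_mult2 pt_summable assms)
    also have "\<dots> = (\<Sum>\<eta>\<in>\<Omega>. ?k \<eta> * f \<eta>)"
      unfolding pt_def by (simp add: suminf_mult2[OF pt_summable[OF assms]])
    finally show ?thesis .
  qed
  have "0 \<le> ?k \<eta>" for \<eta>
    unfolding pt_def using pois_nonneg[OF Nt]
    by (intro suminf_nonneg pt_summable assms mult_nonneg_nonneg mean_nonneg[OF mean_Pk[OF assms(1)]]) auto
  moreover have "(\<Sum>\<eta>\<in>\<Omega>. ?k \<eta>) = 1"
    using lin[of "\<lambda>_. 1"] sums_unique[OF pois_sums, of "N * t"]
    by (simp add: pt_def mean_const[OF mean_Pk[OF assms(1)]])
  ultimately show ?thesis unfolding mean_on_def
    by (intro conjI exI[of _ ?k] ballI allI finite_\<Omega>) (simp_all only: lin[symmetric])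
qed

text \<open>The extremal function with values between 0 and 1 is the indicator of the set where the
  first measure has the larger weight. The overlap hypothesis below speaks of events, but it is
  applied to the probability of lying in an event some steps later.\<close>

lemma mean_diff_le_of_events:
  assumes L: "mean_on \<Omega> L" and M: "mean_on \<Omega> M"
    and ev: "\<And>A. L (\<lambda>\<eta>. of_bool (\<eta> \<in> A)) - M (\<lambda>\<eta>. of_bool (\<eta> \<in> A)) \<le> c"
    and h: "\<And>\<eta>. \<eta> \<in> \<Omega> \<Longrightarrow> 0 \<le> h \<eta>" "\<And>\<eta>. \<eta> \<in> \<Omega> \<Longrightarrow> h \<eta> \<le> 1"
  shows "L h - M h \<le> c"
proof -
  obtain k where k: "\<forall>f. L f = (\<Sum>x\<in>\<Omega>. k x * f x)" by (rule mean_onE[OF L]) (rule that)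
  obtain j where j: "\<forall>f. M f = (\<Sum>x\<in>\<Omega>. j x * f x)" by (rule mean_onE[OF M]) (rule that)
  let ?A = "{x. j x < k x}"
  have "L h - M h = (\<Sum>x\<in>\<Omega>. (k x - j x) * h x)"
    by (simp add: k j sum_subtractf left_diff_distrib)
  also have "\<dots> \<le> (\<Sum>x\<in>\<Omega>. (k x - j x) * of_bool (x \<in> ?A))"
  proof (rule sum_mono)
    fix x assume x: "x \<in> \<Omega>"
    show "(k x - j x) * h x \<le> (k x - j x) * of_bool (x \<in> ?A)"
    proof (cases "x \<in> ?A")
      case True
      then show ?thesis using mult_left_mono[OF h(2)[OF x], of "k x - j x"] by simp
    next
      case False
      then show ?thesis using h(1)[OF x] by (simp add: mult_nonpos_nonneg)
    qed
  qed
  also have "\<dots> = L (\<lambda>\<eta>. of_bool (\<eta> \<in> ?A)) - M (\<lambda>\<eta>. of_bool (\<eta> \<in> ?A))"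
    by (simp add: k j sum_subtractf left_diff_distrib)
  also have "\<dots> \<le> c" by (rule ev)
  finally show ?thesis .
qed

lemma H_dens_nonneg:
  assumes "\<sigma> \<in> \<Omega>"
  shows "0 \<le> H (dens \<sigma> k)"
  using mean_xlnx[OF mean_EE, of "dens \<sigma> k"] dens_nonneg[OF assms] EE_dens_1[OF assms]
  by (simp add: H_def)

lemma H_dens_mono:
  assumes "\<sigma> \<in> \<Omega>" "j \<le> k"
  shows "H (dens \<sigma> k) \<le> H (dens \<sigma> j)"
  using assms(2)
proof (induction k rule: dec_induct)
  case (step k)
  have "0 \<le> EE (Ent {x} (dens \<sigma> k))" for x
    by (rule mean_nonneg[OF mean_EE]) (use Ent_nonneg dens_nonneg[OF assms(1)] in blast)
  then have "0 \<le> (\<Sum>x\<in>\<Lambda>. EE (Ent {x} (dens \<sigma> k))) / N"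
    using N_ge_1 by (intro divide_nonneg_nonneg sum_nonneg) auto
  then show ?case using H_P_le[of "dens \<sigma> k"] dens_nonneg[OF assms(1)] step by (simp add: dens_Suc)
qed simp

end

context dobrushin
begin

lemma event_diff_le_H:
  assumes "\<sigma> \<in> \<Omega>" "card \<Lambda> \<le> k"
  shows "\<bar>(P ^^ k) (\<lambda>\<eta>. of_bool (\<eta> \<in> A)) \<sigma> - EE (\<lambda>\<eta>. of_bool (\<eta> \<in> A))\<bar> \<le> 2 * sqrt (H (dens \<sigma> k))"
proof -
  let ?f = "dens \<sigma> k" and ?I = "\<lambda>\<eta>. of_bool (\<eta> \<in> A) :: real"
  have "(P ^^ k) ?I \<sigma> - EE ?I = EE (\<lambda>\<eta>. ?f \<eta> * ?I \<eta> - ?I \<eta>)"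
    by (simp add: mean_diff[OF mean_EE] EE_dens[OF assms(1)])
  also have "\<bar>\<dots>\<bar> \<le> EE (\<lambda>\<eta>. \<bar>?f \<eta> * ?I \<eta> - ?I \<eta>\<bar>)" by (rule mean_abs_le[OF mean_EE])
  also have "\<dots> \<le> EE (\<lambda>\<eta>. \<bar>?f \<eta> - EE ?f\<bar>)"
    by (rule mean_mono[OF mean_EE]) (use EE_dens_1[OF assms(1)] in auto)
  also have "\<dots> \<le> 2 * sqrt (H ?f)"
  proof (rule power2_le_imp_le)
    have "(EE (\<lambda>\<eta>. \<bar>?f \<eta> - EE ?f\<bar>))\<^sup>2 \<le> 4 * EE ?f * (EE (\<lambda>x. ?f x * ln (?f x)) - EE ?f * ln (EE ?f))"
      by (rule mean_Pinsker[OF mean_EE]) (use dens_pos[OF assms(1) _ assms(2)] in blast)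
    then show "(EE (\<lambda>\<eta>. \<bar>?f \<eta> - EE ?f\<bar>))\<^sup>2 \<le> (2 * sqrt (H ?f))\<^sup>2"
      using H_dens_nonneg[OF assms(1)] by (simp add: EE_dens_1[OF assms(1)] H_def power_mult_distrib)
  qed (use H_dens_nonneg[OF assms(1)] in simp)
  finally show ?thesis .
qed

text \<open>Oscillations contract by \<kappa> per step and two configurations differ in at most
  \<open>N\<close> spins; averaging one of them over the Gibbs measure gives \<open>EE h\<close> by
  stationarity.\<close>

lemma Pk_EE_diff:
  assumes h: "lip h (\<lambda>_. 1)" and \<sigma>: "\<sigma> \<in> \<Omega>"
  shows "\<bar>(P ^^ k) h \<sigma> - EE h\<bar> \<le> N * \<kappa> ^ k"
proof -
  have L: "lip ((P ^^ k) h) (\<lambda>_. \<kappa> ^ k)" using lip_Pk_uniform[OF h] by simp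
  have d: "\<bar>(P ^^ k) h \<eta> - (P ^^ k) h \<sigma>\<bar> \<le> N * \<kappa> ^ k" if "\<eta> \<in> \<Omega>" for \<eta>
    using lip_fiber[OF L subset_refl \<sigma>, of \<eta>] that fiber_all[OF \<sigma>] by (simp add: N_def)
  have "EE ((P ^^ k) h) \<le> (P ^^ k) h \<sigma> + N * \<kappa> ^ k"
    by (rule mean_le[OF mean_EE]) (use d in \<open>force simp: abs_le_iff\<close>)
  moreover have "(P ^^ k) h \<sigma> - N * \<kappa> ^ k \<le> EE ((P ^^ k) h)"
    by (rule mean_ge[OF mean_EE]) (use d in \<open>force simp: abs_le_iff\<close>)
  ultimately show ?thesis by (simp add: EE_Pk abs_le_iff)
qed

lemma lip_event: "lip (\<lambda>\<eta>. of_bool (\<eta> \<in> A)) (\<lambda>_. 1)"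
  by (auto simp: lip_def)

text \<open>The Poisson average of \<kappa> ^ k is exp (- (1 - \<alpha>) * t); the bound shows that
  mixing takes at most a multiple of ln n.\<close>

lemma pt_event_diff:
  assumes "\<sigma> \<in> \<Omega>" "0 \<le> t"
  shows "\<bar>pt t (\<lambda>\<eta>. of_bool (\<eta> \<in> A)) \<sigma> - EE (\<lambda>\<eta>. of_bool (\<eta> \<in> A))\<bar> \<le> N * exp (- (1 - \<alpha>) * t)"
proof -
  let ?I = "\<lambda>\<eta>. of_bool (\<eta> \<in> A) :: real"
  have Nt: "0 \<le> N * t" using assms(2) N_ge_1 by simp
  have s1: "(\<lambda>k. pois (N * t) k * EE ?I) sums (1 * EE ?I)" by (intro sums_mult2 pois_sums)
  have s2: "(\<lambda>k. pois (N * t) k * (P ^^ k) ?I \<sigma>) sums pt t ?I \<sigma>"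
    unfolding pt_def by (rule summable_sums[OF pt_summable[OF assms]])
  have s: "(\<lambda>k. pois (N * t) k * ((P ^^ k) ?I \<sigma> - EE ?I)) sums (pt t ?I \<sigma> - EE ?I)"
    using sums_diff[OF s2 s1] by (simp add: right_diff_distrib)
  have b: "(\<lambda>k. N * (pois (N * t) k * \<kappa> ^ k)) sums (N * exp (- (1 - \<kappa>) * (N * t)))"
    by (intro sums_mult pois_sums_power)
  have le: "\<bar>pois (N * t) k * ((P ^^ k) ?I \<sigma> - EE ?I)\<bar> \<le> N * (pois (N * t) k * \<kappa> ^ k)" for k
    using mult_left_mono[OF Pk_EE_diff[OF lip_event assms(1), of k A] pois_nonneg[OF Nt, of k]] pois_nonneg[OF Nt, of k]
    by (simp add: abs_mult mult_ac)
  have "\<bar>pt t ?I \<sigma> - EE ?I\<bar> \<le> N * exp (- (1 - \<kappa>) * (N * t))"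
  proof (rule abs_leI)
    show "pt t ?I \<sigma> - EE ?I \<le> N * exp (- (1 - \<kappa>) * (N * t))"
      by (rule sums_le[OF _ s b]) (use le in \<open>simp add: abs_le_iff\<close>)
    show "- (pt t ?I \<sigma> - EE ?I) \<le> N * exp (- (1 - \<kappa>) * (N * t))"
      by (rule sums_le[OF _ sums_minus[OF s] b]) (use le in \<open>simp add: abs_le_iff\<close>)
  qed
  also have "- (1 - \<kappa>) * (N * t) = - (1 - \<alpha>) * t" using N_ge_1 by (simp add: \<kappa>_def field_simps)
  finally show ?thesis .
qed

lemma H_dens_decay:
  assumes "\<sigma> \<in> \<Omega>" "card \<Lambda> \<le> k"
  shows "H (dens \<sigma> (k + l)) \<le> exp (- real l / (C\<^sub>T * N)) * H (dens \<sigma> k)"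
proof (induction l)
  case (Suc l)
  let ?e = "1 / (C\<^sub>T * N)"
  have "H (dens \<sigma> (k + Suc l)) \<le> (1 - ?e) * H (dens \<sigma> (k + l))"
    using H_contract[of "dens \<sigma> (k + l)"] dens_pos[OF assms(1)] EE_dens_1[OF assms(1)] assms(2)
    by (simp add: dens_Suc)
  also have "\<dots> \<le> exp (- ?e) * H (dens \<sigma> (k + l))"
    using exp_ge_add_one_self[of "- ?e"] H_dens_nonneg[OF assms(1)] by (intro mult_right_mono) auto
  also have "\<dots> \<le> exp (- ?e) * (exp (- real l / (C\<^sub>T * N)) * H (dens \<sigma> k))"
    using Suc by (intro mult_left_mono) auto
  also have "\<dots> = exp (- real (Suc l) / (C\<^sub>T * N)) * H (dens \<sigma> k)"
    by (simp add: mult.assoc[symmetric] exp_add[symmetric] add_divide_distrib diff_divide_distrib)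
  finally show ?case .
qed simp

end

section \<open>From small overlap to equilibrium\<close>

context spatial_dobrushin
begin

text \<open>\<open>K\<^sub>V\<close> is the coefficient of the dissipated entropy in
  \<open>varentropy_le\<close> and \<open>err\<close> the remainder: \<open>M\<close> cuts off the
  number of updates at a site, \<open>R\<close> the range of influence. Both cutoffs will be of
  order ln N, which keeps \<open>K\<^sub>V\<close> at a power of ln N and makes \<open>err\<close>
  negligible.\<close>

definition K\<^sub>V :: "nat \<Rightarrow> nat \<Rightarrow> real" where
  "K\<^sub>V R M = (4 + 4 / p) * real M * (2 + real ((2 * R + 1) ^ dim) * ln (1 / p)) * C\<^sub>T * real ((2 * R + 1) ^ dim)"

definition err :: "nat \<Rightarrow> nat \<Rightarrow> nat \<Rightarrow> real" where
  "err R M k = (4 + 4 / p) * N * (1 / 2) ^ M * (1 + 1 / N) ^ k * (4 * (N * ln (N / p))\<^sup>2)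
     + real k * (8 * (N * ln (N / p))\<^sup>2 * (\<alpha> ^ (R + 1))\<^sup>2)"

lemma K\<^sub>V_nonneg: "0 \<le> K\<^sub>V R M"
  unfolding K\<^sub>V_def using p_pos p_le_1 C\<^sub>T_pos by (intro mult_nonneg_nonneg add_nonneg_nonneg) auto

lemma err_nonneg: "0 \<le> err R M k"
  unfolding err_def using p_pos N_ge_1 \<alpha>_pos by (intro add_nonneg_nonneg mult_nonneg_nonneg) auto

lemma err_mono: "j \<le> k \<Longrightarrow> err R M j \<le> err R M k"
  unfolding err_def using p_pos N_ge_1 \<alpha>_pos
  by (intro add_mono mult_right_mono mult_left_mono power_increasing mult_nonneg_nonneg) auto

lemma variance_dens_le:
  assumes \<sigma>: "\<sigma> \<in> \<Omega>" and k: "card \<Lambda> \<le> k"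
  defines "h \<equiv> H (dens \<sigma> k)"
  shows "(P ^^ k) (\<lambda>\<eta>. (ln (dens \<sigma> k \<eta>) - h)\<^sup>2) \<sigma>
    \<le> K\<^sub>V R M * (N * (h - H (dens \<sigma> (Suc k)))) + err R M k"
proof -
  note M = mean_Pk[OF \<sigma>]
  let ?g = "\<lambda>\<eta>. ln (dens \<sigma> k \<eta>)"
  have g: "(P ^^ k) ?g \<sigma> = h" unfolding h_def H_def by (rule EE_dens[OF \<sigma>, symmetric])
  have "(P ^^ k) (\<lambda>\<eta>. (?g \<eta> - h)\<^sup>2) \<sigma> = (P ^^ k) (\<lambda>\<eta>. (?g \<eta>)\<^sup>2 - 2 * h * ?g \<eta> + h\<^sup>2) \<sigma>"
    by (rule mean_cong[OF M]) (simp add: power2_eq_square algebra_simps)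
  also have "\<dots> = (P ^^ k) (\<lambda>\<eta>. (?g \<eta>)\<^sup>2) \<sigma> - 2 * h * (P ^^ k) ?g \<sigma> + h\<^sup>2"
    by (simp only: mean_add[OF M] mean_diff[OF M] mean_cmult[OF M] mean_const[OF M])
  also have "\<dots> = (P ^^ k) (\<lambda>\<eta>. (?g \<eta>)\<^sup>2) \<sigma> - ((P ^^ k) ?g \<sigma>)\<^sup>2"
    by (simp add: g power2_eq_square)
  also have "\<dots> \<le> K\<^sub>V R M * (N * (h - H (dens \<sigma> (Suc k)))) + err R M k"
    using varentropy_le[OF \<sigma> k, where R = R and M = M] unfolding K\<^sub>V_def err_def h_def by (simp only: mult.assoc)
  finally show ?thesis .
qed

text \<open>Otherwise, at each step the log-density is at least half the entropy with a probability whose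
  defect is a varentropy over the squared entropy \<open>h k\<close>. As the varentropy is bounded by the entropy
  drop, these defects are bounded by increments of \<open>1 / h k\<close> and telescope, while the union of these
  events has Gibbs measure at most \<open>k1 * exp (- D / 2)\<close>.\<close>

lemma entropy_le_of_overlap:
  fixes R M k1 :: nat
  assumes \<sigma>: "\<sigma> \<in> \<Omega>" and t0: "0 \<le> t0" and D: "0 < D"
    and overlap: "\<And>A. pt t0 (\<lambda>\<eta>. of_bool (\<eta> \<in> A)) \<sigma> - EE (\<lambda>\<eta>. of_bool (\<eta> \<in> A)) \<le> 1 - \<epsilon>"
    and k1: "N * t0 + 3 * N \<le> real k1"
    and small: "t0 / N + 4 * K\<^sub>V R M / D + 4 * (real k1 / N) * err R M k1 / D\<^sup>2 + real k1 * exp (- D / 2) < \<epsilon>"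
  shows "H (dens \<sigma> k1) \<le> D"
proof (rule ccontr)
  assume "\<not> H (dens \<sigma> k1) \<le> D"
  then have HD: "D < H (dens \<sigma> k1)" by simp
  let ?n = "card \<Lambda>" and ?K = "K\<^sub>V R M" and ?e = "err R M k1"
  define h where "h k = H (dens \<sigma> k)" for k
  define S where "S k = {\<eta>. h k / 2 \<le> ln (dens \<sigma> k \<eta>)}" for k
  define A where "A = (\<Union>k\<in>{?n..<k1}. S k)"
  define F where "F k = (P ^^ k) (\<lambda>\<eta>. of_bool (\<eta> \<in> A)) \<sigma>" for k
  \<comment> \<open>\<open>v k\<close> bounds the probability of missing \<open>A\<close> at step
    \<open>k\<close>. Before step \<open>?n\<close> the density may vanish, and from
    \<open>k1\<close> on no lower bound is claimed; the value 0 there makes the sum finite.\<close>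
  define v where "v k = (if ?n \<le> k \<and> k < k1 then 4 * ?K * N * (1 / h (Suc k) - 1 / h k) + 4 * ?e / D\<^sup>2 else 0)" for k
  have Nt: "0 \<le> N * t0" using t0 N_ge_1 by simp
  have nk1: "?n \<le> k1" using k1 Nt N_ge_1 by (simp add: N_def)
  have h_ge: "D < h k" if "k \<le> k1" for k
    using HD H_dens_mono[OF \<sigma> that] by (simp add: h_def)
  have h_mono: "h k \<le> h j" if "j \<le> k" for j k using H_dens_mono[OF \<sigma> that] by (simp add: h_def)
  have v_nonneg: "0 \<le> v k" for k
  proof (cases "?n \<le> k \<and> k < k1")
    case True
    have "1 / h k \<le> 1 / h (Suc k)"
      using h_mono[of k "Suc k"] h_ge[of k] h_ge[of "Suc k"] D True by (intro divide_left_mono) auto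
    then show ?thesis using True K\<^sub>V_nonneg err_nonneg N_ge_1 D
      by (simp add: v_def mult_nonneg_nonneg)
  qed (auto simp: v_def)

  have pi_A: "EE (\<lambda>\<eta>. of_bool (\<eta> \<in> A)) \<le> real k1 * exp (- D / 2)"
  proof -
    have "EE (\<lambda>\<eta>. of_bool (\<eta> \<in> A)) \<le> EE (\<lambda>\<eta>. \<Sum>k\<in>{?n..<k1}. dens \<sigma> k \<eta> * exp (- D / 2))"
    proof (rule mean_mono[OF mean_EE])
      fix \<eta> assume \<eta>: "\<eta> \<in> \<Omega>"
      have nn: "0 \<le> dens \<sigma> k \<eta> * exp (- D / 2)" for k using dens_nonneg[OF \<sigma> \<eta>] by simp
      show "of_bool (\<eta> \<in> A) \<le> (\<Sum>k\<in>{?n..<k1}. dens \<sigma> k \<eta> * exp (- D / 2))"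
      proof (cases "\<eta> \<in> A")
        case True
        then obtain k where k: "k \<in> {?n..<k1}" "\<eta> \<in> S k" by (auto simp: A_def)
        have f: "0 < dens \<sigma> k \<eta>" using dens_pos[OF \<sigma> \<eta>] k by simp
        \<comment> \<open>On \<open>S k\<close> the density is at least exp (D / 2) while its mean
          is 1: Markov's inequality, once for each step.\<close>
        have "D / 2 \<le> ln (dens \<sigma> k \<eta>)" using k h_ge[of k] by (simp add: S_def)
        then have "exp (D / 2) \<le> exp (ln (dens \<sigma> k \<eta>))" by (simp only: exp_le_cancel_iff)
        then have "exp (D / 2) \<le> dens \<sigma> k \<eta>" using f by simp
        then have "exp (D / 2) * exp (- D / 2) \<le> dens \<sigma> k \<eta> * exp (- D / 2)"
          by (intro mult_right_mono) auto
        then have "1 \<le> dens \<sigma> k \<eta> * exp (- D / 2)" by (simp flip: exp_add)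
        also have "\<dots> \<le> (\<Sum>k\<in>{?n..<k1}. dens \<sigma> k \<eta> * exp (- D / 2))"
          by (rule member_le_sum) (use k nn in auto)
        finally show ?thesis by (simp add: True)
      next
        case False
        then show ?thesis using sum_nonneg[OF nn] by simp
      qed
    qed
    also have "\<dots> = (\<Sum>k\<in>{?n..<k1}. EE (dens \<sigma> k) * exp (- D / 2))"
      by (simp only: mean_sum[OF mean_EE] mean_mult_const[OF mean_EE])
    also have "\<dots> = real (k1 - ?n) * exp (- D / 2)" by (simp add: EE_dens_1[OF \<sigma>])
    also have "\<dots> \<le> real k1 * exp (- D / 2)" by (intro mult_right_mono) auto
    finally show ?thesis .
  qed

  have F_nonneg: "0 \<le> F k" for k unfolding F_def by (rule mean_nonneg[OF mean_Pk[OF \<sigma>]]) simp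
  have F_ge: "of_bool (k < k1) - v k \<le> F k" if k: "?n \<le> k" for k
  proof (cases "k < k1")
    case True
    let ?g = "\<lambda>\<eta>. ln (dens \<sigma> k \<eta>)"
    have hk: "0 < h k" "0 < h (Suc k)" "D < h k" using h_ge[of k] h_ge[of "Suc k"] True D by auto
    have "1 - F k = (P ^^ k) (\<lambda>\<eta>. 1 - of_bool (\<eta> \<in> A)) \<sigma>"
      by (simp only: F_def mean_diff[OF mean_Pk[OF \<sigma>]] mean_const[OF mean_Pk[OF \<sigma>]])
    \<comment> \<open>Chebyshev's inequality: off \<open>A\<close> the log-density deviates from its
      mean \<open>h k\<close> by at least \<open>h k / 2\<close>.\<close>
    also have "\<dots> \<le> (P ^^ k) (\<lambda>\<eta>. 4 / (h k)\<^sup>2 * (?g \<eta> - h k)\<^sup>2) \<sigma>"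
    proof (rule mean_mono[OF mean_Pk[OF \<sigma>]])
      fix \<eta>
      show "1 - of_bool (\<eta> \<in> A) \<le> 4 / (h k)\<^sup>2 * (?g \<eta> - h k)\<^sup>2"
      proof (cases "\<eta> \<in> A")
        case False
        then have "\<eta> \<notin> S k" using True k by (auto simp: A_def)
        then have "h k / 2 \<le> \<bar>?g \<eta> - h k\<bar>" unfolding S_def mem_Collect_eq by linarith
        then have "(h k / 2)\<^sup>2 \<le> \<bar>?g \<eta> - h k\<bar>\<^sup>2" using hk by (intro power_mono) auto
        then show ?thesis using False hk by (simp add: field_simps)
      qed simp
    qed
    also have "\<dots> = 4 / (h k)\<^sup>2 * (P ^^ k) (\<lambda>\<eta>. (?g \<eta> - h k)\<^sup>2) \<sigma>"
      by (rule mean_cmult[OF mean_Pk[OF \<sigma>]])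
    also have "\<dots> \<le> 4 / (h k)\<^sup>2 * (?K * (N * (h k - h (Suc k))) + ?e)"
    proof (rule mult_left_mono)
      have "(P ^^ k) (\<lambda>\<eta>. (?g \<eta> - h k)\<^sup>2) \<sigma> \<le> ?K * (N * (h k - h (Suc k))) + err R M k"
        unfolding h_def by (rule variance_dens_le[OF \<sigma> k])
      also have "err R M k \<le> ?e" using True by (intro err_mono) simp
      finally show "(P ^^ k) (\<lambda>\<eta>. (?g \<eta> - h k)\<^sup>2) \<sigma> \<le> ?K * (N * (h k - h (Suc k))) + ?e" by simp
    qed simp
    also have "\<dots> = 4 * ?K * N * ((h k - h (Suc k)) / (h k)\<^sup>2) + 4 * ?e / (h k)\<^sup>2"
      by (simp only: distrib_left times_divide_eq_right times_divide_eq_left mult.assoc)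
    also have "\<dots> \<le> 4 * ?K * N * (1 / h (Suc k) - 1 / h k) + 4 * ?e / D\<^sup>2"
    proof (intro add_mono mult_left_mono divide_left_mono)
      \<comment> \<open>Since \<open>h\<close> is decreasing, one factor \<open>h k\<close> of the
        denominator may be replaced by \<open>h (Suc k)\<close>, which turns the bound into a
        difference.\<close>
      have "(h k - h (Suc k)) / (h k)\<^sup>2 \<le> (h k - h (Suc k)) / (h k * h (Suc k))"
        using h_mono[of k "Suc k"] hk by (intro divide_left_mono) (auto simp: power2_eq_square)
      also have "\<dots> = 1 / h (Suc k) - 1 / h k" using hk by (simp add: field_simps)
      finally show "(h k - h (Suc k)) / (h k)\<^sup>2 \<le> 1 / h (Suc k) - 1 / h k" .
      show "D\<^sup>2 \<le> (h k)\<^sup>2" using hk D by (intro power_mono) auto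
    qed (use K\<^sub>V_nonneg err_nonneg N_ge_1 D hk in auto)
    finally show ?thesis using True k by (simp add: v_def)
  next
    case False
    then show ?thesis using F_nonneg[of k] v_nonneg[of k] by simp
  qed

  have v_sum: "(\<Sum>k<k1. v k) \<le> 4 * ?K * N / D + 4 * real k1 * ?e / D\<^sup>2"
  proof -
    have "(\<Sum>k<k1. v k) = (\<Sum>k\<in>{?n..<k1}. 4 * ?K * N * (1 / h (Suc k) - 1 / h k) + 4 * ?e / D\<^sup>2)"
      by (rule sum.mono_neutral_cong_right) (auto simp: v_def)
    also have "\<dots> = 4 * ?K * N * (1 / h k1 - 1 / h ?n) + real (k1 - ?n) * (4 * ?e / D\<^sup>2)"
      using sum_Suc_diff'[OF nk1, of "\<lambda>k. 1 / h k"] by (simp add: sum.distrib sum_distrib_left[symmetric])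
    also have "\<dots> \<le> 4 * ?K * N * (1 / D) + real k1 * (4 * ?e / D\<^sup>2)"
    proof (intro add_mono mult_left_mono mult_right_mono)
      have "1 / h k1 \<le> 1 / D" using h_ge[of k1] D by (intro divide_left_mono) auto
      moreover have "0 \<le> 1 / h ?n" using h_ge[OF nk1] D by simp
      ultimately show "1 / h k1 - 1 / h ?n \<le> 1 / D" by linarith
    qed (use K\<^sub>V_nonneg err_nonneg N_ge_1 in auto)
    finally show ?thesis by (simp add: mult_ac)
  qed

  \<comment> \<open>The overlap at time \<open>t0\<close> is tested on the probability of being in
    \<open>A\<close> after \<open>?n + m\<close> further steps: the \<open>?n\<close> steps make the
    densities positive, and \<open>m\<close> is averaged below over a block of length
    \<open>?n\<close>.\<close>
  have each: "1 - t0 / N - (\<Sum>j<k1. pois (N * t0) j * v (j + (?n + m))) \<le> 1 - \<epsilon> + real k1 * exp (- D / 2)"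
    if m: "m < ?n" for m
  proof -
    let ?c = "?n + m" and ?x = "N * t0"
    let ?h = "(P ^^ ?c) (\<lambda>\<eta>. of_bool (\<eta> \<in> A))"
    have vb: "\<bar>v k\<bar> \<le> (\<Sum>k<k1. v k)" for k
    proof (cases "k < k1")
      case True
      then have "v k \<le> (\<Sum>k<k1. v k)" using v_nonneg by (intro member_le_sum) auto
      then show ?thesis using v_nonneg by simp
    next
      case False
      then have "v k = 0" by (simp add: v_def)
      then show ?thesis using sum_nonneg[OF v_nonneg] by simp
    qed
    have "pt t0 ?h \<sigma> - EE ?h \<le> 1 - \<epsilon>"
    proof (rule mean_diff_le_of_events[OF mean_pt[OF \<sigma> t0] mean_EE overlap])
      fix \<eta> assume \<eta>: "\<eta> \<in> \<Omega>"
      show "0 \<le> ?h \<eta>" by (rule mean_nonneg[OF mean_Pk[OF \<eta>]]) simp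
      show "?h \<eta> \<le> 1" by (rule mean_le[OF mean_Pk[OF \<eta>]]) simp
    qed
    then have up: "pt t0 ?h \<sigma> \<le> 1 - \<epsilon> + real k1 * exp (- D / 2)" using pi_A by (simp add: EE_Pk)
    have s1: "summable (\<lambda>j. pois ?x j * of_bool (\<not> j + ?c < k1))"
      by (rule pois_summable[OF Nt, where C = 1]) simp
    have s2: "summable (\<lambda>j. pois ?x j * v (j + ?c))"
      by (rule pois_summable[OF Nt]) (rule vb)
    \<comment> \<open>Chebyshev's inequality with deviation \<open>N\<close>. The margin
      \<open>3 * N\<close> in \<open>k1\<close> covers this deviation and the fewer than
      \<open>2 * N\<close> additional steps.\<close>
    have tail: "(\<Sum>j. pois ?x j * of_bool (\<not> j + ?c < k1)) \<le> t0 / N"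
    proof -
      have "(\<Sum>j. pois ?x j * of_bool (\<not> j + ?c < k1)) \<le> ?x / N\<^sup>2"
      proof (rule pois_Chebyshev[OF Nt])
        fix j assume "\<bar>real j - ?x\<bar> < N"
        then have "real j + real ?n + real m < real k1" using k1 m by (simp add: N_def)
        then have "j + ?c < k1" by linarith
        then show "of_bool (\<not> j + ?c < k1) \<le> (0::real)" by simp
      qed (use N_ge_1 in auto)
      then show ?thesis using N_ge_1 by (simp add: power2_eq_square)
    qed
    have "(\<lambda>j. pois ?x j - pois ?x j * of_bool (\<not> j + ?c < k1) - pois ?x j * v (j + ?c))
       sums (1 - (\<Sum>j. pois ?x j * of_bool (\<not> j + ?c < k1)) - (\<Sum>j. pois ?x j * v (j + ?c)))"
      by (intro sums_diff pois_sums summable_sums s1 s2)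
    then have "1 - (\<Sum>j. pois ?x j * of_bool (\<not> j + ?c < k1)) - (\<Sum>j. pois ?x j * v (j + ?c)) \<le> pt t0 ?h \<sigma>"
    proof (rule sums_le[rotated])
      show "(\<lambda>j. pois ?x j * F (j + ?c)) sums pt t0 ?h \<sigma>"
        using summable_sums[OF pt_summable[OF \<sigma> t0, of ?h]] unfolding F_def pt_def by (simp add: funpow_add)
      fix j
      have "pois ?x j * (of_bool (j + ?c < k1) - v (j + ?c)) \<le> pois ?x j * F (j + ?c)"
        by (intro mult_left_mono F_ge pois_nonneg Nt) simp
      then show "pois ?x j - pois ?x j * of_bool (\<not> j + ?c < k1) - pois ?x j * v (j + ?c) \<le> pois ?x j * F (j + ?c)"
        by (auto simp: algebra_simps split: if_splits)
    qed
    moreover have "(\<Sum>j. pois ?x j * v (j + ?c)) = (\<Sum>j<k1. pois ?x j * v (j + ?c))"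
      by (rule suminf_finite) (auto simp: v_def)
    ultimately show ?thesis using tail up by linarith
  qed

  \<comment> \<open>For given \<open>k\<close> and \<open>j\<close> at most one \<open>m\<close>
    satisfies \<open>k = j + (?n + m)\<close>, so over the block each \<open>v k\<close> is counted
    with total weight at most 1; division by \<open>N\<close> then turns the total defect into a
    small average.\<close>
  have mix: "(\<Sum>m<?n. \<Sum>j<k1. pois (N * t0) j * v (j + (?n + m))) \<le> (\<Sum>k<k1. v k)"
  proof -
    have "v i = (\<Sum>k<k1. of_bool (k = i) * v k)" for i
      by (cases "i < k1") (simp_all add: sum_point v_def)
    then have "(\<Sum>m<?n. \<Sum>j<k1. pois (N * t0) j * v (j + (?n + m)))
      = (\<Sum>m<?n. \<Sum>j<k1. pois (N * t0) j * (\<Sum>k<k1. of_bool (k = j + (?n + m)) * v k))"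
      by (intro sum.cong refl) metis
    also have "\<dots> = (\<Sum>m<?n. \<Sum>j<k1. \<Sum>k<k1. pois (N * t0) j * of_bool (k = j + (?n + m)) * v k)"
      by (simp only: sum_distrib_left mult.assoc)
    also have "\<dots> = (\<Sum>m<?n. \<Sum>k<k1. \<Sum>j<k1. pois (N * t0) j * of_bool (k = j + (?n + m)) * v k)"
      by (rule sum.cong[OF refl], rule sum.swap)
    also have "\<dots> = (\<Sum>k<k1. \<Sum>m<?n. \<Sum>j<k1. pois (N * t0) j * of_bool (k = j + (?n + m)) * v k)"
      by (rule sum.swap)
    also have "\<dots> = (\<Sum>k<k1. \<Sum>j<k1. \<Sum>m<?n. pois (N * t0) j * of_bool (k = j + (?n + m)) * v k)"
      by (rule sum.cong[OF refl], rule sum.swap)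
    also have "\<dots> \<le> (\<Sum>k<k1. \<Sum>j<k1. pois (N * t0) j * v k)"
    proof (intro sum_mono)
      fix k j
      have "(\<Sum>m<?n. of_bool (k = j + (?n + m))) \<le> (\<Sum>m<?n. of_bool (m = k - j - ?n) :: real)"
        by (intro sum_mono) auto
      also have "\<dots> \<le> 1" by (simp add: of_bool_def)
      finally have "(\<Sum>m<?n. of_bool (k = j + (?n + m))) * (pois (N * t0) j * v k) \<le> 1 * (pois (N * t0) j * v k)"
        by (intro mult_right_mono mult_nonneg_nonneg pois_nonneg Nt v_nonneg)
      then show "(\<Sum>m<?n. pois (N * t0) j * of_bool (k = j + (?n + m)) * v k) \<le> pois (N * t0) j * v k"
        by (simp only: sum_distrib_left sum_distrib_right mult_ac mult_1)
    qed
    also have "\<dots> = (\<Sum>k<k1. (\<Sum>j<k1. pois (N * t0) j) * v k)" by (simp add: sum_distrib_right)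
    also have "\<dots> \<le> (\<Sum>k<k1. 1 * v k)"
      by (intro sum_mono mult_right_mono pois_sum_le_1 Nt v_nonneg) auto
    finally show ?thesis by simp
  qed
  have "(\<Sum>m<?n. 1 - t0 / N - (\<Sum>j<k1. pois (N * t0) j * v (j + (?n + m))))
      \<le> (\<Sum>m<?n. 1 - \<epsilon> + real k1 * exp (- D / 2))"
    by (intro sum_mono each) auto
  then have "N * (1 - t0 / N) - (\<Sum>m<?n. \<Sum>j<k1. pois (N * t0) j * v (j + (?n + m)))
      \<le> N * (1 - \<epsilon> + real k1 * exp (- D / 2))"
    by (simp add: sum_subtractf N_def)
  then have "N * (1 - t0 / N) - (4 * ?K * N / D + 4 * real k1 * ?e / D\<^sup>2) \<le> N * (1 - \<epsilon> + real k1 * exp (- D / 2))"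
    using mix v_sum by linarith
  then have "N * \<epsilon> \<le> N * (t0 / N + 4 * ?K / D + 4 * (real k1 / N) * ?e / D\<^sup>2 + real k1 * exp (- D / 2))"
    using N_ge_1 by (simp add: algebra_simps)
  then show False using small N_ge_1 by (simp add: mult_le_cancel_left)
qed

text \<open>Once it is at most \<open>D\<close>, the entropy decays at rate
  \<open>1 / (C\<^sub>T * N)\<close> per step, and after \<open>l\<close> more steps Pinsker's
  inequality bounds the distance. At time \<open>t1\<close> the Poisson number of steps exceeds
  \<open>k1 + l\<close> except with probability at most \<open>t1 / N\<close>.\<close>

theorem mixing_after_overlap:
  fixes R M k1 l :: nat
  assumes t0: "0 \<le> t0" and D: "0 < D" and t1: "0 \<le> t1"
    and overlap: "\<And>\<sigma> A. \<sigma> \<in> \<Omega> \<Longrightarrow> pt t0 (\<lambda>\<eta>. of_bool (\<eta> \<in> A)) \<sigma> - EE (\<lambda>\<eta>. of_bool (\<eta> \<in> A)) \<le> 1 - \<epsilon>"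
    and k1: "N * t0 + 3 * N \<le> real k1"
    and small: "t0 / N + 4 * K\<^sub>V R M / D + 4 * (real k1 / N) * err R M k1 / D\<^sup>2 + real k1 * exp (- D / 2) < \<epsilon>"
    and l: "real (k1 + l) + N \<le> N * t1"
    and \<delta>: "2 * sqrt (exp (- real l / (C\<^sub>T * N)) * D) + t1 / N \<le> \<delta>"
    and \<sigma>: "\<sigma> \<in> \<Omega>"
  shows "\<bar>pt t1 (\<lambda>\<eta>. of_bool (\<eta> \<in> A)) \<sigma> - EE (\<lambda>\<eta>. of_bool (\<eta> \<in> A))\<bar> \<le> \<delta>"
proof -
  let ?I = "\<lambda>\<eta>. of_bool (\<eta> \<in> A) :: real" and ?x = "N * t1"
  let ?s = "2 * sqrt (exp (- real l / (C\<^sub>T * N)) * D)"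
  have Nt: "0 \<le> ?x" using t1 N_ge_1 by simp
  have "0 \<le> N * t0" using t0 N_ge_1 by simp
  then have nk1: "card \<Lambda> \<le> k1" using k1 N_ge_1 by (simp add: N_def)
  have "H (dens \<sigma> k1) \<le> D" by (rule entropy_le_of_overlap[OF \<sigma> t0 D overlap[OF \<sigma>] k1 small])
  then have Hl: "H (dens \<sigma> (k1 + l)) \<le> exp (- real l / (C\<^sub>T * N)) * D"
    using H_dens_decay[OF \<sigma> nk1, of l] by (meson exp_ge_zero mult_left_mono order_trans)
  have late: "\<bar>(P ^^ k) ?I \<sigma> - EE ?I\<bar> \<le> ?s" if k: "k1 + l \<le> k" for k
  proof -
    have "\<bar>(P ^^ k) ?I \<sigma> - EE ?I\<bar> \<le> 2 * sqrt (H (dens \<sigma> k))"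
      by (rule event_diff_le_H[OF \<sigma>]) (use k nk1 in simp)
    also have "\<dots> \<le> ?s"
      using H_dens_mono[OF \<sigma> k] Hl by (intro mult_left_mono real_sqrt_le_mono) auto
    finally show ?thesis .
  qed
  have bound: "\<bar>(P ^^ k) ?I \<sigma> - EE ?I\<bar> \<le> 1" for k
  proof -
    have "0 \<le> (P ^^ k) ?I \<sigma>" "(P ^^ k) ?I \<sigma> \<le> 1" "0 \<le> EE ?I" "EE ?I \<le> 1"
      by (rule mean_nonneg[OF mean_Pk[OF \<sigma>]] mean_le[OF mean_Pk[OF \<sigma>]] mean_nonneg[OF mean_EE] mean_le[OF mean_EE]; simp)+
    then show ?thesis by linarith
  qed
  have s0: "0 \<le> ?s" using D by simp
  have le: "\<bar>(P ^^ k) ?I \<sigma> - EE ?I\<bar> \<le> ?s + of_bool (k < k1 + l)" for k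
  proof (cases "k < k1 + l")
    case True
    then show ?thesis using bound[of k] s0 by (simp only: of_bool_eq)
  next
    case False
    then show ?thesis using late[of k] by simp
  qed
  have s1: "(\<lambda>k. pois ?x k * EE ?I) sums (1 * EE ?I)" by (intro sums_mult2 pois_sums)
  have s2: "(\<lambda>k. pois ?x k * (P ^^ k) ?I \<sigma>) sums pt t1 ?I \<sigma>"
    unfolding pt_def by (rule summable_sums[OF pt_summable[OF \<sigma> t1]])
  have s: "(\<lambda>k. pois ?x k * ((P ^^ k) ?I \<sigma> - EE ?I)) sums (pt t1 ?I \<sigma> - EE ?I)"
    using sums_diff[OF s2 s1] by (simp add: right_diff_distrib)
  have tl: "summable (\<lambda>k. pois ?x k * of_bool (k < k1 + l))" by (rule pois_summable[OF Nt, where C = 1]) simp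
  have b: "(\<lambda>k. pois ?x k * ?s + pois ?x k * of_bool (k < k1 + l))
      sums (1 * ?s + (\<Sum>k. pois ?x k * of_bool (k < k1 + l)))"
    by (intro sums_add sums_mult2 pois_sums summable_sums tl)
  have le': "\<bar>pois ?x k * ((P ^^ k) ?I \<sigma> - EE ?I)\<bar> \<le> pois ?x k * ?s + pois ?x k * of_bool (k < k1 + l)" for k
    using mult_left_mono[OF le pois_nonneg[OF Nt], of k k] pois_nonneg[OF Nt, of k]
    by (simp only: abs_mult abs_of_nonneg distrib_left)
  have "\<bar>pt t1 ?I \<sigma> - EE ?I\<bar> \<le> 1 * ?s + (\<Sum>k. pois ?x k * of_bool (k < k1 + l))"
  proof (rule abs_leI)
    show "pt t1 ?I \<sigma> - EE ?I \<le> 1 * ?s + (\<Sum>k. pois ?x k * of_bool (k < k1 + l))"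
      by (rule sums_le[OF _ s b]) (use le' abs_ge_self order_trans in blast)
    show "- (pt t1 ?I \<sigma> - EE ?I) \<le> 1 * ?s + (\<Sum>k. pois ?x k * of_bool (k < k1 + l))"
      by (rule sums_le[OF _ sums_minus[OF s] b]) (use le' abs_ge_minus_self order_trans in blast)
  qed
  also have "(\<Sum>k. pois ?x k * of_bool (k < k1 + l)) \<le> ?x / N\<^sup>2"
  proof (rule pois_Chebyshev[OF Nt])
    fix k assume "\<bar>real k - ?x\<bar> < N"
    then have "real (k1 + l) < real k" using l by linarith
    then show "of_bool (k < k1 + l) \<le> (0::real)" by simp
  qed (use N_ge_1 in auto)
  also have "?x / N\<^sup>2 = t1 / N" using N_ge_1 by (simp add: power2_eq_square)
  finally show ?thesis using \<delta> by simp
qed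

end

section \<open>The lower bound\<close>

context gibbs
begin

text \<open>By Cauchy-Schwarz the squared norms of \<open>(P ^^ j) f\<close> form a log-convex
  sequence, so the first ratio bounds all later ones from below; no spectral decomposition is
  involved. For odd \<open>k\<close>, \<open>P\<close> is an average of projections, hence the
  correlation of u with \<open>P\<close> u is at least the squared norm of \<open>P\<close> u. The
  exponent \<open>Suc k\<close> covers both parities.\<close>

lemma Pk_correlation_ge:
  fixes q :: real
  assumes q: "0 < q" "q \<le> 1" and var: "0 < EE (\<lambda>\<eta>. (f \<eta>)\<^sup>2)"
    and first: "q * EE (\<lambda>\<eta>. (f \<eta>)\<^sup>2) \<le> EE (\<lambda>\<eta>. f \<eta> * P f \<eta>)"
  shows "q ^ Suc k * EE (\<lambda>\<eta>. (f \<eta>)\<^sup>2) \<le> EE (\<lambda>\<eta>. f \<eta> * (P ^^ k) f \<eta>)"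
proof -
  define u where "u j = (P ^^ j) f" for j
  define s where "s j = EE (\<lambda>\<eta>. (u j \<eta>)\<^sup>2)" for j
  have uu: "EE (\<lambda>\<eta>. u i \<eta> * u j \<eta>) = EE (\<lambda>\<eta>. f \<eta> * (P ^^ (i + j)) f \<eta>)" for i j
    using Pk_self_adjoint[of f i "u j"] by (simp add: u_def funpow_add mult.commute)
  have s_eq: "s j = EE (\<lambda>\<eta>. f \<eta> * (P ^^ (j + j)) f \<eta>)" for j
    using uu[of j j] by (simp add: s_def power2_eq_square)
  have convex: "(s (Suc j))\<^sup>2 \<le> s j * s (Suc (Suc j))" for j
  proof -
    have "s (Suc j) = EE (\<lambda>\<eta>. u j \<eta> * u (Suc (Suc j)) \<eta>)"
      unfolding s_eq uu by simp
    then show ?thesis using mean_Cauchy_Schwarz[OF mean_EE, of "u j" "u (Suc (Suc j))"] by (simp add: s_def)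
  qed
  have s0: "0 < s 0" using var by (simp add: s_def u_def)
  have first': "q * s 0 \<le> EE (\<lambda>\<eta>. u 0 \<eta> * u 1 \<eta>)" using first by (simp add: s_def u_def)
  have step: "q\<^sup>2 * s j \<le> s (Suc j) \<and> 0 < s j" for j
  proof (induction j)
    case 0
    have "(q * s 0)\<^sup>2 \<le> (EE (\<lambda>\<eta>. u 0 \<eta> * u 1 \<eta>))\<^sup>2" using first' q s0 by (intro power_mono) auto
    also have "\<dots> \<le> s 0 * s 1" unfolding s_def by (rule mean_Cauchy_Schwarz[OF mean_EE])
    finally have "s 0 * (q\<^sup>2 * s 0) \<le> s 0 * s 1" by (simp add: power2_eq_square mult_ac)
    then show ?case using s0 by (simp add: mult_le_cancel_left)
  next
    case (Suc j)
    have pos: "0 < s (Suc j)" using Suc q by (meson less_le_trans mult_pos_pos zero_less_power)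
    have "s j * (q\<^sup>2 * s (Suc j)) \<le> s (Suc j) * s (Suc j)"
      using Suc pos by (simp add: mult.assoc[symmetric] mult.commute[of "s j"])
    also have "\<dots> \<le> s j * s (Suc (Suc j))" using convex[of j] by (simp add: power2_eq_square)
    finally show ?case using Suc pos by (simp add: mult_le_cancel_left)
  qed
  have even: "q ^ (j + j) * s 0 \<le> s j" for j
  proof (induction j)
    case (Suc j)
    have "q ^ (Suc j + Suc j) * s 0 = q\<^sup>2 * (q ^ (j + j) * s 0)" by (simp add: power2_eq_square)
    also have "\<dots> \<le> q\<^sup>2 * s j" using Suc by (intro mult_left_mono) auto
    also have "\<dots> \<le> s (Suc j)" using step[of j] by simp
    finally show ?case .
  qed simp
  have s0_eq: "EE (\<lambda>\<eta>. (f \<eta>)\<^sup>2) = s 0" by (simp add: s_def u_def)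
  show ?thesis
  proof (cases "even k")
    case True
    then obtain j where k: "k = j + j" by (auto simp: mult_2 elim!: evenE)
    have "q ^ Suc k * s 0 \<le> q ^ k * s 0" using q s0 by (intro mult_right_mono power_decreasing) auto
    also have "\<dots> \<le> s j" unfolding k by (rule even)
    also have "\<dots> = EE (\<lambda>\<eta>. f \<eta> * (P ^^ k) f \<eta>)" unfolding k by (rule s_eq)
    finally show ?thesis unfolding s0_eq .
  next
    case False
    then obtain j where k: "k = Suc (j + j)" by (auto simp: mult_2 elim!: oddE)
    have "q ^ Suc k * s 0 = q ^ (Suc j + Suc j) * s 0" by (simp add: k)
    also have "\<dots> \<le> s (Suc j)" by (rule even)
    also have "s (Suc j) = EE (\<lambda>\<eta>. (P (u j) \<eta>)\<^sup>2)" by (simp add: s_def u_def)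
    also have "\<dots> \<le> EE (\<lambda>\<eta>. (\<Sum>x\<in>\<Lambda>. (avg {x} (u j) \<eta>)\<^sup>2) / N)"
      unfolding P_def N_def
      by (rule mean_mono[OF mean_EE])
        (rule mean_power2_le[OF mean_on_uniform[OF finite_sites sites_nonempty]])
    also have "\<dots> = (\<Sum>x\<in>\<Lambda>. EE (\<lambda>\<eta>. (avg {x} (u j) \<eta>)\<^sup>2)) / N"
      by (simp only: mean_divide[OF mean_EE] mean_sum[OF mean_EE])
    also have "\<dots> = (\<Sum>x\<in>\<Lambda>. EE (\<lambda>\<eta>. u j \<eta> * avg {x} (u j) \<eta>)) / N"
    proof -
      have "EE (\<lambda>\<eta>. (avg {x} (u j) \<eta>)\<^sup>2) = EE (\<lambda>\<eta>. u j \<eta> * avg {x} (u j) \<eta>)" if "x \<in> \<Lambda>" for x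
      proof -
        have "EE (\<lambda>\<eta>. u j \<eta> * avg {x} (avg {x} (u j)) \<eta>) = EE (\<lambda>\<eta>. avg {x} (u j) \<eta> * avg {x} (u j) \<eta>)"
          using that by (intro EE_self_adjoint) simp
        moreover have "EE (\<lambda>\<eta>. u j \<eta> * avg {x} (avg {x} (u j)) \<eta>) = EE (\<lambda>\<eta>. u j \<eta> * avg {x} (u j) \<eta>)"
          by (rule mean_cong[OF mean_EE]) (simp add: avg_tower)
        ultimately show ?thesis by (simp add: power2_eq_square)
      qed
      then show ?thesis by simp
    qed
    also have "\<dots> = EE (\<lambda>\<eta>. (\<Sum>x\<in>\<Lambda>. u j \<eta> * avg {x} (u j) \<eta>) / N)"
      by (simp only: mean_divide[OF mean_EE] mean_sum[OF mean_EE])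
    also have "\<dots> = EE (\<lambda>\<eta>. u j \<eta> * u (Suc j) \<eta>)"
      by (simp add: u_def P_def sum_distrib_left)
    also have "\<dots> = EE (\<lambda>\<eta>. f \<eta> * (P ^^ k) f \<eta>)" unfolding uu k by simp
    finally show ?thesis unfolding s0_eq .
  qed
qed

lemma pt_correlation_ge:
  fixes q :: real
  assumes q: "0 < q" "q \<le> 1" and var: "0 < EE (\<lambda>\<eta>. (f \<eta>)\<^sup>2)" and t: "0 \<le> t"
    and first: "q * EE (\<lambda>\<eta>. (f \<eta>)\<^sup>2) \<le> EE (\<lambda>\<eta>. f \<eta> * P f \<eta>)"
  shows "q * exp (- (1 - q) * (N * t)) * EE (\<lambda>\<eta>. (f \<eta>)\<^sup>2) \<le> EE (\<lambda>\<eta>. f \<eta> * pt t f \<eta>)"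
proof -
  have Nt: "0 \<le> N * t" using t N_ge_1 by simp
  let ?s = "EE (\<lambda>\<eta>. (f \<eta>)\<^sup>2)"
  let ?W = "\<Sum>\<eta>\<in>\<Omega>. w \<eta>"
  have "(\<lambda>k. (\<Sum>\<eta>\<in>\<Omega>. w \<eta> * (f \<eta> * (pois (N * t) k * (P ^^ k) f \<eta>))) / ?W)
      sums ((\<Sum>\<eta>\<in>\<Omega>. w \<eta> * (f \<eta> * pt t f \<eta>)) / ?W)"
    unfolding pt_def by (intro sums_divide sums_sum sums_mult summable_sums pt_summable t)
  then have "(\<lambda>k. EE (\<lambda>\<eta>. f \<eta> * (pois (N * t) k * (P ^^ k) f \<eta>))) sums EE (\<lambda>\<eta>. f \<eta> * pt t f \<eta>)"
    by (simp add: EE_def)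
  also have "(\<lambda>k. EE (\<lambda>\<eta>. f \<eta> * (pois (N * t) k * (P ^^ k) f \<eta>)))
      = (\<lambda>k. pois (N * t) k * EE (\<lambda>\<eta>. f \<eta> * (P ^^ k) f \<eta>))"
    by (simp add: mean_cmult[OF mean_EE, symmetric] mult_ac)
  finally have S: "(\<lambda>k. pois (N * t) k * EE (\<lambda>\<eta>. f \<eta> * (P ^^ k) f \<eta>)) sums EE (\<lambda>\<eta>. f \<eta> * pt t f \<eta>)" .
  have T: "(\<lambda>k. q * (pois (N * t) k * q ^ k) * ?s) sums (q * exp (- (1 - q) * (N * t)) * ?s)"
    by (intro sums_mult sums_mult2 pois_sums_power)
  show ?thesis
  proof (rule sums_le[OF _ T S])
    fix k
    show "q * (pois (N * t) k * q ^ k) * ?s \<le> pois (N * t) k * EE (\<lambda>\<eta>. f \<eta> * (P ^^ k) f \<eta>)"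
      using mult_left_mono[OF Pk_correlation_ge[OF q var first] pois_nonneg[OF Nt], of k k]
      by (simp add: mult_ac)
  qed
qed

end

context dobrushin
begin

text \<open>By the law of total variance the step with i steps to go contributes at most \<kappa> ^
  i, and the geometric series is at most \<open>N / (1 - \<alpha>)\<close>: linear in the volume
  although \<open>g\<close> may vary by as much as \<open>N\<close>.\<close>

lemma lip_variance_le:
  assumes g: "lip g (\<lambda>_. 1)" and "\<sigma> \<in> \<Omega>"
  shows "(P ^^ k) (\<lambda>\<eta>. (g \<eta>)\<^sup>2) \<sigma> - ((P ^^ k) g \<sigma>)\<^sup>2 \<le> N / (1 - \<alpha>)"
proof -
  have "(P ^^ k) (\<lambda>\<eta>. (g \<eta>)\<^sup>2) \<sigma> - ((P ^^ k) g \<sigma>)\<^sup>2 \<le> (\<Sum>i<k. \<kappa> ^ i)"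
    using assms(2)
  proof (induction k arbitrary: \<sigma>)
    case (Suc k)
    note \<sigma> = Suc.prems
    let ?h = "(P ^^ k) g"
    have L: "lip ?h (\<lambda>_. \<kappa> ^ k)" using lip_Pk_uniform[OF g] by simp
    have "P (\<lambda>\<eta>. (?h \<eta>)\<^sup>2) \<sigma> - (P ?h \<sigma>)\<^sup>2 \<le> (\<Sum>x\<in>\<Lambda>. avg {x} (\<lambda>\<eta>. (?h \<eta> - ?h \<sigma>)\<^sup>2) \<sigma>) / N"
      by (rule P_variance_le[OF \<sigma>])
    also have "\<dots> \<le> (\<Sum>x\<in>\<Lambda>. \<kappa> ^ k) / N"
    proof (intro divide_right_mono sum_mono)
      fix x assume x: "x \<in> \<Lambda>"
      show "avg {x} (\<lambda>\<eta>. (?h \<eta> - ?h \<sigma>)\<^sup>2) \<sigma> \<le> \<kappa> ^ k"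
      proof (rule mean_le[OF mean_avg[OF \<sigma>]])
        fix \<eta> assume "\<eta> \<in> fiber {x} \<sigma>"
        then have "\<bar>?h \<eta> - ?h \<sigma>\<bar> \<le> \<kappa> ^ k" by (rule lip_single[OF L x \<sigma>])
        then have "(?h \<eta> - ?h \<sigma>)\<^sup>2 \<le> (\<kappa> ^ k)\<^sup>2" using power_mono[of "\<bar>?h \<eta> - ?h \<sigma>\<bar>" "\<kappa> ^ k" 2] by simp
        also have "\<dots> \<le> \<kappa> ^ k" using \<kappa> by (simp add: power2_eq_square mult_left_le power_le_one)
        finally show "(?h \<eta> - ?h \<sigma>)\<^sup>2 \<le> \<kappa> ^ k" .
      qed
    qed (use N_ge_1 in auto)
    also have "\<dots> = \<kappa> ^ k" using N_ge_1 by (simp add: N_def)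
    finally have step: "P (\<lambda>\<eta>. (?h \<eta>)\<^sup>2) \<sigma> - (P ?h \<sigma>)\<^sup>2 \<le> \<kappa> ^ k" .
    have "P (\<lambda>\<eta>. (P ^^ k) (\<lambda>\<eta>. (g \<eta>)\<^sup>2) \<eta> - (?h \<eta>)\<^sup>2) \<sigma> \<le> (\<Sum>i<k. \<kappa> ^ i)"
      by (rule mean_le[OF mean_P[OF \<sigma>]]) (rule Suc.IH)
    then show ?case unfolding Pk_variance_Suc[OF \<sigma>] using step by simp
  qed simp
  also have "\<dots> \<le> N / (1 - \<alpha>)"
  proof -
    have "(\<Sum>i<k. \<kappa> ^ i) = (1 - \<kappa> ^ k) / (1 - \<kappa>)" using \<kappa> by (simp add: sum_gp_strict)
    also have "\<dots> \<le> 1 / (1 - \<kappa>)" using \<kappa> by (intro divide_right_mono) auto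
    also have "\<dots> = N / (1 - \<alpha>)" using N_ge_1 \<alpha>_less by (simp add: \<kappa>_def)
    finally show ?thesis .
  qed
  finally show ?thesis .
qed

text \<open>As \<open>k\<close> grows, \<open>(P ^^ k) g\<close> tends to the stationary mean 0 at
  every configuration, so the variance bound for the chain passes to the Gibbs measure.\<close>

lemma EE_variance_le:
  assumes g: "lip g (\<lambda>_. 1)" and "EE g = 0"
  shows "EE (\<lambda>\<eta>. (g \<eta>)\<^sup>2) \<le> N / (1 - \<alpha>)"
proof -
  have "EE (\<lambda>\<eta>. (g \<eta>)\<^sup>2) \<le> N / (1 - \<alpha>) + (N * \<kappa> ^ k)\<^sup>2" for k
  proof -
    have "EE (\<lambda>\<eta>. (g \<eta>)\<^sup>2) = EE ((P ^^ k) (\<lambda>\<eta>. (g \<eta>)\<^sup>2))" by (simp add: EE_Pk)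
    also have "\<dots> \<le> N / (1 - \<alpha>) + (N * \<kappa> ^ k)\<^sup>2"
    proof (rule mean_le[OF mean_EE])
      fix \<sigma> assume \<sigma>: "\<sigma> \<in> \<Omega>"
      have "\<bar>(P ^^ k) g \<sigma>\<bar> \<le> N * \<kappa> ^ k" using Pk_EE_diff[OF g \<sigma>, of k] assms(2) by simp
      then have "((P ^^ k) g \<sigma>)\<^sup>2 \<le> (N * \<kappa> ^ k)\<^sup>2" using power_mono[of "\<bar>(P ^^ k) g \<sigma>\<bar>" "N * \<kappa> ^ k" 2] by simp
      then show "(P ^^ k) (\<lambda>\<eta>. (g \<eta>)\<^sup>2) \<sigma> \<le> N / (1 - \<alpha>) + (N * \<kappa> ^ k)\<^sup>2"
        using lip_variance_le[OF g \<sigma>, of k] by linarith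
    qed
    finally show ?thesis .
  qed
  moreover have "(\<lambda>k. N / (1 - \<alpha>) + (N * \<kappa> ^ k)\<^sup>2) \<longlonglongrightarrow> N / (1 - \<alpha>) + (N * 0)\<^sup>2"
    using \<kappa> by (intro tendsto_intros LIMSEQ_realpow_zero) auto
  ultimately show ?thesis using LIMSEQ_le_const by fastforce
qed

text \<open>The random number of steps adds to the variance. Since
  \<open>(P ^^ k) g \<sigma>\<close> moves by at most 1 per step, centring at its value for the
  integer part \<open>k0\<close> of \<open>N * t\<close> costs at most twice the Poisson variance
  plus 2.\<close>

lemma pt_variance_le:
  assumes g: "lip g (\<lambda>_. 1)" and \<sigma>: "\<sigma> \<in> \<Omega>" and t: "0 \<le> t"
  shows "pt t (\<lambda>\<eta>. (g \<eta> - pt t g \<sigma>)\<^sup>2) \<sigma> \<le> N / (1 - \<alpha>) + 2 * (N * t) + 2"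
proof -
  let ?x = "N * t"
  have Nt: "0 \<le> ?x" using t N_ge_1 by simp
  define k0 where "k0 = nat \<lfloor>?x\<rfloor>"
  have k0: "\<bar>real k0 - ?x\<bar> \<le> 1" unfolding k0_def using Nt by (simp add: of_nat_nat) linarith
  define c where "c = (P ^^ k0) g \<sigma>"
  have one: "\<bar>(P ^^ Suc k) g \<sigma> - (P ^^ k) g \<sigma>\<bar> \<le> 1" for k
  proof -
    let ?h = "(P ^^ k) g"
    have "lip ?h (\<lambda>_. \<kappa> ^ k)" using lip_Pk_uniform[OF g] by simp
    then have L: "lip ?h (\<lambda>_. 1)" by (rule lip_mono) (use \<kappa> in \<open>simp add: power_le_one\<close>)
    have d: "\<bar>avg {x} ?h \<sigma> - ?h \<sigma>\<bar> \<le> 1" if x: "x \<in> \<Lambda>" for x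
    proof -
      have b: "\<bar>?h \<eta> - ?h \<sigma>\<bar> \<le> 1" if "\<eta> \<in> fiber {x} \<sigma>" for \<eta> using lip_single[OF L x \<sigma> that] .
      have "avg {x} ?h \<sigma> \<le> ?h \<sigma> + 1" by (rule mean_le[OF mean_avg[OF \<sigma>]]) (use b in \<open>force simp: abs_le_iff\<close>)
      moreover have "?h \<sigma> - 1 \<le> avg {x} ?h \<sigma>"
        by (rule mean_ge[OF mean_avg[OF \<sigma>]]) (use b in \<open>force simp: abs_le_iff\<close>)
      ultimately show ?thesis by linarith
    qed
    have "P ?h \<sigma> - ?h \<sigma> = (\<Sum>x\<in>\<Lambda>. avg {x} ?h \<sigma> - ?h \<sigma>) / N"
      using N_ge_1 by (simp add: P_def sum_subtractf N_def diff_divide_distrib)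
    also have "\<bar>\<dots>\<bar> \<le> (\<Sum>x\<in>\<Lambda>. 1) / N"
      unfolding abs_divide using N_ge_1 sum_mono[of \<Lambda>, OF d]
      by (intro frac_le order_trans[OF sum_abs]) auto
    finally show ?thesis using N_ge_1 by (simp add: N_def)
  qed
  have lipk: "\<bar>(P ^^ (i + j)) g \<sigma> - (P ^^ i) g \<sigma>\<bar> \<le> real j" for i j
  proof (induction j)
    case (Suc j)
    then show ?case using one[of "i + j"] by simp
  qed simp
  have kk: "\<bar>(P ^^ k) g \<sigma> - c\<bar> \<le> \<bar>real k - real k0\<bar>" for k
  proof (cases "k0 \<le> k")
    case True
    then show ?thesis using lipk[of k0 "k - k0"] by (simp add: c_def of_nat_diff)
  next
    case False
    then show ?thesis using lipk[of k "k0 - k"] by (simp add: c_def of_nat_diff abs_minus_commute)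
  qed
  have le: "pois ?x k * (P ^^ k) (\<lambda>\<eta>. (g \<eta> - c)\<^sup>2) \<sigma>
      \<le> pois ?x k * (N / (1 - \<alpha>)) + 2 * (pois ?x k * (real k - ?x)\<^sup>2) + 2 * pois ?x k" for k
  proof -
    note M = mean_Pk[OF \<sigma>, of k]
    have "(P ^^ k) (\<lambda>\<eta>. (g \<eta> - c)\<^sup>2) \<sigma> = (P ^^ k) (\<lambda>\<eta>. (g \<eta>)\<^sup>2 - 2 * c * g \<eta> + c\<^sup>2) \<sigma>"
      by (rule mean_cong[OF M]) (simp add: power2_eq_square algebra_simps)
    also have "\<dots> = (P ^^ k) (\<lambda>\<eta>. (g \<eta>)\<^sup>2) \<sigma> - 2 * c * (P ^^ k) g \<sigma> + c\<^sup>2"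
      by (simp only: mean_add[OF M] mean_diff[OF M] mean_cmult[OF M] mean_const[OF M])
    also have "\<dots> = ((P ^^ k) (\<lambda>\<eta>. (g \<eta>)\<^sup>2) \<sigma> - ((P ^^ k) g \<sigma>)\<^sup>2) + ((P ^^ k) g \<sigma> - c)\<^sup>2"
      by (simp add: power2_eq_square algebra_simps)
    also have "\<dots> \<le> N / (1 - \<alpha>) + (real k - real k0)\<^sup>2"
      using lip_variance_le[OF g \<sigma>, of k] power_mono[OF kk[of k], of 2] by (intro add_mono) auto
    also have "(real k - real k0)\<^sup>2 \<le> 2 * (real k - ?x)\<^sup>2 + 2"
    proof -
      have "(real k - real k0)\<^sup>2 + ((real k - ?x) + (real k0 - ?x))\<^sup>2 = 2 * (real k - ?x)\<^sup>2 + 2 * (real k0 - ?x)\<^sup>2"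
        by (simp add: power2_eq_square algebra_simps)
      moreover have "(real k0 - ?x)\<^sup>2 \<le> 1" using power_mono[OF k0, of 2] by simp
      ultimately show ?thesis using zero_le_power2[of "(real k - ?x) + (real k0 - ?x)"] by linarith
    qed
    finally have "(P ^^ k) (\<lambda>\<eta>. (g \<eta> - c)\<^sup>2) \<sigma> \<le> N / (1 - \<alpha>) + (2 * (real k - ?x)\<^sup>2 + 2)" by simp
    from mult_left_mono[OF this pois_nonneg[OF Nt], of k] show ?thesis by (simp add: algebra_simps)
  qed
  have S: "(\<lambda>k. pois ?x k * (P ^^ k) (\<lambda>\<eta>. (g \<eta> - c)\<^sup>2) \<sigma>) sums pt t (\<lambda>\<eta>. (g \<eta> - c)\<^sup>2) \<sigma>"
    unfolding pt_def by (rule summable_sums[OF pt_summable[OF \<sigma> t]])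
  have T: "(\<lambda>k. pois ?x k * (N / (1 - \<alpha>)) + 2 * (pois ?x k * (real k - ?x)\<^sup>2) + 2 * pois ?x k)
      sums (1 * (N / (1 - \<alpha>)) + 2 * ?x + 2 * 1)"
    by (intro sums_add sums_mult sums_mult2 pois_sums pois_variance)
  have "pt t (\<lambda>\<eta>. (g \<eta> - c)\<^sup>2) \<sigma> \<le> N / (1 - \<alpha>) + 2 * ?x + 2"
    using sums_le[OF le S T] by simp
  moreover have "pt t (\<lambda>\<eta>. (g \<eta> - pt t g \<sigma>)\<^sup>2) \<sigma> \<le> pt t (\<lambda>\<eta>. (g \<eta> - c)\<^sup>2) \<sigma>"
  proof -
    note M = mean_pt[OF \<sigma> t]
    let ?m = "pt t g \<sigma>"
    have ex: "pt t (\<lambda>\<eta>. (g \<eta> - a)\<^sup>2) \<sigma> = pt t (\<lambda>\<eta>. (g \<eta>)\<^sup>2) \<sigma> - 2 * a * ?m + a\<^sup>2" for a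
    proof -
      have "pt t (\<lambda>\<eta>. (g \<eta> - a)\<^sup>2) \<sigma> = pt t (\<lambda>\<eta>. (g \<eta>)\<^sup>2 - 2 * a * g \<eta> + a\<^sup>2) \<sigma>"
        by (rule mean_cong[OF M]) (simp add: power2_eq_square algebra_simps)
      then show ?thesis by (simp only: mean_add[OF M] mean_diff[OF M] mean_cmult[OF M] mean_const[OF M])
    qed
    have "0 \<le> (?m - c)\<^sup>2" by simp
    then show ?thesis unfolding ex by (simp add: power2_eq_square algebra_simps)
  qed
  ultimately show ?thesis by linarith
qed

text \<open>The test observable sums, over the sites, the correlation of the current spin with the start;
  the start is chosen so that this correlation is at least its stationary average, which decays like
  \<open>exp (- t)\<close>.\<close>

theorem exists_separating_event:
  assumes two: "2 \<le> card Q" and N2: "2 \<le> N" and t: "0 \<le> t"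
  shows "\<exists>\<sigma>\<in>\<Omega>. \<exists>A. 1 - 4 * (2 * (N / (1 - \<alpha>)) + 2 * (N * t) + 2) / (N * p\<^sup>2 * exp (- t) / 2)\<^sup>2
    \<le> pt t (\<lambda>\<eta>. of_bool (\<eta> \<in> A)) \<sigma> - EE (\<lambda>\<eta>. of_bool (\<eta> \<in> A))"
proof -
  obtain c c' where c: "c \<in> Q" "c' \<in> Q" "c \<noteq> c'"
  proof -
    have "\<not> (\<forall>a\<in>Q. \<forall>b\<in>Q. a = b)" using two card_le_Suc0_iff_eq[OF finite_spins] by simp
    then show ?thesis using that by blast
  qed
  define \<theta> where "\<theta> x = EE (\<lambda>\<eta>. of_bool (\<eta> x = c))" for x
  define \<phi> where "\<phi> x \<eta> = of_bool (\<eta> x = c) - \<theta> x" for x and \<eta> :: "'a \<Rightarrow> 'b"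
  define q where "q = 1 - 1 / N"
  have q: "0 < q" "q \<le> 1" "1 / 2 \<le> q" using N2 by (auto simp: q_def field_simps)
  obtain \<sigma>0 where \<sigma>0: "\<sigma>0 \<in> \<Omega>" using \<Omega>_nonempty by blast
  have EE_\<phi>: "EE (\<phi> x) = 0" for x
    unfolding \<phi>_def by (simp add: mean_diff[OF mean_EE] mean_const[OF mean_EE] \<theta>_def)
  \<comment> \<open>The second color \<open>c'\<close> also has probability at least
    \<open>p\<close>, so \<open>\<theta> x\<close> stays away from 0 and 1 and the Bernoulli
    variance is at least \<open>p\<^sup>2\<close>.\<close>
  have \<phi>_var: "p\<^sup>2 \<le> EE (\<lambda>\<eta>. (\<phi> x \<eta>)\<^sup>2)" if x: "x \<in> \<Lambda>" for x
  proof -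
    have th: "p \<le> \<theta> x" "p \<le> EE (\<lambda>\<eta>. of_bool (\<eta> x = c'))"
      using avg_spin_ge[OF x subset_refl \<sigma>0] c by (simp_all add: EE_eq[OF \<sigma>0] \<theta>_def)
    have "\<theta> x + EE (\<lambda>\<eta>. of_bool (\<eta> x = c')) = EE (\<lambda>\<eta>. of_bool (\<eta> x = c) + of_bool (\<eta> x = c'))"
      by (simp add: mean_add[OF mean_EE] \<theta>_def)
    also have "\<dots> \<le> 1" by (rule mean_le[OF mean_EE]) (use c in auto)
    finally have th1: "p \<le> 1 - \<theta> x" using th by linarith
    have "EE (\<lambda>\<eta>. (\<phi> x \<eta>)\<^sup>2) = EE (\<lambda>\<eta>. (1 - 2 * \<theta> x) * of_bool (\<eta> x = c) + (\<theta> x)\<^sup>2)"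
      by (rule mean_cong[OF mean_EE]) (auto simp: \<phi>_def power2_eq_square algebra_simps)
    also have "\<dots> = (1 - 2 * \<theta> x) * \<theta> x + (\<theta> x)\<^sup>2"
      by (simp add: mean_add[OF mean_EE] mean_cmult[OF mean_EE] mean_const[OF mean_EE] \<theta>_def)
    also have "\<dots> = \<theta> x * (1 - \<theta> x)" by (simp add: power2_eq_square algebra_simps)
    also have "p * p \<le> \<dots>" using th th1 p_pos by (intro mult_mono) auto
    finally show ?thesis by (simp add: power2_eq_square)
  qed
  have \<phi>_abs: "\<bar>\<phi> x \<eta>\<bar> \<le> 1" for x \<eta>
  proof -
    have "0 \<le> \<theta> x" "\<theta> x \<le> 1" unfolding \<theta>_def by (rule mean_nonneg[OF mean_EE] mean_le[OF mean_EE]; simp)+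
    then show ?thesis by (simp add: \<phi>_def)
  qed
  have corr: "p\<^sup>2 * exp (- t) / 2 \<le> EE (\<lambda>\<eta>. \<bar>pt t (\<phi> x) \<eta>\<bar>)" if x: "x \<in> \<Lambda>" for x
  proof -
    let ?s = "EE (\<lambda>\<eta>. (\<phi> x \<eta>)\<^sup>2)"
    have s: "0 < ?s" using \<phi>_var[OF x] p_pos zero_less_power[of p 2] by linarith
    \<comment> \<open>Only an update at \<open>x\<close> changes the spin there, and its
      contribution is nonnegative; hence one step keeps at least the fraction \<open>q\<close> of
      the correlation.\<close>
    have other: "EE (\<lambda>\<eta>. \<phi> x \<eta> * avg {y} (\<phi> x) \<eta>) = ?s" if y: "y \<in> \<Lambda>" "y \<noteq> x" for y
    proof (rule mean_cong[OF mean_EE])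
      fix \<eta> assume \<eta>: "\<eta> \<in> \<Omega>"
      have "avg {y} (\<phi> x) \<eta> = avg {y} (\<lambda>_. \<phi> x \<eta>) \<eta>"
        by (rule mean_cong[OF mean_avg[OF \<eta>]]) (use y in \<open>auto simp: \<phi>_def fiber_def\<close>)
      also have "\<dots> = \<phi> x \<eta>" by (rule mean_const[OF mean_avg[OF \<eta>]])
      finally show "\<phi> x \<eta> * avg {y} (\<phi> x) \<eta> = (\<phi> x \<eta>)\<^sup>2" by (simp add: power2_eq_square)
    qed
    have self: "0 \<le> EE (\<lambda>\<eta>. \<phi> x \<eta> * avg {x} (\<phi> x) \<eta>)"
    proof -
      have "EE (\<lambda>\<eta>. \<phi> x \<eta> * avg {x} (avg {x} (\<phi> x)) \<eta>) = EE (\<lambda>\<eta>. avg {x} (\<phi> x) \<eta> * avg {x} (\<phi> x) \<eta>)"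
        using x by (intro EE_self_adjoint) simp
      moreover have "EE (\<lambda>\<eta>. \<phi> x \<eta> * avg {x} (avg {x} (\<phi> x)) \<eta>) = EE (\<lambda>\<eta>. \<phi> x \<eta> * avg {x} (\<phi> x) \<eta>)"
        by (rule mean_cong[OF mean_EE]) (simp add: avg_tower)
      moreover have "0 \<le> EE (\<lambda>\<eta>. avg {x} (\<phi> x) \<eta> * avg {x} (\<phi> x) \<eta>)" by (rule mean_nonneg[OF mean_EE]) simp
      ultimately show ?thesis by simp
    qed
    have "EE (\<lambda>\<eta>. \<phi> x \<eta> * P (\<phi> x) \<eta>) = (\<Sum>y\<in>\<Lambda>. EE (\<lambda>\<eta>. \<phi> x \<eta> * avg {y} (\<phi> x) \<eta>)) / N"
      unfolding mean_sum[OF mean_EE, symmetric] mean_divide[OF mean_EE, symmetric]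
      by (simp add: P_def sum_distrib_left)
    also have "(\<Sum>y\<in>\<Lambda>. EE (\<lambda>\<eta>. \<phi> x \<eta> * avg {y} (\<phi> x) \<eta>))
        = EE (\<lambda>\<eta>. \<phi> x \<eta> * avg {x} (\<phi> x) \<eta>) + (N - 1) * ?s"
    proof -
      have "(\<Sum>y\<in>\<Lambda>-{x}. EE (\<lambda>\<eta>. \<phi> x \<eta> * avg {y} (\<phi> x) \<eta>)) = (\<Sum>y\<in>\<Lambda>-{x}. ?s)"
        by (rule sum.cong) (use other in auto)
      also have "\<dots> = (N - 1) * ?s" using x finite_sites N_ge_1 by (simp add: N_def card_Diff_singleton of_nat_diff)
      finally show ?thesis using x finite_sites by (simp add: sum.remove[of \<Lambda> x])
    qed
    finally have "q * ?s \<le> EE (\<lambda>\<eta>. \<phi> x \<eta> * P (\<phi> x) \<eta>)"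
      using self N_ge_1 by (simp add: q_def field_simps)
    then have "q * exp (- (1 - q) * (N * t)) * ?s \<le> EE (\<lambda>\<eta>. \<phi> x \<eta> * pt t (\<phi> x) \<eta>)"
      by (rule pt_correlation_ge[OF q(1,2) s t])
    also have "- (1 - q) * (N * t) = - t" using N_ge_1 by (simp add: q_def)
    also have "EE (\<lambda>\<eta>. \<phi> x \<eta> * pt t (\<phi> x) \<eta>) \<le> EE (\<lambda>\<eta>. \<bar>pt t (\<phi> x) \<eta>\<bar>)"
    proof (rule mean_mono[OF mean_EE])
      fix \<eta>
      have "\<phi> x \<eta> * pt t (\<phi> x) \<eta> \<le> \<bar>\<phi> x \<eta>\<bar> * \<bar>pt t (\<phi> x) \<eta>\<bar>" by (simp add: abs_mult[symmetric])
      also have "\<dots> \<le> 1 * \<bar>pt t (\<phi> x) \<eta>\<bar>" by (intro mult_right_mono \<phi>_abs) simp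
      finally show "\<phi> x \<eta> * pt t (\<phi> x) \<eta> \<le> \<bar>pt t (\<phi> x) \<eta>\<bar>" by simp
    qed
    finally have "q * exp (- t) * ?s \<le> EE (\<lambda>\<eta>. \<bar>pt t (\<phi> x) \<eta>\<bar>)" .
    moreover have "1 / 2 * exp (- t) * p\<^sup>2 \<le> q * exp (- t) * ?s"
      using q \<phi>_var[OF x] by (intro mult_mono) auto
    moreover have "p\<^sup>2 * exp (- t) / 2 = 1 / 2 * exp (- t) * p\<^sup>2" by simp
    ultimately show ?thesis by linarith
  qed
  define \<Delta>0 where "\<Delta>0 = N * p\<^sup>2 * exp (- t) / 2"
  have \<Delta>0: "0 < \<Delta>0" using N_ge_1 p_pos by (simp add: \<Delta>0_def)
  \<comment> \<open>If the total correlation were below the stationary average for every start, the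
    strict inequality would survive averaging.\<close>
  obtain \<sigma> where \<sigma>: "\<sigma> \<in> \<Omega>" and big: "\<Delta>0 \<le> (\<Sum>x\<in>\<Lambda>. \<bar>pt t (\<phi> x) \<sigma>\<bar>)"
  proof (rule ccontr)
    assume "\<not> thesis"
    then have less: "(\<Sum>x\<in>\<Lambda>. \<bar>pt t (\<phi> x) \<sigma>\<bar>) < \<Delta>0" if "\<sigma> \<in> \<Omega>" for \<sigma>
      using that \<open>\<And>\<sigma>. \<sigma> \<in> \<Omega> \<Longrightarrow> \<Delta>0 \<le> (\<Sum>x\<in>\<Lambda>. \<bar>pt t (\<phi> x) \<sigma>\<bar>) \<Longrightarrow> thesis\<close> by force
    have "0 < EE (\<lambda>\<sigma>. \<Delta>0 - (\<Sum>x\<in>\<Lambda>. \<bar>pt t (\<phi> x) \<sigma>\<bar>))"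
      by (rule mean_pos[OF mean_EE]) (use less in simp)
    then have "(\<Sum>x\<in>\<Lambda>. EE (\<lambda>\<sigma>. \<bar>pt t (\<phi> x) \<sigma>\<bar>)) < \<Delta>0"
      by (simp add: mean_diff[OF mean_EE] mean_const[OF mean_EE] mean_sum[OF mean_EE])
    moreover have "(\<Sum>x\<in>\<Lambda>. p\<^sup>2 * exp (- t) / 2) \<le> (\<Sum>x\<in>\<Lambda>. EE (\<lambda>\<sigma>. \<bar>pt t (\<phi> x) \<sigma>\<bar>))"
      by (rule sum_mono) (rule corr)
    ultimately show False by (simp add: \<Delta>0_def N_def)
  qed
  \<comment> \<open>The signs align each summand with its drift from \<open>\<sigma>\<close>: the
    mean of \<open>g\<close> under the chain is the sum of absolute values, while a single spin
    still changes \<open>g\<close> by at most 1.\<close>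
  define g where "g \<eta> = (\<Sum>x\<in>\<Lambda>. sgn (pt t (\<phi> x) \<sigma>) * \<phi> x \<eta>)" for \<eta>
  define \<Delta> where "\<Delta> = pt t g \<sigma>"
  have \<Delta>: "\<Delta> = (\<Sum>x\<in>\<Lambda>. \<bar>pt t (\<phi> x) \<sigma>\<bar>)"
    unfolding \<Delta>_def g_def
    by (simp only: mean_sum[OF mean_pt[OF \<sigma> t]] mean_cmult[OF mean_pt[OF \<sigma> t]])
      (simp add: abs_sgn mult.commute)
  have \<Delta>_pos: "0 < \<Delta>" "\<Delta>0 \<le> \<Delta>" using big \<Delta>0 by (auto simp: \<Delta>)
  have g0: "EE g = 0" unfolding g_def by (simp only: mean_sum[OF mean_EE] mean_cmult[OF mean_EE] EE_\<phi>) simp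
  have lip_g: "lip g (\<lambda>_. 1)" unfolding lip_def
  proof (intro ballI)
    fix y \<zeta> d assume y: "y \<in> \<Lambda>"
    let ?a = "sgn (pt t (\<phi> y) \<sigma>)"
    have "g (\<zeta>(y := d)) - g \<zeta> = (\<Sum>x\<in>\<Lambda>. sgn (pt t (\<phi> x) \<sigma>) * (\<phi> x (\<zeta>(y := d)) - \<phi> x \<zeta>))"
      by (simp add: g_def sum_subtractf right_diff_distrib)
    also have "\<dots> = (\<Sum>x\<in>\<Lambda>. if x = y then ?a * (\<phi> y (\<zeta>(y := d)) - \<phi> y \<zeta>) else 0)"
      by (rule sum.cong) (auto simp: \<phi>_def)
    also have "\<dots> = ?a * (\<phi> y (\<zeta>(y := d)) - \<phi> y \<zeta>)" using y finite_sites by simp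
    finally show "\<bar>g (\<zeta>(y := d)) - g \<zeta>\<bar> \<le> 1" by (auto simp: \<phi>_def abs_mult abs_sgn_eq)
  qed
  \<comment> \<open>The threshold lies halfway between the stationary mean 0 and the mean
    \<open>\<Delta>\<close> under the chain; Chebyshev's inequality is used under both laws.\<close>
  let ?A = "{\<eta>. \<Delta> / 2 \<le> g \<eta>}"
  have A1: "EE (\<lambda>\<eta>. of_bool (\<eta> \<in> ?A)) \<le> 4 / \<Delta>\<^sup>2 * (N / (1 - \<alpha>))"
  proof -
    have "EE (\<lambda>\<eta>. of_bool (\<eta> \<in> ?A)) \<le> EE (\<lambda>\<eta>. 4 / \<Delta>\<^sup>2 * (g \<eta>)\<^sup>2)"
    proof (rule mean_mono[OF mean_EE])
      fix \<eta>
      have "(\<Delta> / 2)\<^sup>2 \<le> (g \<eta>)\<^sup>2" if "\<Delta> / 2 \<le> g \<eta>" using that \<Delta>_pos by (intro power_mono) auto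
      then show "of_bool (\<eta> \<in> ?A) \<le> 4 / \<Delta>\<^sup>2 * (g \<eta>)\<^sup>2" using \<Delta>_pos by (simp add: field_simps)
    qed
    also have "\<dots> = 4 / \<Delta>\<^sup>2 * EE (\<lambda>\<eta>. (g \<eta>)\<^sup>2)" by (rule mean_cmult[OF mean_EE])
    also have "\<dots> \<le> 4 / \<Delta>\<^sup>2 * (N / (1 - \<alpha>))" by (intro mult_left_mono EE_variance_le lip_g g0) simp
    finally show ?thesis .
  qed
  have A2: "1 - pt t (\<lambda>\<eta>. of_bool (\<eta> \<in> ?A)) \<sigma> \<le> 4 / \<Delta>\<^sup>2 * (N / (1 - \<alpha>) + 2 * (N * t) + 2)"
  proof -
    note M = mean_pt[OF \<sigma> t]
    have "1 - pt t (\<lambda>\<eta>. of_bool (\<eta> \<in> ?A)) \<sigma> = pt t (\<lambda>\<eta>. 1 - of_bool (\<eta> \<in> ?A)) \<sigma>"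
      by (simp only: mean_diff[OF M] mean_const[OF M])
    also have "\<dots> \<le> pt t (\<lambda>\<eta>. 4 / \<Delta>\<^sup>2 * (g \<eta> - pt t g \<sigma>)\<^sup>2) \<sigma>"
    proof (rule mean_mono[OF M])
      fix \<eta>
      have "(\<Delta> / 2)\<^sup>2 \<le> (g \<eta> - \<Delta>)\<^sup>2" if "\<not> \<Delta> / 2 \<le> g \<eta>"
      proof -
        have "(\<Delta> / 2)\<^sup>2 \<le> (\<Delta> - g \<eta>)\<^sup>2" using that \<Delta>_pos by (intro power_mono) auto
        then show ?thesis by (simp add: power2_commute)
      qed
      then show "1 - of_bool (\<eta> \<in> ?A) \<le> 4 / \<Delta>\<^sup>2 * (g \<eta> - pt t g \<sigma>)\<^sup>2"
        using \<Delta>_pos by (simp add: field_simps \<Delta>_def[symmetric])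
    qed
    also have "\<dots> = 4 / \<Delta>\<^sup>2 * pt t (\<lambda>\<eta>. (g \<eta> - pt t g \<sigma>)\<^sup>2) \<sigma>" by (rule mean_cmult[OF M])
    also have "\<dots> \<le> 4 / \<Delta>\<^sup>2 * (N / (1 - \<alpha>) + 2 * (N * t) + 2)"
      by (intro mult_left_mono pt_variance_le lip_g \<sigma> t) simp
    finally show ?thesis .
  qed
  let ?V = "2 * (N / (1 - \<alpha>)) + 2 * (N * t) + 2"
  have V: "0 \<le> ?V" using N_ge_1 \<alpha>_less t by (intro add_nonneg_nonneg) auto
  have "1 - 4 * ?V / \<Delta>0\<^sup>2 \<le> 1 - 4 * ?V / \<Delta>\<^sup>2"
    using V \<Delta>_pos \<Delta>0 by (intro diff_left_mono divide_left_mono power_mono) auto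
  also have "\<dots> \<le> pt t (\<lambda>\<eta>. of_bool (\<eta> \<in> ?A)) \<sigma> - EE (\<lambda>\<eta>. of_bool (\<eta> \<in> ?A))"
  proof -
    have "4 * (2 * a + b + 2) / D = 4 / D * a + 4 / D * (a + b + 2)" for a b D :: real
      by (simp add: add_divide_distrib distrib_left)
    from this[of "N / (1 - \<alpha>)" "2 * (N * t)" "\<Delta>\<^sup>2"] show ?thesis using A1 A2 by linarith
  qed
  finally show ?thesis using \<sigma> unfolding \<Delta>0_def by blast
qed

end

section \<open>The Poisson clocks\<close>

definition exp1 :: "real measure" where
  "exp1 = density lborel (exponential_density 1)"

lemma prob_space_exp1: "prob_space exp1"
  unfolding exp1_def by (rule prob_space_exponential_density) simp

lemma sets_exp1 [measurable_cong]: "sets exp1 = sets borel" and space_exp1: "space exp1 = UNIV"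
  by (simp_all add: exp1_def)

lemma nn_integral_exp1:
  assumes [measurable]: "h \<in> borel_measurable borel"
  shows "(\<integral>\<^sup>+u. h u \<partial>exp1) = (\<integral>\<^sup>+u. ennreal (exp (- u)) * indicator {0..} u * h u \<partial>lborel)"
  unfolding exp1_def
  by (subst nn_integral_density)
    (auto intro!: nn_integral_cong simp: exponential_density_def indicator_def)

text \<open>Lack of memory as an identity of integrals, without dividing by the probability of
  surviving to \<open>s\<close>.\<close>

lemma exp1_memoryless:
  assumes [measurable]: "h \<in> borel_measurable borel" and s: "0 \<le> s"
  shows "(\<integral>\<^sup>+u. h u * indicator {s..} u \<partial>exp1) = ennreal (exp (- s)) * (\<integral>\<^sup>+u. h (s + u) \<partial>exp1)"
proof -
  have "(\<integral>\<^sup>+u. h u * indicator {s..} u \<partial>exp1)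
      = (\<integral>\<^sup>+u. ennreal (exp (- u)) * indicator {0..} u * (h u * indicator {s..} u) \<partial>lborel)"
    by (rule nn_integral_exp1) simp
  also have "\<dots> = (\<integral>\<^sup>+u. ennreal (exp (- (s + 1 * u))) * indicator {0..} (s + 1 * u) * (h (s + 1 * u) * indicator {s..} (s + 1 * u)) \<partial>lborel)"
    by (subst nn_integral_real_affine[where t = s and c = 1]) auto
  also have "\<dots> = (\<integral>\<^sup>+u. ennreal (exp (- s)) * (ennreal (exp (- u)) * indicator {0..} u * h (s + u)) \<partial>lborel)"
    using s by (intro nn_integral_cong)
      (auto simp: indicator_def exp_add ennreal_mult'[symmetric] mult.assoc[symmetric] simp flip: exp_diff, auto simp: exp_diff exp_minus field_simps)
  also have "\<dots> = ennreal (exp (- s)) * (\<integral>\<^sup>+u. h (s + u) \<partial>exp1)"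
    by (subst nn_integral_cmult) (auto simp: nn_integral_exp1)
  finally show ?thesis .
qed

lemma nn_integral_PiM_insert:
  assumes i: "i \<notin> J" and H: "H \<in> borel_measurable (PiM (insert i J) (\<lambda>_. exp1))"
  shows "(\<integral>\<^sup>+\<xi>. H \<xi> \<partial>PiM (insert i J) (\<lambda>_. exp1)) = (\<integral>\<^sup>+u. \<integral>\<^sup>+\<xi>. H (\<xi>(i := u)) \<partial>PiM J (\<lambda>_. exp1) \<partial>exp1)"
proof -
  note [measurable] = H
  interpret P: prob_space "PiM J (\<lambda>_. exp1)" by (rule prob_space_PiM) (rule prob_space_exp1)
  have "(\<integral>\<^sup>+\<xi>. H \<xi> \<partial>PiM (insert i J) (\<lambda>_. exp1))
      = (\<integral>\<^sup>+\<xi>. H \<xi> \<partial>distr (exp1 \<Otimes>\<^sub>M PiM J (\<lambda>_. exp1)) (PiM (insert i J) (\<lambda>_. exp1)) (\<lambda>(u, \<xi>). \<xi>(i := u)))"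
    by (subst distr_pair_PiM_eq_PiM) (auto intro: prob_space_exp1)
  also have "\<dots> = (\<integral>\<^sup>+z. H ((snd z)(i := fst z)) \<partial>(exp1 \<Otimes>\<^sub>M PiM J (\<lambda>_. exp1)))"
    by (subst nn_integral_distr) (auto simp: case_prod_beta)
  also have "\<dots> = (\<integral>\<^sup>+u. \<integral>\<^sup>+\<xi>. H (\<xi>(i := u)) \<partial>PiM J (\<lambda>_. exp1) \<partial>exp1)"
    by (subst P.nn_integral_fst[symmetric]) auto
  finally show ?thesis .
qed

lemma component_measurable:
  "i \<in> J \<Longrightarrow> (\<lambda>\<xi>. \<xi> i) \<in> borel_measurable (PiM J (\<lambda>_. exp1))"
  using measurable_component_singleton[of i J "\<lambda>_. exp1"] by (simp cong: measurable_cong_sets add: sets_exp1)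

lemma PiM_exp1_measurableI:
  assumes "\<And>i. i \<in> J \<Longrightarrow> (\<lambda>\<xi>. f \<xi> i) \<in> borel_measurable M" "\<And>\<xi>. \<xi> \<in> space M \<Longrightarrow> f \<xi> \<in> extensional J"
  shows "f \<in> measurable M (PiM J (\<lambda>_. exp1))"
proof (rule measurable_PiM_single')
  show "f \<in> space M \<rightarrow> (\<Pi>\<^sub>E i\<in>J. space exp1)"
    using assms(2) by (auto simp: space_exp1 PiE_iff)
  show "(\<lambda>\<xi>. f \<xi> i) \<in> measurable M exp1" if "i \<in> J" for i
    using assms(1)[OF that] by (simp cong: measurable_cong_sets add: sets_exp1)
qed

lemma space_PiM_exp1: "space (PiM J (\<lambda>_. exp1)) = extensional J"
  by (simp add: space_PiM space_exp1 PiE_def)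

lemma shift_measurable:
  assumes "i \<in> J"
  shows "(\<lambda>\<xi>. \<xi>(i := s + \<xi> i)) \<in> measurable (PiM J (\<lambda>_. exp1)) (PiM J (\<lambda>_. exp1))"
proof (rule PiM_exp1_measurableI)
  fix j assume j: "j \<in> J"
  show "(\<lambda>\<xi>. (\<xi>(i := s + \<xi> i)) j) \<in> borel_measurable (PiM J (\<lambda>_. exp1))"
    using component_measurable[OF j] component_measurable[OF assms] by (cases "j = i") auto
qed (use assms in \<open>auto simp: space_PiM_exp1 extensional_def\<close>)

lemma PiM_memoryless_single:
  assumes i: "i \<in> J" and H: "H \<in> borel_measurable (PiM J (\<lambda>_. exp1))" and s: "0 \<le> s"
  shows "(\<integral>\<^sup>+\<xi>. H \<xi> * indicator {s..} (\<xi> i) \<partial>PiM J (\<lambda>_. exp1))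
    = ennreal (exp (- s)) * (\<integral>\<^sup>+\<xi>. H (\<xi>(i := s + \<xi> i)) \<partial>PiM J (\<lambda>_. exp1))"
proof -
  let ?J = "J - {i}"
  have J: "J = insert i ?J" "i \<notin> ?J" using i by auto
  let ?M = "\<lambda>J. PiM J (\<lambda>_. exp1)"
  interpret P: prob_space "?M ?J" by (rule prob_space_PiM) (rule prob_space_exp1)
  interpret E: prob_space exp1 by (rule prob_space_exp1)
  interpret PE: pair_sigma_finite exp1 "?M ?J" by unfold_locales
  have H' [measurable]: "H \<in> borel_measurable (?M (insert i ?J))" using H J by simp
  have comp [measurable]: "(\<lambda>\<xi>. \<xi> i) \<in> borel_measurable (?M (insert i ?J))"
    by (rule component_measurable) simp
  have upd: "(\<lambda>\<xi>. \<xi>(i := s + \<xi> i)) \<in> measurable (?M (insert i ?J)) (?M (insert i ?J))"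
    by (rule shift_measurable) simp
  have "(\<integral>\<^sup>+\<xi>. H \<xi> * indicator {s..} (\<xi> i) \<partial>?M J)
      = (\<integral>\<^sup>+u. \<integral>\<^sup>+\<xi>. H (\<xi>(i := u)) * indicator {s..} u \<partial>?M ?J \<partial>exp1)"
  proof -
    have "(\<lambda>\<xi>. H \<xi> * indicator {s..} (\<xi> i)) \<in> borel_measurable (?M (insert i ?J))" by measurable
    from nn_integral_PiM_insert[OF J(2) this] show ?thesis by (simp only: J(1)[symmetric] fun_upd_same)
  qed
  also have "\<dots> = (\<integral>\<^sup>+u. (\<integral>\<^sup>+\<xi>. H (\<xi>(i := u)) \<partial>?M ?J) * indicator {s..} u \<partial>exp1)"
    by (intro nn_integral_cong nn_integral_multc) auto
  also have "\<dots> = ennreal (exp (- s)) * (\<integral>\<^sup>+u. \<integral>\<^sup>+\<xi>. H (\<xi>(i := s + u)) \<partial>?M ?J \<partial>exp1)"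
    by (rule exp1_memoryless[OF _ s]) measurable
  also have "(\<integral>\<^sup>+u. \<integral>\<^sup>+\<xi>. H (\<xi>(i := s + u)) \<partial>?M ?J \<partial>exp1) = (\<integral>\<^sup>+\<xi>. H (\<xi>(i := s + \<xi> i)) \<partial>?M (insert i ?J))"
    using nn_integral_PiM_insert[OF J(2) measurable_compose[OF upd H']] by simp
  finally show ?thesis by (simp only: J(1)[symmetric])
qed

text \<open>Induction over \<open>D\<close>, one coordinate at a time; each conditioned clock
  contributes a factor exp (- s).\<close>

lemma PiM_memoryless:
  assumes "finite D" "D \<subseteq> J" and H: "H \<in> borel_measurable (PiM J (\<lambda>_. exp1))" and s: "0 \<le> s"
  shows "(\<integral>\<^sup>+\<xi>. H \<xi> * indicator {\<xi>. \<forall>i\<in>D. s \<le> \<xi> i} \<xi> \<partial>PiM J (\<lambda>_. exp1))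
    = ennreal (exp (- (real (card D) * s))) * (\<integral>\<^sup>+\<xi>. H (\<lambda>i. if i \<in> D then s + \<xi> i else \<xi> i) \<partial>PiM J (\<lambda>_. exp1))"
  using assms(1,2) H
proof (induction D arbitrary: H rule: finite_induct)
  case (insert i D)
  let ?M = "PiM J (\<lambda>_. exp1)"
  note [measurable] = insert.prems(2)
  have iJ: "i \<in> J" using insert by simp
  have ind [measurable]: "{\<xi> \<in> space ?M. \<forall>i\<in>D. s \<le> \<xi> i} \<in> sets ?M"
  proof -
    have "(\<lambda>\<xi>. \<xi> i) \<in> borel_measurable ?M" if "i \<in> D" for i
      using that insert.prems(1) by (intro component_measurable) auto
    then show ?thesis using insert.hyps(1) by (intro sets.sets_Collect_finite_All) auto
  qed
  let ?I = "\<lambda>\<xi>. indicator {\<xi>\<in>space ?M. \<forall>i\<in>D. s \<le> \<xi> i} \<xi> :: ennreal"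
  have upd: "(\<lambda>\<xi>. \<xi>(i := s + \<xi> i)) \<in> measurable ?M ?M" by (rule shift_measurable[OF iJ])
  have "(\<integral>\<^sup>+\<xi>. H \<xi> * indicator {\<xi>. \<forall>i\<in>insert i D. s \<le> \<xi> i} \<xi> \<partial>?M)
      = (\<integral>\<^sup>+\<xi>. (H \<xi> * ?I \<xi>) * indicator {s..} (\<xi> i) \<partial>?M)"
    by (rule nn_integral_cong) (auto simp: indicator_def)
  also have "\<dots> = ennreal (exp (- s)) * (\<integral>\<^sup>+\<xi>. H (\<xi>(i := s + \<xi> i)) * ?I (\<xi>(i := s + \<xi> i)) \<partial>?M)"
    by (rule PiM_memoryless_single[OF iJ _ s]) measurable
  also have "(\<integral>\<^sup>+\<xi>. H (\<xi>(i := s + \<xi> i)) * ?I (\<xi>(i := s + \<xi> i)) \<partial>?M)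
      = (\<integral>\<^sup>+\<xi>. H (\<xi>(i := s + \<xi> i)) * indicator {\<xi>. \<forall>i\<in>D. s \<le> \<xi> i} \<xi> \<partial>?M)"
  proof (rule nn_integral_cong)
    fix \<xi> assume \<xi>: "\<xi> \<in> space ?M"
    then have "\<xi>(i := s + \<xi> i) \<in> space ?M" using measurable_space[OF upd] by blast
    then show "H (\<xi>(i := s + \<xi> i)) * ?I (\<xi>(i := s + \<xi> i))
      = H (\<xi>(i := s + \<xi> i)) * indicator {\<xi>. \<forall>i\<in>D. s \<le> \<xi> i} \<xi>"
      using insert.hyps(2) by (auto simp: indicator_def)
  qed
  also have "\<dots> = ennreal (exp (- (real (card D) * s)))
      * (\<integral>\<^sup>+\<xi>. H ((\<lambda>j. if j \<in> D then s + \<xi> j else \<xi> j)(i := s + (\<lambda>j. if j \<in> D then s + \<xi> j else \<xi> j) i)) \<partial>?M)"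
    using insert.prems(1) measurable_compose[OF upd insert.prems(2)] by (intro insert.IH) auto
  also have "(\<integral>\<^sup>+\<xi>. H ((\<lambda>j. if j \<in> D then s + \<xi> j else \<xi> j)(i := s + (\<lambda>j. if j \<in> D then s + \<xi> j else \<xi> j) i)) \<partial>?M)
      = (\<integral>\<^sup>+\<xi>. H (\<lambda>j. if j \<in> insert i D then s + \<xi> j else \<xi> j) \<partial>?M)"
    using insert.hyps(2) by (intro nn_integral_cong arg_cong[where f = H]) auto
  finally show ?case
    using insert.hyps by (simp add: mult.assoc[symmetric] ennreal_mult'[symmetric] exp_add[symmetric] algebra_simps)
qed simp

section \<open>Measurability of the sequence of ringing sites\<close>

locale poisson_clocks =
  fixes \<Lambda> :: "(int ^ 'd) set"
  assumes fin: "finite \<Lambda>"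
begin

abbreviation "I \<equiv> \<Lambda> \<times> (UNIV :: nat set)"
abbreviation "C \<equiv> clocks \<Lambda>"

lemma clocks_eq: "C = PiM I (\<lambda>_. exp1)"
  by (simp add: clocks_def exp1_def)

lemma prob_space_C: "prob_space C"
  unfolding clocks_eq by (rule prob_space_PiM) (rule prob_space_exp1)

lemma countable_I: "countable I"
  using countable_finite[OF fin] by (intro countable_SIGMA) auto

definition r :: "(int ^ 'd) \<times> nat \<Rightarrow> ((int ^ 'd) \<times> nat \<Rightarrow> real) \<Rightarrow> real" where
  "r i \<xi> = ring_time \<xi> (fst i) (snd i)"

lemma r_measurable [measurable]: "i \<in> I \<Longrightarrow> r i \<in> borel_measurable C"
  unfolding r_def ring_time_def clocks_eq
  by (intro borel_measurable_sum component_measurable) auto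

definition ringing :: "((int ^ 'd) \<times> nat \<Rightarrow> real) \<Rightarrow> real \<Rightarrow> real set" where
  "ringing \<xi> t = {s. s \<le> t \<and> (\<exists>x\<in>\<Lambda>. \<exists>k. ring_time \<xi> x k = s)}"

definition who :: "((int ^ 'd) \<times> nat \<Rightarrow> real) \<Rightarrow> real \<Rightarrow> int ^ 'd" where
  "who \<xi> s = (THE x. x \<in> \<Lambda> \<and> (\<exists>k. ring_time \<xi> x k = s))"

lemma ring_sites_eq: "ring_sites \<Lambda> \<xi> t = map (who \<xi>) (sorted_list_of_set (ringing \<xi> t))"
  by (simp add: ring_sites_def who_def ringing_def)

lemma ringing_eq: "ringing \<xi> t = {s. s \<le> t \<and> (\<exists>i\<in>I. r i \<xi> = s)}"
  unfolding ringing_def r_def by auto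

text \<open>A finite certificate for the rings up to \<open>t\<close>. There are countably many
  index lists and each imposes a measurable condition, which makes the sorted list of ring times
  accessible; when several indices ring at once, any one of them may represent the time.\<close>

definition enumerates :: "((int ^ 'd) \<times> nat) list \<Rightarrow> ((int ^ 'd) \<times> nat \<Rightarrow> real) \<Rightarrow> real \<Rightarrow> bool" where
  "enumerates is \<xi> t \<longleftrightarrow> sorted_wrt (<) (map (\<lambda>i. r i \<xi>) is) \<and> (\<forall>i\<in>set is. r i \<xi> \<le> t) \<and>
     (\<forall>i\<in>I. r i \<xi> \<le> t \<longrightarrow> (\<exists>j\<in>set is. r i \<xi> = r j \<xi>))"

lemma enumerates_sorted:
  assumes "is \<in> lists I" "enumerates is \<xi> t"
  shows "finite (ringing \<xi> t)" "sorted_list_of_set (ringing \<xi> t) = map (\<lambda>i. r i \<xi>) is"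
proof -
  have set: "set (map (\<lambda>i. r i \<xi>) is) = ringing \<xi> t"
    using assms unfolding enumerates_def ringing_eq in_lists_conv_set by force
  then show "finite (ringing \<xi> t)" by (metis List.finite_set)
  show "sorted_list_of_set (ringing \<xi> t) = map (\<lambda>i. r i \<xi>) is"
    unfolding set[symmetric]
    using assms(2) sorted_list_of_set.idem_if_sorted_distinct[of "map (\<lambda>i. r i \<xi>) is"]
    by (auto simp: enumerates_def strict_sorted_iff)
qed

lemma exists_enumeration:
  assumes "finite (ringing \<xi> t)"
  shows "\<exists>is\<in>lists I. enumerates is \<xi> t"
proof -
  let ?xs = "sorted_list_of_set (ringing \<xi> t)"
  have xs: "set ?xs = ringing \<xi> t" "sorted_wrt (<) ?xs" using assms by auto
  have "\<forall>s\<in>ringing \<xi> t. \<exists>i. i \<in> I \<and> r i \<xi> = s" unfolding ringing_eq by auto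
  then obtain f where f: "\<And>s. s \<in> ringing \<xi> t \<Longrightarrow> f s \<in> I \<and> r (f s) \<xi> = s" by metis
  have map: "map (\<lambda>i. r i \<xi>) (map f ?xs) = ?xs" unfolding map_map
    by (rule map_idI) (use f xs(1) in auto)
  have "enumerates (map f ?xs) \<xi> t"
    unfolding enumerates_def
  proof (intro conjI)
    show "sorted_wrt (<) (map (\<lambda>i. r i \<xi>) (map f ?xs))" unfolding map by (rule xs(2))
    show "\<forall>i\<in>set (map f ?xs). r i \<xi> \<le> t" using f xs(1) by (auto simp: ringing_eq)
    show "\<forall>i\<in>I. r i \<xi> \<le> t \<longrightarrow> (\<exists>j\<in>set (map f ?xs). r i \<xi> = r j \<xi>)"
    proof (intro ballI impI)
      fix i assume "i \<in> I" "r i \<xi> \<le> t"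
      then have "r i \<xi> \<in> ringing \<xi> t" unfolding ringing_eq by blast
      then show "\<exists>j\<in>set (map f ?xs). r i \<xi> = r j \<xi>" using f xs(1) by (intro bexI[of _ "f (r i \<xi>)"]) auto
    qed
  qed
  moreover have "set (map f ?xs) \<subseteq> I" using f xs(1) unfolding set_map by blast
  then have "map f ?xs \<in> lists I" unfolding in_lists_conv_set by blast
  ultimately show ?thesis by blast
qed

lemma finite_ringing_iff: "finite (ringing \<xi> t) \<longleftrightarrow> (\<exists>is\<in>lists I. enumerates is \<xi> t)"
  using exists_enumeration enumerates_sorted(1) by blast

lemma enumerates_measurable [measurable]:
  assumes "is \<in> lists I"
  shows "{\<xi>\<in>space C. enumerates is \<xi> t} \<in> sets C"
proof -
  have r: "r i \<in> borel_measurable C" if "i \<in> set is" for i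
    using that assms by (intro r_measurable) (auto simp: in_lists_conv_set)
  have 1: "{\<xi>\<in>space C. sorted_wrt (<) (map (\<lambda>i. r i \<xi>) is)} \<in> sets C"
  proof -
    have "{\<xi>\<in>space C. sorted_wrt (<) (map (\<lambda>i. r i \<xi>) is)}
      = {\<xi>\<in>space C. \<forall>b\<in>{..<length is}. \<forall>a\<in>{..<b}. r (is ! a) \<xi> < r (is ! b) \<xi>}"
      by (auto simp: sorted_wrt_iff_nth_less)
    also have "\<dots> \<in> sets C"
      by (intro sets.sets_Collect_finite_All borel_measurable_less r) (auto intro: r)
    finally show ?thesis .
  qed
  have 2: "{\<xi>\<in>space C. \<forall>i\<in>set is. r i \<xi> \<le> t} \<in> sets C"
    by (intro sets.sets_Collect_finite_All) (auto intro: r borel_measurable_le)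
  have 3: "{\<xi>\<in>space C. \<forall>i\<in>I. r i \<xi> \<le> t \<longrightarrow> (\<exists>j\<in>set is. r i \<xi> = r j \<xi>)} \<in> sets C"
  proof (rule sets.sets_Collect_countable_All'[OF _ countable_I], rule sets.sets_Collect_imp)
    fix i assume i: "i \<in> I"
    show "{\<xi>\<in>space C. r i \<xi> \<le> t} \<in> sets C"
      using r_measurable[OF i] by (rule borel_measurable_le) simp
    show "{\<xi>\<in>space C. \<exists>j\<in>set is. r i \<xi> = r j \<xi>} \<in> sets C"
      using r_measurable[OF i] r by (intro sets.sets_Collect_finite_Ex borel_measurable_eq) auto
  qed
  have "{\<xi>\<in>space C. enumerates is \<xi> t} = {\<xi>\<in>space C. sorted_wrt (<) (map (\<lambda>i. r i \<xi>) is)}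
     \<inter> {\<xi>\<in>space C. \<forall>i\<in>set is. r i \<xi> \<le> t} \<inter> {\<xi>\<in>space C. \<forall>i\<in>I. r i \<xi> \<le> t \<longrightarrow> (\<exists>j\<in>set is. r i \<xi> = r j \<xi>)}"
    by (auto simp: enumerates_def)
  then show ?thesis using 1 2 3 by auto
qed

lemma finite_ringing_measurable: "{\<xi>\<in>space C. finite (ringing \<xi> t)} \<in> sets C"
  unfolding finite_ringing_iff
  by (rule sets.sets_Collect_countable_Ex'[OF enumerates_measurable countable_lists[OF countable_I]])

text \<open>The definite description depends on the clocks only through the set of sites ringing at
  the given time, one of the finitely many subsets of \<open>\<Lambda>\<close>; coincident rings are
  covered as well.\<close>

lemma who_measurable:
  assumes i: "i \<in> I"
  shows "{\<xi>\<in>space C. who \<xi> (r i \<xi>) = y} \<in> sets C"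
proof -
  let ?T = "\<lambda>\<xi>. {x\<in>\<Lambda>. \<exists>k. ring_time \<xi> x k = r i \<xi>}"
  have "{\<xi>\<in>space C. who \<xi> (r i \<xi>) = y}
    = {\<xi>\<in>space C. \<exists>T\<in>{T\<in>Pow \<Lambda>. (THE x. x \<in> T) = y}. \<forall>x\<in>\<Lambda>. (x \<in> T) = (\<exists>k\<in>UNIV. r (x, k) \<xi> = r i \<xi>)}"
    (is "?A = ?B")
  proof
    show "?A \<subseteq> ?B"
    proof
      fix \<xi> assume "\<xi> \<in> ?A"
      then have \<xi>: "\<xi> \<in> space C" "who \<xi> (r i \<xi>) = y" by auto
      have "(THE x. x \<in> ?T \<xi>) = y" using \<xi>(2) by (simp add: who_def)
      then have "?T \<xi> \<in> {T\<in>Pow \<Lambda>. (THE x. x \<in> T) = y}" by auto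
      moreover have "\<forall>x\<in>\<Lambda>. (x \<in> ?T \<xi>) = (\<exists>k\<in>UNIV. r (x, k) \<xi> = r i \<xi>)" by (simp add: r_def)
      ultimately show "\<xi> \<in> ?B" using \<xi>(1) by blast
    qed
    show "?B \<subseteq> ?A"
    proof
      fix \<xi> assume "\<xi> \<in> ?B"
      then obtain T where T: "\<xi> \<in> space C" "T \<subseteq> \<Lambda>" "(THE x. x \<in> T) = y"
        "\<forall>x\<in>\<Lambda>. (x \<in> T) = (\<exists>k. r (x, k) \<xi> = r i \<xi>)" by auto
      have "(x \<in> \<Lambda> \<and> (\<exists>k. ring_time \<xi> x k = r i \<xi>)) = (x \<in> T)" for x
        using T(2,4) unfolding r_def by auto
      then have "who \<xi> (r i \<xi>) = y" using T(3) by (simp add: who_def)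
      then show "\<xi> \<in> ?A" using T(1) by simp
    qed
  qed
  also have "\<dots> \<in> sets C"
  proof (intro sets.sets_Collect_finite_Ex sets.sets_Collect_finite_All)
    show "finite {T\<in>Pow \<Lambda>. (THE x. x \<in> T) = y}" using fin by simp
    fix T x assume "x \<in> \<Lambda>"
    then have "{\<xi>\<in>space C. \<exists>k\<in>UNIV. r (x, k) \<xi> = r i \<xi>} \<in> sets C"
      by (intro sets.sets_Collect_countable_Bex borel_measurable_eq r_measurable i) auto
    then show "{\<xi>\<in>space C. (x \<in> T) = (\<exists>k\<in>UNIV. r (x, k) \<xi> = r i \<xi>)} \<in> sets C"
      using sets.sets_Collect_neg[of C "\<lambda>\<xi>. \<exists>k\<in>UNIV. r (x, k) \<xi> = r i \<xi>"] by (cases "x \<in> T") simp_all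
  qed (rule fin)
  finally show ?thesis .
qed

text \<open>A countable union over certificates. An infinite set of ring times is sorted to the
  empty list by convention, which accounts for the extra piece when \<open>l = []\<close>.\<close>

lemma ring_sites_measurable: "{\<xi>\<in>space C. ring_sites \<Lambda> \<xi> t = l} \<in> sets C"
proof -
  have "{\<xi>\<in>space C. ring_sites \<Lambda> \<xi> t = l} =
    {\<xi>\<in>space C. \<exists>is\<in>{is\<in>lists I. length is = length l}.
        enumerates is \<xi> t \<and> (\<forall>j\<in>{..<length l}. who \<xi> (r (is ! j) \<xi>) = l ! j)}
    \<union> (if l = [] then {\<xi>\<in>space C. \<not> finite (ringing \<xi> t)} else {})" (is "?A = ?B \<union> ?D")
  proof
    show "?A \<subseteq> ?B \<union> ?D"
    proof
      fix \<xi> assume "\<xi> \<in> ?A"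
      then have \<xi>: "\<xi> \<in> space C" "ring_sites \<Lambda> \<xi> t = l" by auto
      show "\<xi> \<in> ?B \<union> ?D"
      proof (cases "finite (ringing \<xi> t)")
        case True
        then obtain "is" where "is": "is \<in> lists I" "enumerates is \<xi> t" using exists_enumeration by blast
        have l: "l = map (\<lambda>i. who \<xi> (r i \<xi>)) is"
          using \<xi>(2) enumerates_sorted(2)[OF "is"] by (auto simp: ring_sites_eq o_def)
        have "is \<in> {is\<in>lists I. length is = length l}" using "is" l by simp
        moreover have "\<forall>j\<in>{..<length l}. who \<xi> (r (is ! j) \<xi>) = l ! j" using l by simp
        ultimately show ?thesis using \<xi> "is" by blast
      next
        case False
        then have "l = []" using \<xi>(2) by (simp add: ring_sites_eq)
        then show ?thesis using False \<xi> by simp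
      qed
    qed
    show "?B \<union> ?D \<subseteq> ?A"
    proof (intro Un_least subsetI)
      fix \<xi> assume "\<xi> \<in> ?B"
      then obtain "is" where "is": "is \<in> lists I" "length is = length l" "enumerates is \<xi> t" "\<xi> \<in> space C"
        "\<And>j. j < length l \<Longrightarrow> who \<xi> (r (is ! j) \<xi>) = l ! j" by auto
      have "ring_sites \<Lambda> \<xi> t = map (\<lambda>i. who \<xi> (r i \<xi>)) is"
        using enumerates_sorted(2)[OF "is"(1,3)] by (simp add: ring_sites_eq o_def)
      also have "\<dots> = l" using "is" by (intro nth_equalityI) auto
      finally show "\<xi> \<in> ?A" using "is" by simp
    next
      fix \<xi> assume "\<xi> \<in> ?D"
      then show "\<xi> \<in> ?A" by (auto simp: ring_sites_eq split: if_splits)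
    qed
  qed
  also have "?B \<union> ?D \<in> sets C"
  proof (rule sets.Un)
    show "?B \<in> sets C"
    proof (rule sets.sets_Collect_countable_Ex')
      show "countable {is\<in>lists I. length is = length l}"
        using countable_lists[OF countable_I] by (rule countable_subset[rotated]) auto
      fix "is" assume "is": "is \<in> {is\<in>lists I. length is = length l}"
      have "{\<xi>\<in>space C. \<forall>j\<in>{..<length l}. who \<xi> (r (is ! j) \<xi>) = l ! j} \<in> sets C"
      proof (intro sets.sets_Collect_finite_All)
        fix j assume "j \<in> {..<length l}"
        then have "is ! j \<in> I" using "is" by (auto simp: in_lists_conv_set)
        then show "{\<xi>\<in>space C. who \<xi> (r (is ! j) \<xi>) = l ! j} \<in> sets C" by (rule who_measurable)
      qed simp
      then show "{\<xi>\<in>space C. enumerates is \<xi> t \<and> (\<forall>j\<in>{..<length l}. who \<xi> (r (is ! j) \<xi>) = l ! j)} \<in> sets C"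
        using enumerates_measurable[of "is" t] "is" by (intro sets.sets_Collect_conj) auto
    qed
    show "?D \<in> sets C" using sets.sets_Collect_neg[OF finite_ringing_measurable] by auto
  qed
  finally show ?thesis .
qed

end

section \<open>Law of the word of ringing sites, by decomposition at the first ring\<close>

context poisson_clocks
begin

text \<open>Positive gaps and finitely many rings are part of the event, so that prefixing a first
  ring leads to an event of the same form.\<close>

definition good :: "real \<Rightarrow> (int ^ 'd) list \<Rightarrow> ((int ^ 'd) \<times> nat \<Rightarrow> real) set" where
  "good t l = {\<xi>\<in>space C. (\<forall>i\<in>I. 0 < \<xi> i) \<and> finite (ringing \<xi> t) \<and> ring_sites \<Lambda> \<xi> t = l}"

lemma good_measurable [measurable]: "good t l \<in> sets C"
proof -
  have "{\<xi>\<in>space C. \<forall>i\<in>I. 0 < \<xi> i} \<in> sets C"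
    by (rule sets.sets_Collect_countable_All'[OF _ countable_I], rule borel_measurable_less)
      (simp_all add: clocks_eq component_measurable)
  moreover have "good t l = {\<xi>\<in>space C. \<forall>i\<in>I. 0 < \<xi> i} \<inter> {\<xi>\<in>space C. finite (ringing \<xi> t)}
      \<inter> {\<xi>\<in>space C. ring_sites \<Lambda> \<xi> t = l}"
    by (auto simp: good_def)
  ultimately show ?thesis using finite_ringing_measurable ring_sites_measurable by auto
qed

text \<open>The clocks seen from the first ring, at \<open>x\<close> and time \<open>s\<close>, onwards are given by \<open>\<xi>\<close>.\<close>

definition restart :: "int ^ 'd \<Rightarrow> real \<Rightarrow> ((int ^ 'd) \<times> nat \<Rightarrow> real) \<Rightarrow> (int ^ 'd) \<times> nat \<Rightarrow> real" where
  "restart x s \<xi> i = (if i \<notin> I then undefined else if i = (x, 0) then s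
     else if fst i = x then \<xi> (x, snd i - 1) else if snd i = 0 then s + \<xi> i else \<xi> i)"

lemma ring_time_restart:
  assumes "x \<in> \<Lambda>"
  shows "ring_time (restart x s \<xi>) x 0 = s"
    and "ring_time (restart x s \<xi>) x (Suc k) = s + ring_time \<xi> x k"
    and "y \<in> \<Lambda> \<Longrightarrow> y \<noteq> x \<Longrightarrow> ring_time (restart x s \<xi>) y k = s + ring_time \<xi> y k"
proof -
  show "ring_time (restart x s \<xi>) x 0 = s" using assms by (simp add: ring_time_def restart_def)
  show "ring_time (restart x s \<xi>) x (Suc k) = s + ring_time \<xi> x k"
    unfolding ring_time_def using assms by (subst sum.atMost_Suc_shift) (simp add: restart_def)
  show "ring_time (restart x s \<xi>) y k = s + ring_time \<xi> y k" if "y \<in> \<Lambda>" "y \<noteq> x"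
    unfolding ring_time_def using that by (induction k) (simp_all add: restart_def)
qed

lemma ring_time_pos:
  assumes "\<forall>i\<in>I. 0 < \<xi> i" "x \<in> \<Lambda>"
  shows "0 < ring_time \<xi> x k"
  unfolding ring_time_def using assms by (intro sum_pos) auto

text \<open>The old ring times are shifted by \<open>s\<close> and preceded by a ring at
  \<open>x\<close>; they lie strictly after \<open>s\<close> because all gaps are positive, so
  \<open>x\<close> heads the word.\<close>

lemma restart_good:
  assumes x: "x \<in> \<Lambda>" and s: "0 < s" "s \<le> t" and \<xi>: "\<xi> \<in> good (t - s) l"
  shows "restart x s \<xi> \<in> good t (x # l)"
proof -
  let ?\<xi> = "restart x s \<xi>" and ?S = "ringing \<xi> (t - s)"
  have \<xi>': "\<xi> \<in> space C" "\<forall>i\<in>I. 0 < \<xi> i" "finite ?S" "ring_sites \<Lambda> \<xi> (t - s) = l"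
    using \<xi> by (auto simp: good_def)
  note rt = ring_time_restart[OF x]
  have S_pos: "0 < u" if "u \<in> ?S" for u
    using that ring_time_pos[OF \<xi>'(2)] by (auto simp: ringing_def)
  have ring: "(\<exists>k. ring_time ?\<xi> y k = s + u) \<longleftrightarrow> (\<exists>k. ring_time \<xi> y k = u)" if "y \<in> \<Lambda>" "0 < u" for y u
  proof (cases "y = x")
    case True
    have "(\<exists>k. ring_time ?\<xi> x k = s + u) \<longleftrightarrow> ring_time ?\<xi> x 0 = s + u \<or> (\<exists>k. ring_time ?\<xi> x (Suc k) = s + u)"
      using not0_implies_Suc by metis
    then show ?thesis using True that by (simp add: rt)
  qed (use that in \<open>simp add: rt\<close>)
  have late: "s < ring_time ?\<xi> y k" if "y \<in> \<Lambda>" "y \<noteq> x" for y k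
    using ring_time_pos[OF \<xi>'(2) that(1), of k] that by (simp add: rt)
  have "ringing ?\<xi> t = insert s ((+) s ` ?S)"
  proof
    show "ringing ?\<xi> t \<subseteq> insert s ((+) s ` ?S)"
    proof
      fix v assume "v \<in> ringing ?\<xi> t"
      then obtain y k where v: "v \<le> t" "y \<in> \<Lambda>" "ring_time ?\<xi> y k = v" by (auto simp: ringing_def)
      show "v \<in> insert s ((+) s ` ?S)"
      proof (cases "y = x \<and> k = 0")
        case True
        then show ?thesis using v by (simp add: rt)
      next
        case False
        have "\<exists>j. ring_time \<xi> y j = v - s"
        proof (cases "y = x")
          case True
          then obtain j where "k = Suc j" using False not0_implies_Suc by blast
          then show ?thesis using v True by (auto simp: rt)
        next
          case False
          then show ?thesis using v by (auto simp: rt)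
        qed
        then have "v - s \<in> ?S" using v by (auto simp: ringing_def)
        then show ?thesis by (intro insertI2 image_eqI[of _ _ "v - s"]) auto
      qed
    qed
    show "insert s ((+) s ` ?S) \<subseteq> ringing ?\<xi> t"
    proof
      fix v assume "v \<in> insert s ((+) s ` ?S)"
      then consider "v = s" | u where "u \<in> ?S" "v = s + u" by blast
      then show "v \<in> ringing ?\<xi> t"
      proof cases
        case 1
        then show ?thesis using x s rt(1) unfolding ringing_def by blast
      next
        case 2
        then obtain y where y: "y \<in> \<Lambda>" "\<exists>k. ring_time \<xi> y k = u" "u \<le> t - s" by (auto simp: ringing_def)
        then have "\<exists>k. ring_time ?\<xi> y k = v" using ring[OF y(1) S_pos[OF 2(1)]] 2 by simp
        then show ?thesis using y 2 unfolding ringing_def by auto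
      qed
    qed
  qed
  note ringing_eq' = this
  let ?xs = "sorted_list_of_set ?S"
  have sorted: "sorted_list_of_set (ringing ?\<xi> t) = s # map ((+) s) ?xs"
  proof -
    have "sorted_wrt (<) ?xs" "set ?xs = ?S" using \<xi>'(3) by auto
    then have "sorted_wrt (<) (s # map ((+) s) ?xs)" using S_pos by (auto simp: sorted_wrt_map)
    moreover have "set (s # map ((+) s) ?xs) = ringing ?\<xi> t" using \<xi>'(3) ringing_eq' by simp
    ultimately show ?thesis
      using sorted_list_of_set.idem_if_sorted_distinct[of "s # map ((+) s) ?xs"] by (metis strict_sorted_iff)
  qed
  have who1: "who ?\<xi> s = x" unfolding who_def
  proof (rule the_equality)
    show "x \<in> \<Lambda> \<and> (\<exists>k. ring_time ?\<xi> x k = s)" using x rt(1) by blast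
    fix y assume "y \<in> \<Lambda> \<and> (\<exists>k. ring_time ?\<xi> y k = s)"
    then show "y = x" using late less_irrefl by metis
  qed
  have who2: "who ?\<xi> (s + u) = who \<xi> u" if "u \<in> ?S" for u
    unfolding who_def using ring[OF _ S_pos[OF that]] by (intro arg_cong[where f = The] ext) auto
  have "ring_sites \<Lambda> ?\<xi> t = x # map (who \<xi>) ?xs"
    unfolding ring_sites_eq sorted using who1 who2 \<xi>'(3) by simp
  also have "\<dots> = x # l" using \<xi>'(4) by (simp add: ring_sites_eq)
  finally have "ring_sites \<Lambda> ?\<xi> t = x # l" .
  moreover have "finite (ringing ?\<xi> t)" using ringing_eq' \<xi>'(3) by simp
  moreover have "\<forall>i\<in>I. 0 < ?\<xi> i"
    using \<xi>'(2) s x by (auto simp: restart_def intro: add_pos_pos)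
  moreover have "?\<xi> \<in> space C" by (simp add: clocks_eq space_PiM_exp1 restart_def extensional_def)
  ultimately show ?thesis by (simp add: good_def)
qed

text \<open>If \<open>x\<close> rings first at time \<open>s\<close>, the other
  \<open>card \<Lambda> - 1\<close> first gaps are at least \<open>s\<close>; by lack of memory this
  costs the exponential factor, and the clocks seen from \<open>s\<close> on have their original
  law. An inequality is enough, because total mass later forces equality.\<close>

lemma first_ring_le:
  assumes x: "x \<in> \<Lambda>" and A: "A \<in> sets C" and B: "B \<in> sets C" and s: "0 \<le> s"
    and sub: "\<And>\<xi>. \<xi> \<in> B \<Longrightarrow> restart x s \<xi> \<in> A"
  defines "J \<equiv> I - {(x, 0)}"
  shows "ennreal (exp (- ((real (card \<Lambda>) - 1) * s))) * emeasure C B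
    \<le> (\<integral>\<^sup>+\<xi>. indicator A (\<xi>((x, 0) := s)) \<partial>PiM J (\<lambda>_. exp1))"
proof -
  let ?M = "PiM J (\<lambda>_. exp1)"
  let ?D = "(\<Lambda> - {x}) \<times> {0::nat}"
  \<comment> \<open>Beyond the first gap at \<open>x\<close>, the gaps at \<open>x\<close> are
    numbered anew from 0.\<close>
  let ?f = "\<lambda>i :: (int ^ 'd) \<times> nat. if fst i = x then (x, snd i - 1) else i"
  let ?H = "\<lambda>\<xi>. indicator A (\<xi>((x, 0) := s)) :: ennreal"
  have D: "finite ?D" "?D \<subseteq> J" using fin by (auto simp: J_def)
  have cardD: "real (card ?D) = real (card \<Lambda>) - 1"
  proof -
    have "card ?D = card (\<Lambda> - {x})" by (simp add: card_cartesian_product)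
    moreover have "0 < card \<Lambda>" using x fin card_gt_0_iff by blast
    ultimately show ?thesis using x fin by (simp add: of_nat_diff Suc_leI)
  qed
  have xI: "(x, 0) \<in> I" using x by simp
  have put: "(\<lambda>\<xi>. \<xi>((x, 0) := s)) \<in> measurable ?M C"
    unfolding clocks_eq
  proof (rule PiM_exp1_measurableI)
    fix i assume "i \<in> I"
    then show "(\<lambda>\<xi>. (\<xi>((x, 0) := s)) i) \<in> borel_measurable ?M"
      by (cases "i = (x, 0)") (auto simp: J_def intro!: component_measurable)
  qed (use xI in \<open>auto simp: space_PiM_exp1 J_def extensional_def\<close>)
  have H: "?H \<in> borel_measurable ?M"
    using measurable_compose[OF put borel_measurable_indicator[OF A]] .
  have "ennreal (exp (- ((real (card \<Lambda>) - 1) * s))) * emeasure C B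
      = ennreal (exp (- (real (card ?D) * s))) * (\<integral>\<^sup>+\<xi>. indicator B \<xi> \<partial>C)"
    using B by (simp add: cardD)
  also have "(\<integral>\<^sup>+\<xi>. indicator B \<xi> \<partial>C) \<le> (\<integral>\<^sup>+\<xi>. ?H (\<lambda>i. if i \<in> ?D then s + (\<lambda>i\<in>J. \<xi> (?f i)) i else (\<lambda>i\<in>J. \<xi> (?f i)) i) \<partial>C)"
  proof (rule nn_integral_mono)
    fix \<xi> assume "\<xi> \<in> space C"
    have "(\<lambda>i. if i \<in> ?D then s + (\<lambda>i\<in>J. \<xi> (?f i)) i else (\<lambda>i\<in>J. \<xi> (?f i)) i)((x, 0) := s) = restart x s \<xi>"
    proof
      fix i
      show "((\<lambda>i. if i \<in> ?D then s + (\<lambda>i\<in>J. \<xi> (?f i)) i else (\<lambda>i\<in>J. \<xi> (?f i)) i)((x, 0) := s)) i = restart x s \<xi> i"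
        using x by (cases i) (auto simp: restart_def J_def)
    qed
    then show "indicator B \<xi> \<le> ?H (\<lambda>i. if i \<in> ?D then s + (\<lambda>i\<in>J. \<xi> (?f i)) i else (\<lambda>i\<in>J. \<xi> (?f i)) i)"
      using sub[of \<xi>] by (simp add: indicator_def)
  qed
  also have "(\<integral>\<^sup>+\<xi>. ?H (\<lambda>i. if i \<in> ?D then s + (\<lambda>i\<in>J. \<xi> (?f i)) i else (\<lambda>i\<in>J. \<xi> (?f i)) i) \<partial>C)
      = (\<integral>\<^sup>+\<xi>. ?H (\<lambda>i. if i \<in> ?D then s + \<xi> i else \<xi> i) \<partial>?M)"
  proof -
    have shift: "(\<lambda>\<xi> i. if i \<in> ?D then s + \<xi> i else \<xi> i) \<in> measurable ?M ?M"
    proof (rule PiM_exp1_measurableI)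
      fix i assume "i \<in> J"
      then show "(\<lambda>\<xi>. if i \<in> ?D then s + \<xi> i else \<xi> i) \<in> borel_measurable ?M"
        using component_measurable[of i J] by (cases "i \<in> ?D") auto
    qed (use D(2) in \<open>auto simp: space_PiM_exp1 extensional_def\<close>)
    have re: "(\<lambda>\<xi>. \<lambda>i\<in>J. \<xi> (?f i)) \<in> measurable C ?M"
      unfolding clocks_eq
    proof (rule PiM_exp1_measurableI)
      fix i assume i: "i \<in> J"
      then have "?f i \<in> I" using x by (auto simp: J_def)
      then show "(\<lambda>\<xi>. (\<lambda>i\<in>J. \<xi> (?f i)) i) \<in> borel_measurable (PiM I (\<lambda>_. exp1))"
        using component_measurable[of "?f i" I] i by simp
    qed auto
    have "inj_on ?f J" by (auto simp: inj_on_def J_def split: if_splits)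
    moreover have "?f \<in> J \<rightarrow> I" using x by (auto simp: J_def)
    ultimately have "?M = distr C ?M (\<lambda>\<xi>. \<lambda>i\<in>J. \<xi> (?f i))"
      unfolding clocks_eq using distr_PiM_reindex[of I "\<lambda>_. exp1" ?f J] prob_space_exp1 by simp
    then have "(\<integral>\<^sup>+\<xi>. ?H (\<lambda>i. if i \<in> ?D then s + \<xi> i else \<xi> i) \<partial>?M)
      = (\<integral>\<^sup>+\<xi>. ?H (\<lambda>i. if i \<in> ?D then s + \<xi> i else \<xi> i) \<partial>distr C ?M (\<lambda>\<xi>. \<lambda>i\<in>J. \<xi> (?f i)))"
      by (rule arg_cong)
    also have "\<dots> = (\<integral>\<^sup>+\<xi>. ?H (\<lambda>i. if i \<in> ?D then s + (\<lambda>i\<in>J. \<xi> (?f i)) i else (\<lambda>i\<in>J. \<xi> (?f i)) i) \<partial>C)"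
      by (rule nn_integral_distr[OF re]) (simp add: measurable_compose[OF shift H])
    finally show ?thesis by simp
  qed
  also have "ennreal (exp (- (real (card ?D) * s))) * (\<integral>\<^sup>+\<xi>. ?H (\<lambda>i. if i \<in> ?D then s + \<xi> i else \<xi> i) \<partial>?M)
      = (\<integral>\<^sup>+\<xi>. ?H \<xi> * indicator {\<xi>. \<forall>i\<in>?D. s \<le> \<xi> i} \<xi> \<partial>?M)"
    by (rule PiM_memoryless[OF D H s, symmetric])
  also have "\<dots> \<le> (\<integral>\<^sup>+\<xi>. ?H \<xi> \<partial>?M)"
    by (rule nn_integral_mono) (simp add: indicator_def)
  finally show ?thesis by (simp add: mult_left_mono)
qed

end

context poisson_clocks
begin

definition N :: real where "N = real (card \<Lambda>)"

lemma AE_exp1: "AE u in exp1. 0 < u \<and> u \<noteq> t"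
proof -
  have "AE u in lborel. u \<noteq> (0::real)" "AE u in lborel. u \<noteq> t"
    by (rule AE_lborel_singleton)+
  then have "AE u in lborel. 0 < ennreal (exponential_density 1 u) \<longrightarrow> 0 < u \<and> u \<noteq> t"
    by eventually_elim (auto simp: exponential_density_def)
  then show ?thesis unfolding exp1_def by (subst AE_density) auto
qed

lemma AE_gaps: "AE \<xi> in C. \<forall>i\<in>I. 0 < \<xi> i \<and> \<xi> i \<noteq> t"
proof -
  interpret E: prob_space exp1 by (rule prob_space_exp1)
  interpret product_prob_space "\<lambda>_. exp1" I by unfold_locales
  have "AE \<xi> in C. 0 < \<xi> i \<and> \<xi> i \<noteq> t" if "i \<in> I" for i
    unfolding clocks_eq by (rule AE_component[OF that AE_exp1])
  then show ?thesis by (subst AE_ball_countable[OF countable_I]) blast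
qed

lemma good_Nil_ge:
  assumes t: "0 \<le> t"
  shows "ennreal (exp (- (N * t))) \<le> emeasure C (good t [])"
proof -
  let ?D = "\<Lambda> \<times> {0::nat}"
  let ?A = "{\<xi>\<in>space C. \<forall>i\<in>?D. t \<le> \<xi> i}"
  have A: "?A \<in> sets C"
    using fin by (intro sets.sets_Collect_finite_All borel_measurable_le)
      (auto simp: clocks_eq intro: component_measurable)
  have "ennreal (exp (- (N * t))) = ennreal (exp (- (real (card ?D) * t))) * (\<integral>\<^sup>+\<xi>. 1 \<partial>C)"
    using prob_space.emeasure_space_1[OF prob_space_C] by (simp add: card_cartesian_product N_def)
  also have "\<dots> = (\<integral>\<^sup>+\<xi>. 1 * indicator {\<xi>. \<forall>i\<in>?D. t \<le> \<xi> i} \<xi> \<partial>C)"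
    unfolding clocks_eq by (rule PiM_memoryless[OF _ _ _ t, symmetric]) (use fin in auto)
  also have "\<dots> = (\<integral>\<^sup>+\<xi>. indicator ?A \<xi> \<partial>C)"
    by (rule nn_integral_cong) (auto simp: indicator_def)
  also have "\<dots> = emeasure C ?A" using A by simp
  also have "\<dots> \<le> emeasure C (good t [])"
  proof (rule emeasure_mono_AE[OF _ good_measurable])
    show "AE \<xi> in C. \<xi> \<in> ?A \<longrightarrow> \<xi> \<in> good t []"
      using AE_gaps[of t] AE_space
    proof eventually_elim
      fix \<xi> assume \<xi>: "\<forall>i\<in>I. 0 < \<xi> i \<and> \<xi> i \<noteq> t" "\<xi> \<in> space C"
      show "\<xi> \<in> ?A \<longrightarrow> \<xi> \<in> good t []"
      proof
        assume "\<xi> \<in> ?A"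
        then have first: "t < \<xi> (x, 0)" if "x \<in> \<Lambda>" for x
          using \<xi>(1) that by (metis (mono_tags, lifting) SigmaI UNIV_I insertI1 less_le mem_Collect_eq)
        have "t < ring_time \<xi> x k" if x: "x \<in> \<Lambda>" for x k
        proof -
          have "\<xi> (x, 0) \<le> (\<Sum>j\<le>k. \<xi> (x, j))"
            by (rule member_le_sum[of 0 "{..k}" "\<lambda>j. \<xi> (x, j)"]) (use \<xi>(1) x in \<open>auto simp: less_imp_le\<close>)
          then show ?thesis using first[OF x] by (simp add: ring_time_def)
        qed
        then have "ringing \<xi> t = {}" unfolding ringing_def by (auto simp: not_le)
        then show "\<xi> \<in> good t []" using \<xi> by (simp add: good_def ring_sites_eq)
      qed
    qed
  qed
  finally show ?thesis .
qed

text \<open>Induction on the word, integrating over the time s of the first ring; the rest of the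
  word has to be produced in the remaining time t - s.\<close>

lemma good_ge:
  assumes "l \<in> lists \<Lambda>" "0 \<le> t"
  shows "ennreal (exp (- (N * t)) * t ^ length l / fact (length l)) \<le> emeasure C (good t l)"
  using assms
proof (induction l arbitrary: t)
  case Nil
  then show ?case using good_Nil_ge by simp
next
  case (Cons x l)
  then have x: "x \<in> \<Lambda>" and l: "l \<in> lists \<Lambda>" and t: "0 \<le> t" by auto
  let ?k = "length l" and ?J = "I - {(x, 0)}"
  let ?F = "\<lambda>s. - exp (- (N * t)) * (t - s) ^ Suc ?k / fact (Suc ?k)"
  let ?h = "\<lambda>s. exp (- (N * t)) * (t - s) ^ ?k / fact ?k"
  have IJ: "I = insert (x, 0) ?J" "(x, 0) \<notin> ?J" using x by auto
  have "ennreal (exp (- (N * t)) * t ^ length (x # l) / fact (length (x # l))) = ennreal (?F t - ?F 0)"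
    by simp
  also have "\<dots> = (\<integral>\<^sup>+s. ennreal (?h s) * indicator {0..t} s \<partial>lborel)"
  proof (rule nn_integral_FTC_Icc[where F = ?F, symmetric])
    fix s assume s: "s \<in> {0..t}"
    have "DERIV (\<lambda>s. (t - s) ^ Suc ?k) s :> - (real (Suc ?k) * (t - s) ^ ?k)"
      by (auto intro!: derivative_eq_intros simp del: power_Suc)
    from DERIV_cmult[OF this, of "- exp (- (N * t)) / fact (Suc ?k)"]
    have "DERIV ?F s :> - exp (- (N * t)) / fact (Suc ?k) * - (real (Suc ?k) * (t - s) ^ ?k)"
      by (simp only: times_divide_eq_left)
    also have "- exp (- (N * t)) / fact (Suc ?k) * - (real (Suc ?k) * (t - s) ^ ?k) = ?h s"
      by (simp add: fact_Suc del: of_nat_Suc)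
    finally show "DERIV ?F s :> ?h s" .
    show "0 \<le> ?h s" using s by simp
  qed (use t in auto)
  also have "\<dots> = (\<integral>\<^sup>+s. ennreal (?h s) * indicator {0<..t} s \<partial>lborel)"
    by (rule nn_integral_cong_AE)
      (use AE_lborel_singleton[of 0] in \<open>eventually_elim; auto simp: indicator_def\<close>)
  also have "\<dots> \<le> (\<integral>\<^sup>+s. ennreal (exp (- s)) * indicator {0..} s *
      (ennreal (exp (- ((N - 1) * s)) * (exp (- (N * (t - s))) * (t - s) ^ ?k / fact ?k)) * indicator {0<..t} s) \<partial>lborel)"
  proof (rule nn_integral_mono)
    fix s :: real
    \<comment> \<open>The density of the first ring, the survival of the other clocks and the factor
      for the remaining time combine to a constant, so that only the power of \<open>t - s\<close>
      has to be integrated.\<close>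
    have "exp (- (N * t)) = exp (- s) * (exp (- ((N - 1) * s)) * exp (- (N * (t - s))))"
      by (simp add: exp_add[symmetric] algebra_simps)
    then show "ennreal (?h s) * indicator {0<..t} s \<le> ennreal (exp (- s)) * indicator {0..} s *
      (ennreal (exp (- ((N - 1) * s)) * (exp (- (N * (t - s))) * (t - s) ^ ?k / fact ?k)) * indicator {0<..t} s)"
      by (auto simp: indicator_def ennreal_mult'[symmetric] mult.assoc)
  qed
  also have "\<dots> = (\<integral>\<^sup>+s. ennreal (exp (- ((N - 1) * s)) * (exp (- (N * (t - s))) * (t - s) ^ ?k / fact ?k)) * indicator {0<..t} s \<partial>exp1)"
    by (rule nn_integral_exp1[symmetric]) measurable
  also have "\<dots> \<le> (\<integral>\<^sup>+s. \<integral>\<^sup>+\<xi>. indicator (good t (x # l)) (\<xi>((x, 0) := s)) \<partial>PiM ?J (\<lambda>_. exp1) \<partial>exp1)"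
  proof (rule nn_integral_mono)
    fix s :: real
    show "ennreal (exp (- ((N - 1) * s)) * (exp (- (N * (t - s))) * (t - s) ^ ?k / fact ?k)) * indicator {0<..t} s
      \<le> (\<integral>\<^sup>+\<xi>. indicator (good t (x # l)) (\<xi>((x, 0) := s)) \<partial>PiM ?J (\<lambda>_. exp1))"
    proof (cases "0 < s \<and> s \<le> t")
      case True
      have "ennreal (exp (- ((N - 1) * s)) * (exp (- (N * (t - s))) * (t - s) ^ ?k / fact ?k))
        = ennreal (exp (- ((N - 1) * s))) * ennreal (exp (- (N * (t - s))) * (t - s) ^ ?k / fact ?k)"
        by (rule ennreal_mult') simp
      also have "\<dots> \<le> ennreal (exp (- ((N - 1) * s))) * emeasure C (good (t - s) l)"
        by (rule mult_left_mono[OF Cons.IH]) (use True in auto)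
      also have "\<dots> \<le> (\<integral>\<^sup>+\<xi>. indicator (good t (x # l)) (\<xi>((x, 0) := s)) \<partial>PiM ?J (\<lambda>_. exp1))"
        unfolding N_def
        by (rule first_ring_le[OF x good_measurable good_measurable]) (use True restart_good[OF x] in auto)
      finally show ?thesis using True by (simp add: indicator_def)
    qed (auto simp: indicator_def)
  qed
  also have "\<dots> = (\<integral>\<^sup>+\<xi>. indicator (good t (x # l)) \<xi> \<partial>PiM (insert (x, 0) ?J) (\<lambda>_. exp1))"
    using good_measurable[of t "x # l"] IJ(1)
    by (intro nn_integral_PiM_insert[OF IJ(2), symmetric] borel_measurable_indicator) (simp add: clocks_eq)
  also have "\<dots> = emeasure C (good t (x # l))"
    unfolding IJ(1)[symmetric] using good_measurable[of t "x # l"] by (simp add: clocks_eq)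
  finally show ?case .
qed

lemma finite_words: "finite {l\<in>lists \<Lambda>. length l = k}" "finite {l\<in>lists \<Lambda>. length l \<le> k}"
  using finite_lists_length_eq[OF fin, of k] finite_lists_length_le[OF fin, of k]
  by (simp_all add: lists_eq_set conj_commute Collect_conj_eq)

lemma card_words: "real (card {l\<in>lists \<Lambda>. length l = k}) = N ^ k"
  using card_lists_length_eq[OF fin, of k] by (simp add: lists_eq_set N_def)

definition word_prob :: "real \<Rightarrow> (int ^ 'd) list \<Rightarrow> real" where
  "word_prob t l = exp (- (N * t)) * t ^ length l / fact (length l)"

lemma sum_words:
  fixes g :: "(int ^ 'd) list \<Rightarrow> real"
  shows "(\<Sum>l\<in>{l\<in>lists \<Lambda>. length l \<le> n}. word_prob t l * g l)
    = (\<Sum>k\<le>n. exp (- (N * t)) * t ^ k / fact k * (\<Sum>l\<in>{l\<in>lists \<Lambda>. length l = k}. g l))"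
proof -
  have "{l\<in>lists \<Lambda>. length l \<le> n} = (\<Union>k\<in>{..n}. {l\<in>lists \<Lambda>. length l = k})" by auto
  then have "(\<Sum>l\<in>{l\<in>lists \<Lambda>. length l \<le> n}. word_prob t l * g l)
      = (\<Sum>k\<le>n. \<Sum>l\<in>{l\<in>lists \<Lambda>. length l = k}. word_prob t l * g l)"
    by (simp only:) (rule sum.UNION_disjoint, auto simp: finite_words)
  also have "\<dots> = (\<Sum>k\<le>n. \<Sum>l\<in>{l\<in>lists \<Lambda>. length l = k}. exp (- (N * t)) * t ^ k / fact k * g l)"
    by (intro sum.cong refl) (auto simp: word_prob_def)
  finally show ?thesis by (simp add: sum_distrib_left)
qed

lemma sum_word_prob: "(\<Sum>l\<in>{l\<in>lists \<Lambda>. length l \<le> n}. word_prob t l) = (\<Sum>k\<le>n. pois (N * t) k)"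
  using sum_words[of t "\<lambda>_. 1" n] by (simp add: card_words pois_def power_mult_distrib mult_ac)

lemma sum_pois_limit: "(\<lambda>n. \<Sum>k\<le>n. pois x k) \<longlonglongrightarrow> 1"
  using pois_sums[of x] by (simp add: sums_def_le)

text \<open>The lower bounds of \<open>good_ge\<close> sum to 1 over all words, so none of them can
  be strict. That infinitely many rings occur up to \<open>t\<close> is thereby seen to have
  probability 0 without a separate argument.\<close>

lemma prob_good:
  assumes l: "l \<in> lists \<Lambda>" and t: "0 \<le> t"
  shows "measure C (good t l) = word_prob t l"
proof -
  interpret prob_space C by (rule prob_space_C)
  have ge: "word_prob t l \<le> prob (good t l)" if "l \<in> lists \<Lambda>" for l
    using good_ge[OF that t] unfolding word_prob_def emeasure_eq_measure by (simp add: ennreal_le_iff)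
  have disj: "disjoint_family_on (good t) X" for X by (auto simp: disjoint_family_on_def good_def)
  have "prob (good t l) - word_prob t l \<le> 1 - (\<Sum>k\<le>n. pois (N * t) k)" if n: "length l \<le> n" for n
  proof -
    let ?W = "{l\<in>lists \<Lambda>. length l \<le> n}"
    have "prob (good t l) - word_prob t l \<le> (\<Sum>l\<in>?W. prob (good t l) - word_prob t l)"
      by (rule member_le_sum[of l ?W "\<lambda>l. prob (good t l) - word_prob t l"])
        (use l n ge finite_words in auto)
    also have "\<dots> = (\<Sum>l\<in>?W. prob (good t l)) - (\<Sum>k\<le>n. pois (N * t) k)"
      by (simp add: sum_subtractf sum_word_prob)
    also have "(\<Sum>l\<in>?W. prob (good t l)) = prob (\<Union>l\<in>?W. good t l)"
      by (rule finite_measure_finite_Union[symmetric]) (use finite_words disj in auto)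
    also have "\<dots> \<le> 1" by (rule prob_le_1)
    finally show ?thesis by simp
  qed
  moreover have "(\<lambda>n. 1 - (\<Sum>k\<le>n. pois (N * t) k)) \<longlonglongrightarrow> 1 - 1"
    by (intro tendsto_intros sum_pois_limit)
  ultimately have "prob (good t l) - word_prob t l \<le> 1 - 1"
    by (intro LIMSEQ_le_const) auto
  then show ?thesis using ge[OF l] by simp
qed

text \<open>The sum is truncated to words of length at most n; as the word probabilities are
  explicit, the neglected mass is a Poisson tail.\<close>

theorem expectation_ring_sites:
  fixes g :: "(int ^ 'd) list \<Rightarrow> real"
  assumes t: "0 \<le> t" and g: "\<And>l. 0 \<le> g l" "\<And>l. g l \<le> 1"
  shows "(\<lambda>k. exp (- (N * t)) * t ^ k / fact k * (\<Sum>l\<in>{l\<in>lists \<Lambda>. length l = k}. g l))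
    sums (\<integral>\<xi>. g (ring_sites \<Lambda> \<xi> t) \<partial>C)"
proof -
  interpret prob_space C by (rule prob_space_C)
  let ?W = "\<lambda>n. {l\<in>lists \<Lambda>. length l \<le> n}"
  let ?g = "\<lambda>\<xi>. g (ring_sites \<Lambda> \<xi> t)"
  let ?Y = "\<lambda>n \<xi>. \<Sum>l\<in>?W n. g l * indicator (good t l) \<xi>"
  have "(\<lambda>\<xi>. ring_sites \<Lambda> \<xi> t) \<in> measurable C (count_space UNIV)"
  proof (rule measurable_count_space_eq_countable[THEN iffD2])
    show "(\<lambda>\<xi>. ring_sites \<Lambda> \<xi> t) \<in> space C \<rightarrow> UNIV \<and> (\<forall>a\<in>UNIV. (\<lambda>\<xi>. ring_sites \<Lambda> \<xi> t) -` {a} \<inter> space C \<in> sets C)"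
      using ring_sites_measurable by (auto simp: vimage_def Int_def conj_commute)
  qed simp
  then have meas [measurable]: "?g \<in> borel_measurable C"
    by (rule measurable_compose) simp
  have int_g: "integrable C ?g"
    by (rule integrable_const_bound[where B = 1]) (use g in auto)
  have int_Y: "integrable C (?Y n)" for n
    by (intro Bochner_Integration.integrable_sum integrable_mult_right integrable_real_indicator good_measurable)
      (simp add: emeasure_eq_measure)
  have EY: "expectation (?Y n) = (\<Sum>k\<le>n. exp (- (N * t)) * t ^ k / fact k * (\<Sum>l\<in>{l\<in>lists \<Lambda>. length l = k}. g l))" for n
  proof -
    have "expectation (?Y n) = (\<Sum>l\<in>?W n. g l * prob (good t l))"
      using good_measurable by (subst Bochner_Integration.integral_sum) (auto simp: emeasure_eq_measure intro!: integrable_real_indicator)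
    also have "\<dots> = (\<Sum>l\<in>?W n. word_prob t l * g l)"
      by (rule sum.cong) (auto simp: prob_good[OF _ t])
    finally show ?thesis by (simp only: sum_words)
  qed
  have close: "\<bar>expectation ?g - expectation (?Y n)\<bar> \<le> 1 - (\<Sum>k\<le>n. pois (N * t) k)" for n
  proof -
    let ?U = "\<Union>l\<in>?W n. good t l"
    have U [measurable]: "?U \<in> sets C" using finite_words by (intro sets.finite_UN) auto
    have probU: "prob ?U = (\<Sum>k\<le>n. pois (N * t) k)"
    proof -
      have "prob ?U = (\<Sum>l\<in>?W n. prob (good t l))"
      proof (rule finite_measure_finite_Union)
        show "disjoint_family_on (good t) (?W n)" by (auto simp: disjoint_family_on_def good_def)
      qed (use finite_words in auto)
      also have "\<dots> = (\<Sum>l\<in>?W n. word_prob t l)" by (rule sum.cong) (auto simp: prob_good[OF _ t])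
      finally show ?thesis by (simp only: sum_word_prob)
    qed
    have pw: "\<bar>?g \<xi> - ?Y n \<xi>\<bar> \<le> 1 - indicator ?U \<xi>" for \<xi>
    proof (cases "\<xi> \<in> ?U")
      case True
      then have m: "ring_sites \<Lambda> \<xi> t \<in> ?W n" "\<xi> \<in> good t (ring_sites \<Lambda> \<xi> t)" by (auto simp: good_def)
      have "?Y n \<xi> = (\<Sum>l\<in>?W n. if l = ring_sites \<Lambda> \<xi> t then g l else 0)"
        by (rule sum.cong) (use m(2) in \<open>auto simp: indicator_def good_def\<close>)
      also have "\<dots> = ?g \<xi>" using m(1) finite_words by simp
      finally show ?thesis using True by simp
    next
      case False
      then have "?Y n \<xi> = 0" by (intro sum.neutral) (auto simp: indicator_def)
      then show ?thesis using g False by simp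
    qed
    have "\<bar>expectation ?g - expectation (?Y n)\<bar> = \<bar>expectation (\<lambda>\<xi>. ?g \<xi> - ?Y n \<xi>)\<bar>"
      by (simp add: Bochner_Integration.integral_diff[OF int_g int_Y])
    also have "\<dots> \<le> expectation (\<lambda>\<xi>. \<bar>?g \<xi> - ?Y n \<xi>\<bar>)" by (rule integral_abs_bound)
    also have "\<dots> \<le> expectation (\<lambda>\<xi>. 1 - indicator ?U \<xi>)"
      by (intro integral_mono integrable_abs Bochner_Integration.integrable_diff int_g int_Y pw integrable_const
          integrable_real_indicator U) (simp add: emeasure_eq_measure)
    also have "\<dots> = 1 - prob ?U"
      using U by (subst Bochner_Integration.integral_diff) (auto simp: prob_space emeasure_eq_measure intro!: integrable_real_indicator)
    finally show ?thesis unfolding probU .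
  qed
  have "(\<lambda>n. expectation (?Y n)) \<longlonglongrightarrow> expectation ?g"
  proof (rule LIM_zero_cancel, rule Lim_null_comparison)
    show "\<forall>\<^sub>F n in sequentially. norm (expectation (?Y n) - expectation ?g) \<le> 1 - (\<Sum>k\<le>n. pois (N * t) k)"
      using close by (intro always_eventually allI) (simp add: abs_minus_commute)
    have "(\<lambda>n. 1 - (\<Sum>k\<le>n. pois (N * t) k)) \<longlonglongrightarrow> 1 - 1"
      by (intro tendsto_intros sum_pois_limit)
    then show "(\<lambda>n. 1 - (\<Sum>k\<le>n. pois (N * t) k)) \<longlonglongrightarrow> 0" by simp
  qed
  then show ?thesis by (simp only: EY sums_def_le)
qed

end

section \<open>The Potts model satisfies Dobrushin's condition\<close>

lemma sum_max_diff_sym: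
  fixes a b :: "'a \<Rightarrow> real"
  assumes "(\<Sum>c\<in>Q. a c) = (\<Sum>c\<in>Q. b c)"
  shows "(\<Sum>c\<in>Q. max 0 (a c - b c)) = (\<Sum>c\<in>Q. max 0 (b c - a c))"
proof -
  have "(\<Sum>c\<in>Q. max 0 (a c - b c)) - (\<Sum>c\<in>Q. max 0 (b c - a c)) = (\<Sum>c\<in>Q. a c - b c)"
    unfolding sum_subtractf[symmetric] by (rule sum.cong) auto
  also have "\<dots> = 0" using assms by (simp add: sum_subtractf)
  finally show ?thesis by simp
qed

text \<open>Two probability vectors proportional to \<open>v\<close>, except that one has weight \<open>b * v i\<close> at \<open>i\<close> and the
  other \<open>b * v j\<close> at \<open>j\<close>: they are the heat-bath laws before and after a neighbour changes its color.\<close>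

definition tilt :: "'c set \<Rightarrow> ('c \<Rightarrow> real) \<Rightarrow> real \<Rightarrow> 'c \<Rightarrow> 'c \<Rightarrow> real" where
  "tilt Q v b i c = (if c = i then b else 1) * v c / (\<Sum>c'\<in>Q. (if c' = i then b else 1) * v c')"

context
  fixes Q :: "'c set" and v :: "'c \<Rightarrow> real" and b :: real
  assumes Q: "finite Q" and v: "\<And>c. c \<in> Q \<Longrightarrow> 0 < v c" and b: "0 < b"
begin

lemma tilt_denominator:
  assumes "i \<in> Q"
  shows "(\<Sum>c\<in>Q. (if c = i then b else 1) * v c) = (\<Sum>c\<in>Q. v c) + (b - 1) * v i"
proof -
  have "(\<Sum>c\<in>Q. (if c = i then b else 1) * v c) = (\<Sum>c\<in>Q. v c + (if c = i then (b - 1) * v i else 0))"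
    by (rule sum.cong) (auto simp: algebra_simps)
  then show ?thesis using Q assms by (simp add: sum.distrib)
qed

lemma tilt_denominator_pos:
  assumes "i \<in> Q"
  shows "0 < (\<Sum>c\<in>Q. v c) + (b - 1) * v i"
  unfolding tilt_denominator[OF assms, symmetric]
  using assms Q v b by (intro sum_pos) auto

lemma sum_tilt:
  assumes "i \<in> Q"
  shows "(\<Sum>c\<in>Q. tilt Q v b i c) = 1"
  using tilt_denominator_pos[OF assms] unfolding tilt_def sum_divide_distrib[symmetric]
  by (simp add: tilt_denominator[OF assms])

text \<open>Let \<open>v j \<le> v i\<close>. For \<open>b \<ge> 1\<close> only the color
  \<open>i\<close> gains when the tilt moves from \<open>j\<close> to \<open>i\<close>, for
  \<open>b \<le> 1\<close> only \<open>i\<close> gains when it moves from \<open>i\<close> to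
  \<open>j\<close>; so the total variation distance is a single term. The opposite order follows
  because the distance is symmetric.\<close>

lemma tilt_diff_le:
  assumes i: "i \<in> Q" and j: "j \<in> Q" "i \<noteq> j" and M: "\<And>i. i \<in> Q \<Longrightarrow> b * v i / ((\<Sum>c\<in>Q. v c) + (b - 1) * v i) \<le> M"
  shows "1 \<le> b \<Longrightarrow> (\<Sum>c\<in>Q. max 0 (tilt Q v b i c - tilt Q v b j c)) \<le> (1 - 1 / b) * M"
    and "b \<le> 1 \<Longrightarrow> (\<Sum>c\<in>Q. max 0 (tilt Q v b i c - tilt Q v b j c)) \<le> 1 - b"
proof -
  let ?Z = "\<lambda>i. (\<Sum>c\<in>Q. v c) + (b - 1) * v i"
  have tilt: "tilt Q v b i c = (if c = i then b else 1) * v c / ?Z i" if "i \<in> Q" for i c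
    by (simp add: tilt_def tilt_denominator[OF that])
  have single: "(\<Sum>c\<in>Q. max 0 (f c)) = max 0 (f i)" if "i \<in> Q" "\<And>c. c \<in> Q \<Longrightarrow> c \<noteq> i \<Longrightarrow> f c \<le> 0" for f :: "'c \<Rightarrow> real" and i
  proof -
    have "(\<Sum>c\<in>Q. max 0 (f c)) = (\<Sum>c\<in>Q. if c = i then max 0 (f i) else 0)"
      by (rule sum.cong) (use that(2) in auto)
    then show ?thesis using that(1) Q by simp
  qed
  have ferro: "(\<Sum>c\<in>Q. max 0 (tilt Q v b i c - tilt Q v b j c)) \<le> (1 - 1 / b) * M"
    if b1: "1 \<le> b" and ij: "i \<in> Q" "j \<in> Q" "i \<noteq> j" and w: "v j \<le> v i" for i j
  proof -
    have Z: "0 < ?Z j" "0 < ?Z i" using tilt_denominator_pos ij by auto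
    have Zle: "?Z j \<le> ?Z i" using b1 w by (simp add: mult_left_mono)
    have M0: "0 \<le> M" using M[OF ij(1)] Z b v[OF ij(1)] by (meson divide_nonneg_pos less_imp_le mult_pos_pos order_trans)
    have "(\<Sum>c\<in>Q. max 0 (tilt Q v b i c - tilt Q v b j c)) = max 0 (tilt Q v b i i - tilt Q v b j i)"
    proof (rule single[OF ij(1)])
      fix c assume c: "c \<in> Q" "c \<noteq> i"
      have "tilt Q v b i c = v c / ?Z i" using c ij by (simp add: tilt)
      also have "\<dots> \<le> v c / ?Z j" using Z Zle v[OF c(1)] by (intro divide_left_mono) auto
      also have "\<dots> \<le> tilt Q v b j c"
        using Z v[OF c(1)] b1 ij by (auto simp: tilt intro!: divide_right_mono)
      finally show "tilt Q v b i c - tilt Q v b j c \<le> 0" by simp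
    qed
    also have "\<dots> \<le> (1 - 1 / b) * M"
    proof (rule max.boundedI)
      show "0 \<le> (1 - 1 / b) * M" using M0 b1 by simp
      have "tilt Q v b i i - tilt Q v b j i = b * v i / ?Z i - v i / ?Z j" using ij by (simp add: tilt)
      also have "\<dots> \<le> b * v i / ?Z i - v i / ?Z i"
        using Z Zle v[OF ij(1)] by (intro diff_left_mono divide_left_mono) auto
      also have "\<dots> = (1 - 1 / b) * (b * v i / ?Z i)" using b by (simp add: left_diff_distrib diff_divide_distrib)
      also have "\<dots> \<le> (1 - 1 / b) * M" using M[OF ij(1)] b1 by (intro mult_left_mono) auto
      finally show "tilt Q v b i i - tilt Q v b j i \<le> (1 - 1 / b) * M" .
    qed
    finally show ?thesis .
  qed
  have anti: "(\<Sum>c\<in>Q. max 0 (tilt Q v b j c - tilt Q v b i c)) \<le> 1 - b"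
    if b1: "b \<le> 1" and ij: "i \<in> Q" "j \<in> Q" "i \<noteq> j" and w: "v j \<le> v i" for i j
  proof -
    have Z: "0 < ?Z j" "0 < ?Z i" using tilt_denominator_pos ij by auto
    have Zle: "?Z i \<le> ?Z j" using b1 w by (simp add: mult_left_mono_neg)
    have "(\<Sum>c\<in>Q. max 0 (tilt Q v b j c - tilt Q v b i c)) = max 0 (tilt Q v b j i - tilt Q v b i i)"
    proof (rule single[OF ij(1)])
      fix c assume c: "c \<in> Q" "c \<noteq> i"
      have "tilt Q v b j c \<le> v c / ?Z j"
        using Z v[OF c(1)] b1 ij b by (auto simp: tilt intro!: divide_right_mono)
      also have "\<dots> \<le> v c / ?Z i" using Z Zle v[OF c(1)] by (intro divide_left_mono) auto
      also have "\<dots> = tilt Q v b i c" using c ij by (simp add: tilt)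
      finally show "tilt Q v b j c - tilt Q v b i c \<le> 0" by simp
    qed
    also have "\<dots> \<le> 1 - b"
    proof (rule max.boundedI)
      have "tilt Q v b j i - tilt Q v b i i = v i / ?Z j - b * v i / ?Z i" using ij by (simp add: tilt)
      also have "\<dots> \<le> v i / ?Z j - b * v i / ?Z j"
        using Z Zle v[OF ij(1)] b by (intro diff_left_mono divide_left_mono) auto
      also have "\<dots> = (1 - b) * (v i / ?Z j)" by (simp add: left_diff_distrib diff_divide_distrib)
      also have "\<dots> \<le> (1 - b) * 1"
      proof (rule mult_left_mono)
        have "v i / ?Z j = tilt Q v b j i" using ij by (simp add: tilt)
        also have "\<dots> \<le> (\<Sum>c\<in>Q. tilt Q v b j c)"
          using ij Q Z b v by (intro member_le_sum) (auto simp: tilt less_imp_le)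
        finally show "v i / ?Z j \<le> 1" using sum_tilt ij by simp
      qed (use b1 in simp)
      finally show "tilt Q v b j i - tilt Q v b i i \<le> 1 - b" by simp
    qed (use b1 in simp)
    finally show ?thesis .
  qed
  have sym: "(\<Sum>c\<in>Q. max 0 (tilt Q v b i c - tilt Q v b j c)) = (\<Sum>c\<in>Q. max 0 (tilt Q v b j c - tilt Q v b i c))"
    using sum_tilt i j by (intro sum_max_diff_sym) simp
  show "1 \<le> b \<Longrightarrow> (\<Sum>c\<in>Q. max 0 (tilt Q v b i c - tilt Q v b j c)) \<le> (1 - 1 / b) * M"
    using ferro[of i j] ferro[of j i] i j sym by (cases "v j \<le> v i") auto
  show "b \<le> 1 \<Longrightarrow> (\<Sum>c\<in>Q. max 0 (tilt Q v b i c - tilt Q v b j c)) \<le> 1 - b"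
    using anti[of i j] anti[of j i] i j sym by (cases "v j \<le> v i") auto
qed

end

section \<open>Lattice geometry: distance, balls and degrees\<close>

definition site_dist :: "int ^ 'd \<Rightarrow> int ^ 'd \<Rightarrow> nat" where
  "site_dist x y = nat (\<Sum>i\<in>UNIV. \<bar>x $ i - y $ i\<bar>)"

lemma adjacent_sym: "adjacent x y \<longleftrightarrow> adjacent y x"
  by (simp add: adjacent_def abs_minus_commute)

lemma adjacent_irrefl: "\<not> adjacent x x"
  by (simp add: adjacent_def)

lemma site_dist_adjacent:
  assumes "adjacent y z"
  shows "site_dist x z \<le> site_dist x y + 1"
proof -
  have "(\<Sum>i\<in>UNIV. \<bar>x $ i - z $ i\<bar>) \<le> (\<Sum>i\<in>UNIV. \<bar>x $ i - y $ i\<bar> + \<bar>y $ i - z $ i\<bar>)"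
    by (rule sum_mono) simp
  also have "\<dots> = (\<Sum>i\<in>UNIV. \<bar>x $ i - y $ i\<bar>) + 1" using assms by (simp add: sum.distrib adjacent_def)
  finally show ?thesis
    unfolding site_dist_def using sum_nonneg[of UNIV "\<lambda>i. \<bar>x $ i - y $ i\<bar>"] by simp
qed

lemma inj_vec_nth: "inj_on vec_nth A"
  by (auto simp: inj_on_def vec_eq_iff)

lemma card_vec_box:
  fixes f :: "'d::finite \<Rightarrow> int set"
  assumes "\<And>i. finite (f i)"
  shows "finite {x :: int ^ 'd. \<forall>i. x $ i \<in> f i}" "card {x :: int ^ 'd. \<forall>i. x $ i \<in> f i} = (\<Prod>i\<in>UNIV. card (f i))"
proof -
  let ?S = "{x :: int ^ 'd. \<forall>i. x $ i \<in> f i}"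
  have im: "vec_nth ` ?S = PiE UNIV f"
  proof
    show "PiE UNIV f \<subseteq> vec_nth ` ?S"
    proof
      fix g assume "g \<in> PiE UNIV f"
      then have "vec_lambda g \<in> ?S" by auto
      then show "g \<in> vec_nth ` ?S" by (intro image_eqI[of _ _ "vec_lambda g"]) auto
    qed
  qed auto
  have "finite (PiE UNIV f)" using assms by (intro finite_PiE) auto
  then show "finite ?S" unfolding im[symmetric] by (rule finite_imageD[OF _ inj_vec_nth])
  show "card ?S = (\<Prod>i\<in>UNIV. card (f i))"
    using card_image[OF inj_vec_nth, of ?S] im card_PiE[of UNIV f] by simp
qed

lemma card_lattice_box: "card (lattice_box (a :: int ^ 'd) n) = n ^ CARD('d)"
proof -
  have "lattice_box a n = {x. \<forall>i. x $ i \<in> {a $ i ..< a $ i + int n}}" by (auto simp: lattice_box_def)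
  then show ?thesis using card_vec_box(2)[of "\<lambda>i. {a $ i ..< a $ i + int n}"] by simp
qed

lemma card_site_ball:
  fixes x :: "int ^ 'd"
  assumes "finite A"
  shows "card {y\<in>A. site_dist x y \<le> R} \<le> (2 * R + 1) ^ CARD('d)"
proof -
  let ?B = "{y. \<forall>i. y $ i \<in> {x $ i - int R .. x $ i + int R}}"
  have "{y\<in>A. site_dist x y \<le> R} \<subseteq> ?B"
  proof
    fix y assume "y \<in> {y\<in>A. site_dist x y \<le> R}"
    then have s: "(\<Sum>i\<in>UNIV. \<bar>x $ i - y $ i\<bar>) \<le> int R" by (simp add: site_dist_def nat_le_iff)
    have "\<bar>x $ i - y $ i\<bar> \<le> int R" for i
      using member_le_sum[of i UNIV "\<lambda>i. \<bar>x $ i - y $ i\<bar>"] s by simp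
    then show "y \<in> ?B" by (auto simp: abs_le_iff) (smt (verit))+
  qed
  then have "card {y\<in>A. site_dist x y \<le> R} \<le> card ?B"
    by (intro card_mono card_vec_box) auto
  also have "\<dots> = (\<Prod>i\<in>(UNIV :: 'd set). 2 * R + 1)"
    by (subst card_vec_box(2)) (simp_all add: nat_add_distrib nat_mult_distrib)
  finally show ?thesis by simp
qed

lemma neighbours:
  fixes x :: "int ^ 'd"
  shows "finite {v. adjacent x v}" "card {v. adjacent x v} \<le> 2 * CARD('d)"
proof -
  let ?f = "\<lambda>(i, s). x + axis i s :: int ^ 'd"
  have sub: "{v. adjacent x v} \<subseteq> ?f ` (UNIV \<times> {1, -1})"
  proof
    fix v assume "v \<in> {v. adjacent x v}"
    then have s: "(\<Sum>i\<in>UNIV. \<bar>x $ i - v $ i\<bar>) = 1" by (simp add: adjacent_def)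
    have "x \<noteq> v" using s by auto
    then obtain i where i: "\<bar>x $ i - v $ i\<bar> \<noteq> 0" by (auto simp: vec_eq_iff)
    have split: "(\<Sum>i\<in>UNIV. \<bar>x $ i - v $ i\<bar>) = \<bar>x $ i - v $ i\<bar> + (\<Sum>j\<in>UNIV-{i}. \<bar>x $ j - v $ j\<bar>)"
      by (rule sum.remove) auto
    have rest: "0 \<le> (\<Sum>j\<in>UNIV-{i}. \<bar>x $ j - v $ j\<bar>)" by (rule sum_nonneg) simp
    have one: "\<bar>x $ i - v $ i\<bar> = 1" and zero: "(\<Sum>j\<in>UNIV-{i}. \<bar>x $ j - v $ j\<bar>) = 0"
      using s split rest i by linarith+
    have "x $ j = v $ j" if "j \<noteq> i" for j
      using zero that by (subst (asm) sum_nonneg_eq_0_iff) auto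
    then have "v = x + axis i (v $ i - x $ i)" by (auto simp: vec_eq_iff axis_def)
    moreover have "v $ i - x $ i \<in> {1, -1}" using one by auto
    ultimately show "v \<in> ?f ` (UNIV \<times> {1, -1})" by (intro image_eqI[of _ _ "(i, v $ i - x $ i)"]) auto
  qed
  then show "finite {v. adjacent x v}" by (rule finite_subset) simp
  have "card {v. adjacent x v} \<le> card (?f ` (UNIV \<times> {1, -1}))" using sub by (intro card_mono) auto
  also have "\<dots> \<le> card ((UNIV :: 'd set) \<times> {1::int, -1})" by (intro card_image_le) simp
  finally show "card {v. adjacent x v} \<le> 2 * CARD('d)" by (simp add: card_cartesian_product)
qed

text \<open>A bound for the influence of one neighbour out of \<open>m\<close>. For \<beta> \<ge> 0
  the fraction is the largest heat-bath probability, attained when all \<open>m\<close> neighbours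
  share a color; for \<beta> < 0 it is the second bound of \<open>tilt_diff_le\<close>.\<close>

definition potts_influence :: "nat \<Rightarrow> real \<Rightarrow> nat \<Rightarrow> real" where
  "potts_influence q \<beta> m =
    (if 0 \<le> \<beta> then (1 - 1 / exp (2 * \<beta>)) * (exp (2 * \<beta>) ^ m / (exp (2 * \<beta>) ^ m + (real q - 1))) else 1 - exp (2 * \<beta>))"

text \<open>The maximum offers two criteria for b = exp (2 * \<beta>). Below
  \<open>1 + 1 / (m - 1)\<close> already \<open>m * (1 - 1 / b)\<close> is less than 1. Below the
  m-th root of \<open>1 + q / m\<close> one has \<open>m * (b ^ m - 1) < q\<close>, which suffices
  because \<open>b ^ m / b\<close> is at least 1.\<close>

lemma potts_influence_ferro:
  fixes m :: nat
  assumes q: "2 \<le> q" and m: "2 \<le> m" and \<beta>: "0 \<le> \<beta>"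
    and less: "\<beta> < 1 / 2 * ln (max (1 + 1 / (real m - 1)) ((1 + real q / real m) powr (1 / real m)))"
  shows "real m * potts_influence q \<beta> m < 1"
proof -
  define b where "b = exp (2 * \<beta>)"
  have b1: "1 \<le> b" using \<beta> by (simp add: b_def)
  have B1: "1 \<le> b ^ m" using b1 by simp
  define B where "B = b ^ m"
  have B: "1 \<le> B" using B1 by (simp add: B_def)
  have Bq: "0 < B + (real q - 1)" using B q by simp
  let ?M = "max (1 + 1 / (real m - 1)) ((1 + real q / real m) powr (1 / real m))"
  have M: "0 < ?M" using m by (simp add: max.strict_coboundedI1 add_pos_nonneg)
  have "exp (2 * \<beta>) < exp (ln ?M)" using less by simp
  then have "b < ?M" using M by (simp add: b_def)
  then consider "b < 1 + 1 / (real m - 1)" | "b < (1 + real q / real m) powr (1 / real m)" by (auto simp: less_max_iff_disj)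
  then have "real m * ((1 - 1 / b) * (B / (B + (real q - 1)))) < 1"
  proof cases
    case 1
    then have "(real m - 1) * b < real m" using m by (simp add: field_simps)
    then have "real m * (1 - 1 / b) < 1" using b1 by (simp add: field_simps)
    moreover have "real m * (1 - 1 / b) * (B / (B + (real q - 1))) \<le> real m * (1 - 1 / b) * 1"
      using B Bq q b1 by (intro mult_left_mono) auto
    ultimately show ?thesis by (simp only: mult.assoc)
  next
    case 2
    let ?y = "1 + real q / real m"
    have y: "0 < ?y" by (intro add_pos_nonneg) auto
    have "B < (?y powr (1 / real m)) ^ m"
      unfolding B_def using 2 b1 m by (intro power_strict_mono) auto
    also have "\<dots> = (?y powr (1 / real m)) powr real m"
      using y by (intro powr_realpow[symmetric]) simp
    also have "\<dots> = ?y powr (1 / real m * real m)" by (rule powr_powr)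
    also have "\<dots> = 1 + real q / real m" using m by (simp add: add_pos_nonneg)
    finally have q_gt: "real m * (B - 1) < real q" using m by (simp add: field_simps)
    have Bb: "B / b = b ^ (m - 1)" using b1 m by (cases m) (auto simp: B_def)
    have "1 \<le> B / b" unfolding Bb using b1 by simp
    then have "real m * (B - B / b) \<le> real m * (B - 1)" by (intro mult_left_mono) auto
    also have "\<dots> < B + (real q - 1)" using q_gt B by linarith
    finally have "real m * ((1 - 1 / b) * B) < B + (real q - 1)" by (simp add: left_diff_distrib)
    then have "real m * ((1 - 1 / b) * B) / (B + (real q - 1)) < 1" using Bq by simp
    then show ?thesis by simp
  qed
  then show ?thesis using \<beta> by (simp add: potts_influence_def b_def B_def)
qed

text \<open>The hypothesis gives 1 - exp (2 * \<beta>) \<le> 1 / (m * q), so the product is at most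
  1 / q. The value \<beta> = 0 belongs to the other branch of the definition, where the influence is
  0.\<close>

lemma potts_influence_anti:
  assumes q: "2 \<le> q" and m: "2 \<le> m" and \<beta>: "\<beta> \<le> 0"
    and ge: "- (1 / 2) * ln (1 + 1 / (real m * real q - 1)) \<le> \<beta>"
  shows "real m * potts_influence q \<beta> m < 1"
proof (cases "\<beta> = 0")
  case False
  have "2 * 2 \<le> real m * real q" using q m by (intro mult_mono) auto
  then have mq: "4 \<le> real m * real q" by simp
  have pos: "0 < 1 + 1 / (real m * real q - 1)" using mq by (simp add: add_pos_pos)
  have "exp (- ln (1 + 1 / (real m * real q - 1))) \<le> exp (2 * \<beta>)" using ge by simp
  then have "1 / (1 + 1 / (real m * real q - 1)) \<le> exp (2 * \<beta>)"
    using pos by (simp add: exp_minus inverse_eq_divide)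
  moreover have "1 / (1 + 1 / (real m * real q - 1)) = 1 - 1 / (real m * real q)"
  proof -
    have "1 / (1 + 1 / (x - 1)) = 1 - 1 / x" if "1 < x" for x :: real
      using that by (simp add: field_simps)
    then show ?thesis using mq by simp
  qed
  ultimately have "1 - exp (2 * \<beta>) \<le> 1 / (real m * real q)" by simp
  then have "real m * (1 - exp (2 * \<beta>)) \<le> real m * (1 / (real m * real q))" by (intro mult_left_mono) auto
  also have "\<dots> = 1 / real q" using m by simp
  also have "\<dots> < 1" using q by simp
  finally show ?thesis using False \<beta> by (simp add: potts_influence_def)
qed (simp add: potts_influence_def)

section \<open>Potts weights: heat-bath probabilities and influences\<close>

locale potts_model =
  fixes q :: nat and \<beta> :: real and \<Lambda> :: "(int ^ 'd) set" and \<tau> :: "int ^ 'd \<Rightarrow> nat option"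
  assumes finite_domain: "finite \<Lambda>" and domain_nonempty: "\<Lambda> \<noteq> {}" and two_colors: "2 \<le> q"
begin

definition nbhd :: "int ^ 'd \<Rightarrow> (int ^ 'd) set" where
  "nbhd x = {v. adjacent x v \<and> (v \<in> \<Lambda> \<or> \<tau> v \<noteq> None)}"

definition nb :: "int ^ 'd \<Rightarrow> (int ^ 'd) set" where
  "nb x = {v\<in>\<Lambda>. adjacent x v}"

definition agree :: "int ^ 'd \<Rightarrow> (int ^ 'd \<Rightarrow> nat) \<Rightarrow> nat \<Rightarrow> nat" where
  "agree x \<sigma> c = card {v\<in>nbhd x. with_boundary \<Lambda> \<tau> \<sigma> v = Some c}"

definition "b = exp (2 * \<beta>)"

text \<open>With K = \<open>max b (1 / b) ^ (2 * CARD('d))\<close>, a color has weight at least 1 /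
  K and all colors together weigh at most \<open>q\<close> times K.\<close>

definition "p\<^sub>0 = 1 / (real q * (max b (1 / b) ^ (2 * CARD('d)))\<^sup>2)"

lemma b_pos: "0 < b"
  by (simp add: b_def)

sublocale gibbs \<Lambda> "{1..q}" "potts_weight \<beta> \<Lambda> \<tau>"
  using finite_domain domain_nonempty two_colors by unfold_locales (auto simp: potts_weight_def)

lemma finite_nbhd: "finite (nbhd x)"
  by (rule finite_subset[OF _ neighbours(1)[of x]]) (auto simp: nbhd_def)

lemma card_nbhd: "card (nbhd x) \<le> 2 * CARD('d)"
  by (rule order_trans[OF card_mono[OF neighbours(1)] neighbours(2)]) (auto simp: nbhd_def)

lemma finite_bonds: "finite (bonds \<Lambda> \<tau>)"
proof (rule finite_subset)
  show "bonds \<Lambda> \<tau> \<subseteq> (\<Union>u\<in>\<Lambda>. (\<lambda>v. {u, v}) ` {v. adjacent u v})" by (auto simp: bonds_def)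
  show "finite (\<Union>u\<in>\<Lambda>. (\<lambda>v. {u, v}) ` {v. adjacent u v})"
    using finite_domain neighbours(1) by (intro finite_UN_I finite_imageI) auto
qed

lemma bonds_at:
  assumes "x \<in> \<Lambda>"
  shows "{e\<in>bonds \<Lambda> \<tau>. x \<in> e} = (\<lambda>v. {x, v}) ` nbhd x"
proof (intro equalityI subsetI)
  fix e assume "e \<in> {e\<in>bonds \<Lambda> \<tau>. x \<in> e}"
  then obtain u v where e: "e = {u, v}" "u \<in> \<Lambda>" "adjacent u v" "v \<in> \<Lambda> \<or> \<tau> v \<noteq> None" "x = u \<or> x = v"
    by (auto simp: bonds_def)
  then show "e \<in> (\<lambda>v. {x, v}) ` nbhd x"
    using adjacent_sym[of u v] by (auto simp: nbhd_def)
qed (use assms in \<open>auto simp: bonds_def nbhd_def\<close>)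

text \<open>Only the bonds at \<open>x\<close> involve the new color; each contributes a factor
  \<open>b\<close> if its other end, inside the domain or on a fixed boundary site, has the same
  color.\<close>

lemma potts_weight_upd:
  assumes x: "x \<in> \<Lambda>"
  obtains R where "0 < R" "\<And>c. potts_weight \<beta> \<Lambda> \<tau> (\<sigma>(x := c)) = R * b ^ agree x \<sigma> c"
proof
  let ?a = "\<lambda>\<sigma> e. 2 * \<beta> * of_bool (\<exists>c. \<forall>w\<in>e. with_boundary \<Lambda> \<tau> \<sigma> w = Some c)"
  let ?R = "exp (\<Sum>e\<in>{e\<in>bonds \<Lambda> \<tau>. x \<notin> e}. ?a \<sigma> e)"
  show "0 < ?R" by simp
  fix c
  have off: "with_boundary \<Lambda> \<tau> (\<sigma>(x := c)) w = with_boundary \<Lambda> \<tau> \<sigma> w" if "w \<noteq> x" for w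
    using that by (simp add: with_boundary_def)
  have at: "with_boundary \<Lambda> \<tau> (\<sigma>(x := c)) x = Some c"
    using x by (simp add: with_boundary_def)
  have inj: "inj_on (\<lambda>v. {x, v}) (nbhd x)"
    by (auto simp: inj_on_def doubleton_eq_iff)
  have split: "bonds \<Lambda> \<tau> = {e\<in>bonds \<Lambda> \<tau>. x \<in> e} \<union> {e\<in>bonds \<Lambda> \<tau>. x \<notin> e}" by auto
  have "(\<Sum>e\<in>bonds \<Lambda> \<tau>. ?a (\<sigma>(x := c)) e)
    = (\<Sum>e\<in>{e\<in>bonds \<Lambda> \<tau>. x \<in> e}. ?a (\<sigma>(x := c)) e) + (\<Sum>e\<in>{e\<in>bonds \<Lambda> \<tau>. x \<notin> e}. ?a (\<sigma>(x := c)) e)"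
    by (subst split, rule sum.union_disjoint) (use finite_bonds in auto)
  also have "(\<Sum>e\<in>{e\<in>bonds \<Lambda> \<tau>. x \<notin> e}. ?a (\<sigma>(x := c)) e) = (\<Sum>e\<in>{e\<in>bonds \<Lambda> \<tau>. x \<notin> e}. ?a \<sigma> e)"
  proof (rule sum.cong[OF refl])
    fix e assume "e \<in> {e\<in>bonds \<Lambda> \<tau>. x \<notin> e}"
    then have "with_boundary \<Lambda> \<tau> (\<sigma>(x := c)) w = with_boundary \<Lambda> \<tau> \<sigma> w" if "w \<in> e" for w
      using that by (intro off) auto
    then show "?a (\<sigma>(x := c)) e = ?a \<sigma> e" by simp
  qed
  also have "(\<Sum>e\<in>{e\<in>bonds \<Lambda> \<tau>. x \<in> e}. ?a (\<sigma>(x := c)) e) = (\<Sum>v\<in>nbhd x. ?a (\<sigma>(x := c)) {x, v})"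
    unfolding bonds_at[OF x] by (subst sum.reindex[OF inj]) simp
  also have "\<dots> = (\<Sum>v\<in>nbhd x. 2 * \<beta> * of_bool (with_boundary \<Lambda> \<tau> \<sigma> v = Some c))"
  proof (rule sum.cong[OF refl])
    fix v assume "v \<in> nbhd x"
    then have "v \<noteq> x" using adjacent_irrefl[of x] by (auto simp: nbhd_def)
    then show "?a (\<sigma>(x := c)) {x, v} = 2 * \<beta> * of_bool (with_boundary \<Lambda> \<tau> \<sigma> v = Some c)"
      by (simp add: at off)
  qed
  also have "\<dots> = 2 * \<beta> * real (agree x \<sigma> c)"
    using finite_nbhd by (simp add: agree_def sum_distrib_left[symmetric] sum_of_bool_eq Int_def)
  finally have "potts_weight \<beta> \<Lambda> \<tau> (\<sigma>(x := c)) = exp (2 * \<beta> * real (agree x \<sigma> c)) * ?R"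
    unfolding potts_weight_def exp_add[symmetric] by (rule arg_cong)
  also have "exp (2 * \<beta> * real (agree x \<sigma> c)) = b ^ agree x \<sigma> c"
    unfolding b_def by (metis exp_of_nat_mult mult.commute)
  finally show "potts_weight \<beta> \<Lambda> \<tau> (\<sigma>(x := c)) = ?R * b ^ agree x \<sigma> c"
    by (simp only: mult.commute)
qed

lemma pr_eq:
  assumes "x \<in> \<Lambda>"
  shows "pr x \<sigma> c = b ^ agree x \<sigma> c / (\<Sum>c'\<in>{1..q}. b ^ agree x \<sigma> c')"
proof -
  obtain R where R: "0 < R" "\<And>c. potts_weight \<beta> \<Lambda> \<tau> (\<sigma>(x := c)) = R * b ^ agree x \<sigma> c"
    using potts_weight_upd[OF assms] by metis
  show ?thesis unfolding pr_def R(2) sum_distrib_left[symmetric] using R(1) by simp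
qed

lemma agree_le: "agree x \<sigma> c \<le> 2 * CARD('d)"
  unfolding agree_def by (rule order_trans[OF card_mono card_nbhd[of x]]) (auto simp: finite_nbhd)

lemma power_b_bounds:
  assumes "k \<le> m"
  shows "1 / max b (1 / b) ^ m \<le> b ^ k" "b ^ k \<le> max b (1 / b) ^ m"
proof -
  let ?m = "max b (1 / b)"
  have m1: "1 \<le> ?m"
  proof (cases "1 \<le> b")
    case False
    then have "1 \<le> 1 / b" using b_pos by simp
    then show ?thesis by (rule max.coboundedI2)
  qed (rule max.coboundedI1)
  have "b ^ k \<le> ?m ^ k" using b_pos by (intro power_mono) auto
  also have "\<dots> \<le> ?m ^ m" using m1 assms by (intro power_increasing) auto
  finally show "b ^ k \<le> ?m ^ m" .
  have "(1 / b) ^ k \<le> ?m ^ k" using b_pos by (intro power_mono) auto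
  also have "\<dots> \<le> ?m ^ m" using m1 assms by (intro power_increasing) auto
  finally have "1 / b ^ k \<le> ?m ^ m" by (simp add: power_divide)
  then have "1 / ?m ^ m \<le> 1 / (1 / b ^ k)" using b_pos m1 by (intro divide_left_mono) (auto intro!: mult_pos_pos)
  then show "1 / ?m ^ m \<le> b ^ k" by simp
qed

lemma p\<^sub>0_pos: "0 < p\<^sub>0"
  using b_pos two_colors by (simp add: p\<^sub>0_def less_max_iff_disj)

lemma p\<^sub>0_le_pr:
  assumes x: "x \<in> \<Lambda>"
  shows "p\<^sub>0 \<le> pr x \<sigma> c"
proof -
  let ?K = "max b (1 / b) ^ (2 * CARD('d))"
  have K: "0 < ?K" using b_pos by (simp add: less_max_iff_disj)
  have "(\<Sum>c'\<in>{1..q}. b ^ agree x \<sigma> c') \<le> (\<Sum>c'\<in>{1..q}. ?K)"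
    by (intro sum_mono power_b_bounds agree_le)
  then have Z: "(\<Sum>c'\<in>{1..q}. b ^ agree x \<sigma> c') \<le> real q * ?K" by simp
  have Z0: "0 < (\<Sum>c'\<in>{1..q}. b ^ agree x \<sigma> c')"
    using b_pos two_colors by (intro sum_pos) auto
  have "p\<^sub>0 = (1 / ?K) / (real q * ?K)" by (simp add: p\<^sub>0_def power2_eq_square)
  also have "\<dots> \<le> b ^ agree x \<sigma> c / (real q * ?K)"
    using power_b_bounds(1)[OF agree_le] K by (intro divide_right_mono) auto
  also have "\<dots> \<le> b ^ agree x \<sigma> c / (\<Sum>c'\<in>{1..q}. b ^ agree x \<sigma> c')"
    using Z Z0 b_pos by (intro divide_left_mono) (auto intro!: mult_pos_pos less_le_trans[OF Z0 Z])
  finally show ?thesis unfolding pr_eq[OF x] .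
qed

lemma influence_other:
  assumes x: "x \<in> \<Lambda>" and y: "y \<in> \<Lambda>" "y \<notin> nb x"
  shows "pr x (\<sigma>(y := c')) c = pr x \<sigma> c"
proof -
  have "agree x (\<sigma>(y := c')) c = agree x \<sigma> c" for c
  proof -
    have "v \<noteq> y" if "v \<in> nbhd x" for v using that y by (auto simp: nbhd_def nb_def)
    then show ?thesis unfolding agree_def by (intro arg_cong[of _ _ card]) (auto simp: with_boundary_def)
  qed
  then show ?thesis unfolding pr_eq[OF x] by presburger
qed

text \<open>Isolates the vote of one neighbour: the votes of the others form the untilted weights,
  and \<open>y\<close> puts the factor \<open>b\<close> on its own color.\<close>

lemma pr_tilt:
  assumes x: "x \<in> \<Lambda>" and y: "y \<in> nb x"
  shows "pr x \<sigma> = tilt {1..q} (\<lambda>c. b ^ card {v\<in>nbhd x - {y}. with_boundary \<Lambda> \<tau> \<sigma> v = Some c}) b (\<sigma> y)"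
proof
  fix c
  have y': "y \<in> \<Lambda>" "y \<in> nbhd x" using y by (auto simp: nb_def nbhd_def)
  have "b ^ agree x \<sigma> c = (if c = \<sigma> y then b else 1) * b ^ card {v\<in>nbhd x - {y}. with_boundary \<Lambda> \<tau> \<sigma> v = Some c}" for c
  proof (cases "c = \<sigma> y")
    case True
    then have "{v\<in>nbhd x. with_boundary \<Lambda> \<tau> \<sigma> v = Some c} = insert y {v\<in>nbhd x - {y}. with_boundary \<Lambda> \<tau> \<sigma> v = Some c}"
      using y' by (auto simp: with_boundary_def)
    then show ?thesis using True finite_nbhd by (simp add: agree_def)
  next
    case False
    then have "{v\<in>nbhd x. with_boundary \<Lambda> \<tau> \<sigma> v = Some c} = {v\<in>nbhd x - {y}. with_boundary \<Lambda> \<tau> \<sigma> v = Some c}"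
      using y' by (auto simp: with_boundary_def)
    then show ?thesis using False by (simp add: agree_def)
  qed
  then show "pr x \<sigma> c = tilt {1..q} (\<lambda>c. b ^ card {v\<in>nbhd x - {y}. with_boundary \<Lambda> \<tau> \<sigma> v = Some c}) b (\<sigma> y) c"
    unfolding pr_eq[OF x] tilt_def by simp
qed

lemma influence_nb:
  assumes x: "x \<in> \<Lambda>" and y: "y \<in> nb x" and \<sigma>: "\<sigma> \<in> \<Omega>" and c': "c' \<in> {1..q}"
  shows "(\<Sum>c\<in>{1..q}. max 0 (pr x \<sigma> c - pr x (\<sigma>(y := c')) c)) \<le> potts_influence q \<beta> (2 * CARD('d))"
proof (cases "\<sigma> y = c'")
  case True
  have q1: "0 < exp (2 * \<beta>) ^ (2 * CARD('d)) + (real q - 1)"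
    using two_colors by (intro add_pos_nonneg) auto
  have "0 \<le> potts_influence q \<beta> (2 * CARD('d))"
    using q1 by (auto simp: potts_influence_def intro!: mult_nonneg_nonneg divide_nonneg_pos)
  then show ?thesis using True by (simp add: fun_upd_idem)
next
  case False
  let ?n = "\<lambda>\<sigma> c. card {v\<in>nbhd x - {y}. with_boundary \<Lambda> \<tau> \<sigma> v = Some c}"
  let ?v = "\<lambda>c. b ^ ?n \<sigma> c"
  let ?B = "b ^ (2 * CARD('d))"
  have y': "y \<in> \<Lambda>" "y \<in> nbhd x" using y by (auto simp: nb_def nbhd_def)
  have same: "?n (\<sigma>(y := c')) c = ?n \<sigma> c" for c
    by (intro arg_cong[of _ _ card]) (auto simp: with_boundary_def)
  \<comment> \<open>With \<open>y\<close> set aside a color has at most 2 * d - 1 votes, so for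
    \<open>b \<ge> 1\<close> even after the tilt its weight is at most \<open>?B\<close>.\<close>
  have n_le: "?n \<sigma> c + 1 \<le> 2 * CARD('d)" for c
  proof -
    have "?n \<sigma> c + 1 \<le> card (nbhd x - {y}) + 1" using finite_nbhd by (intro add_right_mono card_mono) auto
    also have "\<dots> = card (nbhd x)" using y' finite_nbhd by (metis Suc_eq_plus1 card_Suc_Diff1)
    finally show ?thesis using card_nbhd[of x] by simp
  qed
  have i: "\<sigma> y \<in> {1..q}" using \<Omega>_spin[OF \<sigma> y'(1)] .
  \<comment> \<open>The extreme case: the color has all the votes and each of the other
    \<open>q - 1\<close> colors has weight 1; u / (u + (q - 1)) is increasing in u.\<close>
  have M: "b * ?v i / ((\<Sum>c\<in>{1..q}. ?v c) + (b - 1) * ?v i) \<le> ?B / (?B + (real q - 1))"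
    if b1: "1 \<le> b" and i: "i \<in> {1..q}" for i
  proof -
    have "real (card ({1..q} - {i})) * 1 \<le> (\<Sum>c\<in>{1..q}-{i}. ?v c)"
      using b1 by (intro sum_bounded_below) auto
    then have S: "real q - 1 \<le> (\<Sum>c\<in>{1..q}-{i}. ?v c)" using i by (simp add: of_nat_diff)
    have u: "b * ?v i \<le> ?B"
      using power_increasing[OF n_le[of i] b1] by simp
    have eq: "(\<Sum>c\<in>{1..q}. ?v c) + (b - 1) * ?v i = b * ?v i + (\<Sum>c\<in>{1..q}-{i}. ?v c)"
      using i by (subst sum.remove[of _ i]) (auto simp: left_diff_distrib)
    have u0: "0 < b * ?v i" using b_pos by simp
    have q0: "0 \<le> real q - 1" using two_colors by simp
    have "b * ?v i / (b * ?v i + (\<Sum>c\<in>{1..q}-{i}. ?v c)) \<le> b * ?v i / (b * ?v i + (real q - 1))"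
      using u0 S q0 by (intro divide_left_mono mult_pos_pos) auto
    also have "\<dots> \<le> ?B / (?B + (real q - 1))"
    proof -
      have "b * ?v i * (real q - 1) \<le> ?B * (real q - 1)" using u q0 by (rule mult_right_mono)
      then have "b * ?v i * (?B + (real q - 1)) \<le> ?B * (b * ?v i + (real q - 1))"
        by (simp only: distrib_left) (simp add: mult.commute)
      then show ?thesis using u0 u q0 by (simp add: divide_le_eq pos_le_divide_eq mult.commute)
    qed
    finally show ?thesis unfolding eq .
  qed
  have t1: "pr x \<sigma> = tilt {1..q} ?v b (\<sigma> y)" by (rule pr_tilt[OF x y])
  have t2: "pr x (\<sigma>(y := c')) = tilt {1..q} ?v b c'"
    using pr_tilt[OF x y, of "\<sigma>(y := c')"] unfolding same fun_upd_same .
  show ?thesis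
  proof (cases "0 \<le> \<beta>")
    case True
    then have b1: "1 \<le> b" by (simp add: b_def)
    show ?thesis
      using tilt_diff_le(1)[of "{1..q}" ?v b "\<sigma> y" c' "?B / (?B + (real q - 1))", OF _ _ b_pos i c' False M[OF b1] b1] b_pos True
      unfolding t1 t2 by (simp add: potts_influence_def b_def)
  next
    case nonneg: False
    then have b1: "b \<le> 1" by (simp add: b_def)
    have "\<exists>M. \<forall>i\<in>{1..q}. b * ?v i / ((\<Sum>c\<in>{1..q}. ?v c) + (b - 1) * ?v i) \<le> M"
      by (intro exI[of _ "Max ((\<lambda>i. b * ?v i / ((\<Sum>c\<in>{1..q}. ?v c) + (b - 1) * ?v i)) ` {1..q})"]) auto
    then obtain M where M: "\<And>i. i \<in> {1..q} \<Longrightarrow> b * ?v i / ((\<Sum>c\<in>{1..q}. ?v c) + (b - 1) * ?v i) \<le> M" by blast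
    show ?thesis
      using tilt_diff_le(2)[of "{1..q}" ?v b "\<sigma> y" c' M, OF _ _ b_pos i c' False M b1] b_pos nonneg
      unfolding t1 t2 by (simp add: potts_influence_def b_def)
  qed
qed

lemma potts_influence_nonneg: "0 \<le> potts_influence q \<beta> m"
proof -
  have "0 < exp (2 * \<beta>) ^ m + (real q - 1)" using two_colors by (intro add_pos_nonneg) auto
  then show ?thesis by (auto simp: potts_influence_def intro!: mult_nonneg_nonneg divide_nonneg_pos)
qed

text \<open>Fixed boundary sites count in the degree 2 * d but are not in \<open>nb\<close>, as
  their spins never change. The maximum with 1 / 2 keeps \<alpha> positive when the influence
  vanishes.\<close>

lemma spatial_dobrushin:
  assumes "real (2 * CARD('d)) * potts_influence q \<beta> (2 * CARD('d)) < 1"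
  shows "spatial_dobrushin \<Lambda> {1..q} (potts_weight \<beta> \<Lambda> \<tau>) nb (potts_influence q \<beta> (2 * CARD('d)))
    (max (1 / 2) (real (2 * CARD('d)) * potts_influence q \<beta> (2 * CARD('d)))) p\<^sub>0 site_dist CARD('d)"
proof unfold_locales
  let ?\<rho> = "potts_influence q \<beta> (2 * CARD('d))"
  have "card (nb x) \<le> 2 * CARD('d)" for x
    by (rule order_trans[OF card_mono[OF neighbours(1)] neighbours(2)]) (auto simp: nb_def)
  then have "real (card (nb x)) \<le> real (2 * CARD('d))" for x by (simp only: of_nat_le_iff)
  then have "real (card (nb x)) * ?\<rho> \<le> real (2 * CARD('d)) * ?\<rho>" for x
    using potts_influence_nonneg by (intro mult_right_mono)
  then show "real (card (nb x)) * ?\<rho> \<le> max (1 / 2) (real (2 * CARD('d)) * ?\<rho>)" for x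
    by (rule max.coboundedI2)
  show "(\<Sum>c\<in>{1..q}. max 0 (pr x \<sigma> c - pr x (\<sigma>(y := c')) c)) \<le> (if y \<in> nb x then ?\<rho> else 0)"
    if "x \<in> \<Lambda>" "y \<in> \<Lambda>" "x \<noteq> y" "\<sigma> \<in> \<Omega>" "c' \<in> {1..q}" for x y \<sigma> c'
    using that influence_nb influence_other by auto
  show "site_dist x y = site_dist y x" for x y :: "int ^ 'd"
    by (simp add: site_dist_def abs_minus_commute)
  show "x \<notin> nb x" for x by (simp add: nb_def adjacent_irrefl)
  show "y \<in> nb x \<longleftrightarrow> x \<in> nb y" if "x \<in> \<Lambda>" "y \<in> \<Lambda>" for x y
    using that by (simp add: nb_def adjacent_sym)
  show "card {y\<in>\<Lambda>. site_dist x y \<le> R} \<le> (2 * R + 1) ^ CARD('d)" for x R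
    by (rule card_site_ball[OF finite_domain])
  show "p\<^sub>0 \<le> pr x \<sigma> c" if "x \<in> \<Lambda>" for x \<sigma> c
    using that by (rule p\<^sub>0_le_pr)
  show "site_dist x z \<le> site_dist x y + 1" if "z \<in> nb y" for x y z
    using that by (intro site_dist_adjacent) (simp add: nb_def)
qed (use assms potts_influence_nonneg p\<^sub>0_pos in \<open>auto simp: nb_def site_dist_def less_max_iff_disj\<close>)

end

section \<open>Glauber dynamics as a Poissonized chain\<close>

text \<open>Expands the power of \<open>P\<close> over words of sites; in \<open>foldr\<close> the
  head of the word is the outermost average, that is, the update performed first.\<close>

lemma (in gibbs) sum_updates:
  assumes "\<sigma> \<in> \<Omega>"
  shows "(\<Sum>l\<in>{l\<in>lists \<Lambda>. length l = k}. foldr (\<lambda>x. avg {x}) l f \<sigma>) = N ^ k * (P ^^ k) f \<sigma>"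
  using assms
proof (induction k arbitrary: \<sigma>)
  case 0
  have "{l\<in>lists \<Lambda>. length l = 0} = {[]}" by auto
  then show ?case by simp
next
  case (Suc k)
  let ?L = "\<lambda>k. {l\<in>lists \<Lambda>. length l = k}"
  have img: "?L (Suc k) = (\<lambda>(x, l). x # l) ` (\<Lambda> \<times> ?L k)"
    by (auto simp: length_Suc_conv image_iff)
  have fin: "finite (?L k)"
    using finite_lists_length_eq[OF finite_sites, of k] by (rule rev_finite_subset) auto
  have "(\<Sum>l\<in>?L (Suc k). foldr (\<lambda>x. avg {x}) l f \<sigma>)
    = (\<Sum>(x, l)\<in>\<Lambda> \<times> ?L k. avg {x} (foldr (\<lambda>x. avg {x}) l f) \<sigma>)"
    unfolding img by (subst sum.reindex) (auto simp: inj_on_def case_prod_beta)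
  also have "\<dots> = (\<Sum>x\<in>\<Lambda>. avg {x} (\<lambda>\<eta>. \<Sum>l\<in>?L k. foldr (\<lambda>x. avg {x}) l f \<eta>) \<sigma>)"
    by (simp only: sum.cartesian_product[symmetric] mean_sum[OF mean_avg_\<Omega>[OF Suc.prems]])
  also have "\<dots> = (\<Sum>x\<in>\<Lambda>. avg {x} (\<lambda>\<eta>. N ^ k * (P ^^ k) f \<eta>) \<sigma>)"
    by (intro sum.cong refl mean_cong[OF mean_avg_\<Omega>[OF Suc.prems]] Suc.IH)
  also have "\<dots> = N ^ k * (\<Sum>x\<in>\<Lambda>. avg {x} ((P ^^ k) f) \<sigma>)"
    by (simp only: mean_cmult[OF mean_avg_\<Omega>[OF Suc.prems]] sum_distrib_left)
  also have "\<dots> = N ^ Suc k * P ((P ^^ k) f) \<sigma>" using N_ge_1 by (simp add: P_def)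
  finally show ?case by simp
qed

text \<open>Formulated with events and the semigroup, so that it makes sense for every Gibbs
  measure; it is identified with the total variation distance of the dynamics in
  \<open>t_mix_eq\<close>.\<close>

definition (in gibbs) mixed :: "real \<Rightarrow> real \<Rightarrow> bool" where
  "mixed t \<epsilon> \<longleftrightarrow> (\<forall>\<sigma>\<in>\<Omega>. \<forall>A. \<bar>pt t (\<lambda>\<eta>. of_bool (\<eta> \<in> A)) \<sigma> - EE (\<lambda>\<eta>. of_bool (\<eta> \<in> A))\<bar> \<le> \<epsilon>)"

context potts_model
begin

context
  notes One_nat_def [simp del]
begin

definition \<mu> where "\<mu> = potts q \<beta> \<Lambda> \<tau>"

lemma \<Omega>_eq: "\<Omega> = configs q \<Lambda>"
  by (simp add: \<Omega>_def configs_def)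

lemma pmf_\<mu>:
  "pmf \<mu> \<sigma> = (if \<sigma> \<in> \<Omega> then potts_weight \<beta> \<Lambda> \<tau> \<sigma> / (\<Sum>\<eta>\<in>\<Omega>. potts_weight \<beta> \<Lambda> \<tau> \<eta>) else 0)"
  unfolding \<mu>_def \<Omega>_eq using two_colors by (intro pmf_potts finite_domain) simp

lemma partition_pos: "0 < (\<Sum>\<eta>\<in>\<Omega>. potts_weight \<beta> \<Lambda> \<tau> \<eta>)"
  using finite_\<Omega> \<Omega>_nonempty w_pos by (intro sum_pos) auto

lemma set_pmf_\<mu>: "set_pmf \<mu> = \<Omega>"
  using w_pos partition_pos by (force simp: set_pmf_eq pmf_\<mu>)

lemma prob_\<mu>: "measure_pmf.prob \<mu> A = (\<Sum>\<eta>\<in>\<Omega> \<inter> A. potts_weight \<beta> \<Lambda> \<tau> \<eta>) / (\<Sum>\<eta>\<in>\<Omega>. potts_weight \<beta> \<Lambda> \<tau> \<eta>)"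
proof -
  have "measure_pmf.prob \<mu> A = measure_pmf.prob \<mu> (\<Omega> \<inter> A)"
    using measure_Int_set_pmf[of \<mu> A] by (simp add: set_pmf_\<mu> Int_commute)
  also have "\<dots> = (\<Sum>\<eta>\<in>\<Omega> \<inter> A. pmf \<mu> \<eta>)" using finite_\<Omega> by (intro measure_measure_pmf_finite) auto
  finally show ?thesis by (simp add: pmf_\<mu> sum_divide_distrib)
qed

lemma EE_event: "EE (\<lambda>\<eta>. of_bool (\<eta> \<in> A)) = measure_pmf.prob \<mu> A"
proof -
  have "(\<Sum>\<eta>\<in>\<Omega>. potts_weight \<beta> \<Lambda> \<tau> \<eta> * of_bool (\<eta> \<in> A)) = (\<Sum>\<eta>\<in>\<Omega> \<inter> A. potts_weight \<beta> \<Lambda> \<tau> \<eta>)"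
    using finite_\<Omega> by (simp add: of_bool_def sum.inter_restrict if_distrib cong: if_cong)
  then show ?thesis by (simp add: EE_def prob_\<mu>)
qed

context
  fixes x \<sigma> assumes x: "x \<in> \<Lambda>" and \<sigma>: "\<sigma> \<in> \<Omega>"
begin

abbreviation (input) "S \<equiv> {\<eta>. \<forall>y. y \<noteq> x \<longrightarrow> \<eta> y = \<sigma> y}"

lemma fiber_eq_Int: "fiber {x} \<sigma> = \<Omega> \<inter> S"
  by (auto simp: fiber_def)

lemma set_heat_bath: "set_pmf (heat_bath \<mu> x \<sigma>) = fiber {x} \<sigma>"
proof -
  have "set_pmf \<mu> \<inter> S \<noteq> {}" using \<sigma> by (auto simp: set_pmf_\<mu>)
  then show ?thesis unfolding heat_bath_def fiber_eq_Int by (subst set_cond_pmf) (auto simp: set_pmf_\<mu>)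
qed

lemma expectation_heat_bath: "measure_pmf.expectation (heat_bath \<mu> x \<sigma>) f = avg {x} f \<sigma>"
proof -
  let ?w = "potts_weight \<beta> \<Lambda> \<tau>"
  have ne: "set_pmf \<mu> \<inter> S \<noteq> {}" using \<sigma> by (auto simp: set_pmf_\<mu>)
  have pos: "0 < (\<Sum>\<eta>\<in>fiber {x} \<sigma>. ?w \<eta>)" by (rule weight_fiber_pos[OF \<sigma>])
  have "pmf (heat_bath \<mu> x \<sigma>) \<eta> = ?w \<eta> / (\<Sum>\<eta>\<in>fiber {x} \<sigma>. ?w \<eta>)" if "\<eta> \<in> fiber {x} \<sigma>" for \<eta>
    using that partition_pos unfolding heat_bath_def pmf_cond[OF ne]
    by (simp add: prob_\<mu> fiber_eq_Int pmf_\<mu>)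
  moreover have "measure_pmf.expectation (heat_bath \<mu> x \<sigma>) f = (\<Sum>\<eta>\<in>fiber {x} \<sigma>. f \<eta> * pmf (heat_bath \<mu> x \<sigma>) \<eta>)"
    by (rule integral_measure_pmf_real) (auto simp: finite_fiber set_heat_bath)
  ultimately show ?thesis
    by (simp add: avg_def sum_divide_distrib mult.commute)
qed

end

text \<open>Duality: \<open>fold\<close> pushes the law forward through the updates while
  \<open>foldr\<close> pulls the observable back through the same word.\<close>

lemma expectation_updates:
  assumes "set xs \<subseteq> \<Lambda>" "set_pmf p \<subseteq> \<Omega>"
  shows "measure_pmf.expectation (fold (\<lambda>x p. bind_pmf p (heat_bath \<mu> x)) xs p) f
    = measure_pmf.expectation p (foldr (\<lambda>x. avg {x}) xs f)"
  using assms
proof (induction xs arbitrary: p)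
  case (Cons x xs)
  then have x: "x \<in> \<Lambda>" and xs: "set xs \<subseteq> \<Lambda>" by auto
  let ?g = "foldr (\<lambda>x. avg {x}) xs f"
  have "set_pmf (bind_pmf p (heat_bath \<mu> x)) \<subseteq> \<Omega>"
    using Cons.prems(2) set_heat_bath[OF x] fiber_subset by (auto simp: subset_iff)
  then have "measure_pmf.expectation (fold (\<lambda>x p. bind_pmf p (heat_bath \<mu> x)) (x # xs) p) f
      = measure_pmf.expectation (bind_pmf p (heat_bath \<mu> x)) ?g"
    using Cons.IH[OF xs] by simp
  also have "\<dots> = (\<Sum>\<eta>\<in>set_pmf p. pmf p \<eta> *\<^sub>R measure_pmf.expectation (heat_bath \<mu> x \<eta>) ?g)"
    using Cons.prems(2) finite_\<Omega> finite_fiber set_heat_bath[OF x]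
    by (intro pmf_expectation_bind) (auto simp: subset_iff intro: finite_subset[OF Cons.prems(2) finite_\<Omega>])
  also have "\<dots> = (\<Sum>\<eta>\<in>set_pmf p. avg {x} ?g \<eta> * pmf p \<eta>)"
    using Cons.prems(2) by (intro sum.cong refl) (auto simp: expectation_heat_bath[OF x] subset_iff)
  also have "\<dots> = measure_pmf.expectation p (avg {x} ?g)"
    by (rule integral_measure_pmf_real[symmetric]) (use finite_subset[OF Cons.prems(2) finite_\<Omega>] in auto)
  finally show ?case by simp
qed simp

lemma prob_run_updates:
  assumes "set xs \<subseteq> \<Lambda>" "\<sigma> \<in> \<Omega>"
  shows "measure_pmf.prob (run_updates \<mu> xs \<sigma>) A = foldr (\<lambda>x. avg {x}) xs (\<lambda>\<eta>. of_bool (\<eta> \<in> A)) \<sigma>"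
proof -
  have "(\<lambda>\<eta>. of_bool (\<eta> \<in> A)) = (indicator A :: _ \<Rightarrow> real)" by (auto simp: indicator_def)
  then have "measure_pmf.prob (run_updates \<mu> xs \<sigma>) A
    = measure_pmf.expectation (run_updates \<mu> xs \<sigma>) (\<lambda>\<eta>. of_bool (\<eta> \<in> A))"
    by simp
  then show ?thesis
    unfolding run_updates_def using expectation_updates[OF assms(1), of "return_pmf \<sigma>"] assms(2) by simp
qed

text \<open>Each of the \<open>N ^ k\<close> words of length \<open>k\<close> has the same weight;
  with the factor \<open>N ^ k\<close> of \<open>sum_updates\<close> it becomes the Poisson weight
  of mean \<open>N * t\<close>.\<close>

lemma glauber_prob_eq:
  assumes \<sigma>: "\<sigma> \<in> \<Omega>" and t: "0 \<le> t"
  shows "glauber_prob \<Lambda> \<mu> \<sigma> t A = pt t (\<lambda>\<eta>. of_bool (\<eta> \<in> A)) \<sigma>"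
proof -
  interpret clk: poisson_clocks \<Lambda> by unfold_locales (rule finite_domain)
  let ?g = "\<lambda>l. measure_pmf.prob (run_updates \<mu> l \<sigma>) A"
  have N: "clk.N = N" by (simp add: N_def clk.N_def)
  have "(\<lambda>k. exp (- (N * t)) * t ^ k / fact k * (\<Sum>l\<in>{l\<in>lists \<Lambda>. length l = k}. ?g l)) sums glauber_prob \<Lambda> \<mu> \<sigma> t A"
    unfolding glauber_prob_def N[symmetric] by (rule clk.expectation_ring_sites[OF t]) auto
  moreover have "(\<Sum>l\<in>{l\<in>lists \<Lambda>. length l = k}. ?g l) = N ^ k * (P ^^ k) (\<lambda>\<eta>. of_bool (\<eta> \<in> A)) \<sigma>" for k
    unfolding sum_updates[OF \<sigma>, symmetric]
    by (intro sum.cong refl prob_run_updates \<sigma>) auto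
  ultimately have "(\<lambda>k. pois (N * t) k * (P ^^ k) (\<lambda>\<eta>. of_bool (\<eta> \<in> A)) \<sigma>) sums glauber_prob \<Lambda> \<mu> \<sigma> t A"
    by (simp add: pois_def power_mult_distrib mult_ac)
  then show ?thesis unfolding pt_def by (simp add: sums_iff)
qed

lemma tv_to_equilibrium_le_iff:
  assumes \<sigma>: "\<sigma> \<in> \<Omega>" and t: "0 \<le> t"
  shows "tv_to_equilibrium \<Lambda> \<mu> \<sigma> t \<le> \<epsilon> \<longleftrightarrow>
    (\<forall>A. \<bar>pt t (\<lambda>\<eta>. of_bool (\<eta> \<in> A)) \<sigma> - EE (\<lambda>\<eta>. of_bool (\<eta> \<in> A))\<bar> \<le> \<epsilon>)"
proof -
  have pt_bounds: "0 \<le> pt t (\<lambda>\<eta>. of_bool (\<eta> \<in> A)) \<sigma>" "pt t (\<lambda>\<eta>. of_bool (\<eta> \<in> A)) \<sigma> \<le> 1" for A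
    by (intro mean_nonneg[OF mean_pt[OF \<sigma> t]] mean_le[OF mean_pt[OF \<sigma> t]]; simp)+
  have "\<bar>pt t (\<lambda>\<eta>. of_bool (\<eta> \<in> A)) \<sigma> - measure_pmf.prob \<mu> A\<bar> \<le> 1" for A
    using pt_bounds[of A] measure_nonneg[of \<mu> A] measure_pmf.prob_le_1[of \<mu> A] by linarith
  then have "bdd_above (range (\<lambda>A. \<bar>pt t (\<lambda>\<eta>. of_bool (\<eta> \<in> A)) \<sigma> - measure_pmf.prob \<mu> A\<bar>))"
    by (intro bdd_aboveI[of _ 1]) auto
  then show ?thesis
    unfolding tv_to_equilibrium_def glauber_prob_eq[OF assms] EE_event
    by (subst cSUP_le_iff) auto
qed

lemma t_mix_eq: "t_mix q \<beta> \<Lambda> \<tau> \<epsilon> = Inf {t. 0 \<le> t \<and> mixed t \<epsilon>}"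
proof -
  have "(MAX \<sigma>\<in>configs q \<Lambda>. tv_to_equilibrium \<Lambda> (potts q \<beta> \<Lambda> \<tau>) \<sigma> t) \<le> \<epsilon> \<longleftrightarrow> mixed t \<epsilon>" if "0 \<le> t" for t
    unfolding \<Omega>_eq[symmetric] \<mu>_def[symmetric] mixed_def
    using finite_\<Omega> \<Omega>_nonempty by (subst Max_le_iff) (auto simp: tv_to_equilibrium_le_iff[OF _ that])
  then show ?thesis unfolding t_mix_def by (intro arg_cong[of _ _ Inf]) auto
qed

end

end

section \<open>Cutoff\<close>

text \<open>With L = ln N: \<open>R\<close> and \<open>M\<close> are both about c1 * L, and
  \<open>k1\<close> is \<open>N * t0 + 3 * N\<close> rounded up. The level \<open>D\<close> is
  \<open>L ^ (2 * dim + 2)\<close>, one power more than the order of the varentropy coefficient.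
  Finally \<open>l\<close> is \<open>N\<close> times \<open>C * (2 * dim + 3) * ln L\<close>,
  rounded up, which brings the entropy from \<open>D\<close> down to 1 / L. The 6 collects the
  margin 3 in \<open>k1\<close>, two roundings and the Poisson deviation.\<close>

lemma window_parameters:
  fixes \<alpha> p \<epsilon> K C :: real and dim :: nat
  assumes \<alpha>: "0 < \<alpha>" "\<alpha> < 1" and p: "0 < p" "p \<le> 1" and \<epsilon>: "0 < \<epsilon>" and C: "0 < C" and K: "0 \<le> K"
  shows "\<exists>L\<^sub>0\<ge>1. \<forall>N t0. 0 < N \<longrightarrow> L\<^sub>0 \<le> ln N \<longrightarrow> 0 \<le> t0 \<longrightarrow> t0 \<le> K * ln N \<longrightarrow>
    (\<exists>R M k1 l D. 0 < D \<and> N * t0 + 3 * N \<le> real k1 \<and>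
      t0 / N + 4 * ((4 + 4 / p) * real M * (2 + real ((2 * R + 1) ^ dim) * ln (1 / p)) * C * real ((2 * R + 1) ^ dim)) / D
        + 4 * (real k1 / N) * ((4 + 4 / p) * N * (1 / 2) ^ M * (1 + 1 / N) ^ k1 * (4 * (N * ln (N / p))\<^sup>2)
          + real k1 * (8 * (N * ln (N / p))\<^sup>2 * (\<alpha> ^ (R + 1))\<^sup>2)) / D\<^sup>2
        + real k1 * exp (- D / 2) < \<epsilon> \<and>
      real (k1 + l) + N \<le> N * (t0 + (6 + C * real (2 * dim + 3) * ln (ln N))) \<and>
      2 * sqrt (exp (- real l / (C * N)) * D) + (t0 + (6 + C * real (2 * dim + 3) * ln (ln N))) / N \<le> \<epsilon>)"
proof -
  define K2 where "K2 = K + 4"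
  define v where "v = ln (1 / \<alpha>)"
  have v: "0 < v" using \<alpha> by (simp add: v_def)
  \<comment> \<open>\<open>c1\<close> makes \<open>(1 / 2) ^ R\<close> beat the growth exp (K2 * L)
    of the exponential moment and a further fourth power of N, and makes
    \<open>\<alpha> ^ (2 * R)\<close> at most exp (- 4 * L).\<close>
  define c1 where "c1 = max ((4 + K2) / ln 2) (2 / v)"
  have "(4 + K2) / ln 2 \<le> c1" "2 / v \<le> c1" by (auto simp: c1_def)
  then have c1: "4 + K2 \<le> c1 * ln 2" "2 \<le> c1 * v" using v by (simp_all add: pos_divide_le_eq)
  have K2: "4 \<le> K2" using K by (simp add: K2_def)
  have c1_pos: "0 < c1" using c1(2) v by (metis less_le_trans zero_less_mult_pos2 zero_less_numeral)
  define c2 where "c2 = 2 * c1 + 3"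
  define lp where "lp = ln (1 / p)"
  have lp: "0 \<le> lp" using p by (simp add: lp_def)
  define K3 where "K3 = 1 + lp"
  define P where "P = 4 + 4 / p"
  have P: "0 < P" using p by (simp add: P_def add_pos_pos)
  define c3 where "c3 = P * c2 * ((2 + lp) * c2 ^ dim) * C * c2 ^ dim"
  define A1 where "A1 = P * (4 * K3\<^sup>2)"
  define A2 where "A2 = K2 * (8 * K3\<^sup>2)"
  define c4 where "c4 = C * real (2 * dim + 3)"
  have c4: "0 \<le> c4" using C by (simp add: c4_def)
  \<comment> \<open>\<open>g\<close> and \<open>h\<close> majorise the two error sums by functions
    of L alone; both tend to 0, which yields the threshold for L.\<close>
  define g where "g L = K2 * (L * exp (- L)) + 4 * c3 * (1 / L) + 4 * K2 * A1 * (L ^ 3 * exp (- L))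
    + 4 * K2 * A2 * (L ^ 4 * exp (- L)) + K2 * (L * exp (L - L\<^sup>2 / 2))" for L :: real
  define h where "h L = 2 * sqrt (1 / L) + (K2 + 2 + c4) * (L * exp (- L))" for L :: real
  have lims: "((\<lambda>L::real. L * exp (- L)) \<longlongrightarrow> 0) at_top" "((\<lambda>L::real. 1 / L) \<longlongrightarrow> 0) at_top"
    "((\<lambda>L::real. L ^ 3 * exp (- L)) \<longlongrightarrow> 0) at_top" "((\<lambda>L::real. L ^ 4 * exp (- L)) \<longlongrightarrow> 0) at_top"
    "((\<lambda>L::real. L * exp (L - L\<^sup>2 / 2)) \<longlongrightarrow> 0) at_top" "((\<lambda>L::real. sqrt (1 / L)) \<longlongrightarrow> 0) at_top"
    by real_asymp+
  have "(g \<longlongrightarrow> 0) at_top"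
    unfolding g_def[abs_def] by (intro tendsto_add_zero tendsto_mult_right_zero lims)
  then have ev_g: "\<forall>\<^sub>F L in at_top. g L < \<epsilon>" using \<epsilon> by (rule order_tendstoD(2))
  have "(h \<longlongrightarrow> 0) at_top"
    unfolding h_def[abs_def] by (intro tendsto_add_zero tendsto_mult_right_zero lims)
  then have ev_h: "\<forall>\<^sub>F L in at_top. h L < \<epsilon>" using \<epsilon> by (rule order_tendstoD(2))
  obtain L1 where L1: "\<And>L. L1 \<le> L \<Longrightarrow> g L < \<epsilon> \<and> h L < \<epsilon>"
    using eventually_conj[OF ev_g ev_h] unfolding eventually_at_top_linorder by blast
  show ?thesis
  proof (intro exI[of _ "max 1 L1"] conjI allI impI)
    fix N t0 :: real
    assume N: "0 < N" and L: "max 1 L1 \<le> ln N" and t0: "0 \<le> t0" "t0 \<le> K * ln N"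
    define L where "L = ln N"
    have L1': "1 \<le> L" "L1 \<le> L" using L by (auto simp: L_def)
    have NL: "N = exp L" using N by (simp add: L_def)
    have N1: "1 \<le> N" unfolding NL using L1' by simp
    define s where "s = C * real (2 * dim + 3) * ln L"
    define R where "R = nat \<lceil>c1 * L\<rceil>"
    define k1 where "k1 = nat \<lceil>N * t0 + 3 * N\<rceil>"
    define l where "l = nat \<lceil>N * s\<rceil>"
    define D where "D = L ^ (2 * dim + 2)"
    have D_ge: "L\<^sup>2 \<le> D" unfolding D_def using L1' by (intro power_increasing) auto
    then have D1: "1 \<le> D" using L1' one_le_power[of L 2] by linarith
    have s0: "0 \<le> s" using C L1' by (simp add: s_def)
    have R_ge: "c1 * L \<le> real R" and R_le: "real R \<le> c1 * L + 1"
      unfolding R_def using c1_pos L1' by (auto intro!: real_nat_ceiling_ge less_imp_le simp: of_nat_ceiling)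
    have k1_ge: "N * t0 + 3 * N \<le> real k1" unfolding k1_def by (rule real_nat_ceiling_ge)
    have Nt0: "0 \<le> N * t0" using N t0 by simp
    have k1_le: "real k1 \<le> N * t0 + 4 * N"
      using of_nat_ceiling[of "N * t0 + 3 * N"] Nt0 N1 unfolding k1_def by linarith
    have l_ge: "N * s \<le> real l" unfolding l_def by (rule real_nat_ceiling_ge)
    have l_le: "real l \<le> N * s + N"
      using of_nat_ceiling[of "N * s"] s0 N1 mult_nonneg_nonneg[of N s] unfolding l_def by linarith
    have t0L: "t0 + 4 \<le> K2 * L" using t0 L1' by (simp add: K2_def L_def distrib_right)
    have k1N: "real k1 / N \<le> K2 * L"
    proof -
      have "real k1 / N \<le> (N * t0 + 4 * N) / N" using k1_le N by (intro divide_right_mono) auto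
      also have "\<dots> = t0 + 4" using N by (simp add: add_divide_distrib)
      finally show ?thesis using t0L by simp
    qed
    have k1': "real k1 \<le> K2 * L * exp L" using k1N N by (simp add: NL pos_divide_le_eq)
    have T1: "t0 / N \<le> K2 * (L * exp (- L))"
    proof -
      have "t0 / N \<le> K2 * L / N" using t0L N by (intro divide_right_mono) auto
      then show ?thesis by (simp add: NL exp_minus divide_inverse)
    qed
    have ball: "real ((2 * R + 1) ^ dim) \<le> c2 ^ dim * L ^ dim" "real R \<le> c2 * L"
    proof -
      have "real (2 * R + 1) \<le> c2 * L" using R_le L1' by (simp add: c2_def distrib_right)
      then have "real (2 * R + 1) ^ dim \<le> (c2 * L) ^ dim" by (rule power_mono) simp
      then show "real ((2 * R + 1) ^ dim) \<le> c2 ^ dim * L ^ dim" by (simp only: of_nat_power power_mult_distrib)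
      show "real R \<le> c2 * L" using R_le L1' c1_pos by (simp add: c2_def distrib_right)
    qed
    have c2_1: "1 \<le> c2" using c1_pos by (simp add: c2_def)
    have T2: "4 * (P * real R * (2 + real ((2 * R + 1) ^ dim) * lp) * C * real ((2 * R + 1) ^ dim)) / D \<le> 4 * c3 * (1 / L)"
    proof -
      have one: "1 \<le> c2 ^ dim * L ^ dim"
        using one_le_power[OF c2_1, of dim] one_le_power[OF L1'(1), of dim] by (simp add: mult_ge1_I)
      have "2 + real ((2 * R + 1) ^ dim) * lp \<le> 2 * (c2 ^ dim * L ^ dim) + (c2 ^ dim * L ^ dim) * lp"
        using one ball(1) lp by (intro add_mono mult_right_mono) auto
      also have "\<dots> = (2 + lp) * (c2 ^ dim * L ^ dim)" by (simp add: distrib_right)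
      finally have two: "2 + real ((2 * R + 1) ^ dim) * lp \<le> (2 + lp) * (c2 ^ dim * L ^ dim)" .
      have "P * real R * (2 + real ((2 * R + 1) ^ dim) * lp) * C * real ((2 * R + 1) ^ dim)
        \<le> P * (c2 * L) * ((2 + lp) * (c2 ^ dim * L ^ dim)) * C * (c2 ^ dim * L ^ dim)"
        using two ball P lp C L1' c2_1 by (intro mult_mono mult_nonneg_nonneg add_nonneg_nonneg) auto
      also have "\<dots> = c3 * L ^ (2 * dim + 1)"
      proof -
        have "L ^ (2 * dim + 1) = L ^ dim * L ^ dim * L" by (simp add: mult_2 power_add)
        then show ?thesis unfolding c3_def by (simp only: mult_ac)
      qed
      finally have "4 * (P * real R * (2 + real ((2 * R + 1) ^ dim) * lp) * C * real ((2 * R + 1) ^ dim)) / D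
        \<le> 4 * (c3 * L ^ (2 * dim + 1)) / D"
        using D1 by (intro divide_right_mono) auto
      also have "\<dots> = 4 * c3 * (1 / L)" using L1' by (simp add: D_def)
      finally show ?thesis .
    qed
    have lnNp: "0 \<le> ln (N / p)" "ln (N / p) \<le> K3 * L"
    proof -
      have "ln (N / p) = L + lp" using N p by (simp add: L_def lp_def ln_div)
      moreover have "lp * 1 \<le> lp * L" using lp L1' by (intro mult_left_mono) auto
      ultimately show "0 \<le> ln (N / p)" "ln (N / p) \<le> K3 * L" using lp L1' by (simp_all add: K3_def distrib_right)
    qed
    have "(N * ln (N / p))\<^sup>2 \<le> (exp L * (K3 * L))\<^sup>2"
      using lnNp N by (intro power_mono mult_mono) (auto simp: NL)
    also have "\<dots> = K3\<^sup>2 * L\<^sup>2 * exp (2 * L)" by (simp add: power_mult_distrib exp_double)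
    finally have sq: "(N * ln (N / p))\<^sup>2 \<le> K3\<^sup>2 * L\<^sup>2 * exp (2 * L)" .
    have half: "(1 / 2) ^ R \<le> exp (- (4 + K2) * L)"
    proof -
      have "(4 + K2) * L \<le> (c1 * ln 2) * L" using c1 L1' by (intro mult_right_mono) auto
      also have "\<dots> = (c1 * L) * ln 2" by simp
      also have "\<dots> \<le> real R * ln 2" using R_ge by (intro mult_right_mono) auto
      finally have "exp (- (real R * ln 2)) \<le> exp (- (4 + K2) * L)"
        by (simp only: exp_le_cancel_iff mult_minus_left neg_le_iff_le)
      moreover have "exp (- (real R * ln 2)) = ((1::real) / 2) ^ R"
        by (simp add: exp_minus exp_of_nat_mult power_one_over inverse_eq_divide)
      ultimately show ?thesis by simp
    qed
    \<comment> \<open>As \<open>k1 / N\<close> is at most \<open>K2 * L\<close>, doubling the weight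
      of one site costs only a power of \<open>N\<close>.\<close>
    have growth: "(1 + 1 / N) ^ k1 \<le> exp (K2 * L)"
    proof -
      have "(1 + 1 / N) ^ k1 \<le> exp (1 / N) ^ k1" using N by (intro power_mono exp_ge_add_one_self) auto
      also have "\<dots> = exp (real k1 / N)" by (simp flip: exp_of_nat_mult)
      also have "\<dots> \<le> exp (K2 * L)" using k1N by simp
      finally show ?thesis .
    qed
    have decay: "(\<alpha> ^ (R + 1))\<^sup>2 \<le> exp (- 4 * L)"
    proof -
      have "\<alpha> ^ (R + 1) \<le> \<alpha> ^ R" using \<alpha> by (intro power_decreasing) auto
      also have "\<dots> = exp (- (real R * v))"
        using \<alpha> by (simp add: v_def ln_div exp_of_nat_mult)
      also have "\<dots> \<le> exp (- 2 * L)"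
      proof -
        have "2 * L \<le> (c1 * v) * L" using c1 L1' by (intro mult_right_mono) auto
        also have "\<dots> = (c1 * L) * v" by simp
        also have "\<dots> \<le> real R * v" using R_ge v by (intro mult_right_mono) auto
        finally show ?thesis by simp
      qed
      finally have "(\<alpha> ^ (R + 1))\<^sup>2 \<le> (exp (- 2 * L))\<^sup>2" using \<alpha> by (intro power_mono) auto
      then show ?thesis by (simp flip: exp_double)
    qed
    let ?e1 = "P * N * (1 / 2) ^ R * (1 + 1 / N) ^ k1 * (4 * (N * ln (N / p))\<^sup>2)"
    let ?e2 = "real k1 * (8 * (N * ln (N / p))\<^sup>2 * (\<alpha> ^ (R + 1))\<^sup>2)"
    have e1: "?e1 \<le> A1 * (L\<^sup>2 * exp (- L))"
    proof -
      have "?e1 \<le> P * exp L * exp (- (4 + K2) * L) * exp (K2 * L) * (4 * (K3\<^sup>2 * L\<^sup>2 * exp (2 * L)))"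
        using half growth sq P N by (intro mult_mono mult_nonneg_nonneg) (auto simp: NL)
      also have "\<dots> = P * (4 * K3\<^sup>2) * (L\<^sup>2 * (exp L * exp (- (4 + K2) * L) * exp (K2 * L) * exp (2 * L)))"
        by (simp only: mult_ac)
      also have "exp L * exp (- (4 + K2) * L) * exp (K2 * L) * exp (2 * L) = exp (- L)"
        unfolding exp_add[symmetric] by (rule arg_cong[of _ _ exp]) (simp add: algebra_simps)
      finally show ?thesis by (simp add: A1_def)
    qed
    have e2: "?e2 \<le> A2 * (L ^ 3 * exp (- L))"
    proof -
      have "?e2 \<le> K2 * L * exp L * (8 * (K3\<^sup>2 * L\<^sup>2 * exp (2 * L)) * exp (- 4 * L))"
        using k1' sq decay K2 L1' by (intro mult_mono mult_nonneg_nonneg) auto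
      also have "\<dots> = K2 * (8 * K3\<^sup>2) * ((L * L\<^sup>2) * (exp L * exp (2 * L) * exp (- 4 * L)))"
        by (simp only: mult_ac)
      also have "exp L * exp (2 * L) * exp (- 4 * L) = exp (- L)"
        unfolding exp_add[symmetric] by (rule arg_cong[of _ _ exp]) simp
      finally show ?thesis by (simp add: A2_def power3_eq_cube power2_eq_square)
    qed
    have T3: "4 * (real k1 / N) * (?e1 + ?e2) / D\<^sup>2 \<le> 4 * K2 * A1 * (L ^ 3 * exp (- L)) + 4 * K2 * A2 * (L ^ 4 * exp (- L))"
    proof -
      have nn: "0 \<le> ?e1 + ?e2" using P N by (intro add_nonneg_nonneg mult_nonneg_nonneg) auto
      have "4 * (real k1 / N) * (?e1 + ?e2) / D\<^sup>2 \<le> 4 * (real k1 / N) * (?e1 + ?e2) / 1"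
        using nn N D1 one_le_power[OF D1, of 2] by (intro divide_left_mono mult_nonneg_nonneg) auto
      also have "\<dots> \<le> 4 * (K2 * L) * (A1 * (L\<^sup>2 * exp (- L)) + A2 * (L ^ 3 * exp (- L))) / 1"
        by (rule divide_right_mono[OF mult_mono[OF mult_left_mono[OF k1N] add_mono[OF e1 e2]]]) (use nn K2 L1' in auto)
      also have "\<dots> = 4 * K2 * A1 * (L ^ 3 * exp (- L)) + 4 * K2 * A2 * (L ^ 4 * exp (- L))"
        by (simp add: algebra_simps power2_eq_square power3_eq_cube power4_eq_xxxx)
      finally show ?thesis .
    qed
    have T4: "real k1 * exp (- D / 2) \<le> K2 * (L * exp (L - L\<^sup>2 / 2))"
    proof -
      have "real k1 * exp (- D / 2) \<le> K2 * L * exp L * exp (- L\<^sup>2 / 2)"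
        using k1' D_ge K2 L1' by (intro mult_mono) auto
      also have "\<dots> = K2 * (L * (exp L * exp (- L\<^sup>2 / 2)))" by (simp only: mult_ac)
      also have "exp L * exp (- L\<^sup>2 / 2) = exp (L - L\<^sup>2 / 2)" by (simp flip: exp_add)
      finally show ?thesis .
    qed
    have c5: "0 < D" "N * t0 + 3 * N \<le> real k1" using D1 k1_ge by auto
    have c6: "t0 / N + 4 * (P * real R * (2 + real ((2 * R + 1) ^ dim) * lp) * C * real ((2 * R + 1) ^ dim)) / D
        + 4 * (real k1 / N) * (?e1 + ?e2) / D\<^sup>2 + real k1 * exp (- D / 2) < \<epsilon>"
    proof -
      have "g L < \<epsilon>" using L1 L1' by blast
      then show ?thesis using T1 T2 T3 T4 unfolding g_def by linarith
    qed
    have c7: "real (k1 + l) + N \<le> N * (t0 + (6 + C * real (2 * dim + 3) * ln (ln N)))"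
      using k1_le l_le by (simp add: s_def L_def[symmetric] distrib_left)
    have c8: "2 * sqrt (exp (- real l / (C * N)) * D) + (t0 + (6 + C * real (2 * dim + 3) * ln (ln N))) / N \<le> \<epsilon>"
    proof -
      have "s / C = N * s / (C * N)" using N by simp
      also have "\<dots> \<le> real l / (C * N)" using l_ge C N by (intro divide_right_mono) auto
      finally have "exp (- real l / (C * N)) \<le> exp (- (s / C))" by simp
      also have "s / C = real (2 * dim + 3) * ln L" using C by (simp add: s_def)
      also have "exp (- (real (2 * dim + 3) * ln L)) = 1 / L ^ (2 * dim + 3)"
        using L1' by (simp only: exp_minus exp_of_nat_mult) (simp add: inverse_eq_divide)
      finally have "exp (- real l / (C * N)) * D \<le> 1 / L ^ (2 * dim + 3) * D"
        using D1 by (intro mult_right_mono) auto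
      also have "\<dots> = 1 / L" using L1' by (simp add: D_def numeral_3_eq_3)
      finally have sq: "2 * sqrt (exp (- real l / (C * N)) * D) \<le> 2 * sqrt (1 / L)" by simp
      have "ln L \<le> L" using L1' ln_bound[of L] by simp
      then have "c4 * ln L \<le> c4 * L" using c4 by (rule mult_left_mono)
      then have "t0 + (6 + c4 * ln L) \<le> (K2 + 2 + c4) * L"
        using t0L L1' by (simp add: distrib_right)
      then have "(t0 + (6 + c4 * ln L)) / N \<le> (K2 + 2 + c4) * L / N" using N by (intro divide_right_mono) auto
      also have "\<dots> = (K2 + 2 + c4) * (L * exp (- L))" by (simp add: NL exp_minus divide_inverse)
      finally have "(t0 + (6 + c4 * ln L)) / N \<le> (K2 + 2 + c4) * (L * exp (- L))" .
      moreover have "h L < \<epsilon>" using L1 L1' by blast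
      ultimately show ?thesis using sq unfolding h_def c4_def L_def by linarith
    qed
    show "\<exists>R M k1 l D. 0 < D \<and> N * t0 + 3 * N \<le> real k1 \<and>
      t0 / N + 4 * ((4 + 4 / p) * real M * (2 + real ((2 * R + 1) ^ dim) * ln (1 / p)) * C * real ((2 * R + 1) ^ dim)) / D
        + 4 * (real k1 / N) * ((4 + 4 / p) * N * (1 / 2) ^ M * (1 + 1 / N) ^ k1 * (4 * (N * ln (N / p))\<^sup>2)
          + real k1 * (8 * (N * ln (N / p))\<^sup>2 * (\<alpha> ^ (R + 1))\<^sup>2)) / D\<^sup>2
        + real k1 * exp (- D / 2) < \<epsilon> \<and>
      real (k1 + l) + N \<le> N * (t0 + (6 + C * real (2 * dim + 3) * ln (ln N))) \<and>
      2 * sqrt (exp (- real l / (C * N)) * D) + (t0 + (6 + C * real (2 * dim + 3) * ln (ln N))) / N \<le> \<epsilon>"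
      by (intro exI[of _ R] exI[of _ k1] exI[of _ l] exI[of _ D] conjI c5 c6[unfolded P_def lp_def] c7 c8)
  qed simp
qed

text \<open>The window bounds at \<epsilon> and at 1 - \<epsilon> together are two-sided. The lower
  bound of order ln n is given at 1 / e only; with \<delta> = min \<epsilon> (1 / e), monotonicity
  and the window at \<delta> carry it over to 1 - \<epsilon>, so that the ratio tends to 1.\<close>

lemma cutoff_criterion:
  fixes T :: "nat \<Rightarrow> real \<Rightarrow> real"
  assumes lower: "0 < c" "\<forall>\<^sub>F n in sequentially. c * ln (real n) \<le> T n (1 / exp 1)"
    and mono: "\<forall>\<^sub>F n in sequentially. \<forall>\<epsilon> \<epsilon>'. 0 < \<epsilon> \<longrightarrow> \<epsilon> \<le> \<epsilon>' \<longrightarrow> \<epsilon>' < 1 \<longrightarrow> T n \<epsilon>' \<le> T n \<epsilon>"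
    and window: "\<And>\<epsilon>. 0 < \<epsilon> \<Longrightarrow> \<epsilon> < 1 \<Longrightarrow> \<exists>C. \<forall>\<^sub>F n in sequentially. T n \<epsilon> \<le> T n (1 - \<epsilon>) + C * ln (ln (real n))"
  shows "cutoff_with_window T (\<lambda>n. ln (ln (real n)))"
proof -
  let ?w = "\<lambda>n. ln (ln (real n))"
  have w_pos: "\<forall>\<^sub>F n in sequentially. 0 < ?w n" by real_asymp
  have ln_pos: "\<forall>\<^sub>F n in sequentially. 0 < ln (real n)" by real_asymp
  have e: "0 < 1 / exp (1::real)" "1 / exp (1::real) < 1" by auto
  have diff: "\<exists>C\<ge>0. \<forall>\<^sub>F n in sequentially. \<bar>T n \<epsilon> - T n (1 - \<epsilon>)\<bar> \<le> C * ?w n" if \<epsilon>: "0 < \<epsilon>" "\<epsilon> < 1" for \<epsilon>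
  proof -
    obtain C where C: "\<forall>\<^sub>F n in sequentially. T n \<epsilon> \<le> T n (1 - \<epsilon>) + C * ?w n" using window[OF \<epsilon>] by blast
    obtain C' where C': "\<forall>\<^sub>F n in sequentially. T n (1 - \<epsilon>) \<le> T n (1 - (1 - \<epsilon>)) + C' * ?w n"
      using window[of "1 - \<epsilon>"] \<epsilon> by auto
    have "1 - (1 - \<epsilon>) = \<epsilon>" by simp
    note C' = C'[unfolded this]
    have "\<forall>\<^sub>F n in sequentially. \<bar>T n \<epsilon> - T n (1 - \<epsilon>)\<bar> \<le> (\<bar>C\<bar> + \<bar>C'\<bar>) * ?w n"
      using C C' w_pos
    proof eventually_elim
      case (elim n)
      have "C * ?w n \<le> \<bar>C\<bar> * ?w n" "C' * ?w n \<le> \<bar>C'\<bar> * ?w n"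
        by (rule mult_right_mono; use elim(3) in simp)+
      moreover have "0 \<le> \<bar>C\<bar> * ?w n" "0 \<le> \<bar>C'\<bar> * ?w n" using elim(3) by simp_all
      ultimately show ?case using elim(1,2) unfolding distrib_right by (intro abs_leI) linarith+
    qed
    then show ?thesis by (intro exI[of _ "\<bar>C\<bar> + \<bar>C'\<bar>"]) auto
  qed
  have o_ln: "?w \<in> o(\<lambda>n. ln (real n))" by real_asymp
  have "(\<lambda>n. ln (real n)) \<in> O(\<lambda>n. T n (1 / exp 1))"
  proof (rule bigoI[of _ "1 / c"])
    show "\<forall>\<^sub>F n in sequentially. norm (ln (real n)) \<le> 1 / c * norm (T n (1 / exp 1))"
      using lower(2) ln_pos by eventually_elim (use lower(1) in \<open>auto simp: field_simps\<close>)
  qed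
  then have small: "?w \<in> o(\<lambda>n. T n (1 / exp 1))" by (rule landau_o.small_big_trans[OF o_ln])
  have "(\<lambda>n. T n \<epsilon> - T n (1 - \<epsilon>)) \<in> O(?w)" if \<epsilon>: "0 < \<epsilon>" "\<epsilon> < 1" for \<epsilon>
  proof -
    obtain C where C: "\<forall>\<^sub>F n in sequentially. \<bar>T n \<epsilon> - T n (1 - \<epsilon>)\<bar> \<le> C * ?w n" using diff[OF \<epsilon>] by blast
    show ?thesis
      by (rule bigoI[of _ C]) (use C w_pos in \<open>eventually_elim, simp\<close>)
  qed
  then have "has_window T ?w" using small by (auto simp: has_window_def)
  moreover have "(\<lambda>n. T n \<epsilon> / T n (1 - \<epsilon>)) \<longlonglongrightarrow> 1" if \<epsilon>: "0 < \<epsilon>" "\<epsilon> < 1" for \<epsilon>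
  proof -
    define \<delta> where "\<delta> = min \<epsilon> (1 / exp 1)"
    have \<delta>: "0 < \<delta>" "\<delta> < 1" "1 - \<epsilon> \<le> 1 - \<delta>" "\<delta> \<le> 1 / exp 1" using \<epsilon> e by (auto simp: \<delta>_def)
    obtain C where C: "0 \<le> C" "\<forall>\<^sub>F n in sequentially. \<bar>T n \<epsilon> - T n (1 - \<epsilon>)\<bar> \<le> C * ?w n" using diff[OF \<epsilon>] by blast
    obtain C' where C': "0 \<le> C'" "\<forall>\<^sub>F n in sequentially. \<bar>T n \<delta> - T n (1 - \<delta>)\<bar> \<le> C' * ?w n" using diff[OF \<delta>(1,2)] by blast
    have "(\<lambda>n. ?w n / ln (real n)) \<longlonglongrightarrow> 0" by real_asymp
    then have "(\<lambda>n. C' * (?w n / ln (real n))) \<longlonglongrightarrow> 0" by (rule tendsto_mult_right_zero)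
    then have "\<forall>\<^sub>F n in sequentially. C' * (?w n / ln (real n)) < c / 2" using lower(1) by (intro order_tendstoD(2)) auto
    then have big: "\<forall>\<^sub>F n in sequentially. c / 2 * ln (real n) \<le> T n (1 - \<epsilon>)"
      using lower(2) mono C'(2) ln_pos
    proof eventually_elim
      case (elim n)
      have "C' * ?w n < c / 2 * ln (real n)" using elim(1,5) by (simp add: pos_divide_less_eq)
      moreover have "T n (1 - \<delta>) \<le> T n (1 - \<epsilon>)" "T n (1 / exp 1) \<le> T n \<delta>"
        using elim(3) \<delta> \<epsilon> e by auto
      moreover have "T n \<delta> - T n (1 - \<delta>) \<le> C' * ?w n" using elim(4) by simp
      moreover have "c * ln (real n) = c / 2 * ln (real n) + c / 2 * ln (real n)" by simp
      ultimately show ?case using elim(2) by linarith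
    qed
    have "(\<lambda>n. T n \<epsilon> / T n (1 - \<epsilon>) - 1) \<longlonglongrightarrow> 0"
    proof (rule Lim_null_comparison)
      show "\<forall>\<^sub>F n in sequentially. norm (T n \<epsilon> / T n (1 - \<epsilon>) - 1) \<le> C * (2 / c) * (?w n / ln (real n))"
        using big C(2) ln_pos w_pos
      proof eventually_elim
        case (elim n)
        have pos: "0 < c / 2 * ln (real n)" using elim(3) lower(1) by simp
        then have T: "0 < T n (1 - \<epsilon>)" using elim(1) by linarith
        then have "T n \<epsilon> / T n (1 - \<epsilon>) - 1 = (T n \<epsilon> - T n (1 - \<epsilon>)) / T n (1 - \<epsilon>)"
          by (simp add: diff_divide_distrib)
        then have "norm (T n \<epsilon> / T n (1 - \<epsilon>) - 1) = \<bar>T n \<epsilon> - T n (1 - \<epsilon>)\<bar> / T n (1 - \<epsilon>)"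
          using T by (simp only: real_norm_def abs_divide abs_of_pos)
        also have "\<dots> \<le> C * ?w n / (c / 2 * ln (real n))"
          using elim pos T C(1) by (intro frac_le) auto
        finally show ?case by (simp add: mult_ac)
      qed
      have "(\<lambda>n. ?w n / ln (real n)) \<longlonglongrightarrow> 0" by real_asymp
      then show "(\<lambda>n. C * (2 / c) * (?w n / ln (real n))) \<longlonglongrightarrow> 0" by (rule tendsto_mult_right_zero)
    qed
    then show ?thesis by (simp add: LIM_zero_iff)
  qed
  ultimately show ?thesis by (simp add: cutoff_with_window_def cutoff_def)
qed

lemma (in gibbs) mixed_mono: "mixed t \<epsilon> \<Longrightarrow> \<epsilon> \<le> \<epsilon>' \<Longrightarrow> mixed t \<epsilon>'"
  unfolding mixed_def by (meson order_trans)

lemma (in dobrushin) mixed_upper: "0 \<le> t \<Longrightarrow> mixed t (N * exp (- (1 - \<alpha>) * t))"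
  unfolding mixed_def using pt_event_diff by blast

lemma (in dobrushin) mixed_lower:
  assumes "2 \<le> card Q" "2 \<le> N" "0 \<le> t" "mixed t \<epsilon>"
  shows "1 - 4 * (2 * (N / (1 - \<alpha>)) + 2 * (N * t) + 2) / (N * p\<^sup>2 * exp (- t) / 2)\<^sup>2 \<le> \<epsilon>"
proof -
  obtain \<sigma> A where \<sigma>: "\<sigma> \<in> \<Omega>" "1 - 4 * (2 * (N / (1 - \<alpha>)) + 2 * (N * t) + 2) / (N * p\<^sup>2 * exp (- t) / 2)\<^sup>2
      \<le> pt t (\<lambda>\<eta>. of_bool (\<eta> \<in> A)) \<sigma> - EE (\<lambda>\<eta>. of_bool (\<eta> \<in> A))"
    using exists_separating_event[OF assms(1-3)] by blast
  have "\<bar>pt t (\<lambda>\<eta>. of_bool (\<eta> \<in> A)) \<sigma> - EE (\<lambda>\<eta>. of_bool (\<eta> \<in> A))\<bar> \<le> \<epsilon>"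
    using assms(4) \<sigma>(1) unfolding mixed_def by blast
  then show ?thesis using \<sigma>(2) by linarith
qed

text \<open>The constants are chosen before the model: the statement ranges over all instances with
  given \<alpha>, \<open>p\<close>, \<open>dim\<close> and number of colors, because the box and its
  boundary condition vary with n.\<close>

lemma mixed_window:
  fixes \<alpha> p \<epsilon> K :: real and dim m :: nat
  assumes \<alpha>: "0 < \<alpha>" "\<alpha> < 1" and p: "0 < p" "p \<le> 1" and \<epsilon>: "0 < \<epsilon>" and K: "0 \<le> K" and m: "0 < m"
  shows "\<exists>C\<ge>0. \<exists>L\<^sub>0\<ge>1. \<forall>\<Lambda> Q w nb \<rho> dst t0. spatial_dobrushin \<Lambda> Q w nb \<rho> \<alpha> p dst dim \<longrightarrow> card Q = m \<longrightarrow>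
    L\<^sub>0 \<le> ln (real (card \<Lambda>)) \<longrightarrow> 0 \<le> t0 \<longrightarrow> t0 \<le> K * ln (real (card \<Lambda>)) \<longrightarrow> gibbs.mixed \<Lambda> Q w t0 (1 - \<epsilon>) \<longrightarrow>
    gibbs.mixed \<Lambda> Q w (t0 + (6 + C * ln (ln (real (card \<Lambda>))))) \<epsilon>"
proof -
  define C where "C = 4 * real m / (p * (1 - \<alpha>)\<^sup>2)"
  have C: "0 < C" using m p \<alpha> by (simp add: C_def)
  obtain L0 where L0: "1 \<le> L0" and par: "\<forall>N t0. 0 < N \<longrightarrow> L0 \<le> ln N \<longrightarrow> 0 \<le> t0 \<longrightarrow> t0 \<le> K * ln N \<longrightarrow>
    (\<exists>R M k1 l D. 0 < D \<and> N * t0 + 3 * N \<le> real k1 \<and>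
      t0 / N + 4 * ((4 + 4 / p) * real M * (2 + real ((2 * R + 1) ^ dim) * ln (1 / p)) * C * real ((2 * R + 1) ^ dim)) / D
        + 4 * (real k1 / N) * ((4 + 4 / p) * N * (1 / 2) ^ M * (1 + 1 / N) ^ k1 * (4 * (N * ln (N / p))\<^sup>2)
          + real k1 * (8 * (N * ln (N / p))\<^sup>2 * (\<alpha> ^ (R + 1))\<^sup>2)) / D\<^sup>2
        + real k1 * exp (- D / 2) < \<epsilon> \<and>
      real (k1 + l) + N \<le> N * (t0 + (6 + C * real (2 * dim + 3) * ln (ln N))) \<and>
      2 * sqrt (exp (- real l / (C * N)) * D) + (t0 + (6 + C * real (2 * dim + 3) * ln (ln N))) / N \<le> \<epsilon>)"
    using window_parameters[OF \<alpha> p \<epsilon> C K, of dim] by blast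
  have "gibbs.mixed \<Lambda> Q w (t0 + (6 + C * real (2 * dim + 3) * ln (ln (real (card \<Lambda>))))) \<epsilon>"
    if loc: "spatial_dobrushin \<Lambda> Q w nb \<rho> \<alpha> p dst dim" and Q: "card Q = m" and L: "L0 \<le> ln (real (card \<Lambda>))"
      and t0: "0 \<le> t0" "t0 \<le> K * ln (real (card \<Lambda>))" and mx: "gibbs.mixed \<Lambda> Q w t0 (1 - \<epsilon>)"
    for \<Lambda> :: "'a set" and Q :: "'b set" and w nb \<rho> dst t0
  proof -
    interpret spatial_dobrushin \<Lambda> Q w nb \<rho> \<alpha> p dst dim by (rule loc)
    have NN: "real (card \<Lambda>) = N" by (simp add: N_def)
    have N0: "0 < N" using N_ge_1 by simp
    have CC: "C\<^sub>T = C" by (simp add: C\<^sub>T_def C_def Q)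
    let ?t1 = "t0 + (6 + C * real (2 * dim + 3) * ln (ln N))"
    obtain R M k1 l D where D: "0 < D" and k1: "N * t0 + 3 * N \<le> real k1" and
      small: "t0 / N + 4 * ((4 + 4 / p) * real M * (2 + real ((2 * R + 1) ^ dim) * ln (1 / p)) * C * real ((2 * R + 1) ^ dim)) / D
        + 4 * (real k1 / N) * ((4 + 4 / p) * N * (1 / 2) ^ M * (1 + 1 / N) ^ k1 * (4 * (N * ln (N / p))\<^sup>2)
          + real k1 * (8 * (N * ln (N / p))\<^sup>2 * (\<alpha> ^ (R + 1))\<^sup>2)) / D\<^sup>2
        + real k1 * exp (- D / 2) < \<epsilon>" and
      l: "real (k1 + l) + N \<le> N * ?t1" and
      last: "2 * sqrt (exp (- real l / (C * N)) * D) + ?t1 / N \<le> \<epsilon>"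
      using par[rule_format, OF N0 L[unfolded NN] t0(1) t0(2)[unfolded NN]] by metis
    have overlap: "pt t0 (\<lambda>\<eta>. of_bool (\<eta> \<in> A)) \<sigma> - EE (\<lambda>\<eta>. of_bool (\<eta> \<in> A)) \<le> 1 - \<epsilon>" if "\<sigma> \<in> \<Omega>" for \<sigma> A
      using mx that abs_le_D1 unfolding mixed_def by blast
    have "0 \<le> ln (ln N)" using L L0 by (simp add: NN)
    then have t1: "0 \<le> ?t1" using t0 C by simp
    show ?thesis
      unfolding mixed_def NN
      by (intro ballI allI mixing_after_overlap[OF t0(1) D t1 overlap k1 _ l, where R=R and M=M])
        (use small last in \<open>simp_all only: K\<^sub>V_def err_def CC\<close>)
  qed
  then show ?thesis using L0 C by (intro exI[of _ "C * real (2 * dim + 3)"] conjI exI[of _ L0]) auto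
qed

text \<open>Abstracts from the model: \<open>mx n t \<epsilon>\<close> stands for the n-th chain
  being within \<epsilon> of equilibrium at time \<open>t\<close>. The upper bound puts the relevant
  times into the range where the window estimate applies, and the lower bound supplies the order ln
  n.\<close>

lemma cutoff_of_mixed:
  fixes mx :: "nat \<Rightarrow> real \<Rightarrow> real \<Rightarrow> bool" and \<alpha> p :: real and dim :: nat
  assumes \<alpha>: "\<alpha> < 1" and p: "0 < p" and dim: "0 < dim"
    and mono: "\<And>n t \<epsilon> \<epsilon>'. 2 \<le> n \<Longrightarrow> mx n t \<epsilon> \<Longrightarrow> \<epsilon> \<le> \<epsilon>' \<Longrightarrow> mx n t \<epsilon>'"
    and upper: "\<And>n t. 2 \<le> n \<Longrightarrow> 0 \<le> t \<Longrightarrow> mx n t (real n ^ dim * exp (- (1 - \<alpha>) * t))"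
    and lower: "\<And>n t \<epsilon>. 2 \<le> n \<Longrightarrow> 0 \<le> t \<Longrightarrow> mx n t \<epsilon> \<Longrightarrow>
      1 - 4 * (2 * (real n ^ dim / (1 - \<alpha>)) + 2 * (real n ^ dim * t) + 2) / (real n ^ dim * p\<^sup>2 * exp (- t) / 2)\<^sup>2 \<le> \<epsilon>"
    and window: "\<And>\<epsilon> K. 0 < \<epsilon> \<Longrightarrow> \<epsilon> < 1 \<Longrightarrow> 0 \<le> K \<Longrightarrow> \<exists>C\<ge>0. \<exists>L\<^sub>0\<ge>1. \<forall>n\<ge>2. \<forall>t0. L\<^sub>0 \<le> ln (real n ^ dim) \<longrightarrow>
      0 \<le> t0 \<longrightarrow> t0 \<le> K * ln (real n ^ dim) \<longrightarrow> mx n t0 (1 - \<epsilon>) \<longrightarrow> mx n (t0 + (6 + C * ln (ln (real n ^ dim)))) \<epsilon>"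
    and T: "\<And>n \<epsilon>. 2 \<le> n \<Longrightarrow> T n \<epsilon> = Inf {t. 0 \<le> t \<and> mx n t \<epsilon>}"
  shows "cutoff_with_window T (\<lambda>n. ln (ln (real n)))"
proof -
  define S where "S n \<epsilon> = {t. 0 \<le> t \<and> mx n t \<epsilon>}" for n \<epsilon>
  have T: "T n \<epsilon> = Inf (S n \<epsilon>)" if "2 \<le> n" for n \<epsilon> using T[OF that] by (simp add: S_def)
  have bdd: "bdd_below (S n \<epsilon>)" for n \<epsilon> by (rule bdd_belowI[of _ 0]) (simp add: S_def)
  have reach: "(ln (real n ^ dim) + ln (1 / \<epsilon>)) / (1 - \<alpha>) \<in> S n \<epsilon>" if n: "2 \<le> n" and \<epsilon>: "0 < \<epsilon>" "\<epsilon> < 1" for n \<epsilon>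
  proof -
    let ?N = "real n ^ dim"
    let ?t = "(ln ?N + ln (1 / \<epsilon>)) / (1 - \<alpha>)"
    have N: "1 \<le> ?N" using n by (intro one_le_power) simp
    have t: "0 \<le> ?t" using N \<epsilon> \<alpha> by (intro divide_nonneg_pos add_nonneg_nonneg) auto
    have "- (1 - \<alpha>) * ?t = - (ln ?N + ln (1 / \<epsilon>))"
      using nonzero_mult_div_cancel_left[of "1 - \<alpha>" "ln ?N + ln (1 / \<epsilon>)"] \<alpha> by (simp only: mult_minus_left times_divide_eq_right) simp
    then have "?N * exp (- (1 - \<alpha>) * ?t) = ?N * (exp (- ln ?N) * exp (- ln (1 / \<epsilon>)))"
      by (simp only: minus_add_distrib exp_add)
    also have "exp (- ln ?N) = 1 / ?N" using N by (simp only: exp_minus inverse_eq_divide) (subst exp_ln; use n in simp)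
    also have "exp (- ln (1 / \<epsilon>)) = \<epsilon>" using \<epsilon> by (simp add: exp_minus)
    also have "?N * (1 / ?N * \<epsilon>) = \<epsilon>" using n by simp
    finally show ?thesis using upper[OF n t] t by (simp add: S_def)
  qed
  have big: "\<forall>\<^sub>F n in sequentially. c \<le> ln (real n ^ dim)" for c
  proof -
    have "filterlim (\<lambda>n. ln (real n)) at_top sequentially" by real_asymp
    then have "\<forall>\<^sub>F n in sequentially. \<bar>c\<bar> \<le> ln (real n)" by (simp add: filterlim_at_top)
    then show ?thesis using eventually_ge_at_top[of 2]
    proof eventually_elim
      case (elim n)
      have "1 * ln (real n) \<le> real dim * ln (real n)" using dim elim(2) by (intro mult_right_mono) auto
      moreover have "ln (real n ^ dim) = real dim * ln (real n)" using elim(2) by (simp add: ln_realpow)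
      ultimately show ?case using elim(1) by linarith
    qed
  qed
  show ?thesis
  proof (rule cutoff_criterion)
    show "0 < real dim / 4" using dim by simp
    define A where "A = 1 / (1 - \<alpha>)"
    define B where "B = p\<^sup>2"
    have AB: "0 < A" "0 < B" using \<alpha> p by (auto simp: A_def B_def)
    \<comment> \<open>At time (ln x) / 4 the squared separation is of order x ^ (3 / 2) and beats
      the variance of order x * ln x; any factor below 1 / 2 in place of 1 / 4 would do.\<close>
    define F where "F x = 4 * (2 * (x * A) + 2 * (x * (ln x / 4)) + 2) / (x * B * exp (- (ln x / 4)) / 2)\<^sup>2" for x :: real
    have F: "(F \<longlongrightarrow> 0) at_top" unfolding F_def[abs_def] using AB by real_asymp
    have "filterlim (\<lambda>n. real n ^ dim) at_top sequentially"
      using dim by (intro filterlim_pow_at_top filterlim_real_sequentially) auto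
    then have "(\<lambda>n. F (real n ^ dim)) \<longlonglongrightarrow> 0" by (rule filterlim_compose[OF F])
    then have "\<forall>\<^sub>F n in sequentially. F (real n ^ dim) < 1 - 1 / exp 1" by (rule order_tendstoD(2)) simp
    then show "\<forall>\<^sub>F n in sequentially. real dim / 4 * ln (real n) \<le> T n (1 / exp 1)"
      using eventually_ge_at_top[of 2]
    proof eventually_elim
      case (elim n)
      note n = elim(2)
      let ?N = "real n ^ dim"
      have N: "1 \<le> ?N" using n by (intro one_le_power) simp
      have "ln ?N / 4 \<le> t" if "t \<in> S n (1 / exp 1)" for t
      proof (rule ccontr)
        assume less: "\<not> ln ?N / 4 \<le> t"
        have t: "0 \<le> t" "mx n t (1 / exp 1)" using that by (auto simp: S_def)
        have "4 * (2 * (?N / (1 - \<alpha>)) + 2 * (?N * t) + 2) / (?N * p\<^sup>2 * exp (- t) / 2)\<^sup>2 \<le> F ?N"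
          unfolding F_def A_def B_def
          using n N less p \<alpha> t(1)
          by (intro frac_le power_mono divide_right_mono mult_left_mono add_mono)
            (auto intro!: add_nonneg_nonneg divide_nonneg_pos)
        then show False using lower[OF n t] elim(1) by simp
      qed
      moreover have "S n (1 / exp 1) \<noteq> {}" using reach[OF n, of "1 / exp 1"] by auto
      ultimately have "ln ?N / 4 \<le> T n (1 / exp 1)" unfolding T[OF n] by (intro cInf_greatest)
      then show ?case using n by (simp add: ln_realpow)
    qed
    show "\<forall>\<^sub>F n in sequentially. \<forall>\<epsilon> \<epsilon>'. 0 < \<epsilon> \<longrightarrow> \<epsilon> \<le> \<epsilon>' \<longrightarrow> \<epsilon>' < 1 \<longrightarrow> T n \<epsilon>' \<le> T n \<epsilon>"
      using eventually_ge_at_top[of 2]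
    proof eventually_elim
      case (elim n)
      show ?case
      proof (intro allI impI)
        fix \<epsilon> \<epsilon>' :: real assume e: "0 < \<epsilon>" "\<epsilon> \<le> \<epsilon>'" "\<epsilon>' < 1"
        have "S n \<epsilon> \<subseteq> S n \<epsilon>'" using mono[OF elim _ e(2)] by (auto simp: S_def)
        moreover have "S n \<epsilon> \<noteq> {}" using reach[OF elim, of \<epsilon>] e by auto
        ultimately show "T n \<epsilon>' \<le> T n \<epsilon>" unfolding T[OF elim] by (intro cInf_superset_mono bdd)
      qed
    qed
    show "\<exists>C. \<forall>\<^sub>F n in sequentially. T n \<epsilon> \<le> T n (1 - \<epsilon>) + C * ln (ln (real n))" if \<epsilon>: "0 < \<epsilon>" "\<epsilon> < 1" for \<epsilon>
    proof -
      define lb where "lb = ln (1 / (1 - \<epsilon>))"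
      have lb: "0 \<le> lb" using \<epsilon> by (simp add: lb_def)
      \<comment> \<open>\<open>K - 1\<close> comes from the upper bound at 1 - \<epsilon>; the extra
        1 makes room for a time slightly above the infimum.\<close>
      define K where "K = (1 + lb) / (1 - \<alpha>) + 1"
      have K: "0 \<le> K" using lb \<alpha> by (simp add: K_def)
      obtain C L0 where C: "0 \<le> C" and L0: "1 \<le> L0" and win: "\<forall>n\<ge>2. \<forall>t0. L0 \<le> ln (real n ^ dim) \<longrightarrow>
        0 \<le> t0 \<longrightarrow> t0 \<le> K * ln (real n ^ dim) \<longrightarrow> mx n t0 (1 - \<epsilon>) \<longrightarrow> mx n (t0 + (6 + C * ln (ln (real n ^ dim)))) \<epsilon>"
        using window[OF \<epsilon> K] by blast
      have llim: "filterlim (\<lambda>n. ln (ln (real n))) at_top sequentially" by real_asymp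
      then have l1: "\<forall>\<^sub>F n in sequentially. 7 + ln (real dim) \<le> ln (ln (real n))" by (simp add: filterlim_at_top)
      have l2: "\<forall>\<^sub>F n in sequentially. 0 < ln (real n)" by real_asymp
      have "\<forall>\<^sub>F n in sequentially. T n \<epsilon> \<le> T n (1 - \<epsilon>) + (1 + 2 * C) * ln (ln (real n))"
        using big[of L0] l1 l2 eventually_ge_at_top[of 2]
      proof eventually_elim
        case (elim n)
        note n = elim(4)
        let ?L = "ln (real n ^ dim)"
        have L1: "1 \<le> ?L" using elim(1) L0 by simp
        have e': "0 < 1 - \<epsilon>" "1 - \<epsilon> < 1" using \<epsilon> by auto
        have ne: "S n (1 - \<epsilon>) \<noteq> {}" using reach[OF n e'] by auto
        have "0 \<le> ln (real dim)" using dim by simp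
        then have "7 \<le> ln (ln (real n))" "ln (real dim) \<le> ln (ln (real n))" using elim(2) by linarith+
        then have step: "T n (1 - \<epsilon>) + 7 + C * (ln (real dim) + ln (ln (real n)))
            \<le> T n (1 - \<epsilon>) + ln (ln (real n)) + C * (ln (ln (real n)) + ln (ln (real n)))"
          using C by (intro add_mono mult_left_mono) auto
        \<comment> \<open>The infimum need not be attained, so a time within 1 of it is taken; this
          turns the 6 of the window estimate into 7.\<close>
        have "T n (1 - \<epsilon>) < T n (1 - \<epsilon>) + 1" by simp
        then obtain t0 where t0: "t0 \<in> S n (1 - \<epsilon>)" "t0 < T n (1 - \<epsilon>) + 1"
          unfolding T[OF n] using cInf_lessD[OF ne] by blast
        have "T n (1 - \<epsilon>) \<le> (?L + lb) / (1 - \<alpha>)"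
          unfolding T[OF n] lb_def by (rule cInf_lower[OF reach[OF n e'] bdd])
        also have "\<dots> \<le> (?L + lb * ?L) / (1 - \<alpha>)"
          using L1 lb \<alpha> mult_left_mono[OF L1 lb] by (intro divide_right_mono) auto
        also have "\<dots> = (K - 1) * ?L" by (simp add: K_def distrib_right)
        finally have "t0 \<le> K * ?L" using t0(2) L1 by (simp add: left_diff_distrib)
        then have t1: "mx n (t0 + (6 + C * ln ?L)) \<epsilon>" using win n elim(1) t0(1) by (simp add: S_def)
        have "0 \<le> ln ?L" using L1 by simp
        then have "t0 + (6 + C * ln ?L) \<in> S n \<epsilon>" using t1 t0(1) C by (simp add: S_def)
        then have "T n \<epsilon> \<le> t0 + (6 + C * ln ?L)" unfolding T[OF n] by (intro cInf_lower bdd)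
        also have "\<dots> \<le> T n (1 - \<epsilon>) + 7 + C * ln ?L" using t0(2) by simp
        also have "ln ?L = ln (real dim) + ln (ln (real n))"
          using n dim elim(3) by (simp add: ln_realpow ln_mult)
        also note step
        finally show ?case by (simp add: algebra_simps)
      qed
      then show ?thesis by blast
    qed
  qed
qed

lemma potts_cutoff:
  fixes a :: "nat \<Rightarrow> int ^ 'd" and \<tau> :: "nat \<Rightarrow> int ^ 'd \<Rightarrow> nat option"
  assumes q: "2 \<le> q" and small: "real (2 * CARD('d)) * potts_influence q \<beta> (2 * CARD('d)) < 1"
  shows "cutoff_with_window (\<lambda>n. t_mix q \<beta> (lattice_box (a n) n) (\<tau> n)) (\<lambda>n. ln (ln (real n)))"
proof -
  define \<Lambda> where "\<Lambda> n = lattice_box (a n) n" for n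
  define \<rho> where "\<rho> = potts_influence q \<beta> (2 * CARD('d))"
  define \<alpha> where "\<alpha> = max (1 / 2) (real (2 * CARD('d)) * \<rho>)"
  define p where "p = 1 / (real q * (max (exp (2 * \<beta>)) (1 / exp (2 * \<beta>)) ^ (2 * CARD('d)))\<^sup>2)"
  have \<alpha>: "0 < \<alpha>" "\<alpha> < 1" using small by (auto simp: \<alpha>_def \<rho>_def less_max_iff_disj)
  have card: "real (card (\<Lambda> n)) = real n ^ CARD('d)" for n by (simp add: \<Lambda>_def card_lattice_box)
  have model: "potts_model q (\<Lambda> n)" if "2 \<le> n" for n
  proof
    show "finite (\<Lambda> n)" unfolding \<Lambda>_def by (rule finite_lattice_box)
    have "card (\<Lambda> n) \<noteq> 0" using that by (simp add: \<Lambda>_def card_lattice_box)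
    then show "\<Lambda> n \<noteq> {}" by auto
  qed (rule q)
  have sd: "spatial_dobrushin (\<Lambda> n) {1..q} (potts_weight \<beta> (\<Lambda> n) (\<tau> n)) (potts_model.nb (\<Lambda> n)) \<rho> \<alpha> p site_dist CARD('d)"
    if "2 \<le> n" for n
  proof -
    interpret potts_model q \<beta> "\<Lambda> n" "\<tau> n" by (rule model[OF that])
    show ?thesis using spatial_dobrushin[OF small] by (simp add: \<rho>_def \<alpha>_def p_def p\<^sub>0_def b_def)
  qed
  let ?mx = "\<lambda>n. gibbs.mixed (\<Lambda> n) {1..q} (potts_weight \<beta> (\<Lambda> n) (\<tau> n))"
  \<comment> \<open>\<open>p\<close> is the same for every box, so the instance at side length 2
    already shows that it is at most 1.\<close>
  have p: "0 < p" "p \<le> 1"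
  proof -
    interpret spatial_dobrushin "\<Lambda> 2" "{1..q}" "potts_weight \<beta> (\<Lambda> 2) (\<tau> 2)" "potts_model.nb (\<Lambda> 2)" \<rho> \<alpha> p site_dist "CARD('d)"
      by (rule sd) simp
    show "0 < p" "p \<le> 1" by (rule p_pos) (rule p_le_1)
  qed
  have "cutoff_with_window (\<lambda>n. t_mix q \<beta> (\<Lambda> n) (\<tau> n)) (\<lambda>n. ln (ln (real n)))"
  proof (rule cutoff_of_mixed[where mx = ?mx and dim = "CARD('d)", OF \<alpha>(2) p(1)])
    show "0 < CARD('d)" by simp
    fix n :: nat assume n: "2 \<le> n"
    interpret spatial_dobrushin "\<Lambda> n" "{1..q}" "potts_weight \<beta> (\<Lambda> n) (\<tau> n)" "potts_model.nb (\<Lambda> n)" \<rho> \<alpha> p site_dist "CARD('d)"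
      by (rule sd[OF n])
    have N: "real n ^ CARD('d) = N" by (simp add: N_def card)
    have "real n ^ 1 \<le> real n ^ CARD('d)" using n by (intro power_increasing) auto
    then have N2: "2 \<le> N" using n by (simp add: N)
    show "?mx n t \<epsilon>'" if "?mx n t \<epsilon>" "\<epsilon> \<le> \<epsilon>'" for t \<epsilon> \<epsilon>' using mixed_mono that .
    show "?mx n t (real n ^ CARD('d) * exp (- (1 - \<alpha>) * t))" if "0 \<le> t" for t
      unfolding N by (rule mixed_upper[OF that])
    show "1 - 4 * (2 * (real n ^ CARD('d) / (1 - \<alpha>)) + 2 * (real n ^ CARD('d) * t) + 2)
        / (real n ^ CARD('d) * p\<^sup>2 * exp (- t) / 2)\<^sup>2 \<le> \<epsilon>" if "0 \<le> t" "?mx n t \<epsilon>" for t \<epsilon>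
      unfolding N by (rule mixed_lower[OF _ N2 that]) (use q in simp)
    show "t_mix q \<beta> (\<Lambda> n) (\<tau> n) \<epsilon> = Inf {t. 0 \<le> t \<and> ?mx n t \<epsilon>}" for \<epsilon>
      by (rule potts_model.t_mix_eq[OF model[OF n]])
  next
    fix \<epsilon> K :: real assume "0 < \<epsilon>" "\<epsilon> < 1" "0 \<le> K"
    then obtain C L0 where C: "0 \<le> C" "1 \<le> L0" and win: "\<forall>(\<Lambda>::(int^'d) set) (Q::nat set) w nb \<rho> dst t0.
      spatial_dobrushin \<Lambda> Q w nb \<rho> \<alpha> p dst CARD('d) \<longrightarrow> card Q = q \<longrightarrow>
      L0 \<le> ln (real (card \<Lambda>)) \<longrightarrow> 0 \<le> t0 \<longrightarrow> t0 \<le> K * ln (real (card \<Lambda>)) \<longrightarrow> gibbs.mixed \<Lambda> Q w t0 (1 - \<epsilon>) \<longrightarrow>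
      gibbs.mixed \<Lambda> Q w (t0 + (6 + C * ln (ln (real (card \<Lambda>))))) \<epsilon>"
      using mixed_window[OF \<alpha> p, of \<epsilon> K q "CARD('d)"] q by auto
    show "\<exists>C\<ge>0. \<exists>L\<^sub>0\<ge>1. \<forall>n\<ge>2. \<forall>t0. L\<^sub>0 \<le> ln (real n ^ CARD('d)) \<longrightarrow>
      0 \<le> t0 \<longrightarrow> t0 \<le> K * ln (real n ^ CARD('d)) \<longrightarrow> ?mx n t0 (1 - \<epsilon>) \<longrightarrow> ?mx n (t0 + (6 + C * ln (ln (real n ^ CARD('d))))) \<epsilon>"
    proof (rule exI[of _ C], intro exI[of _ L0] conjI C allI impI)
      fix n t0 assume "2 \<le> n" and *: "L0 \<le> ln (real n ^ CARD('d))" "0 \<le> t0" "t0 \<le> K * ln (real n ^ CARD('d))" "?mx n t0 (1 - \<epsilon>)"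
      show "?mx n (t0 + (6 + C * ln (ln (real n ^ CARD('d))))) \<epsilon>"
        using win[rule_format, OF sd[OF \<open>2 \<le> n\<close>], unfolded card, OF _ *] by simp
    qed
  qed
  then show ?thesis by (simp add: \<Lambda>_def)
qed

theorem theorem3:
  fixes q :: nat and \<beta> :: real
    and a :: "nat \<Rightarrow> int ^ 'd" and \<tau> :: "nat \<Rightarrow> int ^ 'd \<Rightarrow> nat option"
  assumes "q \<ge> 2"
    and "\<And>n. boundary_condition q (lattice_box (a n) n) (\<tau> n)"
  shows
    "(0 \<le> \<beta> \<and>
      \<beta> < 1 / 2 * ln (max (1 + 1 / (2 * real CARD('d) - 1))
                          ((1 + real q / (2 * real CARD('d))) powr (1 / (2 * real CARD('d))))) \<longrightarrow>
      cutoff_with_window (\<lambda>n. t_mix q \<beta> (lattice_box (a n) n) (\<tau> n)) (\<lambda>n. ln (ln (real n)))) \<and>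
     (\<beta> \<le> 0 \<and> - (1 / 2) * ln (1 + 1 / (2 * real CARD('d) * real q - 1)) \<le> \<beta> \<longrightarrow>
      cutoff_with_window (\<lambda>n. t_mix q \<beta> (lattice_box (a n) n) (\<tau> n)) (\<lambda>n. ln (ln (real n))))"
proof -
  have dim: "2 \<le> 2 * CARD('d)" by simp
  have eq: "2 * real CARD('d) = real (2 * CARD('d))" by simp
  show ?thesis
    unfolding eq
    using potts_influence_ferro[OF assms(1) dim] potts_influence_anti[OF assms(1) dim] potts_cutoff[OF assms(1)] by blast
qed

end
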